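(* Let $X=\{\Omega,\mathcal F,(\mathcal F_t)_{t\ge0},(X_t)_{t\ge0},(\mathbb P_x)_{x\in\mathbb R^d}\}$ be a Feller process on $\mathbb R^d$ with Feller generator $(L,D(L))$. Suppose that $C_c^\infty(\mathbb R^d)\subset D(L)$ and that for every $u\in C_c^\infty(\mathbb R^d)$, $$Lu(x)=\int_{\mathbb R^d\setminus\{0\}}\left(u(x+z)-u(x)-\langle\nabla u(x),z\rangle\mathbf 1_{\{|z|<1\}}(z)\right)N(x,\mathrm dz),$$ where for each fixed $x\in\mathbb R^d$, $N(x,\mathrm dz)$ is a non-negative deterministic measure on $\mathbb R^d\setminus\{0\}$, and $$\sup_{x\in\mathbb R^d}\int_{\mathbb R^d\setminus\{0\}}|z|^2\,N(x,\mathrm dz)<\infty .$$ Assume also that for every $x\in\mathbb R^d$, $$\int_{\{|z|\ge1\}}z^{(i)}\,N(x,\mathrm dz)=0,\qquad 1\le i\le d.$$ Then $X$ is a purely discontinuous martingale (under $\mathbb P_x$ for every $x\in\mathbb R^d$, with respect to $(\mathcal F_t)_{t\ge0}$) such that for each $t>0$ and $i=1,\dots,d$, $X^{(i)}_t$ has finite second moment, and the predictable quadratic variation of $X$ is given by $$\langle X^{(i)},X^{(j)}\rangle_t=\int_0^t\left(\int_{\mathbb R^d\setminus\{0\}}z^{(i)}z^{(j)}\,N(X_s,\mathrm dz)\right)\mathrm ds,\qquad 1\le i,j\le d,\ t>0.$$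
   Context: For $x\in\mathbb R^d$, $x^{(i)}$ denotes its $i$th coordinate; $\langle\cdot,\cdot\rangle$ between vectors is the standard inner product. $C_\infty(\mathbb R^d)$ is the space of continuous functions vanishing at infinity with the uniform norm; $C_c^\infty(\mathbb R^d)$ is the space of smooth compactly supported functions. A time-homogeneous Markov process $X$ on $\mathbb R^d$ with semigroup $T_tu(x)=\mathbb E_xu(X_t)$ is a Feller process if $T_tu\in C_\infty(\mathbb R^d)$ for all $u\in C_\infty(\mathbb R^d)$, $t>0$, and $\|T_tu-u\|_\infty\to0$ as $t\to0$ for all $u\in C_\infty(\mathbb R^d)$. As usual, $X$ is taken to be càdlàg (in the one-point compactification of $\mathbb R^d$), the filtration $(\mathcal F_t)$ is complete and right continuous, and $X$ is strong Markov with respect to it. Its Feller generator is $Lu=\lim_{t\to0}(T_tu-u)/t$ (limit in $C_\infty(\mathbb R^d)$), with domain $D(L)$ the set of $u\in C_\infty(\mathbb R^d)$ for which the limit exists. Under the hypotheses on $L$ above, $X$ is conservative ($T_t1=1$ for all $t\ge0$). An $\mathbb R^d$-valued process is called a purely discontinuous martingale if each coordinate $X^{(i)}$ is a martingale whose continuous martingale part vanishes (in the decomposition $X^{(i)}=X_0^{(i)}+X^{(i),c}+X^{(i),d}$ into a continuous and a purely discontinuous local martingale). $\langle X^{(i)},X^{(j)}\rangle$ denotes the predictable quadratic covariation. *)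

theory Defs
  imports "HOL-Probability.Probability"
begin

section \<open>Function spaces on \<open>\<real>\<^sup>d\<close>\<close>

text \<open>\<open>\<real>\<^sup>d\<close> is \<^typ>\<open>real ^ 'n\<close>, with \<open>d = CARD('n)\<close>.\<close>

definition C_infty :: "(real ^ 'n \<Rightarrow> real) set" where
  "C_infty = {u. continuous_on UNIV u \<and> (u \<longlongrightarrow> 0) at_infinity}"

fun C_k :: "nat \<Rightarrow> (real ^ 'n \<Rightarrow> real) \<Rightarrow> bool" where
  "C_k 0 u = continuous_on UNIV u"
| "C_k (Suc k) u =
     ((\<forall>x. u differentiable at x) \<and>
      (\<forall>i. C_k k (\<lambda>x. frechet_derivative u (at x) (axis i 1))))"

definition C_c_smooth :: "(real ^ 'n \<Rightarrow> real) set" where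
  "C_c_smooth = {u. (\<forall>k. C_k k u) \<and> compact (closure {x. u x \<noteq> 0})}"

definition grad :: "(real ^ 'n \<Rightarrow> real) \<Rightarrow> real ^ 'n \<Rightarrow> real ^ 'n" where
  "grad u x = (THE D. GDERIV u x :> D)"


section \<open>Filtrations in continuous time\<close>

text \<open>Filtrations and processes are functions of a real time, of which only the restriction to
  \<open>[0, \<infinity>)\<close> is ever used. \<open>full_filtration M F\<close> is \<open>F\<close> together with \<open>F\<^sub>\<infinity> = M\<close>, indexed by
  \<open>[0, \<infinity>]\<close>, so that the library's stopping times may take the value \<open>\<infinity>\<close>.\<close>

definition full_filtration :: "'w measure \<Rightarrow> (real \<Rightarrow> 'w measure) \<Rightarrow> ennreal \<Rightarrow> 'w measure" where
  "full_filtration M F t = (if t = \<infinity> then M else F (enn2real t))"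

definition right_continuous_filtration :: "(real \<Rightarrow> 'w measure) \<Rightarrow> bool" where
  "right_continuous_filtration F \<longleftrightarrow> (\<forall>t\<ge>0. sets (F t) = (\<Inter>s\<in>{t<..}. sets (F s)))"

text \<open>The usual augmentation by the subsets of \<open>P\<close>-null sets. It is a filtration of sub-sigma-algebras
  of \<^term>\<open>completion P\<close>, and it is \<open>F\<close> itself if \<open>F\<close> is already complete with respect to \<open>P\<close>.\<close>

definition augmentation :: "'w measure \<Rightarrow> (real \<Rightarrow> 'w measure) \<Rightarrow> real \<Rightarrow> 'w measure" where
  "augmentation P F t = sigma (space P) (sets (F t) \<union> null_sets (completion P))"


section \<open>Feller processes\<close>

text \<open>The state space of the process is the one-point compactification of \<open>\<real>\<^sup>d\<close>, with \<^term>\<open>None\<close>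
  as the point at infinity; \<open>X t \<omega> = None\<close> means that the process has left \<open>\<real>\<^sup>d\<close>.
  Functions on \<open>\<real>\<^sup>d\<close> are extended by \<open>0\<close>. That the process is conservative is not assumed.\<close>

definition compactified_borel :: "(real ^ 'n) option measure" where
  "compactified_borel = sigma UNIV {U. openin (Alexandroff_compactification euclidean) U}"

definition ext0 :: "(real ^ 'n \<Rightarrow> real) \<Rightarrow> (real ^ 'n) option \<Rightarrow> real" where
  "ext0 u y = (case y of None \<Rightarrow> 0 | Some x \<Rightarrow> u x)"

definition transition_semigroup ::
  "(real ^ 'n \<Rightarrow> 'w measure) \<Rightarrow> (real \<Rightarrow> 'w \<Rightarrow> (real ^ 'n) option) \<Rightarrow>
   real \<Rightarrow> (real ^ 'n \<Rightarrow> real) \<Rightarrow> real ^ 'n \<Rightarrow> real" where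
  "transition_semigroup P X t u x = (\<integral>\<omega>. ext0 u (X t \<omega>) \<partial>P x)"

definition cadlag_compactified :: "(real \<Rightarrow> (real ^ 'n) option) \<Rightarrow> bool" where
  "cadlag_compactified f \<longleftrightarrow>
     (\<forall>t\<ge>0. limitin (Alexandroff_compactification euclidean) f (f t) (at_right t)) \<and>
     (\<forall>t>0. \<exists>l. limitin (Alexandroff_compactification euclidean) f l (at_left t))"

text \<open>The laws \<open>P x\<close> are mutually singular (\<open>X\<^sub>0 = x\<close> almost surely), so a filtration that contains the
  null sets of every single \<open>P x\<close> contains all subsets of the sample space. Accordingly \<open>complete\<close>
  concerns sets that are negligible for the whole family; completeness with respect to
  an individual \<open>P x\<close> is obtained by \<^const>\<open>augmentation\<close>.\<close>

locale feller_process =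
  fixes M :: "'w measure"
    and F :: "real \<Rightarrow> 'w measure"
    and X :: "real \<Rightarrow> 'w \<Rightarrow> (real ^ 'n) option"
    and P :: "real ^ 'n \<Rightarrow> 'w measure"
  assumes prob_P: "\<And>x. prob_space (P x)"
    and sets_P: "\<And>x. sets (P x) = sets M"
    and filtration_F: "filtration (space M) (full_filtration M F)"
    and right_continuous_F: "right_continuous_filtration F"
    and complete: "\<And>A B. A \<subseteq> B \<Longrightarrow> (\<And>x. B \<in> null_sets (P x)) \<Longrightarrow> A \<in> sets (F 0)"
    and adapted: "\<And>t. 0 \<le> t \<Longrightarrow> X t \<in> measurable (F t) compactified_borel"
    and cadlag_paths: "\<And>\<omega>. \<omega> \<in> space M \<Longrightarrow> cadlag_compactified (\<lambda>t. X t \<omega>)"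
    and initial: "\<And>x. AE \<omega> in P x. X 0 \<omega> = Some x"
    and markov:
      "\<And>x s t u. 0 \<le> s \<Longrightarrow> 0 \<le> t \<Longrightarrow> u \<in> borel_measurable borel \<Longrightarrow> bounded (range u) \<Longrightarrow>
         AE \<omega> in P x. real_cond_exp (P x) (F t) (\<lambda>\<omega>. ext0 u (X (t + s) \<omega>)) \<omega>
                     = ext0 (transition_semigroup P X s u) (X t \<omega>)"
    and strong_markov:
      "\<And>x s \<tau> u. 0 \<le> s \<Longrightarrow> stopping_time (full_filtration M F) \<tau> \<Longrightarrow>
         u \<in> borel_measurable borel \<Longrightarrow> bounded (range u) \<Longrightarrow>
         AE \<omega> in P x. real_cond_exp (P x) (filtration.pre_sigma (space M) (full_filtration M F) \<tau>)
                         (\<lambda>\<omega>. if \<tau> \<omega> < \<infinity> then ext0 u (X (enn2real (\<tau> \<omega>) + s) \<omega>) else 0) \<omega>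
                     = (if \<tau> \<omega> < \<infinity> then ext0 (transition_semigroup P X s u) (X (enn2real (\<tau> \<omega>)) \<omega>) else 0)"
    and feller: "\<And>t u. 0 < t \<Longrightarrow> u \<in> C_infty \<Longrightarrow> transition_semigroup P X t u \<in> C_infty"
    and strongly_continuous:
      "\<And>u. u \<in> C_infty \<Longrightarrow> uniform_limit UNIV (\<lambda>t. transition_semigroup P X t u) u (at_right 0)"

text \<open>The generator of a family \<open>T\<close> of operators on \<^const>\<open>C_infty\<close>.\<close>

definition is_generator_value ::
  "(real \<Rightarrow> (real ^ 'n \<Rightarrow> real) \<Rightarrow> real ^ 'n \<Rightarrow> real) \<Rightarrow>
   (real ^ 'n \<Rightarrow> real) \<Rightarrow> (real ^ 'n \<Rightarrow> real) \<Rightarrow> bool" where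
  "is_generator_value T u f \<longleftrightarrow>
     f \<in> C_infty \<and> uniform_limit UNIV (\<lambda>t x. (T t u x - u x) / t) f (at_right 0)"

definition generator_domain ::
  "(real \<Rightarrow> (real ^ 'n \<Rightarrow> real) \<Rightarrow> real ^ 'n \<Rightarrow> real) \<Rightarrow> (real ^ 'n \<Rightarrow> real) set" where
  "generator_domain T = {u \<in> C_infty. \<exists>f. is_generator_value T u f}"

definition generator ::
  "(real \<Rightarrow> (real ^ 'n \<Rightarrow> real) \<Rightarrow> real ^ 'n \<Rightarrow> real) \<Rightarrow>
   (real ^ 'n \<Rightarrow> real) \<Rightarrow> real ^ 'n \<Rightarrow> real" where
  "generator T u = (THE f. is_generator_value T u f)"

text \<open>The \<open>\<real>\<^sup>d\<close>-valued version of a process in the compactification. The value \<open>0\<close> at infinity is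
  irrelevant for processes that almost surely never reach infinity.\<close>

definition finite_part :: "(real \<Rightarrow> 'w \<Rightarrow> (real ^ 'n) option) \<Rightarrow> real \<Rightarrow> 'w \<Rightarrow> real ^ 'n" where
  "finite_part X t \<omega> = (case X t \<omega> of None \<Rightarrow> 0 | Some x \<Rightarrow> x)"


section \<open>Martingales in continuous time\<close>

text \<open>All notions are relative to a filtered probability space \<open>(P, F)\<close>; path properties are
  required almost surely.\<close>

definition cadlag :: "(real \<Rightarrow> real) \<Rightarrow> bool" where
  "cadlag f \<longleftrightarrow> (\<forall>t\<ge>0. (f \<longlongrightarrow> f t) (at_right t)) \<and> (\<forall>t>0. \<exists>l. (f \<longlongrightarrow> l) (at_left t))"

definition martingale ::
  "'w measure \<Rightarrow> (real \<Rightarrow> 'w measure) \<Rightarrow> (real \<Rightarrow> 'w \<Rightarrow> real) \<Rightarrow> bool" where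
  "martingale P F Y \<longleftrightarrow>
     (\<forall>t\<ge>0. Y t \<in> borel_measurable (F t)) \<and>
     (\<forall>t\<ge>0. integrable P (Y t)) \<and>
     (AE \<omega> in P. cadlag (\<lambda>t. Y t \<omega>)) \<and>
     (\<forall>s t. 0 \<le> s \<longrightarrow> s \<le> t \<longrightarrow> (AE \<omega> in P. real_cond_exp P (F s) (Y t) \<omega> = Y s \<omega>))"

definition square_integrable_martingale ::
  "'w measure \<Rightarrow> (real \<Rightarrow> 'w measure) \<Rightarrow> (real \<Rightarrow> 'w \<Rightarrow> real) \<Rightarrow> bool" where
  "square_integrable_martingale P F Y \<longleftrightarrow>
     martingale P F Y \<and> (\<forall>t\<ge>0. integrable P (\<lambda>\<omega>. (Y t \<omega>)\<^sup>2))"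

definition stopped :: "('w \<Rightarrow> ennreal) \<Rightarrow> (real \<Rightarrow> 'w \<Rightarrow> real) \<Rightarrow> real \<Rightarrow> 'w \<Rightarrow> real" where
  "stopped \<tau> Y t \<omega> = Y (enn2real (min (ennreal t) (\<tau> \<omega>))) \<omega>"

definition localizing_sequence ::
  "'w measure \<Rightarrow> (real \<Rightarrow> 'w measure) \<Rightarrow> (nat \<Rightarrow> 'w \<Rightarrow> ennreal) \<Rightarrow> bool" where
  "localizing_sequence P F \<tau> \<longleftrightarrow>
     (\<forall>n. stopping_time (full_filtration P F) (\<tau> n)) \<and>
     (AE \<omega> in P. incseq (\<lambda>n. \<tau> n \<omega>) \<and> (\<lambda>n. \<tau> n \<omega>) \<longlonglongrightarrow> \<infinity>)"

definition local_martingale ::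
  "'w measure \<Rightarrow> (real \<Rightarrow> 'w measure) \<Rightarrow> (real \<Rightarrow> 'w \<Rightarrow> real) \<Rightarrow> bool" where
  "local_martingale P F Y \<longleftrightarrow>
     (\<exists>\<tau>. localizing_sequence P F \<tau> \<and> (\<forall>n. martingale P F (stopped (\<tau> n) Y)))"

definition locally_square_integrable_martingale ::
  "'w measure \<Rightarrow> (real \<Rightarrow> 'w measure) \<Rightarrow> (real \<Rightarrow> 'w \<Rightarrow> real) \<Rightarrow> bool" where
  "locally_square_integrable_martingale P F Y \<longleftrightarrow>
     (\<exists>\<tau>. localizing_sequence P F \<tau> \<and> (\<forall>n. square_integrable_martingale P F (stopped (\<tau> n) Y)))"

definition continuous_local_martingale ::
  "'w measure \<Rightarrow> (real \<Rightarrow> 'w measure) \<Rightarrow> (real \<Rightarrow> 'w \<Rightarrow> real) \<Rightarrow> bool" where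
  "continuous_local_martingale P F Y \<longleftrightarrow>
     local_martingale P F Y \<and> (AE \<omega> in P. continuous_on {0..} (\<lambda>t. Y t \<omega>))"

definition purely_discontinuous_local_martingale ::
  "'w measure \<Rightarrow> (real \<Rightarrow> 'w measure) \<Rightarrow> (real \<Rightarrow> 'w \<Rightarrow> real) \<Rightarrow> bool" where
  "purely_discontinuous_local_martingale P F Y \<longleftrightarrow>
     local_martingale P F Y \<and> (AE \<omega> in P. Y 0 \<omega> = 0) \<and>
     (\<forall>Z. continuous_local_martingale P F Z \<longrightarrow> local_martingale P F (\<lambda>t \<omega>. Y t \<omega> * Z t \<omega>))"

text \<open>\<open>C\<close> is (a version of) the continuous martingale part \<open>Y\<^sup>c\<close> in the decomposition
  \<open>Y = Y\<^sub>0 + Y\<^sup>c + Y\<^sup>d\<close>; it is unique up to indistinguishability.\<close>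

definition continuous_martingale_part ::
  "'w measure \<Rightarrow> (real \<Rightarrow> 'w measure) \<Rightarrow> (real \<Rightarrow> 'w \<Rightarrow> real) \<Rightarrow> (real \<Rightarrow> 'w \<Rightarrow> real) \<Rightarrow> bool" where
  "continuous_martingale_part P F Y C \<longleftrightarrow>
     continuous_local_martingale P F C \<and> (AE \<omega> in P. C 0 \<omega> = 0) \<and>
     purely_discontinuous_local_martingale P F (\<lambda>t \<omega>. Y t \<omega> - Y 0 \<omega> - C t \<omega>)"

definition purely_discontinuous_martingale ::
  "'w measure \<Rightarrow> (real \<Rightarrow> 'w measure) \<Rightarrow> (real \<Rightarrow> 'w \<Rightarrow> real) \<Rightarrow> bool" where
  "purely_discontinuous_martingale P F Y \<longleftrightarrow>
     martingale P F Y \<and>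
     (\<exists>C. continuous_martingale_part P F Y C \<and> (AE \<omega> in P. \<forall>t\<ge>0. C t \<omega> = 0))"

definition vector_purely_discontinuous_martingale ::
  "'w measure \<Rightarrow> (real \<Rightarrow> 'w measure) \<Rightarrow> (real \<Rightarrow> 'w \<Rightarrow> real ^ 'n) \<Rightarrow> bool" where
  "vector_purely_discontinuous_martingale P F Y \<longleftrightarrow>
     (\<forall>i. purely_discontinuous_martingale P F (\<lambda>t \<omega>. Y t \<omega> $ i))"


section \<open>Predictable quadratic covariation\<close>

definition predictable_sigma :: "'w measure \<Rightarrow> (real \<Rightarrow> 'w measure) \<Rightarrow> (real \<times> 'w) measure" where
  "predictable_sigma P F = sigma ({0..} \<times> space P)
     ({{0} \<times> A |A. A \<in> sets (F 0)} \<union> {{s<..t} \<times> A |s t A. 0 \<le> s \<and> s \<le> t \<and> A \<in> sets (F s)})"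

definition finite_variation :: "(real \<Rightarrow> real) \<Rightarrow> bool" where
  "finite_variation f \<longleftrightarrow>
     (\<forall>t\<ge>0. \<exists>B. \<forall>p n. mono p \<longrightarrow> range p \<subseteq> {0..t} \<longrightarrow>
        (\<Sum>k<n. \<bar>f (p (Suc k)) - f (p (k::nat))\<bar>) \<le> B)"

text \<open>\<open>A\<close> is (a version of) \<open>\<langle>Y, Z\<rangle>\<close>: the predictable process of finite variation null at \<open>0\<close>,
  unique up to indistinguishability, for which \<open>Y Z - A\<close> is a local martingale.\<close>

definition predictable_quadratic_covariation ::
  "'w measure \<Rightarrow> (real \<Rightarrow> 'w measure) \<Rightarrow>
   (real \<Rightarrow> 'w \<Rightarrow> real) \<Rightarrow> (real \<Rightarrow> 'w \<Rightarrow> real) \<Rightarrow> (real \<Rightarrow> 'w \<Rightarrow> real) \<Rightarrow> bool" where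
  "predictable_quadratic_covariation P F Y Z A \<longleftrightarrow>
     locally_square_integrable_martingale P F Y \<and>
     locally_square_integrable_martingale P F Z \<and>
     (\<lambda>(t, \<omega>). A t \<omega>) \<in> borel_measurable (predictable_sigma P F) \<and>
     (AE \<omega> in P. A 0 \<omega> = 0 \<and> cadlag (\<lambda>t. A t \<omega>) \<and> finite_variation (\<lambda>t. A t \<omega>)) \<and>
     local_martingale P F (\<lambda>t \<omega>. Y t \<omega> * Z t \<omega> - A t \<omega>)"

end

theory Submission
  imports Defs
begin

text \<open>Cut-offs of functions \<open>g\<close> of quadratic growth lie in \<^const>\<open>C_c_smooth\<close>, and the second moment bound with
  \<open>centred\<close> gives bounded convergence of \<open>L\<close> along the cut-offs to \<open>\<integral> (g (x + z) - g x - \<langle>\<nabla>g x, z\<rangle>) N(x, dz)\<close>.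
  Dynkin's formula passes to the limit: \<open>g = 1\<close> gives conservativeness, \<open>g = y\<^sub>i\<close> the martingale
  property, \<open>g = y\<^sub>i y\<^sub>j\<close> second moments and the quadratic covariation. Doob's maximal inequality excludes
  explosion along the whole path.
  The martingale is purely discontinuous because \<open>1 - cos \<theta>h \<ge> (\<theta>h)\<^sup>2 / 4\<close> for \<open>\<bar>\<theta>h\<bar> \<le> 1\<close>: Dynkin's formula for
  \<open>cos \<theta>y\<^sub>i\<close> and \<open>sin \<theta>y\<^sub>i\<close>, divided by \<open>\<theta>\<^sup>2\<close>, shows as \<open>\<theta> \<rightarrow> \<infinity>\<close> that increments of size at most \<open>1 / \<theta>\<close> contribute
  arbitrarily little to the quadratic variation. Against a bounded continuous martingale the small increments
  are therefore negligible by Cauchy--Schwarz, and the few large ones by uniform continuity of the paths.\<close>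

section \<open>Smooth cut-offs\<close>

text \<open>The hypotheses speak only about compactly supported smooth functions, while 1, y_i and
  y_i y_j do not even vanish at infinity. Each derivative that falls on the cut-off at radius R
  costs a factor 1/R, and quadratic growth is exactly what this scaling still absorbs: the
  second-order Taylor remainder stays below C |z|^2 for all R. The identities are tested against
  bounded weights known at the earlier time, which replaces conditional expectations by plain
  integrals. The weights also make the trigonometric functions usable: 1 - cos \<theta>(b - a) is a
  combination of the increments of cos \<theta>y and sin \<theta>y with weights cos \<theta>a and
  sin \<theta>a, and the resulting bound is an integral over time, hence additive over a partition
  and independent of its mesh. This uniformity is decisive in the product with a continuous
  martingale: the size that separates small from large increments is fixed first, and the partition
  is refined afterwards. Pure discontinuity refers to all continuous local martingales of the
  augmented filtration, which forces localisation and optional stopping with almost surely regular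
  paths.\<close>

lemma C_k_SucI:
  assumes "\<And>x. (u has_derivative u' x) (at x)" and "\<And>i. C_k k (\<lambda>x. u' x (axis i 1))"
  shows "C_k (Suc k) u"
proof -
  have "frechet_derivative u (at x) = u' x" for x
    using frechet_derivative_at[OF assms(1)] by simp
  then show ?thesis
    using assms by (auto simp: differentiable_def)
qed

lemma C_k_SucD:
  assumes "C_k (Suc k) u"
  shows "(u has_derivative frechet_derivative u (at x)) (at x)"
    and "C_k k (\<lambda>x. frechet_derivative u (at x) (axis i 1))"
  using assms by (auto simp: frechet_derivative_works)

lemma C_k_Suc_weaken: "C_k (Suc k) u \<Longrightarrow> C_k k u"
proof (induction k arbitrary: u)
  case 0
  then show ?case
    by (auto intro!: continuous_at_imp_continuous_on differentiable_imp_continuous_within)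
next
  case (Suc k)
  then show ?case
    by (metis C_k.simps(2))
qed

lemma C_k_const: "C_k k (\<lambda>x. c)"
proof (induction k arbitrary: c)
  case (Suc k)
  show ?case
    by (rule C_k_SucI[of _ "\<lambda>x h. 0"]) (auto intro: Suc)
qed auto

lemma C_k_nth: "C_k k (\<lambda>x. x $ i)"
proof (cases k)
  case 0
  then show ?thesis by (auto intro!: continuous_intros)
next
  case (Suc m)
  show ?thesis unfolding Suc
    by (rule C_k_SucI[of _ "\<lambda>x h. h $ i"])
      (auto intro: C_k_const bounded_linear_imp_has_derivative bounded_linear_vec_nth)
qed

lemma C_k_add: "C_k k u \<Longrightarrow> C_k k v \<Longrightarrow> C_k k (\<lambda>x. u x + v x)"
proof (induction k arbitrary: u v)
  case 0
  then show ?case by (auto intro: continuous_intros)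
next
  case (Suc k)
  show ?case
    by (rule C_k_SucI[of _ "\<lambda>x h. frechet_derivative u (at x) h + frechet_derivative v (at x) h"])
      (rule has_derivative_add Suc.IH Suc.prems[THEN C_k_SucD(1)] Suc.prems[THEN C_k_SucD(2)])+
qed

lemma C_k_mult: "C_k k u \<Longrightarrow> C_k k v \<Longrightarrow> C_k k (\<lambda>x. u x * v x)"
proof (induction k arbitrary: u v)
  case 0
  then show ?case by (auto intro: continuous_intros)
next
  case (Suc k)
  show ?case
  proof (rule C_k_SucI[of _ "\<lambda>x h. u x * frechet_derivative v (at x) h + frechet_derivative u (at x) h * v x"])
    show "((\<lambda>x. u x * v x) has_derivative (\<lambda>h. u x * frechet_derivative v (at x) h + frechet_derivative u (at x) h * v x)) (at x)" for x
      using Suc.prems C_k_SucD(1) by (intro has_derivative_mult) auto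
    show "C_k k (\<lambda>x. u x * frechet_derivative v (at x) (axis i 1) + frechet_derivative u (at x) (axis i 1) * v x)" for i
      by (rule C_k_add Suc.IH Suc.prems[THEN C_k_Suc_weaken] Suc.prems[THEN C_k_SucD(2)])+
  qed
qed

text \<open>The parameter is the whole sequence of successive derivatives, so that the induction on
  k can pass from \<open>d n\<close> to \<open>d (Suc n)\<close>: the chain rule produces
  \<open>d (Suc n)\<close> composed with u, times a partial derivative of u.\<close>

lemma C_k_compose:
  assumes d: "\<And>n x. (d n has_real_derivative d (Suc n) x) (at x)"
  shows "C_k k u \<Longrightarrow> C_k k (\<lambda>x. d n (u x))"
proof (induction k arbitrary: n)
  case 0
  have "continuous_on UNIV (d n)"
    using d by (auto intro!: DERIV_continuous_on)
  with 0 show ?case by (auto intro: continuous_on_compose2)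
next
  case (Suc k)
  show ?case
  proof (rule C_k_SucI[of _ "\<lambda>x h. d (Suc n) (u x) * frechet_derivative u (at x) h"])
    show "((\<lambda>x. d n (u x)) has_derivative (\<lambda>h. d (Suc n) (u x) * frechet_derivative u (at x) h)) (at x)" for x
      using DERIV_compose_FDERIV[OF d[of n "u x"] C_k_SucD(1)[OF Suc.prems, of x]]
      by (simp add: mult.commute)
    show "C_k k (\<lambda>x. d (Suc n) (u x) * frechet_derivative u (at x) (axis i 1))" for i
      by (rule C_k_mult Suc.IH Suc.prems[THEN C_k_Suc_weaken] Suc.prems[THEN C_k_SucD(2)])+
  qed
qed

lemma C_k_sum: "finite I \<Longrightarrow> (\<And>i. i \<in> I \<Longrightarrow> C_k k (u i)) \<Longrightarrow> C_k k (\<lambda>x. \<Sum>i\<in>I. u i x)"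
  by (induction I rule: finite_induct) (auto intro: C_k_const C_k_add)

text \<open>The square of the norm is a polynomial in the coordinates and smooth also at 0, unlike
  the norm; the cut-off factor is therefore a function of the square.\<close>

lemma C_k_norm_square: "C_k k (\<lambda>x. (norm x)\<^sup>2)"
  unfolding power2_norm_eq_inner inner_vec_def by (auto intro!: C_k_sum C_k_mult C_k_nth)

section \<open>The function exp (-1/x) and its derivatives\<close>

lemma tendsto_poly_mult_exp_minus:
  "((\<lambda>x. poly p x * exp (- x)) \<longlongrightarrow> (0::real)) at_top"
proof -
  have "((\<lambda>x. \<Sum>i\<le>degree p. coeff p i * (x ^ i / exp x)) \<longlongrightarrow> (\<Sum>i\<le>degree p. coeff p i * 0)) at_top"
    by (intro tendsto_sum tendsto_mult tendsto_const tendsto_power_div_exp_0)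
  then show ?thesis
    by (simp add: poly_altdef exp_minus sum_distrib_right divide_inverse mult.assoc)
qed

text \<open>For x > 0 the derivative of p(1/x) exp(-1/x) is x^(-2) (p - p')(1/x) exp(-1/x); the
  polynomial \<open>[:0, 0, 1:]\<close>, evaluated at 1/x, supplies the factor x^(-2).\<close>

fun bump_poly :: "nat \<Rightarrow> real poly" where
  "bump_poly 0 = 1"
| "bump_poly (Suc n) = [:0, 0, 1:] * (bump_poly n - pderiv (bump_poly n))"

text \<open>The \<open>n\<close>-th derivative of the function \<open>exp (- 1 / x)\<close> on \<open>x > 0\<close>, extended by \<open>0\<close>.\<close>

definition bump :: "nat \<Rightarrow> real \<Rightarrow> real" where
  "bump n x = (if x \<le> 0 then 0 else poly (bump_poly n) (1 / x) * exp (- 1 / x))"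

lemma bump_nonpos [simp]: "x \<le> 0 \<Longrightarrow> bump n x = 0"
  by (simp add: bump_def)

text \<open>Away from 0 this is the recursion for \<open>bump_poly\<close>. At 0 all derivatives
  vanish, since exp(-1/h) beats every power of 1/h.\<close>

lemma has_derivative_bump: "(bump n has_real_derivative bump (Suc n) x) (at x)"
proof -
  consider "x < 0" | "x = 0" | "x > 0" by linarith
  then show ?thesis
  proof cases
    case 1
    have "((\<lambda>x. 0) has_real_derivative 0) (at x)" by simp
    then show ?thesis
      using 1 by (rule_tac has_field_derivative_transform_within_open[where S="{..<0}" and f="\<lambda>x. 0"]) auto
  next
    case 3
    have "((\<lambda>x. poly (bump_poly n) (1 / x) * exp (- 1 / x)) has_real_derivative bump (Suc n) x) (at x)"
      using 3 by (auto intro!: derivative_eq_intros simp: bump_def field_simps power2_eq_square)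
    then show ?thesis
      using 3 by (rule_tac has_field_derivative_transform_within_open[where S="{0<..}"]) (auto simp: bump_def)
  next
    case 2
    have "((\<lambda>h. bump n h / h) \<longlongrightarrow> 0) (at_left 0)"
      by (rule tendsto_eventually) (auto simp: eventually_at_left_field intro!: exI[of _ "-1"])
    moreover have "((\<lambda>h. bump n h / h) \<longlongrightarrow> 0) (at_right 0)"
    proof -
      \<comment> \<open>The difference quotient at 0 from the right, in the variable x = 1/h:
        \<open>pCons 0\<close> multiplies the polynomial by x and so accounts for the division by
        h.\<close>
      have "((\<lambda>x. poly (pCons 0 (bump_poly n)) x * exp (- x)) \<longlongrightarrow> 0) at_top"
        by (rule tendsto_poly_mult_exp_minus)
      moreover have "\<forall>\<^sub>F x in at_top. poly (pCons 0 (bump_poly n)) x * exp (- x) = bump n (inverse x) / inverse x"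
        using eventually_gt_at_top[of 0] by eventually_elim (simp add: bump_def field_simps)
      ultimately show ?thesis
        unfolding filterlim_at_right_to_top by (rule Lim_transform_eventually)
    qed
    ultimately have "((\<lambda>h. bump n h / h) \<longlongrightarrow> 0) (at 0)"
      by (simp add: filterlim_split_at_real)
    then show ?thesis using 2 by (simp add: DERIV_def)
  qed
qed

lemmas DERIV_bump [derivative_intros] = has_derivative_bump[THEN DERIV_chain2]

text \<open>The cut-offs evaluate \<open>bump\<close> only at 1 - (|x| / R)^2, hence never beyond
  1.\<close>

lemma bump_bounded: "\<exists>B. \<forall>x\<le>1. \<bar>bump n x\<bar> \<le> B"
proof -
  have "continuous_on {0..1} (bump n)"
    by (rule continuous_at_imp_continuous_on) (auto intro: DERIV_isCont has_derivative_bump)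
  then have "bounded (bump n ` {0..1})"
    by (intro compact_imp_bounded compact_continuous_image) auto
  then obtain B where B: "\<And>x. 0 \<le> x \<Longrightarrow> x \<le> 1 \<Longrightarrow> \<bar>bump n x\<bar> \<le> B"
    unfolding bounded_iff by fastforce
  have "\<bar>bump n x\<bar> \<le> B" if "x \<le> 1" for x
  proof (cases "x \<le> 0")
    case True
    then show ?thesis using B[of 0] by simp
  next
    case False
    then show ?thesis using B[of x] that by simp
  qed
  then show ?thesis by blast
qed

lemma bump_0_nonneg: "0 \<le> bump 0 x"
  by (simp add: bump_def)

text \<open>On x \<le> 1 the largest value of exp(-1/x) is exp(-1), attained at 1. The factor exp 1
  thus normalises the cut-off factor to lie in [0, 1] and to equal 1 at the origin.\<close>

lemma bump_0_le: "x \<le> 1 \<Longrightarrow> exp 1 * bump 0 x \<le> 1"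
  by (auto simp: bump_def mult_exp_exp divide_le_eq)

lemma bump_0_1: "exp 1 * bump 0 1 = 1"
  by (simp add: bump_def mult_exp_exp)

text \<open>The growth bounds are such that the second derivatives of the cut-offs of \<open>g\<close> at radius \<open>R\<close> are bounded uniformly
  in \<open>R\<close>.\<close>

definition tame :: "(real ^ 'n \<Rightarrow> real) \<Rightarrow> (real ^ 'n \<Rightarrow> real ^ 'n \<Rightarrow> real) \<Rightarrow> (real ^ 'n \<Rightarrow> real ^ 'n \<Rightarrow> real) \<Rightarrow> bool" where
  "tame g D H \<longleftrightarrow> (\<forall>k. C_k k g) \<and> (\<forall>y. (g has_derivative D y) (at y)) \<and>
     (\<forall>y z \<tau>. ((\<lambda>\<tau>. D (y + \<tau> *\<^sub>R z) z) has_real_derivative H (y + \<tau> *\<^sub>R z) z) (at \<tau>)) \<and>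
     (\<exists>C\<ge>0. \<forall>y z. \<bar>g y\<bar> \<le> C * (1 + (norm y)\<^sup>2) \<and> \<bar>D y z\<bar> \<le> C * (1 + norm y) * norm z \<and>
        \<bar>H y z\<bar> \<le> C * (norm z)\<^sup>2)"

section \<open>Functions of quadratic growth to which Dynkin's formula is applied\<close>

lemma nth_mult_le_norm: "\<bar>y $ i\<bar> * \<bar>z $ j\<bar> \<le> norm (y :: real ^ 'n) * norm (z :: real ^ 'n)"
  by (intro mult_mono component_le_norm_cart) auto

lemma tame_one: "tame (\<lambda>_. 1) (\<lambda>_ _. 0) (\<lambda>_ _. 0)"
  unfolding tame_def by (auto intro!: C_k_const exI[of _ 1])

lemma tame_nth:
  fixes i :: "'n::finite"
  shows "tame (\<lambda>y. y $ i) (\<lambda>y z. z $ i) (\<lambda>_ _. 0)"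
proof -
  have "norm y \<le> 1 + (norm y)\<^sup>2" for y :: "real ^ 'n"
  proof -
    have "norm y \<le> max 1 ((norm y)\<^sup>2)"
      using self_le_power[of "norm y" 2] by (cases "norm y \<le> 1") auto
    moreover have "max 1 ((norm y)\<^sup>2) \<le> 1 + (norm y)\<^sup>2"
      unfolding max_def using zero_le_power2[of "norm y"] by argo
    ultimately show ?thesis by (rule order_trans)
  qed
  then have "\<bar>y $ i\<bar> \<le> 1 + (norm y)\<^sup>2" for y :: "real ^ 'n"
    by (rule order_trans[OF component_le_norm_cart])
  moreover have "\<bar>z $ i\<bar> \<le> (1 + norm y) * norm z" for y z :: "real ^ 'n"
    using component_le_norm_cart[of z i] mult_nonneg_nonneg[OF norm_ge_zero[of y] norm_ge_zero[of z]]
    unfolding distrib_right mult_1 by linarith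
  ultimately show ?thesis
    unfolding tame_def
    by (intro conjI allI exI[of _ 1] C_k_nth bounded_linear_imp_has_derivative bounded_linear_vec_nth) auto
qed

lemma tame_nth_mult:
  fixes i j :: "'n::finite"
  shows "tame (\<lambda>y. y $ i * y $ j) (\<lambda>y z. y $ i * z $ j + z $ i * y $ j) (\<lambda>y z. 2 * (z $ i * z $ j))"
proof -
  have 1: "\<bar>y $ i * y $ j\<bar> \<le> 2 * (1 + (norm y)\<^sup>2)" for y :: "real ^ 'n"
  proof -
    have "0 \<le> norm y * norm y" by simp
    then show ?thesis
      using nth_mult_le_norm[of y i y j] unfolding abs_mult power2_eq_square distrib_left by linarith
  qed
  have 2: "\<bar>y $ i * z $ j + z $ i * y $ j\<bar> \<le> 2 * (1 + norm y) * norm z" for y z :: "real ^ 'n"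
  proof -
    have "\<bar>y $ i * z $ j + z $ i * y $ j\<bar> \<le> \<bar>y $ i * z $ j\<bar> + \<bar>z $ i * y $ j\<bar>" by linarith
    also have "\<dots> \<le> 2 * (norm y * norm z)"
      using nth_mult_le_norm[of y i z j] nth_mult_le_norm[of z i y j]
      by (simp add: abs_mult mult.commute)
    also have "\<dots> \<le> 2 * (1 + norm y) * norm z" by (simp add: algebra_simps)
    finally show ?thesis .
  qed
  have 3: "\<bar>2 * (z $ i * z $ j)\<bar> \<le> 2 * (norm z)\<^sup>2" for z :: "real ^ 'n"
    using nth_mult_le_norm[of z i z j] by (simp add: abs_mult power2_eq_square)
  have 4: "((\<lambda>y. y $ i * y $ j) has_derivative (\<lambda>z. y $ i * z $ j + z $ i * y $ j)) (at y)" for y :: "real ^ 'n"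
    by (intro has_derivative_mult bounded_linear_imp_has_derivative bounded_linear_vec_nth)
  show ?thesis
    unfolding tame_def using 1 2 3 4
    by (intro conjI allI exI[of _ 2] C_k_mult C_k_nth)
      (auto intro!: derivative_eq_intros simp: algebra_simps)
qed

text \<open>Sine and cosine share one proof: \<open>d n\<close> stands for the n-th derivative, and
  all derivatives are bounded by 1, so that each derivative of the rescaled function only
  contributes a power of \<theta>.\<close>

lemma tame_trig:
  fixes i :: "'n::finite"
  assumes d: "\<And>n x. (d n has_real_derivative d (Suc n) x) (at x)" and b: "\<And>n x. \<bar>d n x\<bar> \<le> 1"
  shows "tame (\<lambda>y. d 0 (\<theta> * y $ i)) (\<lambda>y z. d 1 (\<theta> * y $ i) * (\<theta> * z $ i))
    (\<lambda>y z. d 2 (\<theta> * y $ i) * (\<theta> * z $ i)\<^sup>2)"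
proof -
  \<comment> \<open>The three summands dominate the bounds 1, |\<theta>| and \<theta>^2 for the
    function and its first and second derivatives.\<close>
  let ?C = "1 + \<bar>\<theta>\<bar> + \<theta>\<^sup>2"
  have 1: "\<bar>d 0 (\<theta> * y $ i)\<bar> \<le> ?C * (1 + (norm y)\<^sup>2)" for y :: "real ^ 'n"
  proof -
    have "1 * 1 \<le> ?C * (1 + (norm y)\<^sup>2)" by (intro mult_mono) auto
    then show ?thesis using b[of 0 "\<theta> * y $ i"] by simp
  qed
  have 2: "\<bar>d 1 (\<theta> * y $ i) * (\<theta> * z $ i)\<bar> \<le> ?C * (1 + norm y) * norm z" for y z :: "real ^ 'n"
  proof -
    have "\<bar>d 1 (\<theta> * y $ i) * (\<theta> * z $ i)\<bar> \<le> 1 * (\<bar>\<theta>\<bar> * norm z)"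
      unfolding abs_mult by (intro mult_mono b component_le_norm_cart) auto
    also have "\<dots> \<le> (?C * (1 + norm y)) * norm z"
    proof -
      have "\<bar>\<theta>\<bar> * 1 \<le> ?C * (1 + norm y)" by (intro mult_mono) auto
      then show ?thesis by (simp add: mult_right_mono)
    qed
    finally show ?thesis .
  qed
  have 3: "\<bar>d 2 (\<theta> * y $ i) * (\<theta> * z $ i)\<^sup>2\<bar> \<le> ?C * (norm z)\<^sup>2" for y z :: "real ^ 'n"
  proof -
    have "\<bar>z $ i\<bar>\<^sup>2 \<le> (norm z)\<^sup>2" by (intro power_mono component_le_norm_cart) auto
    then have "\<bar>d 2 (\<theta> * y $ i) * (\<theta> * z $ i)\<^sup>2\<bar> \<le> 1 * (\<theta>\<^sup>2 * (norm z)\<^sup>2)"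
      unfolding abs_mult power_mult_distrib by (intro mult_mono b) auto
    also have "\<dots> \<le> ?C * (norm z)\<^sup>2" by (simp add: mult_right_mono)
    finally show ?thesis .
  qed
  have n: "((\<lambda>y. y $ i) has_derivative (\<lambda>z. z $ i)) (at y)" for y :: "real ^ 'n"
    by (intro bounded_linear_imp_has_derivative bounded_linear_vec_nth)
  have 4: "((\<lambda>y. d 0 (\<theta> * y $ i)) has_derivative (\<lambda>z. d 1 (\<theta> * y $ i) * (\<theta> * z $ i))) (at y)" for y :: "real ^ 'n"
    using DERIV_compose_FDERIV[OF d[of 0 "\<theta> * y $ i"] has_derivative_mult_right[OF n, of \<theta> y]]
    by (simp add: mult.commute)
  have 5: "((\<lambda>\<tau>. d 1 (\<theta> * (y + \<tau> *\<^sub>R z) $ i) * (\<theta> * z $ i)) has_real_derivative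
      d 2 (\<theta> * (y + \<tau> *\<^sub>R z) $ i) * (\<theta> * z $ i)\<^sup>2) (at \<tau>)" for y z :: "real ^ 'n" and \<tau>
  proof -
    have "((\<lambda>\<tau>. \<theta> * (y + \<tau> *\<^sub>R z) $ i) has_real_derivative \<theta> * z $ i) (at \<tau>)"
      by (auto intro!: derivative_eq_intros)
    from DERIV_cmult_right[OF DERIV_chain2[OF d[of 1] this], where c = "\<theta> * z $ i"]
    show ?thesis by (simp add: power2_eq_square mult.assoc numeral_2_eq_2)
  qed
  have 6: "C_k k (\<lambda>y. d 0 (\<theta> * y $ i))" for k
    by (intro C_k_compose[of d, OF d] C_k_mult C_k_const C_k_nth)
  show ?thesis
    unfolding tame_def using 1 2 3 4 5 6
    by (auto intro!: exI[of _ ?C])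
qed

lemma tame_cos:
  "tame (\<lambda>y. cos (\<theta> * y $ i)) (\<lambda>y z. - sin (\<theta> * y $ i) * (\<theta> * z $ i))
    (\<lambda>y z. - cos (\<theta> * y $ i) * (\<theta> * z $ i)\<^sup>2)"
proof -
  \<comment> \<open>The n-th derivative of the cosine is the cosine shifted by n quarter turns; this
    form keeps the whole sequence of derivatives bounded by 1 at once.\<close>
  have *: "cos (x + (real n * pi / 2 + pi / 2)) = - sin (x + real n * pi / 2)" for n x
    by (simp add: cos_add[of "x + real n * pi / 2" "pi / 2"] add.assoc[symmetric])
  have "((\<lambda>x. cos (x + real n * pi / 2)) has_real_derivative cos (x + real (Suc n) * pi / 2)) (at x)" for n x
    by (auto intro!: derivative_eq_intros simp: * distrib_right add_divide_distrib add.commute[of "pi / 2"])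
  from tame_trig[of "\<lambda>n x. cos (x + real n * pi / 2)" \<theta> i, OF this abs_cos_le_one] show ?thesis
    by (simp add: cos_add)
qed

lemma tame_sin:
  "tame (\<lambda>y. sin (\<theta> * y $ i)) (\<lambda>y z. cos (\<theta> * y $ i) * (\<theta> * z $ i))
    (\<lambda>y z. - sin (\<theta> * y $ i) * (\<theta> * z $ i)\<^sup>2)"
proof -
  have *: "sin (x + (real n * pi / 2 + pi / 2)) = cos (x + real n * pi / 2)" for n x
    by (simp add: sin_add[of "x + real n * pi / 2" "pi / 2"] add.assoc[symmetric])
  have "((\<lambda>x. sin (x + real n * pi / 2)) has_real_derivative sin (x + real (Suc n) * pi / 2)) (at x)" for n x
    by (auto intro!: derivative_eq_intros simp: * distrib_right add_divide_distrib add.commute[of "pi / 2"])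
  from tame_trig[of "\<lambda>n x. sin (x + real n * pi / 2)" \<theta> i, OF this abs_sin_le_one] show ?thesis
    by (simp add: sin_add)
qed

section \<open>Cut-offs at radius n + 1 and their Taylor expansion\<close>

definition cutoff :: "nat \<Rightarrow> (real ^ 'n \<Rightarrow> real) \<Rightarrow> real ^ 'n \<Rightarrow> real" where
  "cutoff n g x = exp 1 * bump 0 (1 - (norm x / real (Suc n))\<^sup>2) * g x"

text \<open>The factor vanishes as soon as 1 - (|x| / (n + 1))^2 \<le> 0, that is outside the ball
  of radius n + 1. It is one fixed profile dilated by n + 1, so that a k-th derivative of it has
  size of order (n + 1)^(-k).\<close>

lemma cutoff_in_C_c_smooth:
  assumes "\<And>k. C_k k g"
  shows "cutoff n g \<in> C_c_smooth"
proof -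
  have "C_k k (cutoff n g)" for k
  proof -
    have "cutoff n g = (\<lambda>x. exp 1 * bump 0 (1 + - inverse ((real (Suc n))\<^sup>2) * (norm x)\<^sup>2) * g x)"
      by (rule ext) (simp add: cutoff_def power_mult_distrib power_inverse divide_inverse mult.commute)
    then show ?thesis
      by (simp only:) (intro C_k_mult C_k_const assms C_k_compose[of bump, OF has_derivative_bump] C_k_add C_k_norm_square)
  qed
  moreover have "{x. cutoff n g x \<noteq> 0} \<subseteq> cball 0 (real (Suc n))"
  proof
    fix x assume "x \<in> {x. cutoff n g x \<noteq> 0}"
    then have "\<not> (1 - (norm x / real (Suc n))\<^sup>2 \<le> 0)"
      unfolding cutoff_def using bump_nonpos[of "1 - (norm x / real (Suc n))\<^sup>2" 0] by auto
    then have "(norm x / real (Suc n))\<^sup>2 < 1" by simp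
    then have "norm x / real (Suc n) < 1"
      by (simp add: power_less_one_iff abs_square_less_1)
    then show "x \<in> cball 0 (real (Suc n))" by simp
  qed
  then have "compact (closure {x. cutoff n g x \<noteq> 0})"
    using bounded_cball bounded_subset by (metis compact_closure)
  ultimately show ?thesis by (simp add: C_c_smooth_def)
qed

lemma cutoff_abs_le: "\<bar>cutoff n g x\<bar> \<le> \<bar>g x\<bar>"
  using bump_0_le[of "1 - (norm x / real (Suc n))\<^sup>2"] bump_0_nonneg[of "1 - (norm x / real (Suc n))\<^sup>2"]
  by (auto simp: cutoff_def abs_mult intro!: mult_left_le_one_le)

lemma bump_cutoff_tendsto:
  "(\<lambda>n. bump k (1 - (norm x / real (Suc n))\<^sup>2)) \<longlonglongrightarrow> bump k 1"
proof -
  have "isCont (bump k) 1" using has_derivative_bump DERIV_isCont by blast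
  moreover have "(\<lambda>n. 1 - (norm x * inverse (real (Suc n)))\<^sup>2) \<longlonglongrightarrow> 1 - (norm x * 0)\<^sup>2"
    by (intro tendsto_intros LIMSEQ_inverse_real_of_nat)
  ultimately show ?thesis
    by (intro isCont_tendsto_compose[of 1 "bump k"]) (simp_all add: divide_inverse)
qed

lemma cutoff_tendsto: "(\<lambda>n. cutoff n g x) \<longlonglongrightarrow> g x"
  using tendsto_mult_right[OF tendsto_mult_left[OF bump_cutoff_tendsto, of "exp 1"], of 0 x "g x"]
  by (simp add: cutoff_def bump_0_1)

text \<open>\<open>grad\<close> is a definite description, so both existence and uniqueness of the
  representing vector are required; its entries are the values of the derivative on the standard
  basis.\<close>

lemma grad_inner:
  assumes "(u has_derivative u') (at x)"
  shows "grad u x \<bullet> z = u' z"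
proof -
  let ?D = "\<chi> i. u' (axis i 1)"
  interpret u': bounded_linear u' using assms by (rule has_derivative_bounded_linear)
  have "u' h = ?D \<bullet> h" for h
  proof -
    have "u' h = u' (\<Sum>i\<in>UNIV. (h $ i) *\<^sub>R axis i 1)"
      using basis_expansion[of h] by (simp add: scalar_mult_eq_scaleR)
    also have "\<dots> = (\<Sum>i\<in>UNIV. h $ i * u' (axis i 1))"
      by (simp add: u'.sum u'.scaleR)
    finally show ?thesis by (simp add: inner_vec_def mult.commute)
  qed
  then have eq: "u' = (\<lambda>h. ?D \<bullet> h)" by blast
  have "GDERIV u x :> ?D" using assms eq by (simp add: gderiv_def inner_commute)
  moreover have "E = ?D" if "GDERIV u x :> E" for E
  proof -
    have "(\<lambda>h. h \<bullet> E) = u'"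
      using that assms by (auto simp: gderiv_def intro: has_derivative_unique)
    then have "h \<bullet> E = h \<bullet> ?D" for h using eq by (metis inner_commute)
    then show ?thesis using vector_eq_ldot by blast
  qed
  ultimately have "grad u x = ?D" unfolding grad_def by (rule the_equality)
  then show ?thesis using eq by simp
qed

lemma norm_line_deriv:
  "((\<lambda>\<tau>. (norm (x + \<tau> *\<^sub>R z))\<^sup>2) has_real_derivative 2 * ((x + \<tau> *\<^sub>R z) \<bullet> z)) (at \<tau>)"
proof -
  have "(\<lambda>\<tau>. (norm (x + \<tau> *\<^sub>R z))\<^sup>2) = (\<lambda>\<tau>. x \<bullet> x + \<tau> * (2 * (x \<bullet> z)) + \<tau>\<^sup>2 * (z \<bullet> z))"
    unfolding power2_norm_eq_inner
    by (auto simp: inner_simps inner_commute power2_eq_square algebra_simps)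
  then show ?thesis
    by (auto intro!: derivative_eq_intros simp: inner_simps algebra_simps)
qed

lemma cutoff_has_derivative:
  assumes "tame g D H"
  shows "(cutoff n g has_derivative (\<lambda>z. exp 1 *
    (bump 1 (1 - (norm x / real (Suc n))\<^sup>2) * (- 2 * (x \<bullet> z) / (real (Suc n))\<^sup>2) * g x
     + bump 0 (1 - (norm x / real (Suc n))\<^sup>2) * D x z))) (at x)"
proof -
  let ?R = "real (Suc n)"
  have g: "(g has_derivative D x) (at x)" using assms by (simp add: tame_def)
  have r: "((\<lambda>x. 1 - (norm x / ?R)\<^sup>2) has_derivative (\<lambda>z. - 2 * (x \<bullet> z) / ?R\<^sup>2)) (at x)"
  proof -
    have "((\<lambda>x. 1 - (x \<bullet> x) * inverse (?R\<^sup>2)) has_derivative (\<lambda>z. - (x \<bullet> z + z \<bullet> x) * inverse (?R\<^sup>2))) (at x)"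
      by (auto intro!: derivative_eq_intros simp: algebra_simps)
    then show ?thesis
      by (simp add: power2_norm_eq_inner inner_commute divide_inverse power_mult_distrib power_inverse)
  qed
  have b: "((\<lambda>x. bump 0 (1 - (norm x / ?R)\<^sup>2)) has_derivative
      (\<lambda>z. bump 1 (1 - (norm x / ?R)\<^sup>2) * (- 2 * (x \<bullet> z) / ?R\<^sup>2))) (at x)"
    using DERIV_compose_FDERIV[OF has_derivative_bump[of 0 "1 - (norm x / ?R)\<^sup>2"] r]
    by (simp add: mult.commute)
  show ?thesis
    unfolding cutoff_def[abs_def]
    using has_derivative_mult_right[OF has_derivative_mult[OF b g], of "exp 1"]
    by (simp add: algebra_simps)
qed

text \<open>A one-dimensional Taylor expansion along the segment from x to x + z. The constant does
  not depend on n because on the support, where |y| \<le> R, every term of the second derivative is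
  balanced: g is of order R^2 and meets two derivatives of the factor, \<open>D\<close> is of order
  R and meets one, \<open>H\<close> is bounded and meets none.\<close>

lemma cutoff_taylor:
  assumes t: "tame g D H"
  shows "\<exists>C\<ge>0. \<forall>n x z. \<bar>cutoff n g (x + z) - cutoff n g x - grad (cutoff n g) x \<bullet> z\<bar> \<le> C * (norm z)\<^sup>2"
proof -
  from t obtain C where C: "C \<ge> 0" "\<And>y. \<bar>g y\<bar> \<le> C * (1 + (norm y)\<^sup>2)"
    "\<And>y z. \<bar>D y z\<bar> \<le> C * (1 + norm y) * norm z" "\<And>y z. \<bar>H y z\<bar> \<le> C * (norm z)\<^sup>2"
    unfolding tame_def by auto
  obtain B0 B1 B2 where "\<And>x. x \<le> 1 \<Longrightarrow> \<bar>bump 0 x\<bar> \<le> B0" "\<And>x. x \<le> 1 \<Longrightarrow> \<bar>bump 1 x\<bar> \<le> B1"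
    "\<And>x. x \<le> 1 \<Longrightarrow> \<bar>bump 2 x\<bar> \<le> B2" using bump_bounded by meson
  note B012 = this
  define B where "B = \<bar>B0\<bar> + \<bar>B1\<bar> + \<bar>B2\<bar>"
  have B: "B \<ge> 0" "\<And>x. x \<le> 1 \<Longrightarrow> \<bar>bump 0 x\<bar> \<le> B" "\<And>x. x \<le> 1 \<Longrightarrow> \<bar>bump 1 x\<bar> \<le> B"
    "\<And>x. x \<le> 1 \<Longrightarrow> \<bar>bump 2 x\<bar> \<le> B"
    using B012 unfolding B_def by (simp, smt (verit, ccfv_threshold), smt (verit, ccfv_threshold), smt (verit, ccfv_threshold))
  \<comment> \<open>The four terms of the second derivative \<open>q2\<close> are bounded by 8, 4, 4
    and 1 times B C |z|^2, and the third occurs twice: 8 + 4 + 8 + 1 = 21.\<close>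
  let ?K = "exp 1 * (21 * (B * C))"
  have "\<bar>cutoff n g (x + z) - cutoff n g x - grad (cutoff n g) x \<bullet> z\<bar> \<le> ?K * (norm z)\<^sup>2" for n x z
  proof -
    define R where "R = real (Suc n)"
    have R: "1 \<le> R" by (simp add: R_def)
    define y where "y \<tau> = x + \<tau> *\<^sub>R z" for \<tau> :: real
    define \<rho> where "\<rho> \<tau> = 1 - (norm (y \<tau>) / R)\<^sup>2" for \<tau> :: real
    define \<rho>1 where "\<rho>1 \<tau> = - 2 * (y \<tau> \<bullet> z) / R\<^sup>2" for \<tau> :: real
    define \<rho>2 where "\<rho>2 = - 2 * (z \<bullet> z) / R\<^sup>2"
    define q where "q \<tau> = exp 1 * (bump 0 (\<rho> \<tau>) * g (y \<tau>))" for \<tau>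
    define q1 where "q1 \<tau> = exp 1 * (bump 1 (\<rho> \<tau>) * \<rho>1 \<tau> * g (y \<tau>) + bump 0 (\<rho> \<tau>) * D (y \<tau>) z)" for \<tau>
    define q2 where "q2 \<tau> = exp 1 * (bump 2 (\<rho> \<tau>) * (\<rho>1 \<tau>)\<^sup>2 * g (y \<tau>) + bump 1 (\<rho> \<tau>) * \<rho>2 * g (y \<tau>)
        + 2 * (bump 1 (\<rho> \<tau>) * \<rho>1 \<tau> * D (y \<tau>) z) + bump 0 (\<rho> \<tau>) * H (y \<tau>) z)" for \<tau>
    have d\<rho>: "(\<rho> has_real_derivative \<rho>1 \<tau>) (at \<tau>)" for \<tau>
    proof -
      have "((\<lambda>\<tau>. 1 - (norm (x + \<tau> *\<^sub>R z))\<^sup>2 * inverse (R\<^sup>2)) has_real_derivative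
          - (2 * ((x + \<tau> *\<^sub>R z) \<bullet> z) * inverse (R\<^sup>2))) (at \<tau>)"
        using DERIV_diff[OF DERIV_const DERIV_cmult_right[OF norm_line_deriv], of 1] by simp
      then show ?thesis
        unfolding \<rho>_def[abs_def] \<rho>1_def y_def
        by (simp add: divide_inverse power_mult_distrib power_inverse)
    qed
    have d\<rho>1: "(\<rho>1 has_real_derivative \<rho>2) (at \<tau>)" for \<tau>
      unfolding \<rho>1_def[abs_def] \<rho>2_def y_def inner_add_left inner_scaleR_left
      by (rule DERIV_cdivide) (auto intro!: derivative_eq_intros)
    have dg: "((\<lambda>\<tau>. g (y \<tau>)) has_real_derivative D (y \<tau>) z) (at \<tau>)" for \<tau>
    proof -
      have "(g has_derivative D (y \<tau>)) (at (y \<tau>))" using t by (simp add: tame_def)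
      moreover have "(y has_derivative (\<lambda>h. h *\<^sub>R z)) (at \<tau>)"
        unfolding y_def[abs_def] by (auto intro!: derivative_eq_intros)
      ultimately have h: "((\<lambda>\<tau>. g (y \<tau>)) has_derivative (\<lambda>h. D (y \<tau>) (h *\<^sub>R z))) (at \<tau>)"
        by (rule has_derivative_compose[rotated])
      interpret bounded_linear "D (y \<tau>)"
        using t by (auto simp: tame_def intro: has_derivative_bounded_linear)
      show ?thesis using h by (simp add: has_field_derivative_def scaleR mult_commute_abs)
    qed
    have dD: "((\<lambda>\<tau>. D (y \<tau>) z) has_real_derivative H (y \<tau>) z) (at \<tau>)" for \<tau>
      using t unfolding y_def by (auto simp: tame_def)
    have db: "((\<lambda>\<tau>. bump k (\<rho> \<tau>)) has_real_derivative bump (Suc k) (\<rho> \<tau>) * \<rho>1 \<tau>) (at \<tau>)" for k \<tau>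
      by (rule DERIV_bump[OF d\<rho>])
    have dq: "(q has_real_derivative q1 \<tau>) (at \<tau>)" for \<tau>
      unfolding q_def[abs_def] q1_def
      by (rule DERIV_cong[OF DERIV_cmult[OF DERIV_mult[OF db dg]]]) (simp add: algebra_simps)
    have dq1: "(q1 has_real_derivative q2 \<tau>) (at \<tau>)" for \<tau>
      unfolding q1_def[abs_def] q2_def
      by (rule DERIV_cong[OF DERIV_cmult[OF DERIV_add[OF DERIV_mult[OF DERIV_mult[OF db d\<rho>1] dg]
            DERIV_mult[OF db dD]]]])
        (simp add: power2_eq_square algebra_simps numeral_2_eq_2)
    have bound: "\<bar>q2 \<tau>\<bar> \<le> ?K * (norm z)\<^sup>2" for \<tau>
    proof (cases "\<rho> \<tau> \<le> 0")
      \<comment> \<open>Outside the support all derivatives of the factor vanish, so the growth of g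
        does not matter there.\<close>
      case True
      then show ?thesis using B C by (simp add: q2_def)
    next
      case False
      have \<rho>le: "\<rho> \<tau> \<le> 1" by (simp add: \<rho>_def)
      have "(norm (y \<tau>) / R)\<^sup>2 < 1" using False by (simp add: \<rho>_def)
      then have "norm (y \<tau>) / R < 1" using R by (simp add: abs_square_less_1)
      then have ny: "norm (y \<tau>) \<le> R" using R by (simp add: divide_simps split: if_splits)
      have z: "\<bar>y \<tau> \<bullet> z\<bar> \<le> R * norm z"
        using Cauchy_Schwarz_ineq2[of "y \<tau>" z] ny
        by (meson mult_right_mono norm_ge_zero order_trans)
      have \<rho>1: "\<bar>\<rho>1 \<tau>\<bar> \<le> 2 * norm z / R"
      proof -
        have "\<bar>\<rho>1 \<tau>\<bar> = 2 * \<bar>y \<tau> \<bullet> z\<bar> / R\<^sup>2" by (simp add: \<rho>1_def abs_mult)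
        also have "\<dots> \<le> 2 * (R * norm z) / R\<^sup>2" using z by (intro divide_right_mono) auto
        also have "\<dots> = 2 * norm z / R" using R by (simp add: power2_eq_square)
        finally show ?thesis .
      qed
      have \<rho>2: "\<bar>\<rho>2\<bar> = 2 * (norm z)\<^sup>2 / R\<^sup>2" by (simp add: \<rho>2_def power2_norm_eq_inner)
      have "1 + (norm (y \<tau>))\<^sup>2 \<le> 2 * R\<^sup>2"
        using power_mono[OF ny norm_ge_zero, of 2] one_le_power[OF R, of 2] by linarith
      then have gy: "\<bar>g (y \<tau>)\<bar> \<le> C * (2 * R\<^sup>2)"
        using C(2)[of "y \<tau>"] C(1) by (meson mult_left_mono order_trans)
      have "C * (1 + norm (y \<tau>)) * norm z \<le> C * (2 * R) * norm z"
        using ny R C(1) by (intro mult_right_mono mult_left_mono) auto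
      then have Dy: "\<bar>D (y \<tau>) z\<bar> \<le> C * (2 * R) * norm z" using C(3)[of "y \<tau>" z] by simp
      have R0: "R \<noteq> 0" using R by simp
      have sq: "\<bar>\<rho>1 \<tau>\<bar>\<^sup>2 \<le> (2 * norm z / R)\<^sup>2" using \<rho>1 by (intro power_mono) auto
      have 1: "\<bar>bump 2 (\<rho> \<tau>) * (\<rho>1 \<tau>)\<^sup>2 * g (y \<tau>)\<bar> \<le> 8 * (B * C) * (norm z)\<^sup>2"
      proof -
        have "\<bar>bump 2 (\<rho> \<tau>) * (\<rho>1 \<tau>)\<^sup>2 * g (y \<tau>)\<bar> \<le> B * (2 * norm z / R)\<^sup>2 * (C * (2 * R\<^sup>2))"
          unfolding abs_mult power_abs[symmetric]
          using B \<rho>le sq gy power2_abs[of "\<rho>1 \<tau>"] by (intro mult_mono) auto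
        also have "\<dots> = 8 * (B * C) * (norm z)\<^sup>2" using R0 by (simp add: power2_eq_square field_simps)
        finally show ?thesis .
      qed
      have 2: "\<bar>bump 1 (\<rho> \<tau>) * \<rho>2 * g (y \<tau>)\<bar> \<le> 4 * (B * C) * (norm z)\<^sup>2"
      proof -
        have "\<bar>bump 1 (\<rho> \<tau>) * \<rho>2 * g (y \<tau>)\<bar> \<le> B * (2 * (norm z)\<^sup>2 / R\<^sup>2) * (C * (2 * R\<^sup>2))"
          unfolding abs_mult \<rho>2 using B \<rho>le gy by (intro mult_mono) auto
        also have "\<dots> = 4 * (B * C) * (norm z)\<^sup>2" using R0 by (simp add: power2_eq_square field_simps)
        finally show ?thesis .
      qed
      have 3: "\<bar>bump 1 (\<rho> \<tau>) * \<rho>1 \<tau> * D (y \<tau>) z\<bar> \<le> 4 * (B * C) * (norm z)\<^sup>2"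
      proof -
        have "\<bar>bump 1 (\<rho> \<tau>) * \<rho>1 \<tau> * D (y \<tau>) z\<bar> \<le> B * (2 * norm z / R) * (C * (2 * R) * norm z)"
          unfolding abs_mult using B \<rho>le Dy \<rho>1 R by (intro mult_mono) auto
        also have "\<dots> = 4 * (B * C) * (norm z)\<^sup>2" using R0 by (simp add: power2_eq_square field_simps)
        finally show ?thesis .
      qed
      have 4: "\<bar>bump 0 (\<rho> \<tau>) * H (y \<tau>) z\<bar> \<le> (B * C) * (norm z)\<^sup>2"
      proof -
        have "\<bar>bump 0 (\<rho> \<tau>) * H (y \<tau>) z\<bar> \<le> B * (C * (norm z)\<^sup>2)"
          unfolding abs_mult using B \<rho>le C by (intro mult_mono) auto
        then show ?thesis by simp
      qed
      have "\<bar>q2 \<tau>\<bar> \<le> exp 1 * (21 * (B * C) * (norm z)\<^sup>2)"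
        unfolding q2_def abs_mult abs_exp_cancel
        using 1 2 3 4 by (intro mult_left_mono) auto
      then show ?thesis by simp
    qed
    define diff where "diff = (\<lambda>m::nat. if m = 0 then q else if m = 1 then q1 else q2)"
    \<comment> \<open>Second-order expansion of \<open>q\<close> between \<tau> = 0 and \<tau> = 1,
      the two ends of the segment.\<close>
    have "\<exists>t>0. t < 1 \<and> q 1 = (\<Sum>m<2. diff m 0 / fact m * 1 ^ m) + diff 2 t / fact 2 * 1 ^ 2"
      by (rule Maclaurin) (auto simp: diff_def dq dq1 less_2_cases_iff)
    then obtain t where "q 1 = q 0 + q1 0 + q2 t / 2"
      by (auto simp: diff_def numeral_2_eq_2)
    then have "\<bar>q 1 - q 0 - q1 0\<bar> \<le> ?K * (norm z)\<^sup>2" using bound[of t] by simp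
    moreover have "q 1 = cutoff n g (x + z)" "q 0 = cutoff n g x"
      by (simp_all add: q_def cutoff_def y_def \<rho>_def R_def)
    moreover have "q1 0 = grad (cutoff n g) x \<bullet> z"
      unfolding grad_inner[OF cutoff_has_derivative[OF t]]
      by (simp add: q1_def y_def \<rho>_def \<rho>1_def R_def)
    ultimately show ?thesis by simp
  qed
  moreover have "?K \<ge> 0" using B C by simp
  ultimately show ?thesis by blast
qed

text \<open>In the product rule the term with the differentiated factor carries 1 / (n + 1)^2 and
  disappears; in the other term the normalised factor tends to 1.\<close>

lemma cutoff_grad_tendsto:
  assumes "tame g D H"
  shows "(\<lambda>n. grad (cutoff n g) x \<bullet> z) \<longlonglongrightarrow> D x z"
proof -
  have "(\<lambda>n. - 2 * (x \<bullet> z) * (inverse (real (Suc n)))\<^sup>2) \<longlonglongrightarrow> - 2 * (x \<bullet> z) * 0\<^sup>2"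
    by (intro tendsto_intros LIMSEQ_inverse_real_of_nat)
  then have "(\<lambda>n. - 2 * (x \<bullet> z) / (real (Suc n))\<^sup>2) \<longlonglongrightarrow> 0"
    by (simp add: divide_inverse power_inverse)
  then have "(\<lambda>n. exp 1 * (bump 1 (1 - (norm x / real (Suc n))\<^sup>2) * (- 2 * (x \<bullet> z) / (real (Suc n))\<^sup>2) * g x
     + bump 0 (1 - (norm x / real (Suc n))\<^sup>2) * D x z)) \<longlonglongrightarrow>
    exp 1 * (bump 1 1 * 0 * g x + bump 0 1 * D x z)"
    by (intro tendsto_intros bump_cutoff_tendsto)
  moreover have "exp 1 * (bump 1 1 * 0 * g x + bump 0 1 * D x z) = (exp 1 * bump 0 1) * D x z"
    by simp
  ultimately show ?thesis
    unfolding grad_inner[OF cutoff_has_derivative[OF assms]] by (simp only: bump_0_1 mult_1)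
qed

section \<open>The generator on functions of quadratic growth\<close>

text \<open>By \<open>centred\<close> it does not matter that \<open>\<langle>\<nabla>g(x), z\<rangle>\<close> is not truncated.\<close>

definition jump_gen ::
  "(real ^ 'n \<Rightarrow> (real ^ 'n) measure) \<Rightarrow> (real ^ 'n \<Rightarrow> real) \<Rightarrow> (real ^ 'n \<Rightarrow> real ^ 'n \<Rightarrow> real) \<Rightarrow> real ^ 'n \<Rightarrow> real" where
  "jump_gen N g D x = (\<integral>z. (g (x + z) - g x - D x z) \<partial>N x)"

locale jump_kernel =
  fixes N :: "real ^ 'n \<Rightarrow> (real ^ 'n) measure"
  assumes sets_N: "\<And>x. sets (N x) = sets (restrict_space borel (UNIV - {0}))"
    and second_moment: "(SUP x. \<integral>\<^sup>+z. ennreal ((norm z)\<^sup>2) \<partial>N x) < \<infinity>"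
    and centred: "\<And>x i. (\<integral>z. (z $ i) * indicator {z. 1 \<le> norm z} z \<partial>N x) = 0"
begin

lemma measurable_N: "f \<in> borel_measurable borel \<Longrightarrow> f \<in> borel_measurable (N x)"
  unfolding measurable_cong_sets[OF sets_N refl] by (rule measurable_restrict_space1)

definition K :: real where
  "K = enn2real (SUP x. \<integral>\<^sup>+z. ennreal ((norm z)\<^sup>2) \<partial>N x)"

lemma K_nonneg: "0 \<le> K"
  by (simp add: K_def)

lemma nn_integral_norm_sq: "(\<integral>\<^sup>+z. ennreal ((norm z)\<^sup>2) \<partial>N x) \<le> ennreal K"
proof -
  have "(SUP x. \<integral>\<^sup>+z. ennreal ((norm z)\<^sup>2) \<partial>N x) = ennreal K"
    using second_moment by (simp add: K_def less_top)
  then show ?thesis by (metis SUP_upper UNIV_I)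
qed

lemma integrable_norm_sq: "integrable (N x) (\<lambda>z. (norm z)\<^sup>2)"
  by (rule integrableI_nonneg)
    (use nn_integral_norm_sq[of x] in \<open>auto intro!: measurable_N simp: le_less_trans\<close>)

lemma integral_norm_sq_le: "(\<integral>z. (norm z)\<^sup>2 \<partial>N x) \<le> K"
  using nn_integral_norm_sq[of x] K_nonneg
  by (subst (asm) nn_integral_eq_integral[OF integrable_norm_sq]) auto

lemma
  assumes f: "f \<in> borel_measurable borel" and b: "\<And>z. \<bar>f z\<bar> \<le> C * (norm z)\<^sup>2"
  shows integrable_N: "integrable (N x) f" and integral_N_le: "0 \<le> C \<Longrightarrow> \<bar>\<integral>z. f z \<partial>N x\<bar> \<le> C * K"
proof -
  show i: "integrable (N x) f"
  proof (rule Bochner_Integration.integrable_bound)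
    show "integrable (N x) (\<lambda>z. C * (norm z)\<^sup>2)"
      by (intro integrable_mult_right integrable_norm_sq)
  qed (use b in \<open>auto intro!: measurable_N f AE_I2 intro: order_trans[OF _ abs_ge_self]\<close>)
  assume "0 \<le> C"
  have "\<bar>\<integral>z. f z \<partial>N x\<bar> \<le> (\<integral>z. \<bar>f z\<bar> \<partial>N x)"
    by (rule integral_abs_bound)
  also have "\<dots> \<le> (\<integral>z. C * (norm z)\<^sup>2 \<partial>N x)"
    using b by (intro integral_mono integrable_abs i integrable_mult_right integrable_norm_sq)
  also have "\<dots> \<le> C * K"
    using integral_norm_sq_le \<open>0 \<le> C\<close> by (simp add: mult_left_mono)
  finally show "\<bar>\<integral>z. f z \<partial>N x\<bar> \<le> C * K" .
qed

text \<open>\<open>centred\<close>, stated for coordinates, extends to every linear functional of z.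
  Integrability comes from |z_i| \<le> |z|^2 on |z| \<ge> 1.\<close>

lemma integral_large_jumps: "(\<integral>z. (v \<bullet> z) * indicator {z. 1 \<le> norm z} z \<partial>N x) = 0"
    and integrable_large_jumps: "integrable (N x) (\<lambda>z. (v \<bullet> z) * indicator {z. 1 \<le> norm z} z)"
proof -
  have i: "integrable (N x) (\<lambda>z. (z $ i) * indicator {z. 1 \<le> norm z} z)" for i
  proof (rule integrable_N[where C = 1])
    show "(\<lambda>z::real^'n. (z $ i) * indicator {z. 1 \<le> norm z} z) \<in> borel_measurable borel"
      by measurable
    show "\<bar>(z $ i) * indicator {z. 1 \<le> norm z} z\<bar> \<le> 1 * (norm z)\<^sup>2" for z :: "real ^ 'n"
    proof (cases "1 \<le> norm z")
      case True
      then show ?thesis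
        using component_le_norm_cart[of z i] self_le_power[of "norm z" 2] by simp
    qed simp
  qed
  have eq: "(v \<bullet> z) * indicator {z. 1 \<le> norm z} z = (\<Sum>i\<in>UNIV. v $ i * ((z $ i) * indicator {z. 1 \<le> norm z} z))" for z
    by (simp add: inner_vec_def sum_distrib_right mult.assoc)
  show "(\<integral>z. (v \<bullet> z) * indicator {z. 1 \<le> norm z} z \<partial>N x) = 0"
    unfolding eq by (subst Bochner_Integration.integral_sum) (auto intro!: integrable_mult_right i simp: centred)
  show "integrable (N x) (\<lambda>z. (v \<bullet> z) * indicator {z. 1 \<le> norm z} z)"
    unfolding eq by (auto intro!: integrable_mult_right i)
qed

lemma tame_cutoff_continuous: "tame g D H \<Longrightarrow> continuous_on UNIV (cutoff n g)"
  using cutoff_in_C_c_smooth[of g n] unfolding tame_def C_c_smooth_def by (auto dest: spec[of _ 0])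

lemma tame_continuous: "tame g D H \<Longrightarrow> continuous_on UNIV g"
  unfolding tame_def by (auto dest: spec[of _ 0])

lemma tame_deriv_continuous: "tame g D H \<Longrightarrow> continuous_on UNIV (D x)"
  unfolding tame_def by (auto dest: has_derivative_linear intro: linear_continuous_on linear_conv_bounded_linear[THEN iffD1])

text \<open>Dropping the truncation of the gradient term changes the integral by a large-jump
  integral, which is 0. The integrand is then a Taylor remainder below C |z|^2 with C independent of
  n; this single bound yields both the uniform estimate C K and the dominated convergence.\<close>

lemma generator_cutoff:
  assumes t: "tame g D H"
  obtains C where "C \<ge> 0"
    "\<And>n x. \<bar>\<integral>z. (cutoff n g (x + z) - cutoff n g x - (grad (cutoff n g) x \<bullet> z) * indicator {z. norm z < 1} z) \<partial>N x\<bar> \<le> C"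
    "\<And>x. (\<lambda>n. \<integral>z. (cutoff n g (x + z) - cutoff n g x - (grad (cutoff n g) x \<bullet> z) * indicator {z. norm z < 1} z) \<partial>N x)
       \<longlonglongrightarrow> jump_gen N g D x"
proof -
  obtain C where C: "C \<ge> 0" "\<And>n x z. \<bar>cutoff n g (x + z) - cutoff n g x - grad (cutoff n g) x \<bullet> z\<bar> \<le> C * (norm z)\<^sup>2"
    using cutoff_taylor[OF t] by blast
  have [measurable]: "cutoff n g \<in> borel_measurable borel" for n
    by (rule borel_measurable_continuous_onI[OF tame_cutoff_continuous[OF t]])
  have [measurable]: "g \<in> borel_measurable borel"
    by (rule borel_measurable_continuous_onI[OF tame_continuous[OF t]])
  have [measurable]: "D x \<in> borel_measurable borel" for x
    by (rule borel_measurable_continuous_onI[OF tame_deriv_continuous[OF t]])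
  have eq: "(\<integral>z. (cutoff n g (x + z) - cutoff n g x - (grad (cutoff n g) x \<bullet> z) * indicator {z. norm z < 1} z) \<partial>N x)
     = (\<integral>z. (cutoff n g (x + z) - cutoff n g x - grad (cutoff n g) x \<bullet> z) \<partial>N x)" for n x
  proof -
    let ?f = "\<lambda>z. cutoff n g (x + z) - cutoff n g x - grad (cutoff n g) x \<bullet> z"
    let ?h = "\<lambda>z. (grad (cutoff n g) x \<bullet> z) * indicator {z. 1 \<le> norm z} z"
    have "(\<integral>z. (cutoff n g (x + z) - cutoff n g x - (grad (cutoff n g) x \<bullet> z) * indicator {z. norm z < 1} z) \<partial>N x)
        = (\<integral>z. ?f z + ?h z \<partial>N x)"
      by (rule Bochner_Integration.integral_cong) (auto simp: indicator_def)
    also have "\<dots> = (\<integral>z. ?f z \<partial>N x) + (\<integral>z. ?h z \<partial>N x)"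
      by (rule Bochner_Integration.integral_add[OF integrable_N[OF _ C(2)] integrable_large_jumps]) measurable
    finally show ?thesis by (simp add: integral_large_jumps)
  qed
  show thesis
  proof (rule that[of "C * K"])
    show "C * K \<ge> 0" using C K_nonneg by simp
    fix x
    show "\<bar>\<integral>z. (cutoff n g (x + z) - cutoff n g x - (grad (cutoff n g) x \<bullet> z) * indicator {z. norm z < 1} z) \<partial>N x\<bar> \<le> C * K" for n
      unfolding eq by (rule integral_N_le[OF _ C(2) C(1)]) measurable
    show "(\<lambda>n. \<integral>z. (cutoff n g (x + z) - cutoff n g x - (grad (cutoff n g) x \<bullet> z) * indicator {z. norm z < 1} z) \<partial>N x)
       \<longlonglongrightarrow> jump_gen N g D x"
      unfolding eq jump_gen_def
    proof (rule integral_dominated_convergence[where w = "\<lambda>z. C * (norm z)\<^sup>2"])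
      show "AE z in N x. (\<lambda>n. cutoff n g (x + z) - cutoff n g x - grad (cutoff n g) x \<bullet> z) \<longlonglongrightarrow> g (x + z) - g x - D x z"
        by (intro AE_I2 tendsto_diff cutoff_tendsto cutoff_grad_tendsto[OF t])
    qed (use C in \<open>auto intro!: integrable_mult_right integrable_norm_sq measurable_N\<close>)
  qed
qed

end

section \<open>Right-continuous processes\<close>

text \<open>Floor plus one, rather than the ceiling: the grid points have to lie strictly to the
  right of s, also when s is itself on the grid, so that right limits can be inserted.\<close>

lemma filterlim_floor_grid: "filterlim (\<lambda>n. (of_int \<lfloor>real (Suc n) * s\<rfloor> + 1) / real (Suc n)) (at_right s) sequentially"
  for s :: real
proof (rule tendsto_imp_filterlim_at_right)
  have gt: "s < (of_int \<lfloor>real (Suc n) * s\<rfloor> + 1) / real (Suc n)" for n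
    using floor_correct[of "real (Suc n) * s"] by (simp add: pos_less_divide_eq mult.commute)
  then show "\<forall>\<^sub>F n in sequentially. s < (of_int \<lfloor>real (Suc n) * s\<rfloor> + 1) / real (Suc n)"
    by simp
  have le: "(of_int \<lfloor>real (Suc n) * s\<rfloor> + 1) / real (Suc n) \<le> s + inverse (real (Suc n))" for n
  proof -
    have "of_int \<lfloor>real (Suc n) * s\<rfloor> + 1 \<le> real (Suc n) * s + 1" by simp
    then have "(of_int \<lfloor>real (Suc n) * s\<rfloor> + 1) / real (Suc n) \<le> (real (Suc n) * s + 1) / real (Suc n)"
      by (intro divide_right_mono) auto
    also have "\<dots> = s + inverse (real (Suc n))" by (simp add: field_simps)
    finally show ?thesis .
  qed
  show "(\<lambda>n. (of_int \<lfloor>real (Suc n) * s\<rfloor> + 1) / real (Suc n)) \<longlonglongrightarrow> s"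
  proof (rule tendsto_sandwich[of "\<lambda>_. s" _ _ "\<lambda>n. s + inverse (real (Suc n))"])
    show "(\<lambda>n. s + inverse (real (Suc n))) \<longlonglongrightarrow> s"
      using tendsto_add[OF tendsto_const LIMSEQ_inverse_real_of_nat, of s] by simp
    show "\<forall>\<^sub>F n in sequentially. s \<le> (of_int \<lfloor>real (Suc n) * s\<rfloor> + 1) / real (Suc n)"
      by (intro always_eventually allI less_imp_le gt)
  qed (use le in auto)
qed

text \<open>Right-continuous adapted processes are progressively measurable: time is replaced by the
  next grid point, which takes countably many values. Clipping to [0, T] keeps every value
  measurable at time T, and for s \<ge> T all approximations already equal the value at T.\<close>

lemma clip_measurable_right_continuous:
  fixes f :: "real \<Rightarrow> 'w \<Rightarrow> real"
  assumes f: "\<And>t. 0 \<le> t \<Longrightarrow> t \<le> T \<Longrightarrow> f t \<in> borel_measurable M" and T: "0 \<le> T"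
    and rc: "\<And>\<omega> t. \<omega> \<in> space M \<Longrightarrow> 0 \<le> t \<Longrightarrow> t < T \<Longrightarrow> ((\<lambda>s. f s \<omega>) \<longlongrightarrow> f t \<omega>) (at_right t)"
  shows "(\<lambda>(s, \<omega>). f (max 0 (min s T)) \<omega>) \<in> borel_measurable (borel \<Otimes>\<^sub>M M)"
proof -
  define r where "r n s = (of_int \<lfloor>real (Suc n) * s\<rfloor> + 1) / real (Suc n)" for n and s :: real
  let ?f = "\<lambda>n (s, \<omega>). f (max 0 (min (r n s) T)) \<omega>"
  have "?f n \<in> borel_measurable (borel \<Otimes>\<^sub>M M)" for n
  proof -
    have "(\<lambda>x. (\<lambda>i x. f (max 0 (min ((of_int i + 1) / real (Suc n)) T)) (snd x)) \<lfloor>real (Suc n) * fst x\<rfloor> x)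
       \<in> borel_measurable (borel \<Otimes>\<^sub>M M)"
    proof (rule measurable_compose_countable[where g = "\<lambda>x. \<lfloor>real (Suc n) * fst x\<rfloor>"
          and f = "\<lambda>i x. f (max 0 (min ((of_int i + 1) / real (Suc n)) T)) (snd x)"])
      show "(\<lambda>x. f (max 0 (min ((of_int i + 1) / real (Suc n)) T)) (snd x)) \<in> borel_measurable (borel \<Otimes>\<^sub>M M)" for i :: int
        using T by (intro measurable_compose[OF measurable_snd f]) auto
    qed measurable
    then show ?thesis by (simp add: r_def split_beta)
  qed
  moreover have "(\<lambda>n. ?f n x) \<longlonglongrightarrow> (\<lambda>(s, \<omega>). f (max 0 (min s T)) \<omega>) x" if "x \<in> space (borel \<Otimes>\<^sub>M M)" for x
  proof -
  from that obtain s \<omega> where x: "x = (s, \<omega>)" and \<omega>: "\<omega> \<in> space M" by (auto simp: space_pair_measure)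
  have r: "filterlim (\<lambda>n. r n s) (at_right s) sequentially"
    unfolding r_def by (rule filterlim_floor_grid)
  then have lim: "(\<lambda>n. r n s) \<longlonglongrightarrow> s" and "\<forall>\<^sub>F n in sequentially. r n s \<in> {s<..} \<and> r n s \<noteq> s"
    unfolding filterlim_at by blast+
  then have gt: "\<forall>\<^sub>F n in sequentially. s < r n s"
    by (auto elim!: eventually_mono)
  have "(\<lambda>n. f (max 0 (min (r n s) T)) \<omega>) \<longlonglongrightarrow> f (max 0 (min s T)) \<omega>"
  proof -
    consider "s < 0" | "0 \<le> s" "s < T" | "T \<le> s" by linarith
    then show ?thesis
    proof cases
      case 1
      then have "\<forall>\<^sub>F n in sequentially. r n s < 0" using lim by (rule order_tendstoD[rotated])
      then show ?thesis using 1 T by (intro tendsto_eventually) (auto elim!: eventually_mono simp: max_def min_def)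
    next
      case 2
      have "filterlim (\<lambda>n. max 0 (min (r n s) T)) (at_right s) sequentially"
      proof (rule tendsto_imp_filterlim_at_right)
        have "(\<lambda>n. max 0 (min (r n s) T)) \<longlonglongrightarrow> max 0 (min s T)" by (intro tendsto_intros lim)
        then show "(\<lambda>n. max 0 (min (r n s) T)) \<longlonglongrightarrow> s" using 2 by simp
        show "\<forall>\<^sub>F n in sequentially. s < max 0 (min (r n s) T)"
          using gt by eventually_elim (use 2 in auto)
      qed
      then have "(\<lambda>n. f (max 0 (min (r n s) T)) \<omega>) \<longlonglongrightarrow> f s \<omega>"
        by (rule filterlim_compose[OF rc[OF \<omega> 2]])
      then show ?thesis using 2 by simp
    next
      case 3
      have "\<forall>\<^sub>F n in sequentially. f (max 0 (min (r n s) T)) \<omega> = f (max 0 (min s T)) \<omega>"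
        using gt by eventually_elim (use 3 in auto)
      then show ?thesis by (rule tendsto_eventually)
    qed
  qed
  then show ?thesis by (simp add: x)
  qed
  ultimately show ?thesis by (rule borel_measurable_LIMSEQ_real[where u = ?f, rotated])
qed

section \<open>Functions vanishing at infinity and the one-point compactification\<close>

lemma C_infty_bounded:
  assumes "u \<in> C_infty"
  obtains B where "B \<ge> 0" "\<And>x. \<bar>u x\<bar> \<le> B"
proof -
  have "\<forall>\<^sub>F x in at_infinity. dist (u x) 0 < 1"
    using assms tendstoD[of u 0 at_infinity 1] unfolding C_infty_def by simp
  then obtain b where b: "\<And>x. b \<le> norm x \<Longrightarrow> \<bar>u x\<bar> < 1"
    by (auto simp: eventually_at_infinity)
  have "continuous_on (cball 0 b) u"
    using assms unfolding C_infty_def by (auto intro: continuous_on_subset)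
  then have "bounded (u ` cball 0 b)"
    by (intro compact_imp_bounded compact_continuous_image compact_cball)
  then obtain B where B: "\<And>x. norm x \<le> b \<Longrightarrow> \<bar>u x\<bar> \<le> B"
    unfolding bounded_iff by fastforce
  show thesis
  proof (rule that[of "max 1 B"])
    show "\<bar>u x\<bar> \<le> max 1 B" for x
      using b[of x] B[of x] by (cases "norm x \<le> b") auto
  qed simp
qed

lemma C_infty_borel: "u \<in> C_infty \<Longrightarrow> u \<in> borel_measurable borel"
  unfolding C_infty_def by (auto intro: borel_measurable_continuous_onI)

lemma C_infty_bounded_range: "u \<in> C_infty \<Longrightarrow> bounded (range u)"
  by (erule C_infty_bounded) (auto simp: bounded_iff)

lemma topspace_compactification: "topspace (Alexandroff_compactification (euclidean :: (real ^ 'n) topology)) = UNIV"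
  by (simp add: topspace_Alexandroff_compactification UNIV_option_conv)

text \<open>Vanishing at infinity is continuity of the extension at the added point: if 0 lies in V,
  the complement of the preimage of V is closed and bounded, hence compact; otherwise the preimage
  is an open subset of the finite part.\<close>

lemma continuous_map_ext0:
  assumes "u \<in> C_infty"
  shows "continuous_map (Alexandroff_compactification euclidean) euclidean (ext0 u)"
proof -
  have cont: "continuous_on UNIV u" and lim: "(u \<longlongrightarrow> 0) at_infinity"
    using assms by (auto simp: C_infty_def)
  have "openin (Alexandroff_compactification euclidean) (ext0 u -` V)" if V: "open V" for V
  proof (cases "0 \<in> V")
    case True
    have cl: "closed (u -` (- V))"
      using continuous_closed_vimage[of "- V" u] V cont
      by (auto simp: continuous_on_eq_continuous_at closed_def)
    have "\<forall>\<^sub>F x in at_infinity. u x \<in> V"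
      using lim V True by (rule topological_tendstoD)
    then obtain b where "\<And>x. b \<le> norm x \<Longrightarrow> u x \<in> V"
      by (auto simp: eventually_at_infinity)
    then have "u -` (- V) \<subseteq> cball 0 b"
      by (auto simp: not_le[symmetric] intro: less_imp_le elim: contrapos_np)
    then have "compact (u -` (- V))"
      using cl by (meson bounded_cball bounded_subset compact_eq_bounded_closed)
    moreover have "ext0 u -` V = insert None (Some ` (UNIV - u -` (- V)))"
      using True by (force simp: ext0_def image_iff split: option.splits)
    ultimately show ?thesis
      using cl by (auto simp: openin_Alexandroff_compactification)
  next
    case False
    have "open (u -` V)" using cont V by (simp add: open_vimage)
    moreover have "ext0 u -` V = Some ` (u -` V)"
      using False by (auto simp: ext0_def image_iff split: option.splits)
    ultimately show ?thesis by simp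
  qed
  then show ?thesis
    by (simp add: continuous_map_def topspace_compactification vimage_def del: topspace_Alexandroff_compactification)
qed

text \<open>The topology of the compactification gives information only about functions such as
  those in \<open>C_infty\<close>. The coordinates are not among them, but they are quotients of
  \<open>num\<close> and \<open>den\<close>, which are; \<open>den\<close> is positive on the finite
  part and its extension is 0 exactly at infinity.\<close>

definition den :: "real ^ 'n \<Rightarrow> real" where "den x = 1 / (1 + (norm x)\<^sup>2)"
definition num :: "'n \<Rightarrow> real ^ 'n \<Rightarrow> real" where "num i x = x $ i / (1 + (norm x)\<^sup>2)"

lemma one_plus_norm_sq_pos: "1 + (norm x)\<^sup>2 > 0" for x :: "real ^ 'n"
  by (simp add: add_pos_nonneg)

lemma one_plus_norm_sq_neq_0 [simp]: "1 + (norm x)\<^sup>2 \<noteq> 0" for x :: "real ^ 'n"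
  using one_plus_norm_sq_pos[of x] by linarith

lemma tendsto_inverse_norm: "((\<lambda>x::real ^ 'n. inverse (norm x)) \<longlongrightarrow> 0) at_infinity"
  by (rule tendsto_inverse_0_at_top[OF filterlim_norm_at_top])

lemma num_den_bound:
  fixes x :: "real ^ 'n"
  assumes "norm x \<ge> 1" "\<bar>c\<bar> \<le> norm x"
  shows "\<bar>c / (1 + (norm x)\<^sup>2)\<bar> \<le> inverse (norm x)"
proof -
  have "\<bar>c / (1 + (norm x)\<^sup>2)\<bar> \<le> norm x / (norm x)\<^sup>2"
    unfolding abs_divide using assms one_plus_norm_sq_pos[of x] by (intro frac_le) auto
  also have "norm x / (norm x)\<^sup>2 = inverse (norm x)"
    using assms by (simp add: power2_eq_square field_simps)
  finally show ?thesis .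
qed

lemma den_C_infty: "den \<in> C_infty"
proof -
  have "(den \<longlongrightarrow> 0) at_infinity"
    by (rule Lim_null_comparison[OF _ tendsto_inverse_norm])
      (auto simp: eventually_at_infinity den_def intro!: exI[of _ 1] num_den_bound[of _ 1, simplified])
  then show ?thesis
    unfolding C_infty_def den_def[abs_def]
    by (auto intro!: continuous_intros)
qed

lemma num_C_infty: "num i \<in> C_infty"
proof -
  have "(num i \<longlongrightarrow> 0) at_infinity"
    by (rule Lim_null_comparison[OF _ tendsto_inverse_norm])
      (auto simp: eventually_at_infinity num_def intro!: exI[of _ 1] num_den_bound[simplified] component_le_norm_cart)
  then show ?thesis
    unfolding C_infty_def num_def[abs_def]
    by (auto intro!: continuous_intros)
qed

lemma ext0_den_eq_0_iff: "ext0 den y = 0 \<longleftrightarrow> y = None"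
  by (auto simp: ext0_def den_def split: option.splits)

text \<open>With \<open>0 / 0 = 0\<close> this is also true at the point at infinity.\<close>

lemma finite_part_nth: "finite_part X t \<omega> $ i = ext0 (num i) (X t \<omega>) / ext0 den (X t \<omega>)"
  by (auto simp: finite_part_def ext0_def num_def den_def split: option.splits)

text \<open>A Borel function need not extend continuously; this formula reduces the measurability of
  its extension along the process to that of the finite part and of the \<open>den\<close>
  process.\<close>

lemma ext0_eq: "ext0 u (X t \<omega>) = (if ext0 den (X t \<omega>) = 0 then 0 else u (finite_part X t \<omega>))"
  unfolding ext0_den_eq_0_iff by (auto simp: ext0_def finite_part_def split: option.splits)

lemma abs_ext0_le: "0 \<le> B \<Longrightarrow> (\<And>x. \<bar>u x\<bar> \<le> B) \<Longrightarrow> \<bar>ext0 u y\<bar> \<le> B"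
  by (auto simp: ext0_def split: option.splits)

lemma ext0_borel_measurable:
  assumes "u \<in> C_infty"
  shows "ext0 u \<in> borel_measurable compactified_borel"
proof (rule borel_measurableI)
  fix V :: "real set" assume "open V"
  then have "openin (Alexandroff_compactification euclidean) (ext0 u -` V)"
    using continuous_map_ext0[OF assms]
    by (simp add: continuous_map_def topspace_compactification vimage_def del: topspace_Alexandroff_compactification)
  then show "ext0 u -` V \<inter> space compactified_borel \<in> sets compactified_borel"
    by (simp add: compactified_borel_def)
qed

section \<open>Measurability and paths of the process\<close>

context feller_process
begin

lemma space_P: "space (P x) = space M"
  using sets_P by (rule sets_eq_imp_space_eq)

lemma space_F: "0 \<le> t \<Longrightarrow> space (F t) = space M"
  using filtration.space_F[OF filtration_F, of "ennreal t"] by (simp add: full_filtration_def)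

lemma sets_F_mono: "0 \<le> s \<Longrightarrow> s \<le> t \<Longrightarrow> sets (F s) \<subseteq> sets (F t)"
  using filtration.sets_F_mono[OF filtration_F, of "ennreal s" "ennreal t"]
  by (simp add: full_filtration_def ennreal_leI)

lemma sets_F_subset: "0 \<le> t \<Longrightarrow> sets (F t) \<subseteq> sets M"
  using filtration.sets_F_mono[OF filtration_F, of "ennreal t" \<infinity>]
  by (simp add: full_filtration_def)

lemma subalg: "0 \<le> t \<Longrightarrow> subalgebra (P x) (F t)"
  by (simp add: subalgebra_def space_P space_F sets_P sets_F_subset)

lemma measurable_F_P: "0 \<le> t \<Longrightarrow> f \<in> borel_measurable (F t) \<Longrightarrow> f \<in> borel_measurable (P x)"
  by (rule measurable_from_subalg[OF subalg])

lemma measurable_F_mono: "0 \<le> s \<Longrightarrow> s \<le> t \<Longrightarrow> f \<in> borel_measurable (F s) \<Longrightarrow> f \<in> borel_measurable (F t)"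
  by (rule measurable_from_subalg[of "F t" "F s"]) (auto simp: subalgebra_def space_F dest: sets_F_mono[of s t])

lemma ext0_C_infty_adapted:
  assumes "0 \<le> t" "u \<in> C_infty"
  shows "(\<lambda>\<omega>. ext0 u (X t \<omega>)) \<in> borel_measurable (F t)"
  using measurable_compose[OF adapted[OF assms(1)] ext0_borel_measurable[OF assms(2)]] .

text \<open>Time and sample point both depend on the parameter a, so that one rule serves a fixed
  time as well as the pair of time and sample point in progressive measurability.\<close>

lemma measurable_finite_part_I:
  assumes "\<And>i. (\<lambda>a. ext0 (num i) (X (t a) (w a))) \<in> borel_measurable A"
    and "(\<lambda>a. ext0 den (X (t a) (w a))) \<in> borel_measurable A"
  shows "(\<lambda>a. finite_part X (t a) (w a)) \<in> borel_measurable A"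
proof (subst borel_measurable_euclidean_space, rule ballI)
  fix b :: "real ^ 'n" assume "b \<in> Basis"
  then obtain i where "b = axis i 1" by (auto simp: Basis_vec_def)
  then show "(\<lambda>a. finite_part X (t a) (w a) \<bullet> b) \<in> borel_measurable A"
    using assms by (simp add: inner_axis finite_part_nth)
qed

lemma Y_adapted: "0 \<le> t \<Longrightarrow> finite_part X t \<in> borel_measurable (F t)"
  by (rule measurable_finite_part_I[of "\<lambda>_. t" "\<lambda>\<omega>. \<omega>"]) (auto intro: ext0_C_infty_adapted num_C_infty den_C_infty)

lemma ext0_adapted:
  assumes "0 \<le> t" and [measurable]: "u \<in> borel_measurable borel"
  shows "(\<lambda>\<omega>. ext0 u (X t \<omega>)) \<in> borel_measurable (F t)"
proof -
  have [measurable]: "finite_part X t \<in> borel_measurable (F t)"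
    "(\<lambda>\<omega>. ext0 den (X t \<omega>)) \<in> borel_measurable (F t)"
    using assms by (auto intro: Y_adapted ext0_C_infty_adapted den_C_infty)
  have "(\<lambda>\<omega>. if ext0 den (X t \<omega>) = 0 then 0 else u (finite_part X t \<omega>)) \<in> borel_measurable (F t)"
    by measurable
  then show ?thesis by (subst ext0_eq)
qed

lemma ext0_right_continuous:
  assumes "u \<in> C_infty" "\<omega> \<in> space M" "0 \<le> t"
  shows "((\<lambda>s. ext0 u (X s \<omega>)) \<longlongrightarrow> ext0 u (X t \<omega>)) (at_right t)"
  using continuous_map_limit[OF continuous_map_ext0[OF assms(1)], of "\<lambda>t. X t \<omega>" "X t \<omega>" "at_right t"]
    cadlag_paths[OF assms(2)] assms(3)
  by (simp add: cadlag_compactified_def o_def limitin_canonical_iff)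

text \<open>The limit point l lies in the compactification, possibly at infinity, and is common to
  all u; this is what later allows the limit of the quotient of \<open>num\<close> and
  \<open>den\<close> to be formed.\<close>

lemma ext0_left_limit:
  assumes "\<omega> \<in> space M" "0 < t"
  obtains l where "\<And>u. u \<in> C_infty \<Longrightarrow> ((\<lambda>s. ext0 u (X s \<omega>)) \<longlongrightarrow> ext0 u l) (at_left t)"
proof -
  obtain l where l: "limitin (Alexandroff_compactification euclidean) (\<lambda>t. X t \<omega>) l (at_left t)"
    using cadlag_paths[OF assms(1)] assms(2) by (auto simp: cadlag_compactified_def)
  show thesis
    by (rule that[of l])
      (use continuous_map_limit[OF continuous_map_ext0 l] in \<open>simp add: o_def limitin_canonical_iff\<close>)
qed

lemma ext0_C_infty_progressive:
  assumes "0 \<le> T" "u \<in> C_infty"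
  shows "(\<lambda>(s, \<omega>). ext0 u (X (max 0 (min s T)) \<omega>)) \<in> borel_measurable (borel \<Otimes>\<^sub>M F T)"
proof (rule clip_measurable_right_continuous[where f = "\<lambda>t \<omega>. ext0 u (X t \<omega>)"])
  show "(\<lambda>\<omega>. ext0 u (X t \<omega>)) \<in> borel_measurable (F T)" if "0 \<le> t" "t \<le> T" for t
    using that assms by (auto intro: measurable_F_mono[OF _ _ ext0_C_infty_adapted])
  show "((\<lambda>s. ext0 u (X s \<omega>)) \<longlongrightarrow> ext0 u (X t \<omega>)) (at_right t)"
    if "\<omega> \<in> space (F T)" "0 \<le> t" "t < T" for \<omega> t
    using that assms by (intro ext0_right_continuous) (auto simp: space_F)
qed fact

lemma Y_progressive:
  assumes "0 \<le> T"
  shows "(\<lambda>(s, \<omega>). finite_part X (max 0 (min s T)) \<omega>) \<in> borel_measurable (borel \<Otimes>\<^sub>M F T)"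
  using ext0_C_infty_progressive[OF assms num_C_infty] ext0_C_infty_progressive[OF assms den_C_infty]
  by (simp add: split_beta' measurable_finite_part_I)

lemma ext0_progressive:
  assumes "0 \<le> T" and [measurable]: "u \<in> borel_measurable borel"
  shows "(\<lambda>(s, \<omega>). ext0 u (X (max 0 (min s T)) \<omega>)) \<in> borel_measurable (borel \<Otimes>\<^sub>M F T)"
proof -
  note [measurable] = Y_progressive[OF assms(1)] ext0_C_infty_progressive[OF assms(1) den_C_infty]
  have "(\<lambda>(s, \<omega>). if ext0 den (X (max 0 (min s T)) \<omega>) = 0 then 0 else u (finite_part X (max 0 (min s T)) \<omega>))
      \<in> borel_measurable (borel \<Otimes>\<^sub>M F T)"
    unfolding split_beta' by measurable
  then show ?thesis by (subst ext0_eq)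
qed

text \<open>Passage from progressive measurability to joint measurability for the product measure,
  as needed for integrals over time and probability.\<close>

lemma measurable_lborel_pair_F:
  assumes "0 \<le> T" and f: "f \<in> borel_measurable (borel \<Otimes>\<^sub>M F T)"
  shows "f \<in> borel_measurable (lborel \<Otimes>\<^sub>M P x)"
proof -
  have [measurable]: "(\<lambda>\<omega>. \<omega>) \<in> measurable (P x) (F T)"
  proof (rule measurableI)
    fix A assume "A \<in> sets (F T)"
    then have "A \<in> sets M" using sets_F_subset[OF assms(1)] by blast
    then show "(\<lambda>\<omega>. \<omega>) -` A \<inter> space (P x) \<in> sets (P x)"
      by (simp add: space_P sets_P)
  qed (simp add: space_P space_F assms(1))
  have "(\<lambda>p. (fst p, snd p)) \<in> measurable (lborel \<Otimes>\<^sub>M P x) (borel \<Otimes>\<^sub>M F T)"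
    by measurable
  then show ?thesis using measurable_compose[OF _ f] by simp
qed

section \<open>Weighted expectations and Dynkin's formula on the domain of the generator\<close>

lemma integrable_weighted:
  assumes "0 \<le> s" "0 \<le> r" and W: "W \<in> borel_measurable (F s)" "\<And>\<omega>. \<bar>W \<omega>\<bar> \<le> B"
    and u: "u \<in> borel_measurable borel" "\<And>y. \<bar>u y\<bar> \<le> C"
  shows "integrable (P x) (\<lambda>\<omega>. W \<omega> * ext0 u (X r \<omega>))"
proof -
  interpret prob_space "P x" by (rule prob_P)
  \<comment> \<open>The bounds hold at every point of the type, so any point, here
    \<open>undefined\<close>, shows that they are nonnegative.\<close>
  have C: "0 \<le> C" and B: "0 \<le> B" using u(2)[of undefined] W(2)[of undefined] by linarith+
  show ?thesis
  proof (rule integrable_const_bound[where B = "B * C"])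
    show "AE \<omega> in P x. norm (W \<omega> * ext0 u (X r \<omega>)) \<le> B * C"
      using B C W(2) abs_ext0_le[of C u, OF C u(2)] by (auto simp: abs_mult intro!: mult_mono)
    show "(\<lambda>\<omega>. W \<omega> * ext0 u (X r \<omega>)) \<in> borel_measurable (P x)"
      using assms by (intro borel_measurable_times measurable_F_P[OF _ W(1)] measurable_F_P[OF _ ext0_adapted])
  qed
qed

text \<open>A weight known at time s is also known at time r, so the conditional expectation at r
  can be moved inside the integral. The step h is positive because the Feller property is stated for
  positive times.\<close>

lemma weighted_markov:
  assumes "0 \<le> s" "s \<le> r" "0 < h" and W: "W \<in> borel_measurable (F s)" "\<And>\<omega>. \<bar>W \<omega>\<bar> \<le> B"
    and u: "u \<in> C_infty"
  shows "(\<integral>\<omega>. W \<omega> * ext0 u (X (r + h) \<omega>) \<partial>P x) = (\<integral>\<omega>. W \<omega> * ext0 (transition_semigroup P X h u) (X r \<omega>) \<partial>P x)"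
proof -
  interpret prob_space "P x" by (rule prob_P)
  interpret finite_measure_subalgebra "P x" "F r" using assms by unfold_locales (auto intro: subalg)
  obtain C where C: "\<And>x. \<bar>u x\<bar> \<le> C" using C_infty_bounded[OF u] by blast
  have Wr: "W \<in> borel_measurable (F r)" using assms by (intro measurable_F_mono[OF _ _ W(1)])
  have m: "(\<lambda>\<omega>. ext0 u (X (r + h) \<omega>)) \<in> borel_measurable (P x)"
    using assms by (intro measurable_F_P[OF _ ext0_C_infty_adapted]) auto
  have "(\<integral>\<omega>. W \<omega> * ext0 u (X (r + h) \<omega>) \<partial>P x)
      = (\<integral>\<omega>. W \<omega> * real_cond_exp (P x) (F r) (\<lambda>\<omega>. ext0 u (X (r + h) \<omega>)) \<omega> \<partial>P x)"
    using assms C by (intro real_cond_exp_intg(2)[symmetric] Wr m integrable_weighted[of s _ W B]) (auto intro: C_infty_borel)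
  also have "\<dots> = (\<integral>\<omega>. W \<omega> * ext0 (transition_semigroup P X h u) (X r \<omega>) \<partial>P x)"
  proof (rule integral_cong_AE)
    show "(\<lambda>\<omega>. W \<omega> * ext0 (transition_semigroup P X h u) (X r \<omega>)) \<in> borel_measurable (P x)"
      using assms feller[OF assms(3) u]
      by (intro borel_measurable_times measurable_F_P[OF _ Wr] measurable_F_P[OF _ ext0_C_infty_adapted]) auto
    show "(\<lambda>\<omega>. W \<omega> * real_cond_exp (P x) (F r) (\<lambda>\<omega>. ext0 u (X (r + h) \<omega>)) \<omega>) \<in> borel_measurable (P x)"
      using assms by (intro borel_measurable_times measurable_F_P[OF _ Wr] borel_measurable_cond_exp2) auto
    show "AE \<omega> in P x. W \<omega> * real_cond_exp (P x) (F r) (\<lambda>\<omega>. ext0 u (X (r + h) \<omega>)) \<omega>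
        = W \<omega> * ext0 (transition_semigroup P X h u) (X r \<omega>)"
      using markov[of h r u x] assms C_infty_borel[OF u] C_infty_bounded_range[OF u] by auto
  qed
  finally show ?thesis .
qed

lemma weighted_diff_le:
  assumes "0 \<le> s" "0 \<le> r" and W: "W \<in> borel_measurable (F s)" "\<And>\<omega>. \<bar>W \<omega>\<bar> \<le> B"
    and u: "u \<in> borel_measurable borel" "\<And>y. \<bar>u y\<bar> \<le> e"
  shows "\<bar>\<integral>\<omega>. W \<omega> * ext0 u (X r \<omega>) \<partial>P x\<bar> \<le> B * e"
proof -
  interpret prob_space "P x" by (rule prob_P)
  have e: "0 \<le> e" and B: "0 \<le> B" using u(2)[of undefined] W(2)[of undefined] by linarith+
  have "\<bar>\<integral>\<omega>. W \<omega> * ext0 u (X r \<omega>) \<partial>P x\<bar> \<le> (\<integral>\<omega>. \<bar>W \<omega> * ext0 u (X r \<omega>)\<bar> \<partial>P x)"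
    by (rule integral_abs_bound)
  also have "\<dots> \<le> (\<integral>\<omega>. B * e \<partial>P x)"
    using B e W(2) abs_ext0_le[of e u, OF e u(2)]
    by (intro integral_mono integrable_abs integrable_weighted[OF assms]) (auto simp: abs_mult intro!: mult_mono)
  finally show ?thesis by (simp add: prob_space)
qed

lemma ext0_linear: "ext0 (\<lambda>x. a * u x + b * v x) y = a * ext0 u y + b * ext0 v y"
  by (auto simp: ext0_def split: option.splits)

text \<open>The Markov and Feller properties make the right derivative of \<open>E (W u(X\<^sub>t))\<close> uniform in \<open>t\<close>, so the semigroup
  property is not needed.\<close>

lemma weighted_dynkin:
  assumes st: "0 \<le> s" "s \<le> t" and W: "W \<in> borel_measurable (F s)" "\<And>\<omega>. \<bar>W \<omega>\<bar> \<le> B"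
    and u: "u \<in> C_infty" and gen: "is_generator_value (transition_semigroup P X) u f"
  shows "(\<integral>\<omega>. W \<omega> * ext0 u (X t \<omega>) \<partial>P x) - (\<integral>\<omega>. W \<omega> * ext0 u (X s \<omega>) \<partial>P x)
     = (\<integral>r. indicator {s..t} r * (\<integral>\<omega>. W \<omega> * ext0 f (X r \<omega>) \<partial>P x) \<partial>lborel)"
proof -
  let ?T = "transition_semigroup P X"
  define \<Phi> where "\<Phi> r = (\<integral>\<omega>. W \<omega> * ext0 u (X r \<omega>) \<partial>P x)" for r
  define \<phi> where "\<phi> r = (\<integral>\<omega>. W \<omega> * ext0 f (X r \<omega>) \<partial>P x)" for r
  have f: "f \<in> C_infty" using gen by (simp add: is_generator_value_def)
  obtain Bu where Bu: "\<And>x. \<bar>u x\<bar> \<le> Bu" using C_infty_bounded[OF u] by blast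
  obtain Bf where Bf: "\<And>x. \<bar>f x\<bar> \<le> Bf" using C_infty_bounded[OF f] by blast
  have B: "0 \<le> B" using W(2)[of undefined] by linarith
  have Tint: "integrable (P x) (\<lambda>\<omega>. W \<omega> * ext0 v (X r \<omega>))" if "0 \<le> r" "v \<in> C_infty" for r v
    using C_infty_bounded[OF that(2)] by (metis integrable_weighted[OF st(1) that(1) W C_infty_borel[OF that(2)]])
  \<comment> \<open>The Markov property turns the shift by h into an application of
    \<open>?T h\<close> to f, so the modulus of continuity of \<phi> comes from strong continuity
    and is the same at every r.\<close>
  have \<phi>_step: "\<bar>\<phi> (r + h) - \<phi> r\<bar> \<le> B * e"
    if "s \<le> r" "0 < h" and e: "\<And>x. \<bar>?T h f x - f x\<bar> \<le> e" for r h e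
  proof -
    have Tf: "?T h f \<in> C_infty" using feller that f by blast
    have "\<phi> (r + h) - \<phi> r = (\<integral>\<omega>. W \<omega> * ext0 (\<lambda>x. 1 * ?T h f x + (-1) * f x) (X r \<omega>) \<partial>P x)"
      using that st unfolding \<phi>_def ext0_linear weighted_markov[OF st(1) that(1,2) W f]
      by (subst Bochner_Integration.integral_diff[symmetric]) (auto intro!: Tint Tf f simp: algebra_simps)
    also have "\<bar>\<dots>\<bar> \<le> B * e"
      using that st C_infty_borel[OF Tf] C_infty_borel[OF f] by (intro weighted_diff_le[OF st(1) _ W]) auto
    finally show ?thesis .
  qed
  \<comment> \<open>Likewise the forward difference quotient of \<Phi> differs from \<phi> by the
    uniform error in the limit defining the generator.\<close>
  have \<Phi>_step: "\<bar>\<Phi> (r + h) - \<Phi> r - h * \<phi> r\<bar> \<le> B * (h * e)"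
    if "s \<le> r" "0 < h" and e: "\<And>x. \<bar>(?T h u x - u x) / h - f x\<bar> \<le> e" for r h e
  proof -
    have Tu: "?T h u \<in> C_infty" using feller that u by blast
    have "\<Phi> (r + h) - \<Phi> r - h * \<phi> r
        = (\<integral>\<omega>. W \<omega> * ext0 (\<lambda>x. 1 * (1 * ?T h u x + (-1) * u x) + (- h) * f x) (X r \<omega>) \<partial>P x)"
    proof -
      have "(\<integral>\<omega>. W \<omega> * ext0 (\<lambda>x. 1 * (1 * ?T h u x + (-1) * u x) + (- h) * f x) (X r \<omega>) \<partial>P x)
         = (\<integral>\<omega>. (W \<omega> * ext0 (?T h u) (X r \<omega>) - W \<omega> * ext0 u (X r \<omega>)) - h * (W \<omega> * ext0 f (X r \<omega>)) \<partial>P x)"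
        unfolding ext0_linear by (rule Bochner_Integration.integral_cong) (auto simp: algebra_simps)
      also have "\<dots> = \<Phi> (r + h) - \<Phi> r - h * \<phi> r"
        using that st unfolding \<phi>_def \<Phi>_def weighted_markov[OF st(1) that(1,2) W u]
        by (simp add: Tint Tu u f)
      finally show ?thesis by simp
    qed
    also have "\<bar>\<dots>\<bar> \<le> B * (h * e)"
    proof (rule weighted_diff_le[OF st(1) _ W])
      show "\<bar>1 * (1 * ?T h u y + (-1) * u y) + (- h) * f y\<bar> \<le> h * e" for y
      proof -
        have "1 * (1 * ?T h u y + (-1) * u y) + (- h) * f y = h * ((?T h u y - u y) / h - f y)"
          using that by (simp add: field_simps)
        then show ?thesis using e[of y] that by (simp add: abs_mult)
      qed
    qed (use that st C_infty_borel[OF Tu] C_infty_borel[OF u] C_infty_borel[OF f] in auto)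
    finally show ?thesis .
  qed
  have \<phi>_cont: "\<exists>\<delta>>0. \<forall>r r'. s \<le> r \<longrightarrow> s \<le> r' \<longrightarrow> \<bar>r - r'\<bar> < \<delta> \<longrightarrow> \<bar>\<phi> r - \<phi> r'\<bar> \<le> B * e" if "e > 0" for e
  proof -
    have "\<forall>\<^sub>F h in at_right 0. \<forall>x\<in>UNIV. dist (?T h f x) (f x) < e"
      using strongly_continuous[OF f] that unfolding uniform_limit_iff by blast
    then obtain \<delta> where \<delta>: "\<delta> > 0" "\<And>h x. 0 < h \<Longrightarrow> h < \<delta> \<Longrightarrow> \<bar>?T h f x - f x\<bar> < e"
      by (auto simp: eventually_at_right_field dist_real_def)
    have "\<bar>\<phi> r - \<phi> r'\<bar> \<le> B * e" if "s \<le> r" "s \<le> r'" "\<bar>r - r'\<bar> < \<delta>" for r r'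
    proof -
      consider "r = r'" | "r < r'" | "r' < r" by linarith
      then show ?thesis
      proof cases
        case 1 then show ?thesis using B \<open>e > 0\<close> by simp
      next
        case 2
        then show ?thesis
          using \<phi>_step[of r "r' - r" e] \<delta>(2)[of "r' - r"] that by (auto simp: abs_minus_commute less_imp_le)
      next
        case 3
        then show ?thesis
          using \<phi>_step[of r' "r - r'" e] \<delta>(2)[of "r - r'"] that by (auto simp: less_imp_le)
      qed
    qed
    then show ?thesis using \<delta>(1) by blast
  qed
  have "continuous_on {s..t} \<phi>"
    unfolding continuous_on_iff
  proof (intro ballI allI impI)
    fix r e :: real assume "r \<in> {s..t}" "0 < e"
    obtain \<delta> where \<delta>: "\<delta> > 0" "\<And>r'. s \<le> r' \<Longrightarrow> \<bar>r' - r\<bar> < \<delta> \<Longrightarrow> \<bar>\<phi> r' - \<phi> r\<bar> \<le> B * (e / (B + 1))"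
      using \<phi>_cont[of "e / (B + 1)"] B \<open>0 < e\<close> \<open>r \<in> {s..t}\<close> by auto
    have lt: "B * (e / (B + 1)) < e" using B \<open>0 < e\<close> by (simp add: field_simps)
    have "dist (\<phi> x') (\<phi> r) < e" if "x' \<in> {s..t}" "dist x' r < \<delta>" for x'
      using le_less_trans[OF \<delta>(2) lt, of x'] that by (simp add: dist_real_def)
    then show "\<exists>d>0. \<forall>x'\<in>{s..t}. dist x' r < d \<longrightarrow> dist (\<phi> x') (\<phi> r) < e"
      using \<delta>(1) by blast
  qed
  moreover have "(\<Phi> has_vector_derivative \<phi> r) (at r within {s..t})" if r: "s \<le> r" "r \<le> t" for r
    unfolding has_vector_derivative_def has_derivative_within_alt
  proof (intro conjI allI impI bounded_linear_scaleR_left)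
    fix e :: real assume "0 < e"
    \<comment> \<open>Two errors of size \<open>B * e'\<close> have to fit into e in the backward
      case below; B + 1 avoids a division by 0.\<close>
    define e' where "e' = e / (2 * (B + 1))"
    have "2 * (B + 1) \<noteq> 0" using B by simp
    then have "(2 * (B + 1)) * e' = e"
      unfolding e'_def times_divide_eq_right by (rule nonzero_mult_div_cancel_left)
    moreover have "e' > 0" using B \<open>0 < e\<close> by (simp add: e'_def)
    ultimately have e': "e' > 0" "B * e' + B * e' \<le> e" by (auto simp: algebra_simps)
    obtain \<delta>1 where \<delta>1: "\<delta>1 > 0" "\<And>r r'. s \<le> r \<Longrightarrow> s \<le> r' \<Longrightarrow> \<bar>r - r'\<bar> < \<delta>1 \<Longrightarrow> \<bar>\<phi> r - \<phi> r'\<bar> \<le> B * e'"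
      using \<phi>_cont[OF e'(1)] by auto
    have "\<forall>\<^sub>F h in at_right 0. \<forall>x\<in>UNIV. dist ((?T h u x - u x) / h) (f x) < e'"
      using gen e'(1) unfolding is_generator_value_def uniform_limit_iff by blast
    then obtain \<delta>2 where \<delta>2: "\<delta>2 > 0" "\<And>h x. 0 < h \<Longrightarrow> h < \<delta>2 \<Longrightarrow> \<bar>(?T h u x - u x) / h - f x\<bar> < e'"
      by (auto simp: eventually_at_right_field dist_real_def)
    have "norm (\<Phi> y - \<Phi> r - (y - r) *\<^sub>R \<phi> r) \<le> e * norm (y - r)"
      if y: "y \<in> {s..t}" "norm (y - r) < min \<delta>1 \<delta>2" for y
    proof -
      consider "y = r" | "r < y" | "y < r" by linarith
      then show ?thesis
      proof cases
        case 1 then show ?thesis by simp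
      next
        case 2
        have "\<bar>\<Phi> y - \<Phi> r - (y - r) * \<phi> r\<bar> \<le> B * ((y - r) * e')"
          using \<Phi>_step[of r "y - r" e'] \<delta>2(2)[of "y - r"] y r 2 by (auto simp: less_imp_le)
        also have "\<dots> \<le> e * (y - r)"
        proof -
          have "B * e' \<le> e" using e' B by (simp add: mult_nonneg_nonneg) (smt (verit) mult_nonneg_nonneg)
          then have "(B * e') * (y - r) \<le> e * (y - r)" using 2 by (intro mult_right_mono) auto
          then show ?thesis by (simp add: algebra_simps)
        qed
        finally show ?thesis using 2 by simp
      next
        \<comment> \<open>To the left of r only forward steps are available: the step starts at y,
          and \<phi> y is exchanged for \<phi> r by the uniform continuity of \<phi>.\<close>
        case 3
        have 1: "\<bar>\<Phi> r - \<Phi> y - (r - y) * \<phi> y\<bar> \<le> B * ((r - y) * e')"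
          using \<Phi>_step[of y "r - y" e'] \<delta>2(2)[of "r - y"] y r 3 by (auto simp: less_imp_le)
        have "\<bar>\<phi> y - \<phi> r\<bar> \<le> B * e'" using \<delta>1(2)[of y r] y r by auto
        then have 2: "\<bar>(r - y) * (\<phi> y - \<phi> r)\<bar> \<le> (r - y) * (B * e')"
          using 3 by (simp add: abs_mult mult_left_mono)
        have "\<Phi> y - \<Phi> r - (y - r) * \<phi> r = - (\<Phi> r - \<Phi> y - (r - y) * \<phi> y) - (r - y) * (\<phi> y - \<phi> r)"
          by (simp add: algebra_simps)
        then have "\<bar>\<Phi> y - \<Phi> r - (y - r) * \<phi> r\<bar> \<le> (B * e' + B * e') * (r - y)"
          using 1 2 unfolding distrib_right by (smt (verit) mult.assoc mult.commute)
        also have "\<dots> \<le> e * (r - y)" using e' 3 by (intro mult_right_mono) auto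
        finally show ?thesis using 3 by simp
      qed
    qed
    then show "\<exists>d>0. \<forall>y\<in>{s..t}. norm (y - r) < d \<longrightarrow> norm (\<Phi> y - \<Phi> r - (y - r) *\<^sub>R \<phi> r) \<le> e * norm (y - r)"
      using \<delta>1(1) \<delta>2(1) by (intro exI[of _ "min \<delta>1 \<delta>2"]) auto
  qed
  ultimately have "(\<integral>r. indicator {s..t} r *\<^sub>R \<phi> r \<partial>lborel) = \<Phi> t - \<Phi> s"
    using st by (intro integral_FTC_Icc) auto
  then show ?thesis by (simp add: \<phi>_def \<Phi>_def)
qed

end

section \<open>Moments and Dynkin's formula\<close>

locale feller_jump = feller_process M F X P + jump_kernel N
  for M :: "'w measure" and F X and P :: "real ^ 'n \<Rightarrow> 'w measure" and N :: "real ^ 'n \<Rightarrow> (real ^ 'n) measure" +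
  assumes domain: "C_c_smooth \<subseteq> generator_domain (transition_semigroup P X)"
    and generator: "\<And>u x. u \<in> C_c_smooth \<Longrightarrow>
      generator (transition_semigroup P X) u x
        = (\<integral>z. (u (x + z) - u x - (grad u x \<bullet> z) * indicator {z. norm z < 1} z) \<partial>N x)"
begin

abbreviation "Y \<equiv> finite_part X"
abbreviation "T \<equiv> transition_semigroup P X"

text \<open>Uniform limits are pointwise limits and hence unique, so the definite description in
  \<open>generator\<close> denotes the limit on the domain.\<close>

lemma is_generator_value_generator:
  assumes "u \<in> C_c_smooth"
  shows "is_generator_value T u (Defs.generator T u)"
proof -
  obtain f where f: "is_generator_value T u f"
    using assms domain by (auto simp: generator_domain_def)
  have uniq: "h = f" if "is_generator_value T u h" for h
  proof
    fix x
    have "((\<lambda>t. (T t u x - u x) / t) \<longlongrightarrow> h x) (at_right 0)" "((\<lambda>t. (T t u x - u x) / t) \<longlongrightarrow> f x) (at_right 0)"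
      using that f by (auto simp: is_generator_value_def intro: tendsto_uniform_limitI)
    then show "h x = f x" by (rule tendsto_unique[OF trivial_limit_at_right_real])
  qed
  have "Defs.generator T u = f" unfolding Defs.generator_def by (rule the_equality, rule f, erule uniq)
  then show ?thesis using f by simp
qed

lemma cutoff_smooth: "tame g D H \<Longrightarrow> cutoff n g \<in> C_c_smooth"
  by (rule cutoff_in_C_c_smooth) (simp add: tame_def)

lemma cutoff_C_infty:
  fixes g :: "real ^ 'n \<Rightarrow> real"
  shows "tame g D H \<Longrightarrow> cutoff n g \<in> C_infty"
  using cutoff_smooth[of g D H n] domain by (auto simp: generator_domain_def)

lemma generator_cutoff_C_infty: "tame g D H \<Longrightarrow> Defs.generator T (cutoff n g) \<in> C_infty"
  using is_generator_value_generator[OF cutoff_smooth] by (auto simp: is_generator_value_def)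

lemma cutoff_generator_limit:
  assumes "tame g D H"
  obtains C where "C \<ge> 0" "\<And>n x. \<bar>Defs.generator T (cutoff n g) x\<bar> \<le> C" "\<And>x. \<bar>jump_gen N g D x\<bar> \<le> C"
    "\<And>x. (\<lambda>n. Defs.generator T (cutoff n g) x) \<longlonglongrightarrow> jump_gen N g D x"
proof -
  note gen = generator[OF cutoff_smooth[OF assms]]
  obtain C where C: "C \<ge> 0" "\<And>n x. \<bar>Defs.generator T (cutoff n g) x\<bar> \<le> C"
    "\<And>x. (\<lambda>n. Defs.generator T (cutoff n g) x) \<longlonglongrightarrow> jump_gen N g D x"
    using generator_cutoff[OF assms] unfolding gen[symmetric] by blast
  have "\<bar>jump_gen N g D x\<bar> \<le> C" for x
    by (rule LIMSEQ_le_const2[OF tendsto_rabs[OF C(3)]]) (use C(2) in auto)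
  then show thesis using that C by blast
qed

text \<open>The kernel comes with no regularity in x. Measurability in x is inherited from the
  generator values of the cut-offs, which are continuous and converge pointwise.\<close>

lemma jump_gen_borel:
  assumes "tame g D H"
  shows "jump_gen N g D \<in> borel_measurable borel"
proof (rule borel_measurable_LIMSEQ_real)
  obtain C where C: "C \<ge> 0" "\<And>n x. \<bar>Defs.generator T (cutoff n g) x\<bar> \<le> C" "\<And>x. \<bar>jump_gen N g D x\<bar> \<le> C"
    and lim: "\<And>x. (\<lambda>n. Defs.generator T (cutoff n g) x) \<longlonglongrightarrow> jump_gen N g D x"
    by (rule cutoff_generator_limit[OF assms]) (rule that)
  show "(\<lambda>n. Defs.generator T (cutoff n g) x) \<longlonglongrightarrow> jump_gen N g D x" for x by (rule lim)
  show "Defs.generator T (cutoff n g) \<in> borel_measurable borel" for n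
    by (rule C_infty_borel[OF generator_cutoff_C_infty[OF assms]])
qed

lemma tame_borel: "tame g D H \<Longrightarrow> g \<in> borel_measurable borel"
  by (rule borel_measurable_continuous_onI[OF tame_continuous])

lemma measurable_Y: "0 \<le> t \<Longrightarrow> Y t \<in> borel_measurable (P x)"
  using measurable_from_subalg[OF subalg Y_adapted] .

lemma measurable_ext0: "0 \<le> t \<Longrightarrow> u \<in> borel_measurable borel \<Longrightarrow> (\<lambda>\<omega>. ext0 u (X t \<omega>)) \<in> borel_measurable (P x)"
  using measurable_F_P[OF _ ext0_adapted] .

lemma measurable_weighted_integral:
  assumes "0 \<le> s" "s \<le> t" "W \<in> borel_measurable (F s)" "v \<in> borel_measurable borel"
  shows "(\<lambda>r. indicator {s..t} r * (\<integral>\<omega>. W \<omega> * ext0 v (X r \<omega>) \<partial>P x)) \<in> borel_measurable borel"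
proof -
  interpret prob_space "P x" by (rule prob_P)
  have W: "W \<in> borel_measurable (F t)" using assms by (intro measurable_F_mono[OF _ _ assms(3)]) auto
  have "(\<lambda>p. W (snd p) * ext0 v (X (max 0 (min (fst p) t)) (snd p))) \<in> borel_measurable (borel \<Otimes>\<^sub>M F t)"
    using ext0_progressive[of t v] assms W by (simp add: split_beta')
  then have "(\<lambda>p. W (snd p) * ext0 v (X (max 0 (min (fst p) t)) (snd p))) \<in> borel_measurable (lborel \<Otimes>\<^sub>M P x)"
    using assms by (intro measurable_lborel_pair_F) auto
  then have [measurable]: "(\<lambda>r. \<integral>\<omega>. W \<omega> * ext0 v (X (max 0 (min r t)) \<omega>) \<partial>P x) \<in> borel_measurable lborel"
    by (intro borel_measurable_lebesgue_integral) (simp add: split_beta')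
  have "(\<lambda>r. indicator {s..t} r * (\<integral>\<omega>. W \<omega> * ext0 v (X (max 0 (min r t)) \<omega>) \<partial>P x)) \<in> borel_measurable lborel"
    by measurable
  also have "(\<lambda>r. indicator {s..t} r * (\<integral>\<omega>. W \<omega> * ext0 v (X (max 0 (min r t)) \<omega>) \<partial>P x))
      = (\<lambda>r. indicator {s..t} r * (\<integral>\<omega>. W \<omega> * ext0 v (X r \<omega>) \<partial>P x))"
    using assms by (auto simp: indicator_def max_def min_def)
  finally show ?thesis by simp
qed

lemma integrable_indicator_const:
  fixes s t :: real
  shows "integrable lborel (\<lambda>r. indicator {s..t} r * (c::real))"
  by (intro integrable_mult_left integrable_real_indicator) (auto simp: emeasure_lborel_Icc_eq)

text \<open>Dominated convergence over the sample space and then over time, with the uniform bound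
  of the generator values. The left side remains a limit, since at this stage neither
  conservativeness nor integrability of \<open>g (Y t)\<close> is available.\<close>

lemma cutoff_dynkin_limit:
  assumes st: "0 \<le> s" "s \<le> t" and W: "W \<in> borel_measurable (F s)" "\<And>\<omega>. \<bar>W \<omega>\<bar> \<le> B" and t: "tame g D H"
  shows "(\<lambda>n. (\<integral>\<omega>. W \<omega> * ext0 (cutoff n g) (X t \<omega>) \<partial>P x) - (\<integral>\<omega>. W \<omega> * ext0 (cutoff n g) (X s \<omega>) \<partial>P x))
     \<longlonglongrightarrow> (\<integral>r. indicator {s..t} r * (\<integral>\<omega>. W \<omega> * ext0 (jump_gen N g D) (X r \<omega>) \<partial>P x) \<partial>lborel)"
proof -
  interpret prob_space "P x" by (rule prob_P)
  obtain C where C: "C \<ge> 0" "\<And>n x. \<bar>Defs.generator T (cutoff n g) x\<bar> \<le> C" "\<And>x. \<bar>jump_gen N g D x\<bar> \<le> C"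
    and lim: "\<And>x. (\<lambda>n. Defs.generator T (cutoff n g) x) \<longlonglongrightarrow> jump_gen N g D x"
    by (rule cutoff_generator_limit[OF t]) (rule that)
  note bm = C_infty_borel[OF generator_cutoff_C_infty[OF t]] jump_gen_borel[OF t]
  have B: "0 \<le> B" using W(2)[of undefined] by linarith
  have ext0_lim: "(\<lambda>n. ext0 (Defs.generator T (cutoff n g)) y) \<longlonglongrightarrow> ext0 (jump_gen N g D) y" for y
    using lim by (cases y) (auto simp: ext0_def)
  have inner: "(\<lambda>n. \<integral>\<omega>. W \<omega> * ext0 (Defs.generator T (cutoff n g)) (X r \<omega>) \<partial>P x)
      \<longlonglongrightarrow> (\<integral>\<omega>. W \<omega> * ext0 (jump_gen N g D) (X r \<omega>) \<partial>P x)" if "0 \<le> r" for r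
  proof (rule integral_dominated_convergence[where w = "\<lambda>_. B * C"])
    show "AE \<omega> in P x. (\<lambda>n. W \<omega> * ext0 (Defs.generator T (cutoff n g)) (X r \<omega>)) \<longlonglongrightarrow> W \<omega> * ext0 (jump_gen N g D) (X r \<omega>)"
      by (intro AE_I2 tendsto_mult_left ext0_lim)
    show "AE \<omega> in P x. norm (W \<omega> * ext0 (Defs.generator T (cutoff n g)) (X r \<omega>)) \<le> B * C" for n
      using W(2) B abs_ext0_le[of C "Defs.generator T (cutoff n g)", OF C(1) C(2)]
      by (intro AE_I2) (auto simp: abs_mult intro!: mult_mono)
  qed (use st that bm in \<open>auto intro!: borel_measurable_times measurable_F_P[OF _ W(1)] measurable_ext0\<close>)
  have "(\<lambda>n. \<integral>r. indicator {s..t} r * (\<integral>\<omega>. W \<omega> * ext0 (Defs.generator T (cutoff n g)) (X r \<omega>) \<partial>P x) \<partial>lborel)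
     \<longlonglongrightarrow> (\<integral>r. indicator {s..t} r * (\<integral>\<omega>. W \<omega> * ext0 (jump_gen N g D) (X r \<omega>) \<partial>P x) \<partial>lborel)"
  proof (rule integral_dominated_convergence[where w = "\<lambda>r. indicator {s..t} r * (B * C)"])
    show "AE r in lborel. (\<lambda>n. indicator {s..t} r * (\<integral>\<omega>. W \<omega> * ext0 (Defs.generator T (cutoff n g)) (X r \<omega>) \<partial>P x))
        \<longlonglongrightarrow> indicator {s..t} r * (\<integral>\<omega>. W \<omega> * ext0 (jump_gen N g D) (X r \<omega>) \<partial>P x)"
      using st by (intro AE_I2) (auto intro!: inner simp: indicator_def)
    show "AE r in lborel. norm (indicator {s..t} r * (\<integral>\<omega>. W \<omega> * ext0 (Defs.generator T (cutoff n g)) (X r \<omega>) \<partial>P x))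
        \<le> indicator {s..t} r * (B * C)" for n
      using st weighted_diff_le[OF st(1) _ W bm(1) C(2)] by (intro AE_I2) (auto simp: indicator_def)
  qed (use st W bm in \<open>auto intro!: measurable_weighted_integral integrable_indicator_const\<close>)
  then show ?thesis
    unfolding weighted_dynkin[OF st W cutoff_C_infty[OF t] is_generator_value_generator[OF cutoff_smooth[OF t]], symmetric] .
qed

section \<open>Conservativeness and second moments at fixed times\<close>

lemma AE_initial: "AE \<omega> in P x. ext0 u (X 0 \<omega>) = u x"
  using initial[of x] by eventually_elim (simp add: ext0_def)

lemma integral_initial: "u \<in> borel_measurable borel \<Longrightarrow> (\<integral>\<omega>. ext0 u (X 0 \<omega>) \<partial>P x) = u x"
proof -
  interpret prob_space "P x" by (rule prob_P)
  assume "u \<in> borel_measurable borel"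
  then have "(\<integral>\<omega>. ext0 u (X 0 \<omega>) \<partial>P x) = (\<integral>\<omega>. u x \<partial>P x)"
    using AE_initial by (intro integral_cong_AE measurable_ext0) auto
  then show ?thesis by (simp add: prob_space)
qed

text \<open>The extension by 0 of the constant 1 is the indicator of the finite part. The
  expectations of its cut-offs tend to the probability that X is finite at time t, and to 1 at time
  0; their difference tends to 0 because the remainder of a constant vanishes.\<close>

lemma AE_finite_at:
  assumes "0 \<le> t"
  shows "AE \<omega> in P x. X t \<omega> \<noteq> None"
proof -
  interpret prob_space "P x" by (rule prob_P)
  let ?one = "\<lambda>_::real^'n. 1 :: real"
  let ?D = "\<lambda>_ _::real^'n. 0 :: real"
  have m: "(\<lambda>\<omega>. ext0 u (X t \<omega>)) \<in> borel_measurable (P x)" if "u \<in> borel_measurable borel" for u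
    using measurable_ext0[OF assms that] .
  have "jump_gen N ?one ?D = (\<lambda>_. 0)" by (simp add: jump_gen_def fun_eq_iff)
  moreover have "ext0 (\<lambda>_. 0) y = 0" for y :: "(real ^ 'n) option" by (auto simp: ext0_def split: option.splits)
  ultimately have "(\<lambda>n. (\<integral>\<omega>. ext0 (cutoff n ?one) (X t \<omega>) \<partial>P x) - (\<integral>\<omega>. ext0 (cutoff n ?one) (X 0 \<omega>) \<partial>P x)) \<longlonglongrightarrow> 0"
    using cutoff_dynkin_limit[of 0 t "\<lambda>_. 1" 1 ?one ?D _ x, OF _ assms _ _ tame_one] by simp
  moreover have "(\<lambda>n. \<integral>\<omega>. ext0 (cutoff n ?one) (X t \<omega>) \<partial>P x) \<longlonglongrightarrow> (\<integral>\<omega>. ext0 ?one (X t \<omega>) \<partial>P x)"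
  proof (rule integral_dominated_convergence[where w = "\<lambda>_. 1"])
    show "AE \<omega> in P x. (\<lambda>n. ext0 (cutoff n ?one) (X t \<omega>)) \<longlonglongrightarrow> ext0 ?one (X t \<omega>)"
      using cutoff_tendsto[of ?one] by (intro AE_I2) (auto simp: ext0_def split: option.splits)
    show "AE \<omega> in P x. norm (ext0 (cutoff n ?one) (X t \<omega>)) \<le> 1" for n
      using abs_ext0_le[of 1 "cutoff n ?one"] cutoff_abs_le[of n ?one] by (intro AE_I2) auto
  qed (auto intro!: m C_infty_borel[OF cutoff_C_infty[OF tame_one]])
  moreover have "(\<lambda>n. \<integral>\<omega>. ext0 (cutoff n ?one) (X 0 \<omega>) \<partial>P x) \<longlonglongrightarrow> 1"
    using cutoff_tendsto[of ?one x]
    by (subst integral_initial) (auto intro: C_infty_borel cutoff_C_infty tame_one)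
  ultimately have "(\<integral>\<omega>. ext0 ?one (X t \<omega>) \<partial>P x) - 1 = 0"
    using tendsto_diff LIMSEQ_unique by blast
  moreover have i: "integrable (P x) (\<lambda>\<omega>. ext0 ?one (X t \<omega>))"
    using m[of ?one] abs_ext0_le[of 1 ?one] by (intro integrable_const_bound[where B = 1]) auto
  ultimately have "(\<integral>\<omega>. 1 - ext0 ?one (X t \<omega>) \<partial>P x) = 0"
    by (simp add: prob_space)
  moreover have "0 \<le> 1 - ext0 ?one y" for y using abs_ext0_le[of 1 ?one y] by auto
  ultimately have "AE \<omega> in P x. 1 - ext0 ?one (X t \<omega>) = 0"
    using i by (subst (asm) integral_nonneg_eq_0_iff_AE) auto
  then show ?thesis by eventually_elim (auto simp: ext0_def split: option.splits)
qed

lemma AE_ext0_eq: "0 \<le> t \<Longrightarrow> AE \<omega> in P x. ext0 u (X t \<omega>) = u (Y t \<omega>)"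
  using AE_finite_at[of t x] by (auto simp: ext0_def finite_part_def)

text \<open>The cut-offs of the square are nonnegative, and Dynkin's formula bounds their
  expectations by \<open>g x + t * C\<close> uniformly in n; Fatou's lemma transfers the bound to
  the square itself.\<close>

lemma square_integrable_nth:
  assumes "0 \<le> t"
  shows "integrable (P x) (\<lambda>\<omega>. (Y t \<omega> $ i)\<^sup>2)"
proof -
  interpret prob_space "P x" by (rule prob_P)
  define g where "g = (\<lambda>y::real^'n. y $ i * y $ i)"
  define D where "D = (\<lambda>(y::real^'n) z. y $ i * z $ i + z $ i * y $ i)"
  have t: "tame g D (\<lambda>y z. 2 * (z $ i * z $ i))" unfolding g_def D_def by (rule tame_nth_mult)
  obtain C where C: "C \<ge> 0" "\<And>n x. \<bar>Defs.generator T (cutoff n g) x\<bar> \<le> C" "\<And>x. \<bar>jump_gen N g D x\<bar> \<le> C"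
    and lim: "\<And>x. (\<lambda>n. Defs.generator T (cutoff n g) x) \<longlonglongrightarrow> jump_gen N g D x"
    by (rule cutoff_generator_limit[OF t]) (rule that)
  have bm: "cutoff n g \<in> borel_measurable borel" for n
    by (rule C_infty_borel[OF cutoff_C_infty[OF t]])
  have cut: "0 \<le> cutoff n g y" for n y
    unfolding cutoff_def g_def using bump_0_nonneg by simp
  have c: "0 \<le> ext0 (cutoff n g) y" for n y
    using cut by (auto simp: ext0_def split: option.splits)
  have int: "integrable (P x) (\<lambda>\<omega>. ext0 (cutoff n g) (X t \<omega>))" for n
  proof -
    obtain K where "\<And>x. \<bar>cutoff n g x\<bar> \<le> K" using C_infty_bounded[OF cutoff_C_infty[OF t]] by blast
    then show ?thesis
      using integrable_weighted[of 0 t "\<lambda>_. 1" 1 "cutoff n g" K x] assms bm by simp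
  qed
  have le: "(\<integral>\<omega>. ext0 (cutoff n g) (X t \<omega>) \<partial>P x) \<le> g x + t * C" for n
  proof -
    let ?G = "Defs.generator T (cutoff n g)"
    have "\<bar>indicator {0..t} r * (\<integral>\<omega>. ext0 ?G (X r \<omega>) \<partial>P x)\<bar> \<le> indicator {0..t} r * C" for r
      using weighted_diff_le[of 0 r "\<lambda>_. 1" 1 ?G C x] C C_infty_borel[OF generator_cutoff_C_infty[OF t]]
      by (auto simp: indicator_def)
    then have "indicator {0..t} r * (\<integral>\<omega>. ext0 ?G (X r \<omega>) \<partial>P x) \<le> indicator {0..t} r * C" for r
      using abs_le_D1 by blast
    then have "(\<integral>r. indicator {0..t} r * (\<integral>\<omega>. ext0 ?G (X r \<omega>) \<partial>P x) \<partial>lborel) \<le> (\<integral>r. indicator {0..t} r * C \<partial>lborel)"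
      using C(1) by (intro integral_mono_AE' integrable_indicator_const) auto
    also have "\<dots> = t * C" using assms by (simp)
    finally have "(\<integral>\<omega>. ext0 (cutoff n g) (X t \<omega>) \<partial>P x) - (\<integral>\<omega>. ext0 (cutoff n g) (X 0 \<omega>) \<partial>P x) \<le> t * C"
      using weighted_dynkin[of 0 t "\<lambda>_. 1" 1 "cutoff n g" ?G x]
        cutoff_C_infty[OF t] is_generator_value_generator[OF cutoff_smooth[OF t]] assms by simp
    moreover have "cutoff n g x \<le> g x" using cutoff_abs_le[of n g x] cut[of n x] by (simp add: g_def)
    ultimately show ?thesis by (simp add: integral_initial bm)
  qed
  have "(\<integral>\<^sup>+\<omega>. ennreal (ext0 g (X t \<omega>)) \<partial>P x) = (\<integral>\<^sup>+\<omega>. liminf (\<lambda>n. ennreal (ext0 (cutoff n g) (X t \<omega>))) \<partial>P x)"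
  proof (rule nn_integral_cong)
    fix \<omega>
    have "(\<lambda>n. ext0 (cutoff n g) (X t \<omega>)) \<longlonglongrightarrow> ext0 g (X t \<omega>)"
      using cutoff_tendsto[of g] by (cases "X t \<omega>") (auto simp: ext0_def)
    then have "(\<lambda>n. ennreal (ext0 (cutoff n g) (X t \<omega>))) \<longlonglongrightarrow> ennreal (ext0 g (X t \<omega>))"
      by (rule tendsto_ennrealI)
    then show "ennreal (ext0 g (X t \<omega>)) = liminf (\<lambda>n. ennreal (ext0 (cutoff n g) (X t \<omega>)))"
      by (simp add: lim_imp_Liminf)
  qed
  also have "\<dots> \<le> liminf (\<lambda>n. \<integral>\<^sup>+\<omega>. ennreal (ext0 (cutoff n g) (X t \<omega>)) \<partial>P x)"
    using measurable_ext0[OF assms bm] by (intro nn_integral_liminf) auto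
  also have "\<dots> \<le> ennreal (g x + t * C)"
    using le c by (intro Liminf_le) (auto simp: nn_integral_eq_integral[OF int] ennreal_leI)
  finally have "(\<integral>\<^sup>+\<omega>. ennreal (ext0 g (X t \<omega>)) \<partial>P x) < \<infinity>" by (simp add: le_less_trans)
  moreover have "ext0 g (X t \<omega>) = (Y t \<omega> $ i)\<^sup>2" for \<omega>
    by (auto simp: ext0_def finite_part_def g_def power2_eq_square split: option.splits)
  ultimately show ?thesis
    using measurable_compose[OF measurable_Y[OF assms, of x] borel_measurable_nth[of i]]
    by (intro integrableI_nonneg) (auto intro: borel_measurable_power)
qed

lemma integrable_norm_sq_Y: "0 \<le> t \<Longrightarrow> integrable (P x) (\<lambda>\<omega>. (norm (Y t \<omega>))\<^sup>2)"
  unfolding power2_norm_eq_inner inner_vec_def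
  using square_integrable_nth[of t x] by (auto simp: power2_eq_square)

lemma integrable_tame:
  assumes "0 \<le> t" "tame g D H"
  shows "integrable (P x) (\<lambda>\<omega>. g (Y t \<omega>))"
proof -
  interpret prob_space "P x" by (rule prob_P)
  obtain C where C: "\<And>y. \<bar>g y\<bar> \<le> C * (1 + (norm y)\<^sup>2)" using assms(2) unfolding tame_def by blast
  show ?thesis
  proof (rule Bochner_Integration.integrable_bound)
    show "integrable (P x) (\<lambda>\<omega>. C * (1 + (norm (Y t \<omega>))\<^sup>2))"
      using integrable_norm_sq_Y[OF assms(1)] by simp
    show "(\<lambda>\<omega>. g (Y t \<omega>)) \<in> borel_measurable (P x)"
      using measurable_compose[OF measurable_Y[OF assms(1)] tame_borel[OF assms(2)]] .
    show "AE \<omega> in P x. norm (g (Y t \<omega>)) \<le> norm (C * (1 + (norm (Y t \<omega>))\<^sup>2))"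
      using C by (intro AE_I2) (auto intro: order_trans[OF _ abs_ge_self])
  qed
qed

section \<open>Dynkin's formula for functions of quadratic growth\<close>

lemma integrable_bounded_mult:
  fixes f :: "'w \<Rightarrow> real"
  assumes "integrable Q f" "W \<in> borel_measurable Q" "\<And>\<omega>. \<bar>W \<omega>\<bar> \<le> (B::real)"
  shows "integrable Q (\<lambda>\<omega>. W \<omega> * f \<omega>)"
proof (rule Bochner_Integration.integrable_bound)
  show "integrable Q (\<lambda>\<omega>. B * \<bar>f \<omega>\<bar>)" using assms by simp
  show "AE \<omega> in Q. norm (W \<omega> * f \<omega>) \<le> norm (B * \<bar>f \<omega>\<bar>)"
    using assms(3) by (intro AE_I2) (auto simp: abs_mult intro!: mult_right_mono intro: order_trans[OF _ abs_ge_self])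
qed (use assms in auto)

text \<open>The second moments now provide the dominating function B |g(Y)| that lets the cut-off be
  removed on the left side. The time interval is half open so that consecutive intervals add
  up.\<close>

lemma weighted_expectation_diff:
  assumes st: "0 \<le> s" "s \<le> t" and W: "W \<in> borel_measurable (F s)" "\<And>\<omega>. \<bar>W \<omega>\<bar> \<le> B" and t: "tame g D H"
  shows "(\<integral>\<omega>. W \<omega> * (g (Y t \<omega>) - g (Y s \<omega>)) \<partial>P x)
     = (\<integral>r. indicator {s<..t} r * (\<integral>\<omega>. W \<omega> * jump_gen N g D (Y r \<omega>) \<partial>P x) \<partial>lborel)"
proof -
  interpret prob_space "P x" by (rule prob_P)
  have WP: "W \<in> borel_measurable (P x)" using measurable_F_P[OF st(1) W(1)] .
  have lim: "(\<lambda>n. \<integral>\<omega>. W \<omega> * ext0 (cutoff n g) (X r \<omega>) \<partial>P x) \<longlonglongrightarrow> (\<integral>\<omega>. W \<omega> * g (Y r \<omega>) \<partial>P x)" if "0 \<le> r" for r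
  proof (rule integral_dominated_convergence[where w = "\<lambda>\<omega>. B * \<bar>g (Y r \<omega>)\<bar>"])
    show "AE \<omega> in P x. (\<lambda>n. W \<omega> * ext0 (cutoff n g) (X r \<omega>)) \<longlonglongrightarrow> W \<omega> * g (Y r \<omega>)"
      using AE_finite_at[OF that]
      by eventually_elim (auto intro!: tendsto_mult_left simp: cutoff_tendsto ext0_def finite_part_def)
    have "\<bar>ext0 (cutoff n g) (X r \<omega>)\<bar> \<le> \<bar>g (Y r \<omega>)\<bar>" for n \<omega>
      using cutoff_abs_le by (auto simp: ext0_def finite_part_def split: option.splits)
    then show "AE \<omega> in P x. norm (W \<omega> * ext0 (cutoff n g) (X r \<omega>)) \<le> B * \<bar>g (Y r \<omega>)\<bar>" for n
      using W(2) by (intro AE_I2) (auto simp: abs_mult intro!: mult_mono intro: order_trans[OF abs_ge_zero])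
  qed (use that integrable_tame[OF that t] measurable_compose[OF measurable_Y[OF that] tame_borel[OF t]] in
      \<open>auto intro!: borel_measurable_times WP measurable_ext0 C_infty_borel cutoff_C_infty[OF t]\<close>)
  have "(\<lambda>n. (\<integral>\<omega>. W \<omega> * ext0 (cutoff n g) (X t \<omega>) \<partial>P x) - (\<integral>\<omega>. W \<omega> * ext0 (cutoff n g) (X s \<omega>) \<partial>P x))
     \<longlonglongrightarrow> (\<integral>\<omega>. W \<omega> * g (Y t \<omega>) \<partial>P x) - (\<integral>\<omega>. W \<omega> * g (Y s \<omega>) \<partial>P x)"
    using st by (intro tendsto_diff lim) auto
  then have "(\<integral>\<omega>. W \<omega> * g (Y t \<omega>) \<partial>P x) - (\<integral>\<omega>. W \<omega> * g (Y s \<omega>) \<partial>P x)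
      = (\<integral>r. indicator {s..t} r * (\<integral>\<omega>. W \<omega> * ext0 (jump_gen N g D) (X r \<omega>) \<partial>P x) \<partial>lborel)"
    using cutoff_dynkin_limit[OF st W t] by (rule LIMSEQ_unique)
  also have "\<dots> = (\<integral>r. indicator {s<..t} r * (\<integral>\<omega>. W \<omega> * jump_gen N g D (Y r \<omega>) \<partial>P x) \<partial>lborel)"
  proof (rule Bochner_Integration.integral_cong_AE)
    have eq: "(\<integral>\<omega>. W \<omega> * ext0 (jump_gen N g D) (X r \<omega>) \<partial>P x) = (\<integral>\<omega>. W \<omega> * jump_gen N g D (Y r \<omega>) \<partial>P x)" if "0 \<le> r" for r
      using AE_ext0_eq[OF that, of "jump_gen N g D" x] measurable_compose[OF measurable_Y[OF that] jump_gen_borel[OF t]]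
        measurable_ext0[OF that jump_gen_borel[OF t]]
      by (intro integral_cong_AE borel_measurable_times WP) auto
    have *: "indicator {s<..t} r * (\<integral>\<omega>. W \<omega> * jump_gen N g D (Y r \<omega>) \<partial>P x)
        = indicator {s<..t} r * (indicator {s..t} r * (\<integral>\<omega>. W \<omega> * ext0 (jump_gen N g D) (X r \<omega>) \<partial>P x))" for r
      using st by (auto simp: indicator_def eq)
    show m: "(\<lambda>r. indicator {s..t} r * (\<integral>\<omega>. W \<omega> * ext0 (jump_gen N g D) (X r \<omega>) \<partial>P x)) \<in> borel_measurable lborel"
      using st by (simp add: measurable_weighted_integral W jump_gen_borel[OF t])
    show "(\<lambda>r. indicator {s<..t} r * (\<integral>\<omega>. W \<omega> * jump_gen N g D (Y r \<omega>) \<partial>P x)) \<in> borel_measurable lborel"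
      unfolding * by (intro borel_measurable_times m) auto
    show "AE r in lborel. indicator {s..t} r * (\<integral>\<omega>. W \<omega> * ext0 (jump_gen N g D) (X r \<omega>) \<partial>P x)
        = indicator {s<..t} r * (\<integral>\<omega>. W \<omega> * jump_gen N g D (Y r \<omega>) \<partial>P x)"
      unfolding * using AE_lborel_singleton[of s] by eventually_elim (auto simp: indicator_def)
  qed
  finally show ?thesis
    using integrable_bounded_mult[OF integrable_tame[OF _ t] WP W(2)] st
    by (simp add: right_diff_distrib)
qed

lemma jump_gen_Y_progressive:
  assumes "0 \<le> t" "tame g D H"
  shows "(\<lambda>(r, \<omega>). jump_gen N g D (Y (max 0 (min r t)) \<omega>)) \<in> borel_measurable (borel \<Otimes>\<^sub>M F t)"
  using measurable_compose[OF Y_progressive[OF assms(1)] jump_gen_borel[OF assms(2)]] by (simp add: split_beta')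

text \<open>With the time integral inside the expectation, the identity for all weights says that
  the increment of g(Y) minus the time integral is orthogonal to the past: the martingale
  property.\<close>

lemma weighted_expectation_diff_Fubini:
  assumes st: "0 \<le> s" "s \<le> t" and W: "W \<in> borel_measurable (F s)" "\<And>\<omega>. \<bar>W \<omega>\<bar> \<le> B" and t: "tame g D H"
  shows "(\<integral>\<omega>. W \<omega> * (g (Y t \<omega>) - g (Y s \<omega>)) \<partial>P x)
     = (\<integral>\<omega>. W \<omega> * (\<integral>r. indicator {s<..t} r * jump_gen N g D (Y r \<omega>) \<partial>lborel) \<partial>P x)"
proof -
  interpret prob_space "P x" by (rule prob_P)
  interpret pair_sigma_finite lborel "P x" by unfold_locales
  obtain C where C: "C \<ge> 0" "\<And>n x. \<bar>Defs.generator T (cutoff n g) x\<bar> \<le> C" "\<And>x. \<bar>jump_gen N g D x\<bar> \<le> C"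
    and lim: "\<And>x. (\<lambda>n. Defs.generator T (cutoff n g) x) \<longlonglongrightarrow> jump_gen N g D x"
    by (rule cutoff_generator_limit[OF t]) (rule that)
  have B: "0 \<le> B" using W(2)[of undefined] by linarith
  have WP: "W \<in> borel_measurable (P x)" using measurable_F_P[OF st(1) W(1)] .
  define h where "h r \<omega> = indicator {s<..t} r * (W \<omega> * jump_gen N g D (Y r \<omega>))" for r \<omega>
  have m: "(\<lambda>(r, \<omega>). jump_gen N g D (Y (max 0 (min r t)) \<omega>)) \<in> borel_measurable (lborel \<Otimes>\<^sub>M P x)"
    using st t by (intro measurable_lborel_pair_F[of t] jump_gen_Y_progressive) auto
  have h_eq: "h r \<omega> = indicator {s<..t} r * (W \<omega> * jump_gen N g D (Y (max 0 (min r t)) \<omega>))" for r \<omega>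
    using st by (auto simp: h_def indicator_def max_def min_def)
  have "integrable (lborel \<Otimes>\<^sub>M P x) (case_prod h)"
  proof (rule Bochner_Integration.integrable_bound)
    have "emeasure (lborel \<Otimes>\<^sub>M P x) ({s<..t} \<times> space (P x)) = ennreal (t - s)"
      using st by (simp add: sigma_finite_measure.emeasure_pair_measure_Times[OF prob_space_imp_sigma_finite[OF prob_P]]
          emeasure_space_1)
    then show "integrable (lborel \<Otimes>\<^sub>M P x) (\<lambda>p. indicator ({s<..t} \<times> space (P x)) p * (B * C))"
      by (intro integrable_mult_left integrable_real_indicator) auto
    show "case_prod h \<in> borel_measurable (lborel \<Otimes>\<^sub>M P x)"
      using m WP unfolding h_eq split_beta' by measurable
    have "\<bar>W \<omega> * jump_gen N g D (Y r \<omega>)\<bar> \<le> B * C" for r \<omega>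
      using W(2) C(1,3) B by (auto simp: abs_mult intro!: mult_mono)
    then show "AE p in lborel \<Otimes>\<^sub>M P x. norm (case_prod h p) \<le> norm (indicator ({s<..t} \<times> space (P x)) p * (B * C))"
      using B C by (intro AE_I2) (auto simp: h_def indicator_def space_pair_measure)
  qed
  then have "(\<integral>\<omega>. (\<integral>r. h r \<omega> \<partial>lborel) \<partial>P x) = (\<integral>r. (\<integral>\<omega>. h r \<omega> \<partial>P x) \<partial>lborel)"
    by (rule Fubini_integral)
  moreover have "(\<integral>r. h r \<omega> \<partial>lborel) = W \<omega> * (\<integral>r. indicator {s<..t} r * jump_gen N g D (Y r \<omega>) \<partial>lborel)" for \<omega>
    by (simp add: h_def mult.left_commute[of _ "W \<omega>"])
  moreover have "(\<integral>\<omega>. h r \<omega> \<partial>P x) = indicator {s<..t} r * (\<integral>\<omega>. W \<omega> * jump_gen N g D (Y r \<omega>) \<partial>P x)" for r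
    by (simp add: h_def)
  ultimately show ?thesis
    unfolding weighted_expectation_diff[OF assms] by simp
qed

end

section \<open>Small increments\<close>

text \<open>The two bounds have different roles: the quadratic one gives the dominating function
  |z|^2 after rescaling, the linear one makes the rescaled remainder vanish for each fixed
  z.\<close>

lemma trig_taylor:
  fixes d :: "nat \<Rightarrow> real \<Rightarrow> real"
  assumes d: "\<And>n x. (d n has_real_derivative d (Suc n) x) (at x)" and b: "\<And>n x. \<bar>d n x\<bar> \<le> 1"
  shows "\<bar>d 0 (a + h) - d 0 a - d 1 a * h\<bar> \<le> h\<^sup>2" "\<bar>d 0 (a + h) - d 0 a - d 1 a * h\<bar> \<le> 2 + \<bar>h\<bar>"
proof -
  have "\<exists>t. \<bar>t\<bar> \<le> \<bar>h\<bar> \<and> d 0 (a + h) = (\<Sum>m<2. d m (a + 0) / fact m * h ^ m) + d 2 (a + t) / fact 2 * h ^ 2"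
    by (rule Maclaurin_all_le[where diff = "\<lambda>n h. d n (a + h)"]) (auto intro!: DERIV_shift[THEN iffD1] d simp: add.commute)
  then obtain t where "d 0 (a + h) = d 0 a + d 1 a * h + d 2 (a + t) / 2 * h\<^sup>2"
    by (auto simp: numeral_2_eq_2)
  then have "\<bar>d 0 (a + h) - d 0 a - d 1 a * h\<bar> = \<bar>d 2 (a + t)\<bar> / 2 * h\<^sup>2"
    by (simp add: abs_mult)
  also have "\<dots> \<le> 1 * h\<^sup>2"
    using b[of 2 "a + t"] by (intro mult_right_mono) auto
  finally show "\<bar>d 0 (a + h) - d 0 a - d 1 a * h\<bar> \<le> h\<^sup>2" by simp
  have "\<bar>d 1 a * h\<bar> \<le> 1 * \<bar>h\<bar>" unfolding abs_mult using b by (intro mult_right_mono) auto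
  then show "\<bar>d 0 (a + h) - d 0 a - d 1 a * h\<bar> \<le> 2 + \<bar>h\<bar>"
    using b[of 0 "a + h"] b[of 0 a] by linarith
qed

text \<open>The fourth-order expansion together with x^4 \<le> x^2 gives 1 - cos x \<ge> (11/24)
  x^2, which exceeds x^2 / 4.\<close>

lemma square_le_one_minus_cos:
  fixes x :: real
  assumes "\<bar>x\<bar> \<le> 1"
  shows "x\<^sup>2 \<le> 4 * (1 - cos x)"
proof -
  obtain t where t: "cos x = (\<Sum>m<4. cos_coeff m * x ^ m) + (cos (t + 1 / 2 * real 4 * pi) / fact 4) * x ^ 4"
    using Maclaurin_cos_expansion[of x 4] by blast
  have "(\<Sum>m<4. cos_coeff m * x ^ m) = 1 - x\<^sup>2 / 2"
  proof -
    have "{..<4::nat} = {0, 1, 2, 3}" by auto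
    then show ?thesis by (simp add: cos_coeff_def)
  qed
  moreover have "(cos (t + 1 / 2 * real 4 * pi) / fact 4) * x ^ 4 \<le> 1 / 24 * x\<^sup>2"
  proof -
    have "x ^ 4 \<le> x\<^sup>2"
    proof -
      have "x ^ 4 = x\<^sup>2 * x\<^sup>2" by (simp flip: power_add)
      also have "\<dots> \<le> x\<^sup>2 * 1" using assms by (intro mult_left_mono) (auto simp: abs_square_le_1)
      finally show ?thesis by simp
    qed
    then have "(cos (t + 1 / 2 * real 4 * pi) / fact 4) * x ^ 4 \<le> 1 / fact 4 * x ^ 4"
      by (intro mult_right_mono divide_right_mono) auto
    also have "\<dots> \<le> 1 / 24 * x\<^sup>2" using \<open>x ^ 4 \<le> x\<^sup>2\<close> by (simp add: fact_numeral)
    finally show ?thesis .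
  qed
  ultimately have "cos x \<le> 1 - x\<^sup>2 / 2 + 1 / 24 * x\<^sup>2" using t by linarith
  moreover have "q \<le> 4 * (1 - c)" if "c \<le> 1 - q / 2 + 1 / 24 * q" "0 \<le> q" for c q :: real
    using that by (simp add: field_simps)
  ultimately show ?thesis using zero_le_power2 by blast
qed

lemma indicator_Ioc_add:
  fixes a b c r :: real
  assumes "a \<le> b" "b \<le> c"
  shows "indicator {a<..b} r + indicator {b<..c} r = (indicator {a<..c} r :: real)"
  using assms by (auto simp: indicator_def)

context jump_kernel
begin

text \<open>Here the pure jump form of the generator enters: with \<theta> = m + 1, the remainder
  divided by \<theta>^2 is at most |z|^2 and tends to 0 for each z. A second-order differential term
  in the generator would survive the division by \<theta>^2.\<close>

lemma jump_gen_trig_limit: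
  fixes i :: 'n
  assumes d: "\<And>n x. (d n has_real_derivative d (Suc n) x) (at x)" and b: "\<And>n x. \<bar>d n x\<bar> \<le> 1"
  shows "(\<lambda>m. \<bar>jump_gen N (\<lambda>y. d 0 (real (Suc m) * y $ i)) (\<lambda>y z. d 1 (real (Suc m) * y $ i) * (real (Suc m) * z $ i)) x\<bar> / (real (Suc m))\<^sup>2)
      \<longlonglongrightarrow> 0" (is ?lim)
    and "\<bar>jump_gen N (\<lambda>y. d 0 (real (Suc m) * y $ i)) (\<lambda>y z. d 1 (real (Suc m) * y $ i) * (real (Suc m) * z $ i)) x\<bar> / (real (Suc m))\<^sup>2 \<le> K"
proof -
  define R where "R m z = (d 0 (real (Suc m) * (x + z) $ i) - d 0 (real (Suc m) * x $ i)
      - d 1 (real (Suc m) * x $ i) * (real (Suc m) * z $ i)) / (real (Suc m))\<^sup>2" for m z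
  have cont: "continuous_on UNIV (d n)" for n
    by (rule continuous_at_imp_continuous_on) (use d DERIV_isCont in blast)
  have Rm: "R m \<in> borel_measurable borel" for m
    unfolding R_def[abs_def]
    by (intro borel_measurable_continuous_onI continuous_intros continuous_on_compose2[OF cont]) auto
  have R1: "\<bar>R m z\<bar> \<le> 1 * (norm z)\<^sup>2" for m z
  proof -
    have "\<bar>R m z\<bar> \<le> (real (Suc m) * z $ i)\<^sup>2 / (real (Suc m))\<^sup>2"
      unfolding R_def abs_divide using trig_taylor(1)[where d = d and a = "real (Suc m) * x $ i" and h = "real (Suc m) * z $ i", OF d b]
      by (intro frac_le) (auto simp: distrib_left)
    also have "\<dots> = \<bar>z $ i\<bar>\<^sup>2" by (simp add: power_mult_distrib)
    also have "\<dots> \<le> (norm z)\<^sup>2" by (intro power_mono component_le_norm_cart) auto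
    finally show ?thesis by simp
  qed
  have R2: "(\<lambda>m. R m z) \<longlonglongrightarrow> 0" for z
  proof (rule Lim_null_comparison)
    show "\<forall>\<^sub>F m in sequentially. norm (R m z) \<le> 2 * (inverse (real (Suc m)))\<^sup>2 + \<bar>z $ i\<bar> * inverse (real (Suc m))"
    proof (rule always_eventually, rule allI)
      fix m
      have "\<bar>R m z\<bar> \<le> (2 + \<bar>real (Suc m) * z $ i\<bar>) / (real (Suc m))\<^sup>2"
        unfolding R_def abs_divide using trig_taylor(2)[where d = d and a = "real (Suc m) * x $ i" and h = "real (Suc m) * z $ i", OF d b]
        by (intro frac_le) (auto simp: distrib_left)
      also have "\<dots> = 2 * (inverse (real (Suc m)))\<^sup>2 + \<bar>z $ i\<bar> * inverse (real (Suc m))"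
      proof -
        have "(2 + R * c) / R\<^sup>2 = 2 * (inverse R)\<^sup>2 + c * inverse R" if "R \<noteq> 0" for R c :: real
          using that by (simp add: power2_eq_square field_simps)
        then show ?thesis by (simp only: abs_mult abs_of_nat of_nat_neq_0 not_False_eq_True)
      qed
      finally show "norm (R m z) \<le> 2 * (inverse (real (Suc m)))\<^sup>2 + \<bar>z $ i\<bar> * inverse (real (Suc m))" by simp
    qed
    have "(\<lambda>m. 2 * (inverse (real (Suc m)))\<^sup>2 + \<bar>z $ i\<bar> * inverse (real (Suc m))) \<longlonglongrightarrow> 2 * 0\<^sup>2 + \<bar>z $ i\<bar> * 0"
      by (intro tendsto_intros LIMSEQ_inverse_real_of_nat)
    then show "(\<lambda>m. 2 * (inverse (real (Suc m)))\<^sup>2 + \<bar>z $ i\<bar> * inverse (real (Suc m))) \<longlonglongrightarrow> 0" by simp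
  qed
  have eq: "\<bar>jump_gen N (\<lambda>y. d 0 (real (Suc m) * y $ i)) (\<lambda>y z. d 1 (real (Suc m) * y $ i) * (real (Suc m) * z $ i)) x\<bar> / (real (Suc m))\<^sup>2
      = \<bar>\<integral>z. R m z \<partial>N x\<bar>" for m
    unfolding jump_gen_def R_def by (simp add: abs_divide)
  have "(\<lambda>m. \<integral>z. R m z \<partial>N x) \<longlonglongrightarrow> (\<integral>z. 0 \<partial>N x)"
  proof (rule integral_dominated_convergence[where w = "\<lambda>z. (norm z)\<^sup>2"])
    show "AE z in N x. (\<lambda>m. R m z) \<longlonglongrightarrow> 0" using R2 by simp
    show "AE z in N x. norm (R m z) \<le> (norm z)\<^sup>2" for m using R1 by simp
  qed (auto intro: measurable_N integrable_norm_sq Rm)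
  then show ?lim unfolding eq by (simp add: tendsto_rabs_zero)
  show "\<bar>jump_gen N (\<lambda>y. d 0 (real (Suc m) * y $ i)) (\<lambda>y z. d 1 (real (Suc m) * y $ i) * (real (Suc m) * z $ i)) x\<bar> / (real (Suc m))\<^sup>2 \<le> K"
    unfolding eq using integral_N_le[OF Rm R1] by simp
qed

end

context feller_jump
begin

lemma measurable_Y_integral:
  fixes v :: "real ^ 'n \<Rightarrow> real"
  assumes "0 \<le> s" "s \<le> t" "v \<in> borel_measurable borel"
  shows "(\<lambda>r. indicator {s<..t} r * (\<integral>\<omega>. v (Y r \<omega>) \<partial>P x)) \<in> borel_measurable borel"
proof -
  interpret prob_space "P x" by (rule prob_P)
  have "(\<lambda>p. v (Y (max 0 (min (fst p) t)) (snd p))) \<in> borel_measurable (borel \<Otimes>\<^sub>M F t)"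
    using measurable_compose[OF Y_progressive[of t] assms(3)] assms by (simp add: split_beta')
  then have "(\<lambda>p. v (Y (max 0 (min (fst p) t)) (snd p))) \<in> borel_measurable (lborel \<Otimes>\<^sub>M P x)"
    using assms by (intro measurable_lborel_pair_F) auto
  then have [measurable]: "(\<lambda>r. \<integral>\<omega>. v (Y (max 0 (min r t)) \<omega>) \<partial>P x) \<in> borel_measurable lborel"
    by (intro borel_measurable_lebesgue_integral) (simp add: split_beta')
  have "(\<lambda>r. indicator {s<..t} r * (\<integral>\<omega>. v (Y (max 0 (min r t)) \<omega>) \<partial>P x)) \<in> borel_measurable lborel"
    by measurable
  also have "(\<lambda>r. indicator {s<..t} r * (\<integral>\<omega>. v (Y (max 0 (min r t)) \<omega>) \<partial>P x))
      = (\<lambda>r. indicator {s<..t} r * (\<integral>\<omega>. v (Y r \<omega>) \<partial>P x))"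
    using assms by (auto simp: indicator_def max_def min_def)
  finally show ?thesis by simp
qed

lemma expectation_Y_bounded:
  fixes v :: "real ^ 'n \<Rightarrow> real"
  assumes "0 \<le> r" "v \<in> borel_measurable borel" "\<And>y. \<bar>v y\<bar> \<le> C"
  shows "integrable (P x) (\<lambda>\<omega>. v (Y r \<omega>))" "\<bar>\<integral>\<omega>. v (Y r \<omega>) \<partial>P x\<bar> \<le> C"
proof -
  interpret prob_space "P x" by (rule prob_P)
  show i: "integrable (P x) (\<lambda>\<omega>. v (Y r \<omega>))"
    using measurable_compose[OF measurable_Y[OF assms(1)] assms(2)] assms(3)
    by (intro integrable_const_bound[where B = C]) auto
  have "\<bar>\<integral>\<omega>. v (Y r \<omega>) \<partial>P x\<bar> \<le> (\<integral>\<omega>. \<bar>v (Y r \<omega>)\<bar> \<partial>P x)" by (rule integral_abs_bound)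
  also have "\<dots> \<le> (\<integral>\<omega>. C \<partial>P x)" using assms i by (intro integral_mono) auto
  finally show "\<bar>\<integral>\<omega>. v (Y r \<omega>) \<partial>P x\<bar> \<le> C" by (simp add: prob_space)
qed

lemma integrable_Y_integral:
  fixes v :: "real ^ 'n \<Rightarrow> real"
  assumes "0 \<le> s" "s \<le> t" "v \<in> borel_measurable borel" "\<And>y. \<bar>v y\<bar> \<le> C"
  shows "integrable lborel (\<lambda>r. indicator {s<..t} r * (\<integral>\<omega>. v (Y r \<omega>) \<partial>P x))"
proof (rule Bochner_Integration.integrable_bound)
  show "integrable lborel (\<lambda>r. indicator {s..t} r * C)" by (rule integrable_indicator_const)
  show "(\<lambda>r. indicator {s<..t} r * (\<integral>\<omega>. v (Y r \<omega>) \<partial>P x)) \<in> borel_measurable lborel"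
    using measurable_Y_integral[OF assms(1-3)] by simp
  show "AE r in lborel. norm (indicator {s<..t} r * (\<integral>\<omega>. v (Y r \<omega>) \<partial>P x)) \<le> norm (indicator {s..t} r * C)"
    using assms expectation_Y_bounded(2)[OF _ assms(3,4), of _ x]
    by (intro AE_I2) (auto simp: indicator_def intro: order_trans[OF _ abs_ge_self])
qed

lemma weighted_expectation_diff_abs:
  assumes st: "0 \<le> s" "s \<le> t" and W: "W \<in> borel_measurable (F s)" "\<And>\<omega>. \<bar>W \<omega>\<bar> \<le> 1" and t: "tame g D H"
  shows "\<bar>\<integral>\<omega>. W \<omega> * (g (Y t \<omega>) - g (Y s \<omega>)) \<partial>P x\<bar>
     \<le> (\<integral>r. indicator {s<..t} r * (\<integral>\<omega>. \<bar>jump_gen N g D (Y r \<omega>)\<bar> \<partial>P x) \<partial>lborel)"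
proof -
  interpret prob_space "P x" by (rule prob_P)
  obtain C where C: "C \<ge> 0" "\<And>n x. \<bar>Defs.generator T (cutoff n g) x\<bar> \<le> C" "\<And>x. \<bar>jump_gen N g D x\<bar> \<le> C"
    and lim: "\<And>x. (\<lambda>n. Defs.generator T (cutoff n g) x) \<longlonglongrightarrow> jump_gen N g D x"
    by (rule cutoff_generator_limit[OF t]) (rule that)
  have jm [measurable]: "jump_gen N g D \<in> borel_measurable borel" by (rule jump_gen_borel[OF t])
  have WP: "W \<in> borel_measurable (P x)" using measurable_F_P[OF st(1) W(1)] .
  have le: "\<bar>\<integral>\<omega>. W \<omega> * jump_gen N g D (Y r \<omega>) \<partial>P x\<bar> \<le> (\<integral>\<omega>. \<bar>jump_gen N g D (Y r \<omega>)\<bar> \<partial>P x)" if "0 \<le> r" for r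
  proof -
    have i: "integrable (P x) (\<lambda>\<omega>. jump_gen N g D (Y r \<omega>))"
      by (rule expectation_Y_bounded[OF that jm C(3)])
    have "\<bar>\<integral>\<omega>. W \<omega> * jump_gen N g D (Y r \<omega>) \<partial>P x\<bar> \<le> (\<integral>\<omega>. \<bar>W \<omega> * jump_gen N g D (Y r \<omega>)\<bar> \<partial>P x)"
      by (rule integral_abs_bound)
    also have "\<dots> \<le> (\<integral>\<omega>. \<bar>jump_gen N g D (Y r \<omega>)\<bar> \<partial>P x)"
      using W(2) by (intro integral_mono integrable_abs integrable_bounded_mult[OF i WP W(2)] i)
        (auto simp: abs_mult intro!: mult_left_le_one_le)
    finally show ?thesis .
  qed
  have "\<bar>\<integral>\<omega>. W \<omega> * (g (Y t \<omega>) - g (Y s \<omega>)) \<partial>P x\<bar>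
      \<le> (\<integral>r. \<bar>indicator {s<..t} r * (\<integral>\<omega>. W \<omega> * jump_gen N g D (Y r \<omega>) \<partial>P x)\<bar> \<partial>lborel)"
    unfolding weighted_expectation_diff[OF st W t] by (rule integral_abs_bound)
  also have "\<dots> \<le> (\<integral>r. indicator {s<..t} r * (\<integral>\<omega>. \<bar>jump_gen N g D (Y r \<omega>)\<bar> \<partial>P x) \<partial>lborel)"
  proof (rule integral_mono_AE')
    show "integrable lborel (\<lambda>r. indicator {s<..t} r * (\<integral>\<omega>. \<bar>jump_gen N g D (Y r \<omega>)\<bar> \<partial>P x))"
      using st C(3) by (intro integrable_Y_integral[where C = C]) auto
    show "AE r in lborel. \<bar>indicator {s<..t} r * (\<integral>\<omega>. W \<omega> * jump_gen N g D (Y r \<omega>) \<partial>P x)\<bar>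
        \<le> indicator {s<..t} r * (\<integral>\<omega>. \<bar>jump_gen N g D (Y r \<omega>)\<bar> \<partial>P x)"
      using st le by (intro AE_I2) (auto simp: indicator_def)
  qed auto
  finally show ?thesis .
qed

text \<open>On increments of size at most 1/\<theta> the square is at most (4/\<theta>^2) (1 - cos
  \<theta>d). Its expectation over [a, b] is bounded by 4 \<open>I m a b\<close>, an integral over
  the time interval, so the estimate sums over any partition to at most 4 \<open>I m 0 t\<close>,
  which tends to 0 as \<theta> grows.\<close>

lemma small_increments:
  fixes i :: 'n
  assumes "0 \<le> t" "0 < \<eta>"
  shows "\<exists>\<epsilon>>0. \<forall>\<tau> n. 0 \<le> \<tau> 0 \<longrightarrow> (\<forall>k<n. \<tau> k \<le> \<tau> (Suc k)) \<longrightarrow> \<tau> n \<le> t \<longrightarrow>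
    (\<Sum>k<n. \<integral>\<omega>. (if \<bar>Y (\<tau> (Suc k)) \<omega> $ i - Y (\<tau> k) \<omega> $ i\<bar> \<le> \<epsilon>
       then (Y (\<tau> (Suc k)) \<omega> $ i - Y (\<tau> k) \<omega> $ i)\<^sup>2 else 0) \<partial>P x) \<le> \<eta>"
proof -
  interpret prob_space "P x" by (rule prob_P)
  define gc where "gc m = (\<lambda>y::real^'n. cos (real (Suc m) * y $ i))" for m
  define Dc where "Dc m = (\<lambda>(y::real^'n) z. - sin (real (Suc m) * y $ i) * (real (Suc m) * z $ i))" for m
  define gs where "gs m = (\<lambda>y::real^'n. sin (real (Suc m) * y $ i))" for m
  define Ds where "Ds m = (\<lambda>(y::real^'n) z. cos (real (Suc m) * y $ i) * (real (Suc m) * z $ i))" for m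
  define \<psi> where "\<psi> m y = \<bar>jump_gen N (gc m) (Dc m) y\<bar> / (real (Suc m))\<^sup>2 + \<bar>jump_gen N (gs m) (Ds m) y\<bar> / (real (Suc m))\<^sup>2" for m y
  have tc: "tame (gc m) (Dc m) (\<lambda>y z. - cos (real (Suc m) * y $ i) * (real (Suc m) * z $ i)\<^sup>2)" for m
    unfolding gc_def Dc_def by (rule tame_cos)
  have ts: "tame (gs m) (Ds m) (\<lambda>y z. - sin (real (Suc m) * y $ i) * (real (Suc m) * z $ i)\<^sup>2)" for m
    unfolding gs_def Ds_def by (rule tame_sin)
  have c': "cos (a + (real n * pi / 2 + pi / 2)) = - sin (a + real n * pi / 2)" for n a
    by (simp add: cos_add[of "a + real n * pi / 2" "pi / 2"] add.assoc[symmetric])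
  have dc: "((\<lambda>x. cos (x + real n * pi / 2)) has_real_derivative cos (x + real (Suc n) * pi / 2)) (at x)" for n x
    by (auto intro!: derivative_eq_intros simp: c' distrib_right add_divide_distrib add.commute[of "pi / 2"])
  have s': "sin (a + (real n * pi / 2 + pi / 2)) = cos (a + real n * pi / 2)" for n a
    by (simp add: sin_add[of "a + real n * pi / 2" "pi / 2"] add.assoc[symmetric])
  have ds: "((\<lambda>x. sin (x + real n * pi / 2)) has_real_derivative sin (x + real (Suc n) * pi / 2)) (at x)" for n x
    by (auto intro!: derivative_eq_intros simp: s' distrib_right add_divide_distrib add.commute[of "pi / 2"])
  have \<psi>_lim: "(\<lambda>m. \<psi> m y) \<longlonglongrightarrow> 0" for y
    using tendsto_add[OF jump_gen_trig_limit(1)[where d = "\<lambda>n x. cos (x + real n * pi / 2)" and i = i and x = y, OF dc abs_cos_le_one] jump_gen_trig_limit(1)[where d = "\<lambda>n x. sin (x + real n * pi / 2)" and i = i and x = y, OF ds abs_sin_le_one]]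
    unfolding \<psi>_def gc_def Dc_def gs_def Ds_def by (simp add: cos_add sin_add)
  have \<psi>_le: "\<psi> m y \<le> 2 * K" for m y
    using add_mono[OF jump_gen_trig_limit(2)[where d = "\<lambda>n x. cos (x + real n * pi / 2)" and i = i and x = y and m = m, OF dc abs_cos_le_one] jump_gen_trig_limit(2)[where d = "\<lambda>n x. sin (x + real n * pi / 2)" and i = i and x = y and m = m, OF ds abs_sin_le_one]]
    unfolding \<psi>_def gc_def Dc_def gs_def Ds_def by (simp add: cos_add sin_add)
  have \<psi>_nonneg: "0 \<le> \<psi> m y" for m y by (simp add: \<psi>_def)
  have \<psi>_abs: "\<bar>\<psi> m y\<bar> \<le> 2 * K" for m y using \<psi>_le \<psi>_nonneg by (simp add: abs_of_nonneg)
  have \<psi>_meas: "\<psi> m \<in> borel_measurable borel" for m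
    unfolding \<psi>_def[abs_def] using jump_gen_borel[OF tc] jump_gen_borel[OF ts]
    by (intro borel_measurable_add borel_measurable_divide borel_measurable_abs) auto
  define I where "I m a b = (\<integral>r. indicator {a<..b} r * (\<integral>\<omega>. \<psi> m (Y r \<omega>) \<partial>P x) \<partial>lborel)" for m a b
  have I_int: "integrable lborel (\<lambda>r. indicator {a<..b} r * (\<integral>\<omega>. \<psi> m (Y r \<omega>) \<partial>P x))" if "0 \<le> a" "a \<le> b" for a b m
    using integrable_Y_integral[OF that \<psi>_meas \<psi>_abs] .
  \<comment> \<open>Additivity in the interval is what makes the final bound independent of the
    number and position of the partition points.\<close>
  have I_add: "I m a b + I m b c = I m a c" if "0 \<le> a" "a \<le> b" "b \<le> c" for m a b c
    using that I_int[of a b m] I_int[of b c m]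
    unfolding I_def by (subst Bochner_Integration.integral_add[symmetric])
      (auto simp: distrib_right[symmetric] indicator_Ioc_add)
  have I_nonneg: "0 \<le> I m a b" for m a b
    unfolding I_def using \<psi>_nonneg by (intro integral_nonneg_AE) (auto simp: indicator_def)
  have step: "(\<integral>\<omega>. (if \<bar>Y b \<omega> $ i - Y a \<omega> $ i\<bar> \<le> 1 / real (Suc m) then (Y b \<omega> $ i - Y a \<omega> $ i)\<^sup>2 else 0) \<partial>P x) \<le> 4 * I m a b"
    if ab: "0 \<le> a" "a \<le> b" for a b m
  proof -
    let ?\<theta> = "real (Suc m)"
    let ?Wc = "\<lambda>\<omega>. gc m (Y a \<omega>)" and ?Ws = "\<lambda>\<omega>. gs m (Y a \<omega>)"
    let ?d = "\<lambda>\<omega>. Y b \<omega> $ i - Y a \<omega> $ i"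
    have Wc: "?Wc \<in> borel_measurable (F a)" "\<And>\<omega>. \<bar>?Wc \<omega>\<bar> \<le> 1"
      using measurable_compose[OF Y_adapted[OF ab(1)] tame_borel[OF tc]] by (auto simp: gc_def)
    have Ws: "?Ws \<in> borel_measurable (F a)" "\<And>\<omega>. \<bar>?Ws \<omega>\<bar> \<le> 1"
      using measurable_compose[OF Y_adapted[OF ab(1)] tame_borel[OF ts]] by (auto simp: gs_def)
    have b0: "0 \<le> b" using ab by simp
    note [measurable] = measurable_Y[OF ab(1), of x] measurable_Y[OF b0, of x]
    have [measurable]: "(\<lambda>\<omega>. Y a \<omega> $ i) \<in> borel_measurable (P x)" "(\<lambda>\<omega>. Y b \<omega> $ i) \<in> borel_measurable (P x)"
      by (rule measurable_compose[OF _ borel_measurable_nth], measurable)+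
    have intc: "integrable (P x) (\<lambda>\<omega>. ?Wc \<omega> * (gc m (Y b \<omega>) - gc m (Y a \<omega>)))"
      using integrable_tame[OF b0 tc] integrable_tame[OF ab(1) tc] measurable_F_P[OF ab(1) Wc(1)] Wc(2)
      by (intro integrable_bounded_mult[where B = 1]) auto
    have ints: "integrable (P x) (\<lambda>\<omega>. ?Ws \<omega> * (gs m (Y b \<omega>) - gs m (Y a \<omega>)))"
      using integrable_tame[OF b0 ts] integrable_tame[OF ab(1) ts] measurable_F_P[OF ab(1) Ws(1)] Ws(2)
      by (intro integrable_bounded_mult[where B = 1]) auto
    have int1: "integrable (P x) (\<lambda>\<omega>. 4 / ?\<theta>\<^sup>2 * (1 - cos (?\<theta> * ?d \<omega>)))"
      by (intro integrable_mult_right Bochner_Integration.integrable_diff integrable_const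
          integrable_const_bound[where B = 1]) auto
    \<comment> \<open>The cosine of a difference, combined with cos^2 + sin^2 = 1 at time a,
      expresses 1 - cos through increments over [a, b] with weights known at time a, to which
      Dynkin's formula applies.\<close>
    have pt: "1 - cos (?\<theta> * ?d \<omega>) = - (?Wc \<omega> * (gc m (Y b \<omega>) - gc m (Y a \<omega>))) - ?Ws \<omega> * (gs m (Y b \<omega>) - gs m (Y a \<omega>))" for \<omega>
    proof -
      have "cos (?\<theta> * ?d \<omega>) = cos (?\<theta> * Y b \<omega> $ i) * cos (?\<theta> * Y a \<omega> $ i) + sin (?\<theta> * Y b \<omega> $ i) * sin (?\<theta> * Y a \<omega> $ i)"
        unfolding right_diff_distrib by (rule cos_diff)
      moreover have "cos (?\<theta> * Y a \<omega> $ i) * cos (?\<theta> * Y a \<omega> $ i) + sin (?\<theta> * Y a \<omega> $ i) * sin (?\<theta> * Y a \<omega> $ i) = 1"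
        using sin_cos_squared_add3 by simp
      ultimately show ?thesis unfolding gc_def gs_def right_diff_distrib by (simp only: mult.commute)
    qed
    have "(\<integral>\<omega>. (if \<bar>?d \<omega>\<bar> \<le> 1 / ?\<theta> then (?d \<omega>)\<^sup>2 else 0) \<partial>P x) \<le> (\<integral>\<omega>. 4 / ?\<theta>\<^sup>2 * (1 - cos (?\<theta> * ?d \<omega>)) \<partial>P x)"
    proof (rule integral_mono_AE'[OF int1])
      show "AE \<omega> in P x. (if \<bar>?d \<omega>\<bar> \<le> 1 / ?\<theta> then (?d \<omega>)\<^sup>2 else 0) \<le> 4 / ?\<theta>\<^sup>2 * (1 - cos (?\<theta> * ?d \<omega>))"
      proof (rule AE_I2)
        fix \<omega>
        show "(if \<bar>?d \<omega>\<bar> \<le> 1 / ?\<theta> then (?d \<omega>)\<^sup>2 else 0) \<le> 4 / ?\<theta>\<^sup>2 * (1 - cos (?\<theta> * ?d \<omega>))"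
        proof (cases "\<bar>?d \<omega>\<bar> \<le> 1 / ?\<theta>")
          case True
          then have "\<bar>?\<theta> * ?d \<omega>\<bar> \<le> 1" by (simp only: abs_mult abs_of_nat pos_le_divide_eq of_nat_0_less_iff zero_less_Suc mult.commute)
          then have "(?\<theta> * ?d \<omega>)\<^sup>2 / ?\<theta>\<^sup>2 \<le> 4 * (1 - cos (?\<theta> * ?d \<omega>)) / ?\<theta>\<^sup>2"
            by (intro divide_right_mono square_le_one_minus_cos) auto
          moreover have "(?\<theta> * ?d \<omega>)\<^sup>2 / ?\<theta>\<^sup>2 = (?d \<omega>)\<^sup>2"
            unfolding power_mult_distrib by (rule nonzero_mult_div_cancel_left) simp
          ultimately show ?thesis using True by simp
        qed (simp)
      qed
    qed auto
    also have "\<dots> = 4 / ?\<theta>\<^sup>2 * (- (\<integral>\<omega>. ?Wc \<omega> * (gc m (Y b \<omega>) - gc m (Y a \<omega>)) \<partial>P x)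
        - (\<integral>\<omega>. ?Ws \<omega> * (gs m (Y b \<omega>) - gs m (Y a \<omega>)) \<partial>P x))"
      unfolding pt using intc ints by simp
    also have "\<dots> \<le> 4 / ?\<theta>\<^sup>2 * ((\<integral>r. indicator {a<..b} r * (\<integral>\<omega>. \<bar>jump_gen N (gc m) (Dc m) (Y r \<omega>)\<bar> \<partial>P x) \<partial>lborel)
        + (\<integral>r. indicator {a<..b} r * (\<integral>\<omega>. \<bar>jump_gen N (gs m) (Ds m) (Y r \<omega>)\<bar> \<partial>P x) \<partial>lborel))"
      using weighted_expectation_diff_abs[OF ab Wc tc[of m], of x] weighted_expectation_diff_abs[OF ab Ws ts[of m], of x]
      by (intro mult_left_mono) (auto simp: abs_le_iff)
    also have "\<dots> = 4 * I m a b"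
    proof -
      obtain C where C: "\<And>x. \<bar>jump_gen N (gc m) (Dc m) x\<bar> \<le> C"
        by (rule cutoff_generator_limit[OF tc]) (rule that)
      obtain C' where C': "\<And>x. \<bar>jump_gen N (gs m) (Ds m) x\<bar> \<le> C'"
        by (rule cutoff_generator_limit[OF ts]) (rule that)
      have m: "(\<lambda>y. \<bar>jump_gen N (gc m) (Dc m) y\<bar>) \<in> borel_measurable borel" "(\<lambda>y. \<bar>jump_gen N (gs m) (Ds m) y\<bar>) \<in> borel_measurable borel"
        using jump_gen_borel[OF tc] jump_gen_borel[OF ts] by auto
      have e: "(\<integral>\<omega>. \<psi> m (Y r \<omega>) \<partial>P x) = ((\<integral>\<omega>. \<bar>jump_gen N (gc m) (Dc m) (Y r \<omega>)\<bar> \<partial>P x)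
          + (\<integral>\<omega>. \<bar>jump_gen N (gs m) (Ds m) (Y r \<omega>)\<bar> \<partial>P x)) / ?\<theta>\<^sup>2" if "0 \<le> r" for r
        unfolding \<psi>_def add_divide_distrib
        using expectation_Y_bounded(1)[OF that m(1), of C x] expectation_Y_bounded(1)[OF that m(2), of C' x] C C'
        by (subst Bochner_Integration.integral_add) auto
      have "I m a b = (\<integral>r. (indicator {a<..b} r * (\<integral>\<omega>. \<bar>jump_gen N (gc m) (Dc m) (Y r \<omega>)\<bar> \<partial>P x)
          + indicator {a<..b} r * (\<integral>\<omega>. \<bar>jump_gen N (gs m) (Ds m) (Y r \<omega>)\<bar> \<partial>P x)) / ?\<theta>\<^sup>2 \<partial>lborel)"
        unfolding I_def using ab by (intro Bochner_Integration.integral_cong) (auto simp: e indicator_def)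
      also have "\<dots> = ((\<integral>r. indicator {a<..b} r * (\<integral>\<omega>. \<bar>jump_gen N (gc m) (Dc m) (Y r \<omega>)\<bar> \<partial>P x) \<partial>lborel)
          + (\<integral>r. indicator {a<..b} r * (\<integral>\<omega>. \<bar>jump_gen N (gs m) (Ds m) (Y r \<omega>)\<bar> \<partial>P x) \<partial>lborel)) / ?\<theta>\<^sup>2"
        using integrable_Y_integral[OF ab m(1), of C x] integrable_Y_integral[OF ab m(2), of C' x] C C'
        by simp
      finally show ?thesis by simp
    qed
    finally show ?thesis .
  qed
  have "(\<lambda>m. I m 0 t) \<longlonglongrightarrow> (\<integral>r. 0 \<partial>(lborel :: real measure))"
    unfolding I_def
  proof (rule integral_dominated_convergence[where w = "\<lambda>r. indicator {0..t} r * (2 * K)"])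
    have "(\<lambda>m. \<integral>\<omega>. \<psi> m (Y r \<omega>) \<partial>P x) \<longlonglongrightarrow> (\<integral>\<omega>. 0 \<partial>P x)" if "0 \<le> r" for r
    proof (rule integral_dominated_convergence[where w = "\<lambda>_. 2 * K"])
      show "(\<lambda>\<omega>. \<psi> m (Y r \<omega>)) \<in> borel_measurable (P x)" for m
        using measurable_compose[OF measurable_Y[OF that] \<psi>_meas] .
    qed (use \<psi>_lim \<psi>_abs in auto)
    then show "AE r in lborel. (\<lambda>m. indicator {0<..t} r * (\<integral>\<omega>. \<psi> m (Y r \<omega>) \<partial>P x)) \<longlonglongrightarrow> 0"
      by (intro AE_I2) (auto simp: indicator_def)
    show "AE r in lborel. norm (indicator {0<..t} r * (\<integral>\<omega>. \<psi> m (Y r \<omega>) \<partial>P x)) \<le> indicator {0..t} r * (2 * K)" for m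
      using expectation_Y_bounded(2)[OF _ \<psi>_meas \<psi>_abs] K_nonneg by (intro AE_I2) (auto simp: indicator_def)
  qed (use assms K_nonneg measurable_Y_integral[OF _ _ \<psi>_meas] integrable_indicator_const in auto)
  then have "(\<lambda>m. 4 * I m 0 t) \<longlonglongrightarrow> 4 * 0" by (intro tendsto_mult_left) simp
  then have "\<forall>\<^sub>F m in sequentially. 4 * I m 0 t < \<eta>"
    using assms(2) by (intro order_tendstoD(2)) auto
  \<comment> \<open>This m determines the threshold 1 / (m + 1) for small increments, before any
    partition is chosen.\<close>
  then obtain m where m: "4 * I m 0 t < \<eta>" by (auto simp: eventually_sequentially)
  show ?thesis
  proof (intro exI[of _ "1 / real (Suc m)"] conjI allI impI)
    fix \<tau> :: "nat \<Rightarrow> real" and n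
    assume \<tau>: "0 \<le> \<tau> 0" "\<forall>k<n. \<tau> k \<le> \<tau> (Suc k)" "\<tau> n \<le> t"
    have mono: "\<tau> 0 \<le> \<tau> k" if "k \<le> n" for k using that \<tau>(2) by (induction k) (auto intro: order_trans)
    have "(\<Sum>k<j. \<integral>\<omega>. (if \<bar>Y (\<tau> (Suc k)) \<omega> $ i - Y (\<tau> k) \<omega> $ i\<bar> \<le> 1 / real (Suc m)
       then (Y (\<tau> (Suc k)) \<omega> $ i - Y (\<tau> k) \<omega> $ i)\<^sup>2 else 0) \<partial>P x) \<le> 4 * I m (\<tau> 0) (\<tau> j)" if "j \<le> n" for j
      using that
    proof (induction j)
      case 0
      then show ?case using I_nonneg by simp
    next
      case (Suc j)
      then have "0 \<le> \<tau> j" "\<tau> j \<le> \<tau> (Suc j)" "\<tau> 0 \<le> \<tau> j" using mono[of j] \<tau> by auto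
      then show ?case
        using Suc step[of "\<tau> j" "\<tau> (Suc j)" m] I_add[of "\<tau> 0" "\<tau> j" "\<tau> (Suc j)" m] \<tau>(1)
        unfolding sum.lessThan_Suc by linarith
    qed
    from this[of n] have "(\<Sum>k<n. \<integral>\<omega>. (if \<bar>Y (\<tau> (Suc k)) \<omega> $ i - Y (\<tau> k) \<omega> $ i\<bar> \<le> 1 / real (Suc m)
       then (Y (\<tau> (Suc k)) \<omega> $ i - Y (\<tau> k) \<omega> $ i)\<^sup>2 else 0) \<partial>P x) \<le> 4 * I m (\<tau> 0) (\<tau> n)" by simp
    moreover have "I m (\<tau> 0) (\<tau> n) \<le> I m 0 t"
      using I_add[of 0 "\<tau> 0" "\<tau> n" m] I_add[of 0 "\<tau> n" t m] I_nonneg[of m 0 "\<tau> 0"] I_nonneg[of m "\<tau> n" t] \<tau> mono[of n]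
      by linarith
    ultimately show "(\<Sum>k<n. \<integral>\<omega>. (if \<bar>Y (\<tau> (Suc k)) \<omega> $ i - Y (\<tau> k) \<omega> $ i\<bar> \<le> 1 / real (Suc m)
       then (Y (\<tau> (Suc k)) \<omega> $ i - Y (\<tau> k) \<omega> $ i)\<^sup>2 else 0) \<partial>P x) \<le> \<eta>"
      using m by linarith
  qed simp
qed

end

section \<open>Martingales and maximal inequalities\<close>

fun runmax :: "(nat \<Rightarrow> real) \<Rightarrow> nat \<Rightarrow> real" where
  "runmax y 0 = y 0"
| "runmax y (Suc n) = max (runmax y n) (y (Suc n))"

lemma le_runmax: "k \<le> n \<Longrightarrow> y k \<le> runmax y n"
  by (induction n) (auto simp: le_Suc_eq intro: order_trans max.cobounded1)

lemma runmax_le: "(\<And>k. k \<le> n \<Longrightarrow> y k \<le> c) \<Longrightarrow> runmax y n \<le> c"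
  by (induction n) auto

text \<open>The sum on the right is a discrete stochastic integral, so for a submartingale its expectation is not negative.\<close>

lemma runmax_sq_le:
  assumes "\<And>k. 0 \<le> y k"
  shows "(runmax y n)\<^sup>2 \<le> 4 * (y n)\<^sup>2 - 4 * (\<Sum>k<n. runmax y k * (y (Suc k) - y k))"
proof -
  \<comment> \<open>Discrete integration by parts: when the running maximum M increases, it
    coincides with y, so the sum of M dy behaves like M y - M^2 / 2.\<close>
  have sum: "(\<Sum>k<n. runmax y k * (y (Suc k) - y k)) \<le> runmax y n * y n - (runmax y n)\<^sup>2 / 2"
  proof (induction n)
    case 0
    then show ?case by (simp add: power2_eq_square)
  next
    case (Suc n)
    let ?M = "runmax y n"
    have "(\<Sum>k<Suc n. runmax y k * (y (Suc k) - y k)) \<le> ?M * y (Suc n) - ?M\<^sup>2 / 2"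
      using Suc by (simp add: algebra_simps)
    also have "\<dots> \<le> runmax y (Suc n) * y (Suc n) - (runmax y (Suc n))\<^sup>2 / 2"
    proof (cases "y (Suc n) \<le> ?M")
      case True
      then show ?thesis by (simp add: max_def)
    next
      case False
      have "0 \<le> (y (Suc n) - ?M)\<^sup>2" by simp
      then have "?M * y (Suc n) - ?M\<^sup>2 / 2 \<le> (y (Suc n))\<^sup>2 / 2"
        unfolding power2_diff by (simp add: mult.commute)
      also have "\<dots> = y (Suc n) * y (Suc n) - (y (Suc n))\<^sup>2 / 2"
        by (simp add: power2_eq_square)
      finally show ?thesis using False by (simp add: max_def)
    qed
    finally show ?case .
  qed
  \<comment> \<open>Completing the square absorbs the mixed term 4 M y into M^2 + 4 y^2 and produces
    Doob's constant 4.\<close>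
  have "0 \<le> (runmax y n - 2 * y n)\<^sup>2" by simp
  then have "4 * (runmax y n * y n) \<le> (runmax y n)\<^sup>2 + 4 * (y n)\<^sup>2"
    unfolding power2_diff by (simp add: power2_eq_square algebra_simps)
  then show ?thesis using sum by linarith
qed

lemma integrable_mult_of_squares:
  fixes f g :: "'a \<Rightarrow> real"
  assumes [measurable]: "f \<in> borel_measurable Q" "g \<in> borel_measurable Q"
    and "integrable Q (\<lambda>\<omega>. (f \<omega>)\<^sup>2)" "integrable Q (\<lambda>\<omega>. (g \<omega>)\<^sup>2)"
  shows "integrable Q (\<lambda>\<omega>. f \<omega> * g \<omega>)"
proof (rule Bochner_Integration.integrable_bound)
  show "integrable Q (\<lambda>\<omega>. (f \<omega>)\<^sup>2 + (g \<omega>)\<^sup>2)" using assms by simp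
  have "\<bar>a * b\<bar> \<le> a\<^sup>2 + b\<^sup>2" for a b :: real
  proof -
    have "0 \<le> (\<bar>a\<bar> - \<bar>b\<bar>)\<^sup>2" by simp
    then have "2 * (\<bar>a\<bar> * \<bar>b\<bar>) \<le> a\<^sup>2 + b\<^sup>2" by (simp add: power2_diff mult.assoc)
    moreover have "0 \<le> \<bar>a\<bar> * \<bar>b\<bar>" by simp
    ultimately show ?thesis unfolding abs_mult by linarith
  qed
  then show "AE \<omega> in Q. norm (f \<omega> * g \<omega>) \<le> norm ((f \<omega>)\<^sup>2 + (g \<omega>)\<^sup>2)"
    by (intro AE_I2) simp
qed measurable

section \<open>Dyadic times\<close>

lemma filterlim_dyadic_grid:
  fixes s :: real
  assumes "0 < T"
  shows "filterlim (\<lambda>n. (of_int \<lfloor>2 ^ n * (s / T)\<rfloor> + 1) * T / 2 ^ n) (at_right s) sequentially"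
proof -
  \<comment> \<open>The general grid has mesh 1 / (n + 1); the subsequence 2^n - 1 makes the mesh
    2^(-n), and dilation by T maps the dyadic grid of [0, 1] to that of [0, T].\<close>
  have "filterlim (\<lambda>n::nat. 2 ^ n - 1 :: nat) sequentially sequentially"
  proof (rule filterlim_at_top_mono[OF filterlim_ident])
    show "\<forall>\<^sub>F n in sequentially. n \<le> 2 ^ n - (1::nat)"
    proof (intro always_eventually allI)
      fix n :: nat
      have "n < 2 ^ n" by (rule less_exp)
      then show "n \<le> 2 ^ n - 1" by linarith
    qed
  qed
  from filterlim_compose[OF filterlim_floor_grid this, of "s / T"]
  have 1: "filterlim (\<lambda>n. (of_int \<lfloor>2 ^ n * (s / T)\<rfloor> + 1) / 2 ^ n) (at_right (s / T)) sequentially"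
    by (simp add: of_nat_diff)
  have "filterlim (\<lambda>x. x * T) (at_right s) (at_right (s / T))"
    unfolding filterlim_at
  proof (intro conjI)
    have "((\<lambda>x. x * T) \<longlongrightarrow> s / T * T) (at_right (s / T))" by (intro tendsto_intros)
    then show "((\<lambda>x. x * T) \<longlongrightarrow> s) (at_right (s / T))" using assms by simp
    show "\<forall>\<^sub>F x in at_right (s / T). x * T \<in> {s<..} \<and> x * T \<noteq> s"
      using eventually_at_right_less[of "s / T"] by eventually_elim (use assms in \<open>auto simp: field_simps\<close>)
  qed
  from filterlim_compose[OF this 1] show ?thesis by (simp add: field_simps)
qed

text \<open>This transfers bounds known at countably many times to all times before T: the dyadic
  point just after s does not exceed T, since s < T. The end point T is itself dyadic and is treated
  by the users of the lemma.\<close>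

lemma right_limit_in_closed:
  fixes g :: "real \<Rightarrow> 'b :: t2_space"
  assumes "0 \<le> s" "s < T" and lim: "(g \<longlongrightarrow> l) (at_right s)" and "closed C"
    and C: "\<And>n k. k \<le> 2 ^ n \<Longrightarrow> g (real k * T / 2 ^ n) \<in> C"
  shows "l \<in> C"
proof (rule Lim_in_closed_set[OF \<open>closed C\<close>])
  let ?d = "\<lambda>n. (of_int \<lfloor>2 ^ n * (s / T)\<rfloor> + 1) * T / 2 ^ n"
  show "((\<lambda>n. g (?d n)) \<longlongrightarrow> l) sequentially"
    using assms by (intro filterlim_compose[OF lim filterlim_dyadic_grid]) auto
  show "\<forall>\<^sub>F n in sequentially. g (?d n) \<in> C"
  proof (intro always_eventually allI)
    fix n
    have "s / T < 1" using assms by simp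
    from mult_strict_left_mono[OF this, of "2 ^ n"] have "2 ^ n * (s / T) < 2 ^ n" by simp
    then have "\<lfloor>2 ^ n * (s / T)\<rfloor> < 2 ^ n" by (simp add: floor_less_iff)
    moreover have "0 \<le> \<lfloor>2 ^ n * (s / T)\<rfloor>" using assms by simp
    ultimately have "nat (\<lfloor>2 ^ n * (s / T)\<rfloor> + 1) \<le> 2 ^ n" by (simp add: nat_le_iff)
    from C[OF this] show "g (?d n) \<in> C" using \<open>0 \<le> \<lfloor>2 ^ n * (s / T)\<rfloor>\<close> by simp
  qed
qed simp

section \<open>Martingales tested on sets, and Doob's inequality in mean square\<close>

locale filtered_prob_space = prob_space Q for Q :: "'w measure" +
  fixes G :: "real \<Rightarrow> 'w measure"
  assumes subalg_G: "\<And>t. 0 \<le> t \<Longrightarrow> subalgebra Q (G t)"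
    and G_mono: "\<And>s t. 0 \<le> s \<Longrightarrow> s \<le> t \<Longrightarrow> sets (G s) \<subseteq> sets (G t)"
begin

text \<open>Conditional expectations are replaced by integrals over sets of the earlier
  sigma-algebra, and path regularity is split off. In this form the martingale property is easily
  moved to the augmented filtration and checked for stopped processes.\<close>

definition mart :: "(real \<Rightarrow> 'w \<Rightarrow> real) \<Rightarrow> bool" where
  "mart y \<longleftrightarrow> (\<forall>t\<ge>0. y t \<in> borel_measurable (G t)) \<and> (\<forall>t\<ge>0. integrable Q (y t)) \<and>
     (\<forall>s t A. 0 \<le> s \<longrightarrow> s \<le> t \<longrightarrow> A \<in> sets (G s) \<longrightarrow>
       (\<integral>\<omega>. indicator A \<omega> * y t \<omega> \<partial>Q) = (\<integral>\<omega>. indicator A \<omega> * y s \<omega> \<partial>Q))"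

lemma space_G: "0 \<le> t \<Longrightarrow> space (G t) = space Q"
  using subalg_G by (auto simp: subalgebra_def)

lemma sets_G: "0 \<le> t \<Longrightarrow> A \<in> sets (G t) \<Longrightarrow> A \<in> sets Q"
  using subalg_G by (auto simp: subalgebra_def)

lemma measurable_G: "0 \<le> t \<Longrightarrow> f \<in> measurable (G t) N \<Longrightarrow> f \<in> measurable Q N"
  by (rule measurable_from_subalg[OF subalg_G])

lemma measurable_G_mono: "0 \<le> s \<Longrightarrow> s \<le> t \<Longrightarrow> f \<in> measurable (G s) N \<Longrightarrow> f \<in> measurable (G t) N"
  by (rule measurable_from_subalg[of "G t" "G s"]) (auto simp: subalgebra_def space_G dest: G_mono[of s t])

lemma mart_measurable: "mart y \<Longrightarrow> 0 \<le> t \<Longrightarrow> y t \<in> borel_measurable (G t)"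
  and mart_integrable: "mart y \<Longrightarrow> 0 \<le> t \<Longrightarrow> integrable Q (y t)"
  and mart_eq: "mart y \<Longrightarrow> 0 \<le> s \<Longrightarrow> s \<le> t \<Longrightarrow> A \<in> sets (G s) \<Longrightarrow>
       (\<integral>\<omega>. indicator A \<omega> * y t \<omega> \<partial>Q) = (\<integral>\<omega>. indicator A \<omega> * y s \<omega> \<partial>Q)"
  unfolding mart_def by blast+

lemma finite_measure_subalgebra: "0 \<le> t \<Longrightarrow> finite_measure_subalgebra Q (G t)"
  by unfold_locales (rule subalg_G)

lemma mart_cond_exp:
  assumes "mart y" "0 \<le> s" "s \<le> t"
  shows "AE \<omega> in Q. real_cond_exp Q (G s) (y t) \<omega> = y s \<omega>"
proof -
  interpret finite_measure_subalgebra Q "G s" using assms by (intro finite_measure_subalgebra)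
  show ?thesis
    using assms mart_eq[OF assms]
    by (intro real_cond_exp_charact)
      (auto simp: set_lebesgue_integral_def mart_integrable mart_measurable)
qed

lemma mart_iff: "martingale Q G y \<longleftrightarrow> mart y \<and> (AE \<omega> in Q. cadlag (\<lambda>t. y t \<omega>))"
proof
  assume m: "martingale Q G y"
  have "(\<integral>\<omega>. indicator A \<omega> * y t \<omega> \<partial>Q) = (\<integral>\<omega>. indicator A \<omega> * y s \<omega> \<partial>Q)"
    if st: "0 \<le> s" "s \<le> t" "A \<in> sets (G s)" for s t A
  proof -
    interpret finite_measure_subalgebra Q "G s" using st by (intro finite_measure_subalgebra)
    have int: "integrable Q (y t)" "integrable Q (y s)" using m st by (auto simp: martingale_def)
    have A: "A \<in> sets Q" using st by (auto intro: sets_G)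
    have AE: "AE \<omega> in Q. real_cond_exp Q (G s) (y t) \<omega> = y s \<omega>"
      using m st by (auto simp: martingale_def)
    have "(\<integral>\<omega>. indicator A \<omega> * y t \<omega> \<partial>Q) = (\<integral>\<omega>. indicator A \<omega> * real_cond_exp Q (G s) (y t) \<omega> \<partial>Q)"
      using real_cond_exp_intA[OF int(1) st(3)] by (simp add: set_lebesgue_integral_def)
    also have "\<dots> = (\<integral>\<omega>. indicator A \<omega> * y s \<omega> \<partial>Q)"
      using AE A int by (intro integral_cong_AE) auto
    finally show ?thesis .
  qed
  then show "mart y \<and> (AE \<omega> in Q. cadlag (\<lambda>t. y t \<omega>))"
    using m unfolding martingale_def mart_def by blast
next
  assume "mart y \<and> (AE \<omega> in Q. cadlag (\<lambda>t. y t \<omega>))"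
  then show "martingale Q G y"
    unfolding martingale_def using mart_cond_exp mart_measurable mart_integrable by blast
qed

lemma mart_weighted:
  assumes "mart y" "0 \<le> s" "s \<le> t" and W: "W \<in> borel_measurable (G s)"
    and "integrable Q (\<lambda>\<omega>. W \<omega> * y t \<omega>)"
  shows "(\<integral>\<omega>. W \<omega> * y t \<omega> \<partial>Q) = (\<integral>\<omega>. W \<omega> * y s \<omega> \<partial>Q)"
proof -
  interpret finite_measure_subalgebra Q "G s" using assms by (intro finite_measure_subalgebra)
  have "0 \<le> t" using assms by simp
  have WQ: "W \<in> borel_measurable Q" using assms(2) W by (rule measurable_G)
  have y: "y t \<in> borel_measurable Q" "y s \<in> borel_measurable Q"
    using borel_measurable_integrable[OF mart_integrable[OF assms(1) \<open>0 \<le> t\<close>]]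
      borel_measurable_integrable[OF mart_integrable[OF assms(1,2)]] .
  have "(\<integral>\<omega>. W \<omega> * y t \<omega> \<partial>Q) = (\<integral>\<omega>. W \<omega> * real_cond_exp Q (G s) (y t) \<omega> \<partial>Q)"
    by (rule real_cond_exp_intg(2)[symmetric]) fact+
  also have "\<dots> = (\<integral>\<omega>. W \<omega> * y s \<omega> \<partial>Q)"
    using mart_cond_exp[OF assms(1-3)] WQ y by (intro integral_cong_AE) auto
  finally show ?thesis .
qed

text \<open>The pathwise inequality for |y| is integrated; what remains is that the transform of |y|
  by its running maximum has nonnegative expectation. The maximum times the sign of y is a weight
  known at the left end of each step and reduces this to the martingale property of y.\<close>

lemma doob_L2:
  assumes y: "mart y" and sq: "\<And>t. 0 \<le> t \<Longrightarrow> integrable Q (\<lambda>\<omega>. (y t \<omega>)\<^sup>2)"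
    and \<tau>: "0 \<le> \<tau> 0" "\<And>k. \<tau> k \<le> \<tau> (Suc k)"
  shows "integrable Q (\<lambda>\<omega>. (runmax (\<lambda>k. \<bar>y (\<tau> k) \<omega>\<bar>) n)\<^sup>2)" (is ?int)
    and "(\<integral>\<omega>. (runmax (\<lambda>k. \<bar>y (\<tau> k) \<omega>\<bar>) n)\<^sup>2 \<partial>Q) \<le> 4 * (\<integral>\<omega>. (y (\<tau> n) \<omega>)\<^sup>2 \<partial>Q)" (is ?le)
    and "(\<lambda>\<omega>. runmax (\<lambda>k. \<bar>y (\<tau> k) \<omega>\<bar>) n) \<in> borel_measurable Q"
proof -
  let ?R = "\<lambda>n \<omega>. runmax (\<lambda>k. \<bar>y (\<tau> k) \<omega>\<bar>) n"
  have \<tau>0: "0 \<le> \<tau> k" for k by (induction k) (use \<tau> in \<open>auto intro: order_trans\<close>)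
  have Rm: "?R n \<in> borel_measurable (G (\<tau> n))" for n
  proof (induction n)
    case 0
    then show ?case using mart_measurable[OF y \<tau>0[of 0]] by simp
  next
    case (Suc n)
    then have "?R n \<in> borel_measurable (G (\<tau> (Suc n)))"
      by (rule measurable_G_mono[OF \<tau>0 \<tau>(2)])
    then show ?case using mart_measurable[OF y \<tau>0[of "Suc n"]] by simp
  qed
  have RQ: "?R n \<in> borel_measurable Q" for n
    using measurable_G[OF \<tau>0 Rm] .
  then show "?R n \<in> borel_measurable Q" .
  have yQ: "y (\<tau> k) \<in> borel_measurable Q" for k
    using mart_integrable[OF y \<tau>0] by (rule borel_measurable_integrable)
  have R0: "0 \<le> ?R j \<omega>" for j \<omega>
    using le_runmax[of 0 j "\<lambda>k. \<bar>y (\<tau> k) \<omega>\<bar>"] by (auto intro: order_trans[OF abs_ge_zero])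
  have Rint: "integrable Q (\<lambda>\<omega>. (?R n \<omega>)\<^sup>2)" for n
  proof (rule Bochner_Integration.integrable_bound)
    show "integrable Q (\<lambda>\<omega>. \<Sum>k\<le>n. (y (\<tau> k) \<omega>)\<^sup>2)" using sq[OF \<tau>0] by simp
    have "(?R n \<omega>)\<^sup>2 \<le> (\<Sum>k\<le>n. (y (\<tau> k) \<omega>)\<^sup>2)" for \<omega>
    proof (induction n)
      case (Suc n)
      have "(max M b)\<^sup>2 \<le> M\<^sup>2 + b\<^sup>2" for M b :: real by (simp add: max_def)
      from order_trans[OF this[of _ "\<bar>y (\<tau> (Suc n)) \<omega>\<bar>"] add_right_mono[OF Suc]] show ?case by simp
    qed simp
    then show "AE \<omega> in Q. norm ((?R n \<omega>)\<^sup>2) \<le> norm (\<Sum>k\<le>n. (y (\<tau> k) \<omega>)\<^sup>2)"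
      by (intro AE_I2) (simp add: sum_nonneg)
  qed (use RQ in simp)
  then show ?int .
  have prod_int: "integrable Q (\<lambda>\<omega>. ?R k \<omega> * \<bar>y (\<tau> j) \<omega>\<bar>)" for k j
    using RQ yQ Rint sq[OF \<tau>0] by (intro integrable_mult_of_squares) auto
  have step: "0 \<le> (\<integral>\<omega>. ?R k \<omega> * (\<bar>y (\<tau> (Suc k)) \<omega>\<bar> - \<bar>y (\<tau> k) \<omega>\<bar>) \<partial>Q)" for k
  proof -
    let ?W = "\<lambda>\<omega>. ?R k \<omega> * sgn (y (\<tau> k) \<omega>)"
    have W: "?W \<in> borel_measurable (G (\<tau> k))"
      using Rm[of k] mart_measurable[OF y \<tau>0[of k]] by simp
    have WQ: "?W \<in> borel_measurable Q" using measurable_G[OF \<tau>0 W] .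
    have Wint: "integrable Q (\<lambda>\<omega>. (?W \<omega>)\<^sup>2)"
    proof (rule Bochner_Integration.integrable_bound[OF Rint[of k]])
      show "(\<lambda>\<omega>. (?W \<omega>)\<^sup>2) \<in> borel_measurable Q" using WQ by (rule borel_measurable_power)
    qed (auto simp: power_mult_distrib sgn_if)
    have i: "integrable Q (\<lambda>\<omega>. ?W \<omega> * y (\<tau> j) \<omega>)" for j
      using WQ yQ Wint sq[OF \<tau>0] by (intro integrable_mult_of_squares) auto
    have "0 = (\<integral>\<omega>. ?W \<omega> * y (\<tau> (Suc k)) \<omega> \<partial>Q) - (\<integral>\<omega>. ?W \<omega> * y (\<tau> k) \<omega> \<partial>Q)"
      using mart_weighted[OF y \<tau>0 \<tau>(2) W i] by simp
    also have "\<dots> = (\<integral>\<omega>. ?W \<omega> * y (\<tau> (Suc k)) \<omega> - ?W \<omega> * y (\<tau> k) \<omega> \<partial>Q)"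
      using i by simp
    also have "\<dots> \<le> (\<integral>\<omega>. ?R k \<omega> * \<bar>y (\<tau> (Suc k)) \<omega>\<bar> - ?R k \<omega> * \<bar>y (\<tau> k) \<omega>\<bar> \<partial>Q)"
    proof (rule integral_mono)
      fix \<omega>
      \<comment> \<open>Convexity of the absolute value: the sign is a subgradient at the earlier
        value.\<close>
      have "sgn (y (\<tau> k) \<omega>) * y (\<tau> (Suc k)) \<omega> - sgn (y (\<tau> k) \<omega>) * y (\<tau> k) \<omega> \<le> \<bar>y (\<tau> (Suc k)) \<omega>\<bar> - \<bar>y (\<tau> k) \<omega>\<bar>"
        by (auto simp: sgn_if)
      from mult_left_mono[OF this R0[of \<omega> k]]
      show "?W \<omega> * y (\<tau> (Suc k)) \<omega> - ?W \<omega> * y (\<tau> k) \<omega> \<le> ?R k \<omega> * \<bar>y (\<tau> (Suc k)) \<omega>\<bar> - ?R k \<omega> * \<bar>y (\<tau> k) \<omega>\<bar>"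
        by (simp add: right_diff_distrib mult.assoc)
    qed (use i prod_int in auto)
    finally show ?thesis by (simp add: right_diff_distrib)
  qed
  have sum_int: "integrable Q (\<lambda>\<omega>. ?R k \<omega> * (\<bar>y (\<tau> (Suc k)) \<omega>\<bar> - \<bar>y (\<tau> k) \<omega>\<bar>))" for k
    unfolding right_diff_distrib by (intro Bochner_Integration.integrable_diff prod_int)
  have "(\<integral>\<omega>. (?R n \<omega>)\<^sup>2 \<partial>Q)
      \<le> (\<integral>\<omega>. 4 * (y (\<tau> n) \<omega>)\<^sup>2 - 4 * (\<Sum>k<n. ?R k \<omega> * (\<bar>y (\<tau> (Suc k)) \<omega>\<bar> - \<bar>y (\<tau> k) \<omega>\<bar>)) \<partial>Q)"
  proof (rule integral_mono)
    show "(?R n \<omega>)\<^sup>2 \<le> 4 * (y (\<tau> n) \<omega>)\<^sup>2 - 4 * (\<Sum>k<n. ?R k \<omega> * (\<bar>y (\<tau> (Suc k)) \<omega>\<bar> - \<bar>y (\<tau> k) \<omega>\<bar>))" for \<omega>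
      using runmax_sq_le[of "\<lambda>k. \<bar>y (\<tau> k) \<omega>\<bar>" n] by simp
  qed (use Rint sq[OF \<tau>0] sum_int in auto)
  also have "\<dots> = 4 * (\<integral>\<omega>. (y (\<tau> n) \<omega>)\<^sup>2 \<partial>Q) - 4 * (\<Sum>k<n. \<integral>\<omega>. ?R k \<omega> * (\<bar>y (\<tau> (Suc k)) \<omega>\<bar> - \<bar>y (\<tau> k) \<omega>\<bar>) \<partial>Q)"
    using sq[OF \<tau>0] sum_int by simp
  also have "\<dots> \<le> 4 * (\<integral>\<omega>. (y (\<tau> n) \<omega>)\<^sup>2 \<partial>Q)"
    using step by (simp add: sum_nonneg)
  finally show ?le .
qed

text \<open>The dyadic grids are nested, since k / 2^n = 2k / 2^(n+1), so the grid maxima increase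
  and monotone convergence carries over the bound, whose right side depends only on the end point
  T.\<close>

lemma doob_sup:
  assumes y: "mart y" and sq: "\<And>t. 0 \<le> t \<Longrightarrow> integrable Q (\<lambda>\<omega>. (y t \<omega>)\<^sup>2)" and T: "0 \<le> T"
  obtains S where "S \<in> borel_measurable Q" "\<And>\<omega>. 0 \<le> S \<omega>" "integrable Q (\<lambda>\<omega>. (S \<omega>)\<^sup>2)"
    "AE \<omega> in Q. \<forall>n k. k \<le> 2 ^ n \<longrightarrow> \<bar>y (real k * T / 2 ^ n) \<omega>\<bar> \<le> S \<omega>"
proof -
  let ?R = "\<lambda>n \<omega>. runmax (\<lambda>k. \<bar>y (real k * T / 2 ^ n) \<omega>\<bar>) (2 ^ n)"
  have gr: "0 \<le> real 0 * T / 2 ^ n" "real k * T / 2 ^ n \<le> real (Suc k) * T / 2 ^ n" for k n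
    using T by (auto intro!: divide_right_mono mult_right_mono)
  have R0: "0 \<le> ?R n \<omega>" for n \<omega>
    using le_runmax[of 0 "2 ^ n" "\<lambda>k. \<bar>y (real k * T / 2 ^ n) \<omega>\<bar>"] by (auto intro: order_trans[OF abs_ge_zero])
  have Rm: "?R n \<in> borel_measurable Q" for n by (rule doob_L2(3)[where \<tau> = "\<lambda>k. real k * T / 2 ^ n", OF y sq gr(1)[of n] gr(2)[of _ n]])
  have mono: "?R n \<omega> \<le> ?R (Suc n) \<omega>" for n \<omega>
  proof (rule runmax_le)
    fix k :: nat assume "k \<le> 2 ^ n"
    then have "2 * k \<le> 2 ^ Suc n" by simp
    from le_runmax[OF this, of "\<lambda>k. \<bar>y (real k * T / 2 ^ Suc n) \<omega>\<bar>"]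
    show "\<bar>y (real k * T / 2 ^ n) \<omega>\<bar> \<le> ?R (Suc n) \<omega>" by simp
  qed
  \<comment> \<open>The supremum is formed in the extended reals, where it always exists; its finite
    integral shows afterwards that it is finite almost surely.\<close>
  define U where "U \<omega> = (SUP n. ennreal ((?R n \<omega>)\<^sup>2))" for \<omega>
  have Um: "U \<in> borel_measurable Q" unfolding U_def[abs_def] using Rm by measurable
  have "(\<integral>\<^sup>+\<omega>. U \<omega> \<partial>Q) = (SUP n. \<integral>\<^sup>+\<omega>. ennreal ((?R n \<omega>)\<^sup>2) \<partial>Q)"
    unfolding U_def
  proof (rule nn_integral_monotone_convergence_SUP)
    show "incseq (\<lambda>n \<omega>. ennreal ((?R n \<omega>)\<^sup>2))"
      using mono R0 by (intro incseq_SucI le_funI ennreal_leI power_mono)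
  qed (use Rm in measurable)
  also have "\<dots> \<le> ennreal (4 * (\<integral>\<omega>. (y T \<omega>)\<^sup>2 \<partial>Q))"
  proof (rule SUP_least)
    fix n
    have "(\<integral>\<^sup>+\<omega>. ennreal ((?R n \<omega>)\<^sup>2) \<partial>Q) = ennreal (\<integral>\<omega>. (?R n \<omega>)\<^sup>2 \<partial>Q)"
      by (rule nn_integral_eq_integral[OF doob_L2(1)[where \<tau> = "\<lambda>k. real k * T / 2 ^ n", OF y sq gr(1)[of n] gr(2)[of _ n]]]) auto
    also have "\<dots> \<le> ennreal (4 * (\<integral>\<omega>. (y T \<omega>)\<^sup>2 \<partial>Q))"
      using doob_L2(2)[where \<tau> = "\<lambda>k. real k * T / 2 ^ n", OF y sq gr(1)[of n] gr(2)[of _ n], of "2 ^ n"] by (intro ennreal_leI) simp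
    finally show "(\<integral>\<^sup>+\<omega>. ennreal ((?R n \<omega>)\<^sup>2) \<partial>Q) \<le> ennreal (4 * (\<integral>\<omega>. (y T \<omega>)\<^sup>2 \<partial>Q))" .
  qed
  finally have Ufin: "(\<integral>\<^sup>+\<omega>. U \<omega> \<partial>Q) < \<infinity>" by (simp add: le_less_trans)
  then have AE_fin: "AE \<omega> in Q. U \<omega> \<noteq> \<infinity>"
    using Um by (intro nn_integral_PInf_AE) auto
  show thesis
  proof (rule that[of "\<lambda>\<omega>. sqrt (enn2real (U \<omega>))"])
    show "(\<lambda>\<omega>. sqrt (enn2real (U \<omega>))) \<in> borel_measurable Q" using Um by measurable
    have "(\<integral>\<^sup>+\<omega>. ennreal (enn2real (U \<omega>)) \<partial>Q) \<le> (\<integral>\<^sup>+\<omega>. U \<omega> \<partial>Q)"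
      by (intro nn_integral_mono) (simp add: ennreal_enn2real_if)
    then have "integrable Q (\<lambda>\<omega>. enn2real (U \<omega>))"
      using Um Ufin by (intro integrableI_nonneg) auto
    then show "integrable Q (\<lambda>\<omega>. (sqrt (enn2real (U \<omega>)))\<^sup>2)" by simp
    show "AE \<omega> in Q. \<forall>n k. k \<le> 2 ^ n \<longrightarrow> \<bar>y (real k * T / 2 ^ n) \<omega>\<bar> \<le> sqrt (enn2real (U \<omega>))"
      using AE_fin
    proof eventually_elim
      case (elim \<omega>)
      show ?case
      proof (intro allI impI)
        fix n k :: nat assume "k \<le> 2 ^ n"
        have "ennreal ((?R n \<omega>)\<^sup>2) \<le> U \<omega>" unfolding U_def by (rule SUP_upper) simp
        then have "(?R n \<omega>)\<^sup>2 \<le> enn2real (U \<omega>)"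
          using elim by (metis enn2real_ennreal enn2real_mono infinity_ennreal_def less_top zero_le_power2)
        then have "?R n \<omega> \<le> sqrt (enn2real (U \<omega>))" by (rule real_le_rsqrt)
        then show "\<bar>y (real k * T / 2 ^ n) \<omega>\<bar> \<le> sqrt (enn2real (U \<omega>))"
          using le_runmax[OF \<open>k \<le> 2 ^ n\<close>, of "\<lambda>k. \<bar>y (real k * T / 2 ^ n) \<omega>\<bar>"] by linarith
      qed
    qed
  qed simp
qed

end

section \<open>Products with continuous martingales\<close>

text \<open>A pathwise version of the fourth-moment bound for quadratic variation: for a bounded
  martingale the last sum is a martingale transform with expectation 0. The induction expands (S +
  q)^2 with q = V'^2 - V^2 - 2 V (V' - V) in the mixed term and q \<le> 4 c^2 in the square.\<close>

lemma sum_sq_increments_sq_le: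
  fixes V :: "nat \<Rightarrow> real"
  assumes V: "\<And>k. \<bar>V k\<bar> \<le> c"
  defines "S \<equiv> \<lambda>n. \<Sum>k<n. (V (Suc k) - V k)\<^sup>2"
  shows "(S n)\<^sup>2 \<le> 2 * (S n * (V n)\<^sup>2) + 4 * c\<^sup>2 * S n - 4 * (\<Sum>k<n. S k * V k * (V (Suc k) - V k))"
proof (induction n)
  case 0
  then show ?case by (simp add: S_def)
next
  case (Suc n)
  define q where "q = (V (Suc n) - V n)\<^sup>2"
  have S: "S (Suc n) = S n + q" by (simp add: S_def q_def)
  have q: "0 \<le> q" "q \<le> 4 * c\<^sup>2"
  proof -
    show "0 \<le> q" by (simp add: q_def)
    have "\<bar>V (Suc n) - V n\<bar> \<le> 2 * c" using V[of n] V[of "Suc n"] by linarith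
    then have "\<bar>V (Suc n) - V n\<bar>\<^sup>2 \<le> (2 * c)\<^sup>2" by (intro power_mono) auto
    then show "q \<le> 4 * c\<^sup>2" by (simp add: q_def power_mult_distrib)
  qed
  have arith: "Z \<le> 2 * W + F' - 4 * (U + X)"
    if "qq \<le> cq" "0 \<le> qV" "Sq = SV' - SV - 2 * X" "Z = S2 + 2 * Sq + qq" "W = SV' + qV" "F' = F + cq"
      "S2 \<le> 2 * SV + F - 4 * U" for Z W F F' U X qq cq qV Sq SV SV' S2 :: real
    using that unfolding distrib_left by linarith
  show ?case
    unfolding sum.lessThan_Suc
  proof (rule arith[OF _ _ _ _ _ _ Suc])
    show "q * q \<le> 4 * c\<^sup>2 * q" using q by (intro mult_right_mono)
    show "0 \<le> q * (V (Suc n))\<^sup>2" using q by simp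
    have "q = (V (Suc n))\<^sup>2 - (V n)\<^sup>2 - 2 * V n * (V (Suc n) - V n)"
      by (simp add: q_def power2_eq_square algebra_simps)
    from arg_cong[OF this, of "\<lambda>z. S n * z"]
    show "S n * q = S n * (V (Suc n))\<^sup>2 - S n * (V n)\<^sup>2 - 2 * (S n * V n * (V (Suc n) - V n))"
      by (rule trans) (simp add: algebra_simps)
    show "(S (Suc n))\<^sup>2 = (S n)\<^sup>2 + 2 * (S n * q) + q * q"
      unfolding S by (simp add: power2_eq_square algebra_simps)
    show "S (Suc n) * (V (Suc n))\<^sup>2 = S n * (V (Suc n))\<^sup>2 + q * (V (Suc n))\<^sup>2"
      unfolding S by (simp add: algebra_simps)
    show "4 * c\<^sup>2 * S (Suc n) = 4 * c\<^sup>2 * S n + 4 * c\<^sup>2 * q"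
      unfolding S by (simp add: algebra_simps)
  qed
qed

lemma abs_mult_le_weighted_squares:
  fixes d v :: real
  assumes "0 < \<alpha>"
  shows "\<bar>d * v\<bar> \<le> \<alpha> * d\<^sup>2 + v\<^sup>2 / \<alpha>"
proof -
  have "0 \<le> (sqrt \<alpha> * \<bar>d\<bar> - \<bar>v\<bar> / sqrt \<alpha>)\<^sup>2" by simp
  also have "\<dots> = \<alpha> * d\<^sup>2 + v\<^sup>2 / \<alpha> - 2 * (\<bar>d\<bar> * \<bar>v\<bar>)"
    unfolding power2_diff using assms by (simp add: power_mult_distrib power_divide)
  finally have "2 * (\<bar>d\<bar> * \<bar>v\<bar>) \<le> \<alpha> * d\<^sup>2 + v\<^sup>2 / \<alpha>" by simp
  moreover have "0 \<le> \<bar>d\<bar> * \<bar>v\<bar>" by simp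
  ultimately show ?thesis unfolding abs_mult by linarith
qed

text \<open>Small d is handled by Young's inequality with weight \<alpha>. For large d, |d| \<le>
  d^2 / \<epsilon> turns |v| \<le> h into a multiple of d^2. On the bad event, where v is not small,
  Young's inequality is used with weight \<kappa>.\<close>

lemma increment_product_le:
  fixes d v :: real
  assumes pos: "0 < \<alpha>" "0 < \<epsilon>" "0 \<le> h" "0 < \<kappa>" and good: "\<not> bad \<Longrightarrow> \<bar>v\<bar> \<le> h"
  shows "\<bar>d * v\<bar> \<le> \<alpha> * (if \<bar>d\<bar> \<le> \<epsilon> then d\<^sup>2 else 0) + v\<^sup>2 / \<alpha> + (h / \<epsilon>) * d\<^sup>2 + \<kappa> * d\<^sup>2 + of_bool bad * v\<^sup>2 / \<kappa>"
proof -
  have nn: "0 \<le> v\<^sup>2 / \<alpha>" "0 \<le> (h / \<epsilon>) * d\<^sup>2" "0 \<le> \<kappa> * d\<^sup>2" "0 \<le> of_bool bad * v\<^sup>2 / \<kappa>"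
    using pos by auto
  consider "\<bar>d\<bar> \<le> \<epsilon>" | "\<epsilon> < \<bar>d\<bar>" "bad" | "\<epsilon> < \<bar>d\<bar>" "\<not> bad" by linarith
  then show ?thesis
  proof cases
    case 1
    then show ?thesis using abs_mult_le_weighted_squares[OF pos(1), of d v] nn by simp
  next
    case 2
    then show ?thesis using abs_mult_le_weighted_squares[OF pos(4), of d v] nn by simp
  next
    case 3
    have "\<bar>d * v\<bar> \<le> \<bar>d\<bar> * h" unfolding abs_mult using good[OF 3(2)] by (intro mult_left_mono) auto
    also have "\<dots> \<le> (\<bar>d\<bar> * (\<bar>d\<bar> / \<epsilon>)) * h"
    proof -
      have "\<bar>d\<bar> * 1 \<le> \<bar>d\<bar> * (\<bar>d\<bar> / \<epsilon>)" using 3 pos by (intro mult_left_mono) auto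
      then show ?thesis using pos by (intro mult_right_mono) auto
    qed
    also have "\<dots> = (h / \<epsilon>) * d\<^sup>2" by (simp add: power2_eq_square)
    finally show ?thesis using nn 3 by simp
  qed
qed

context filtered_prob_space
begin

text \<open>This is how the absence of a continuous martingale part is verified and used.\<close>

definition vanishing_small_increments :: "(real \<Rightarrow> 'w \<Rightarrow> real) \<Rightarrow> bool" where
  "vanishing_small_increments y \<longleftrightarrow> (\<forall>t\<ge>0. \<forall>\<eta>>0. \<exists>\<epsilon>>0. \<forall>\<tau> n. 0 \<le> \<tau> 0 \<longrightarrow> (\<forall>k<n. \<tau> k \<le> \<tau> (Suc k)) \<longrightarrow> \<tau> n \<le> t \<longrightarrow>
    (\<Sum>k<n. \<integral>\<omega>. (if \<bar>y (\<tau> (Suc k)) \<omega> - y (\<tau> k) \<omega>\<bar> \<le> \<epsilon> then (y (\<tau> (Suc k)) \<omega> - y (\<tau> k) \<omega>)\<^sup>2 else 0) \<partial>Q) \<le> \<eta>)"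

lemma integrable_bounded:
  fixes f :: "'w \<Rightarrow> real"
  shows "f \<in> borel_measurable Q \<Longrightarrow> (\<And>\<omega>. \<bar>f \<omega>\<bar> \<le> b) \<Longrightarrow> integrable Q f"
  by (rule integrable_const_bound[where B = b]) auto

text \<open>Increments are orthogonal to the past, so the mean square of an increment is the
  increment of the mean square, and the sum telescopes.\<close>

lemma sum_sq_increments:
  assumes y: "mart y" and sq: "\<And>t. 0 \<le> t \<Longrightarrow> integrable Q (\<lambda>\<omega>. (y t \<omega>)\<^sup>2)"
    and \<tau>: "0 \<le> \<tau> 0" "\<And>k. \<tau> k \<le> \<tau> (Suc k)"
  shows "integrable Q (\<lambda>\<omega>. (y (\<tau> (Suc k)) \<omega> - y (\<tau> k) \<omega>)\<^sup>2)" (is ?int)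
    and "(\<Sum>k<n. \<integral>\<omega>. (y (\<tau> (Suc k)) \<omega> - y (\<tau> k) \<omega>)\<^sup>2 \<partial>Q) = (\<integral>\<omega>. (y (\<tau> n) \<omega>)\<^sup>2 \<partial>Q) - (\<integral>\<omega>. (y (\<tau> 0) \<omega>)\<^sup>2 \<partial>Q)"
proof -
  have \<tau>0: "0 \<le> \<tau> k" for k by (induction k) (use \<tau> in \<open>auto intro: order_trans\<close>)
  have yQ: "y (\<tau> k) \<in> borel_measurable Q" for k
    using mart_integrable[OF y \<tau>0] by (rule borel_measurable_integrable)
  have yy: "integrable Q (\<lambda>\<omega>. y (\<tau> j) \<omega> * y (\<tau> k) \<omega>)" for j k
    by (intro integrable_mult_of_squares yQ sq \<tau>0)
  have eq: "(y (\<tau> (Suc k)) \<omega> - y (\<tau> k) \<omega>)\<^sup>2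
      = y (\<tau> (Suc k)) \<omega> * y (\<tau> (Suc k)) \<omega> - 2 * (y (\<tau> k) \<omega> * y (\<tau> (Suc k)) \<omega>) + y (\<tau> k) \<omega> * y (\<tau> k) \<omega>" for k \<omega>
    by (simp add: power2_eq_square algebra_simps)
  show ?int unfolding eq
    by (intro Bochner_Integration.integrable_add Bochner_Integration.integrable_diff integrable_mult_right yy)
  have one: "(\<integral>\<omega>. (y (\<tau> (Suc k)) \<omega> - y (\<tau> k) \<omega>)\<^sup>2 \<partial>Q) = (\<integral>\<omega>. (y (\<tau> (Suc k)) \<omega>)\<^sup>2 \<partial>Q) - (\<integral>\<omega>. (y (\<tau> k) \<omega>)\<^sup>2 \<partial>Q)" for k
    unfolding eq using yy mart_weighted[OF y \<tau>0 \<tau>(2) mart_measurable[OF y \<tau>0] yy, of k]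
    by (simp add: power2_eq_square)
  show "(\<Sum>k<n. \<integral>\<omega>. (y (\<tau> (Suc k)) \<omega> - y (\<tau> k) \<omega>)\<^sup>2 \<partial>Q) = (\<integral>\<omega>. (y (\<tau> n) \<omega>)\<^sup>2 \<partial>Q) - (\<integral>\<omega>. (y (\<tau> 0) \<omega>)\<^sup>2 \<partial>Q)"
    unfolding one by (rule sum_lessThan_telescope)
qed

text \<open>On an event of small probability the squared increments of V cannot be controlled by
  their mean alone; a second moment of their sum, uniform over partitions, is needed. The constant
  is (2 + 4) c^2 from the pathwise bound times the mean bound c^2.\<close>

lemma sum_sq_increments_fourth_moment:
  assumes V: "mart V" and c: "\<And>t \<omega>. 0 \<le> t \<Longrightarrow> \<bar>V t \<omega>\<bar> \<le> c"
    and \<tau>: "0 \<le> \<tau> 0" "\<And>k. \<tau> k \<le> \<tau> (Suc k)"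
  shows "integrable Q (\<lambda>\<omega>. (\<Sum>k<n. (V (\<tau> (Suc k)) \<omega> - V (\<tau> k) \<omega>)\<^sup>2)\<^sup>2)" (is ?int)
    and "(\<integral>\<omega>. (\<Sum>k<n. (V (\<tau> (Suc k)) \<omega> - V (\<tau> k) \<omega>)\<^sup>2)\<^sup>2 \<partial>Q) \<le> 6 * c ^ 4"
    and "(\<integral>\<omega>. (\<Sum>k<n. (V (\<tau> (Suc k)) \<omega> - V (\<tau> k) \<omega>)\<^sup>2) \<partial>Q) \<le> c\<^sup>2" (is ?two)
proof -
  let ?S = "\<lambda>n \<omega>. \<Sum>k<n. (V (\<tau> (Suc k)) \<omega> - V (\<tau> k) \<omega>)\<^sup>2"
  have \<tau>0: "0 \<le> \<tau> k" for k by (induction k) (use \<tau> in \<open>auto intro: order_trans\<close>)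
  have VQ: "V t \<in> borel_measurable Q" if "0 \<le> t" for t
    using mart_integrable[OF V that] by (rule borel_measurable_integrable)
  have Vsq: "(V t \<omega>)\<^sup>2 \<le> c\<^sup>2" if "0 \<le> t" for t \<omega>
    using power_mono[OF c[OF that, of \<omega>] abs_ge_zero, of 2] by simp
  have Vsq_int: "integrable Q (\<lambda>\<omega>. (V t \<omega>)\<^sup>2)" if "0 \<le> t" for t
    using Vsq[OF that] VQ[OF that] by (intro integrable_bounded[where b = "c\<^sup>2"]) auto
  have c0: "0 \<le> c" using c[of 0 undefined] by linarith
  have SG: "?S n \<in> borel_measurable (G (\<tau> n))" for n
  proof (induction n)
    case (Suc n)
    have "V (\<tau> n) \<in> borel_measurable (G (\<tau> (Suc n)))" "V (\<tau> (Suc n)) \<in> borel_measurable (G (\<tau> (Suc n)))"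
      using measurable_G_mono[OF \<tau>0 \<tau>(2) mart_measurable[OF V \<tau>0]] mart_measurable[OF V \<tau>0] by auto
    then show ?case
      using measurable_G_mono[OF \<tau>0 \<tau>(2) Suc] unfolding sum.lessThan_Suc by simp
  qed simp
  have SQ: "?S n \<in> borel_measurable Q" for n by (rule measurable_G[OF \<tau>0 SG])
  have inc: "(V (\<tau> (Suc k)) \<omega> - V (\<tau> k) \<omega>)\<^sup>2 \<le> (2 * c)\<^sup>2" for k \<omega>
  proof -
    have "\<bar>V (\<tau> (Suc k)) \<omega> - V (\<tau> k) \<omega>\<bar> \<le> 2 * c" using c[OF \<tau>0, of k \<omega>] c[OF \<tau>0, of "Suc k" \<omega>] by linarith
    from power_mono[OF this abs_ge_zero, of 2] show ?thesis by simp
  qed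
  have Sb: "0 \<le> ?S n \<omega>" "?S n \<omega> \<le> real n * (2 * c)\<^sup>2" for n \<omega>
    using sum_mono[of "{..<n}", OF inc] by (auto intro: sum_nonneg)
  have Sabs: "\<bar>?S n \<omega>\<bar> \<le> real n * (2 * c)\<^sup>2" for n \<omega> using Sb[of \<omega> n] by simp
  have Sint: "integrable Q (?S n)" for n by (rule integrable_bounded[OF SQ Sabs])
  show ?int
    using SQ power_mono[OF Sabs abs_ge_zero, of _ _ 2] by (intro integrable_bounded[where b = "(real n * (2 * c)\<^sup>2)\<^sup>2"]) auto
  have two: "(\<integral>\<omega>. ?S n \<omega> \<partial>Q) \<le> c\<^sup>2"
  proof -
    have "(\<integral>\<omega>. ?S n \<omega> \<partial>Q) = (\<integral>\<omega>. (V (\<tau> n) \<omega>)\<^sup>2 \<partial>Q) - (\<integral>\<omega>. (V (\<tau> 0) \<omega>)\<^sup>2 \<partial>Q)"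
      using sum_sq_increments[OF V Vsq_int \<tau>] by (simp add: Bochner_Integration.integral_sum)
    moreover have "(\<integral>\<omega>. (V (\<tau> n) \<omega>)\<^sup>2 \<partial>Q) \<le> (\<integral>\<omega>. c\<^sup>2 \<partial>Q)"
      by (intro integral_mono Vsq_int Vsq \<tau>0) auto
    moreover have "(\<integral>\<omega>. c\<^sup>2 \<partial>Q) = c\<^sup>2" by (simp add: prob_space)
    moreover have "0 \<le> (\<integral>\<omega>. (V (\<tau> 0) \<omega>)\<^sup>2 \<partial>Q)" by simp
    ultimately show ?thesis by linarith
  qed
  then show ?two .
  have WG: "(\<lambda>\<omega>. ?S k \<omega> * V (\<tau> k) \<omega>) \<in> borel_measurable (G (\<tau> k))" for k
    using SG[of k] mart_measurable[OF V \<tau>0[of k]] by (intro borel_measurable_times)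
  have WVb: "\<bar>?S k \<omega> * V (\<tau> k) \<omega> * V (\<tau> j) \<omega>\<bar> \<le> real k * (2 * c)\<^sup>2 * c * c" for k j \<omega>
    unfolding abs_mult using Sabs[of \<omega> k] c[OF \<tau>0, of k \<omega>] c[OF \<tau>0, of j \<omega>] c0
    by (intro mult_mono) auto
  have WVint: "integrable Q (\<lambda>\<omega>. ?S k \<omega> * V (\<tau> k) \<omega> * V (\<tau> j) \<omega>)" for k j
    by (rule integrable_bounded[OF _ WVb]) (intro borel_measurable_times measurable_G[OF \<tau>0 SG] VQ \<tau>0)
  have zero: "(\<integral>\<omega>. ?S k \<omega> * V (\<tau> k) \<omega> * (V (\<tau> (Suc k)) \<omega> - V (\<tau> k) \<omega>) \<partial>Q) = 0" for k
    using mart_weighted[OF V \<tau>0 \<tau>(2) WG WVint] WVint by (simp add: right_diff_distrib)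
  have zint: "integrable Q (\<lambda>\<omega>. ?S k \<omega> * V (\<tau> k) \<omega> * (V (\<tau> (Suc k)) \<omega> - V (\<tau> k) \<omega>))" for k
    unfolding right_diff_distrib by (intro Bochner_Integration.integrable_diff WVint)
  have "(\<integral>\<omega>. (?S n \<omega>)\<^sup>2 \<partial>Q)
      \<le> (\<integral>\<omega>. 6 * c\<^sup>2 * ?S n \<omega> - 4 * (\<Sum>k<n. ?S k \<omega> * V (\<tau> k) \<omega> * (V (\<tau> (Suc k)) \<omega> - V (\<tau> k) \<omega>)) \<partial>Q)"
  proof (rule integral_mono)
    fix \<omega>
    have "(?S n \<omega>)\<^sup>2 \<le> 2 * (?S n \<omega> * (V (\<tau> n) \<omega>)\<^sup>2) + 4 * c\<^sup>2 * ?S n \<omega>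
        - 4 * (\<Sum>k<n. ?S k \<omega> * V (\<tau> k) \<omega> * (V (\<tau> (Suc k)) \<omega> - V (\<tau> k) \<omega>))"
      by (rule sum_sq_increments_sq_le) (intro c \<tau>0)
    moreover have "?S n \<omega> * (V (\<tau> n) \<omega>)\<^sup>2 \<le> ?S n \<omega> * c\<^sup>2"
      by (intro mult_left_mono Vsq \<tau>0 Sb)
    ultimately show "(?S n \<omega>)\<^sup>2 \<le> 6 * c\<^sup>2 * ?S n \<omega> - 4 * (\<Sum>k<n. ?S k \<omega> * V (\<tau> k) \<omega> * (V (\<tau> (Suc k)) \<omega> - V (\<tau> k) \<omega>))"
      by (simp add: mult.commute)
  qed (use \<open>?int\<close> Sint zint in auto)
  also have "\<dots> = 6 * c\<^sup>2 * (\<integral>\<omega>. ?S n \<omega> \<partial>Q)"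
    using Sint zint zero by simp
  also have "\<dots> \<le> 6 * c\<^sup>2 * c\<^sup>2" using two by (intro mult_left_mono) auto
  also have "\<dots> = 6 * c ^ 4" by (simp add: power_add[symmetric] power2_eq_square power4_eq_xxxx)
  finally show "(\<integral>\<omega>. (?S n \<omega>)\<^sup>2 \<partial>Q) \<le> 6 * c ^ 4" .
qed

text \<open>The mixed products, with one factor at each end of a step, have the same integral over A
  as the product at the left end, by the martingale property of the other factor. So only the
  product of the two increments remains.\<close>

lemma product_increments:
  assumes y: "mart y" and sq: "\<And>t. 0 \<le> t \<Longrightarrow> integrable Q (\<lambda>\<omega>. (y t \<omega>)\<^sup>2)"
    and V: "mart V" and c: "\<And>t \<omega>. 0 \<le> t \<Longrightarrow> \<bar>V t \<omega>\<bar> \<le> c"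
    and \<tau>: "0 \<le> \<tau> 0" "\<And>k. \<tau> k \<le> \<tau> (Suc k)" and A: "A \<in> sets (G (\<tau> 0))"
  shows "(\<integral>\<omega>. indicator A \<omega> * (y (\<tau> n) \<omega> * V (\<tau> n) \<omega>) \<partial>Q) - (\<integral>\<omega>. indicator A \<omega> * (y (\<tau> 0) \<omega> * V (\<tau> 0) \<omega>) \<partial>Q)
    = (\<Sum>k<n. \<integral>\<omega>. indicator A \<omega> * ((y (\<tau> (Suc k)) \<omega> - y (\<tau> k) \<omega>) * (V (\<tau> (Suc k)) \<omega> - V (\<tau> k) \<omega>)) \<partial>Q)"
proof -
  have \<tau>0: "0 \<le> \<tau> k" for k by (induction k) (use \<tau> in \<open>auto intro: order_trans\<close>)
  have \<tau>mono: "\<tau> 0 \<le> \<tau> k" for k by (induction k) (use \<tau> in \<open>auto intro: order_trans\<close>)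
  have Ak: "A \<in> sets (G (\<tau> k))" for k using A G_mono[OF \<tau>(1) \<tau>mono[of k]] by blast
  have AQ: "A \<in> sets Q" using A \<tau>(1) by (auto intro: sets_G)
  have VQ: "V (\<tau> k) \<in> borel_measurable Q" for k
    using mart_integrable[OF V \<tau>0] by (rule borel_measurable_integrable)
  have yQ: "y (\<tau> k) \<in> borel_measurable Q" for k
    using mart_integrable[OF y \<tau>0] by (rule borel_measurable_integrable)
  have Vsq_int: "integrable Q (\<lambda>\<omega>. (V (\<tau> k) \<omega>)\<^sup>2)" for k
    using power_mono[OF c[OF \<tau>0] abs_ge_zero, of k _ 2] VQ[of k] by (intro integrable_bounded[where b = "c\<^sup>2"]) auto
  have yV: "integrable Q (\<lambda>\<omega>. y (\<tau> j) \<omega> * V (\<tau> k) \<omega>)" for j k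
    by (intro integrable_mult_of_squares yQ VQ sq Vsq_int \<tau>0)
  have iyV: "integrable Q (\<lambda>\<omega>. indicator A \<omega> * (y (\<tau> j) \<omega> * V (\<tau> k) \<omega>))" for j k
    using integrable_mult_indicator[OF AQ yV[of j k]] by simp
  have 1: "(\<integral>\<omega>. indicator A \<omega> * (y (\<tau> k) \<omega> * V (\<tau> (Suc k)) \<omega>) \<partial>Q) = (\<integral>\<omega>. indicator A \<omega> * (y (\<tau> k) \<omega> * V (\<tau> k) \<omega>) \<partial>Q)" for k
  proof -
    have "(\<lambda>\<omega>. indicator A \<omega> * y (\<tau> k) \<omega>) \<in> borel_measurable (G (\<tau> k))"
      using Ak mart_measurable[OF y \<tau>0] by (intro borel_measurable_times borel_measurable_indicator) auto
    from mart_weighted[OF V \<tau>0 \<tau>(2) this] show ?thesis using iyV[of k "Suc k"] by (simp add: mult.assoc)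
  qed
  have 2: "(\<integral>\<omega>. indicator A \<omega> * (y (\<tau> (Suc k)) \<omega> * V (\<tau> k) \<omega>) \<partial>Q) = (\<integral>\<omega>. indicator A \<omega> * (y (\<tau> k) \<omega> * V (\<tau> k) \<omega>) \<partial>Q)" for k
  proof -
    have "(\<lambda>\<omega>. indicator A \<omega> * V (\<tau> k) \<omega>) \<in> borel_measurable (G (\<tau> k))"
      using Ak mart_measurable[OF V \<tau>0] by (intro borel_measurable_times borel_measurable_indicator) auto
    from mart_weighted[OF y \<tau>0 \<tau>(2) this] show ?thesis using iyV[of "Suc k" k]
      by (simp add: mult.assoc mult.commute[of "V _ _"])
  qed
  have "(\<integral>\<omega>. indicator A \<omega> * ((y (\<tau> (Suc k)) \<omega> - y (\<tau> k) \<omega>) * (V (\<tau> (Suc k)) \<omega> - V (\<tau> k) \<omega>)) \<partial>Q)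
     = (\<integral>\<omega>. indicator A \<omega> * (y (\<tau> (Suc k)) \<omega> * V (\<tau> (Suc k)) \<omega>) \<partial>Q) - (\<integral>\<omega>. indicator A \<omega> * (y (\<tau> k) \<omega> * V (\<tau> k) \<omega>) \<partial>Q)" for k
  proof -
    have "(\<integral>\<omega>. indicator A \<omega> * ((y (\<tau> (Suc k)) \<omega> - y (\<tau> k) \<omega>) * (V (\<tau> (Suc k)) \<omega> - V (\<tau> k) \<omega>)) \<partial>Q)
      = (\<integral>\<omega>. (indicator A \<omega> * (y (\<tau> (Suc k)) \<omega> * V (\<tau> (Suc k)) \<omega>) - indicator A \<omega> * (y (\<tau> (Suc k)) \<omega> * V (\<tau> k) \<omega>))
          - (indicator A \<omega> * (y (\<tau> k) \<omega> * V (\<tau> (Suc k)) \<omega>) - indicator A \<omega> * (y (\<tau> k) \<omega> * V (\<tau> k) \<omega>)) \<partial>Q)"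
      by (simp add: algebra_simps)
    then show ?thesis using iyV 1 2 by simp
  qed
  then show ?thesis
    by (simp only: sum_lessThan_telescope[where f = "\<lambda>k. \<integral>\<omega>. indicator A \<omega> * (y (\<tau> k) \<omega> * V (\<tau> k) \<omega>) \<partial>Q"])
qed

text \<open>The difference \<open>E\<close> does not depend on a partition, but it equals the sum of
  expected products of increments over any of them. The order of choices is essential: \<epsilon>
  from the small increments, which is valid for all partitions, then the oscillation h allowed for
  V, and last a grid so fine that V exceeds h only with small probability.\<close>

lemma bounded_continuous_product:
  assumes y: "mart y" and sq: "\<And>t. 0 \<le> t \<Longrightarrow> integrable Q (\<lambda>\<omega>. (y t \<omega>)\<^sup>2)" and small: "vanishing_small_increments y"
    and V: "mart V" and c: "\<And>t \<omega>. 0 \<le> t \<Longrightarrow> \<bar>V t \<omega>\<bar> \<le> c" and cont: "AE \<omega> in Q. continuous_on {0..} (\<lambda>t. V t \<omega>)"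
    and st: "0 \<le> s" "s \<le> t" and A: "A \<in> sets (G s)"
  shows "(\<integral>\<omega>. indicator A \<omega> * (y t \<omega> * V t \<omega>) \<partial>Q) = (\<integral>\<omega>. indicator A \<omega> * (y s \<omega> * V s \<omega>) \<partial>Q)"
proof -
  have t0: "0 \<le> t" using st by simp
  define E where "E = (\<integral>\<omega>. indicator A \<omega> * (y t \<omega> * V t \<omega>) \<partial>Q) - (\<integral>\<omega>. indicator A \<omega> * (y s \<omega> * V s \<omega>) \<partial>Q)"
  define Y2 where "Y2 = (\<integral>\<omega>. (y t \<omega>)\<^sup>2 \<partial>Q)"
  have Y2: "0 \<le> Y2" by (simp add: Y2_def)
  have c0: "0 \<le> c" using c[of 0 undefined] by linarith
  have AQ: "A \<in> sets Q" using A st by (auto intro: sets_G)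
  have "\<bar>E\<bar> \<le> 6 * \<delta>" if \<delta>: "0 < \<delta>" for \<delta>
  proof -
    \<comment> \<open>The quadratic variation of V has mean at most c^2, so this weight makes its
      contribution at most \<delta>. The small increments of y carry the factor \<alpha> and are
      therefore requested up to \<delta> / \<alpha>.\<close>
    define \<alpha> where "\<alpha> = (c\<^sup>2 + 1) / \<delta>"
    have \<alpha>: "0 < \<alpha>" "c\<^sup>2 / \<alpha> \<le> \<delta>"
    proof -
      have "0 < c\<^sup>2 + 1" by (simp add: add_nonneg_pos)
      then show "0 < \<alpha>" using \<delta> by (simp add: \<alpha>_def)
      then show "c\<^sup>2 / \<alpha> \<le> \<delta>" using \<delta> by (simp add: pos_divide_le_eq) (simp add: \<alpha>_def)
    qed
    have "0 < \<delta> / \<alpha>" using \<delta> \<alpha> by simp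
    with small t0 have "\<exists>\<epsilon>>0. \<forall>\<tau> n. 0 \<le> \<tau> 0 \<longrightarrow> (\<forall>k<n. \<tau> k \<le> \<tau> (Suc k)) \<longrightarrow> \<tau> n \<le> t \<longrightarrow>
      (\<Sum>k<n. \<integral>\<omega>. (if \<bar>y (\<tau> (Suc k)) \<omega> - y (\<tau> k) \<omega>\<bar> \<le> \<epsilon> then (y (\<tau> (Suc k)) \<omega> - y (\<tau> k) \<omega>)\<^sup>2 else 0) \<partial>Q) \<le> \<delta> / \<alpha>"
      unfolding vanishing_small_increments_def by simp
    then obtain \<epsilon> where \<epsilon>: "\<epsilon> > 0" and sm: "\<forall>\<tau> n. 0 \<le> \<tau> 0 \<longrightarrow> (\<forall>k<n. \<tau> k \<le> \<tau> (Suc k)) \<longrightarrow> \<tau> n \<le> t \<longrightarrow>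
      (\<Sum>k<n. \<integral>\<omega>. (if \<bar>y (\<tau> (Suc k)) \<omega> - y (\<tau> k) \<omega>\<bar> \<le> \<epsilon> then (y (\<tau> (Suc k)) \<omega> - y (\<tau> k) \<omega>)\<^sup>2 else 0) \<partial>Q) \<le> \<delta> / \<alpha>"
      by (elim exE conjE) (rule that)
    \<comment> \<open>Chosen so that h / \<epsilon> = \<kappa>: the terms from large increments and
      from the bad event both become \<kappa> times the squared increments of y, whose expected sum
      is at most \<open>Y2\<close>.\<close>
    define h where "h = \<epsilon> * (\<delta> / (Y2 + 1))"
    define \<kappa> where "\<kappa> = \<delta> / (Y2 + 1)"
    have \<kappa>: "0 < \<kappa>" using \<delta> Y2 by (simp add: \<kappa>_def)
    have \<kappa>Y: "\<kappa> * Y2 \<le> \<delta>" using \<delta> Y2 by (simp add: \<kappa>_def pos_divide_le_eq)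
    have h: "0 < h" "h / \<epsilon> = \<kappa>" using \<epsilon> \<kappa> by (simp_all add: h_def \<kappa>_def[symmetric])
    \<comment> \<open>Weight for 1_B S \<le> \<mu> S^2 + 1_B / \<mu> on the bad event B, where S is
      the sum of squared increments of V and has second moment at most 6 c^4. The target is \<delta>
      \<kappa> because this term is divided by \<kappa>.\<close>
    define \<mu> where "\<mu> = \<delta> * \<kappa> / (6 * c ^ 4 + 1)"
    have c4: "0 < 6 * c ^ 4 + 1" by (simp add: add_nonneg_pos)
    have \<mu>: "0 < \<mu>" using \<delta> \<kappa> c4 by (simp add: \<mu>_def)
    have \<mu>c: "\<mu> * (6 * c ^ 4) \<le> \<delta> * \<kappa>"
    proof -
      have "\<mu> * (6 * c ^ 4) \<le> \<mu> * (6 * c ^ 4 + 1)" using \<mu> by (intro mult_left_mono) auto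
      also have "\<dots> = \<delta> * \<kappa>" using c4 by (simp add: \<mu>_def)
      finally show ?thesis .
    qed
    define \<tau> where "\<tau> n k = s + real k * ((t - s) / real (Suc n))" for n k
    have \<tau>0: "\<tau> n 0 = s" "0 \<le> \<tau> n 0" for n using st by (auto simp: \<tau>_def)
    have \<tau>mono: "\<tau> n k \<le> \<tau> n (Suc k)" for n k
      unfolding \<tau>_def using st by (intro add_left_mono mult_right_mono divide_nonneg_nonneg) auto
    have \<tau>n: "\<tau> n (Suc n) = t" for n by (simp add: \<tau>_def)
    have \<tau>pos: "0 \<le> \<tau> n k" "s \<le> \<tau> n k" for n k using st by (auto simp: \<tau>_def)
    have \<tau>le: "\<tau> n k \<le> t" if "k \<le> Suc n" for n k
    proof -
      have "real k * ((t - s) / real (Suc n)) \<le> real (Suc n) * ((t - s) / real (Suc n))"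
        using that st by (intro mult_right_mono) auto
      then show ?thesis by (simp add: \<tau>_def)
    qed
    have [measurable]: "V (\<tau> n k) \<in> borel_measurable Q" "y (\<tau> n k) \<in> borel_measurable Q" for n k
      using mart_integrable[OF V \<tau>pos(1)] mart_integrable[OF y \<tau>pos(1)] by (auto intro: borel_measurable_integrable)
    \<comment> \<open>The bad event of the n-th grid: some increment of V exceeds h. Uniform
      continuity of the path on [s, t] removes almost every sample point from it for large
      n.\<close>
    define B where "B n = {\<omega> \<in> space Q. \<exists>k\<in>{..n}. h < \<bar>V (\<tau> n (Suc k)) \<omega> - V (\<tau> n k) \<omega>\<bar>}" for n
    have B_sets: "B n \<in> sets Q" for n unfolding B_def by measurable
    have "(\<lambda>n. \<integral>\<omega>. (indicator (B n) \<omega> :: real) \<partial>Q) \<longlonglongrightarrow> (\<integral>\<omega>. 0 \<partial>Q)"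
    proof (rule integral_dominated_convergence[where w = "\<lambda>_. 1"])
      show "AE \<omega> in Q. (\<lambda>n. indicator (B n) \<omega> :: real) \<longlonglongrightarrow> 0"
        using cont
      proof eventually_elim
        case (elim \<omega>)
        have "continuous_on {s..t} (\<lambda>t. V t \<omega>)" using elim st by (auto intro: continuous_on_subset)
        then have "uniformly_continuous_on {s..t} (\<lambda>t. V t \<omega>)" by (rule compact_uniformly_continuous) simp
        then obtain d where d: "d > 0" "\<And>a b. a \<in> {s..t} \<Longrightarrow> b \<in> {s..t} \<Longrightarrow> \<bar>b - a\<bar> < d \<Longrightarrow> \<bar>V b \<omega> - V a \<omega>\<bar> < h"
          using h(1) unfolding uniformly_continuous_on_def dist_real_def by meson
        have "(\<lambda>n. (t - s) * inverse (real (Suc n))) \<longlonglongrightarrow> (t - s) * 0"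
          by (intro tendsto_intros LIMSEQ_inverse_real_of_nat)
        then have "\<forall>\<^sub>F n in sequentially. (t - s) * inverse (real (Suc n)) < d"
          using d(1) by (intro order_tendstoD(2)) auto
        then have "\<forall>\<^sub>F n in sequentially. indicator (B n) \<omega> = (0::real)"
        proof eventually_elim
          case (elim n)
          have "\<bar>V (\<tau> n (Suc k)) \<omega> - V (\<tau> n k) \<omega>\<bar> < h" if "k \<le> n" for k
          proof (rule d(2))
            show "\<tau> n k \<in> {s..t}" "\<tau> n (Suc k) \<in> {s..t}" using that \<tau>pos \<tau>le by auto
            have "\<tau> n (Suc k) - \<tau> n k = (t - s) * inverse (real (Suc n))"
              unfolding \<tau>_def by (simp add: divide_inverse distrib_right)
            then show "\<bar>\<tau> n (Suc k) - \<tau> n k\<bar> < d" using elim st by simp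
          qed
          then have "\<omega> \<notin> B n" unfolding B_def by (auto simp: not_less intro: less_imp_le)
          then show ?case by simp
        qed
        then show ?case by (rule tendsto_eventually)
      qed
    qed (use B_sets in auto)
    \<comment> \<open>The factor \<mu> compensates the division by \<mu> in the term 1_B /
      \<mu>.\<close>
    then have "\<forall>\<^sub>F n in sequentially. measure Q (B n) < \<delta> * \<kappa> * \<mu>"
      using \<delta> \<kappa> \<mu> B_sets by (intro order_tendstoD(2)) auto
    then obtain n where PB: "measure Q (B n) < \<delta> * \<kappa> * \<mu>" by (auto simp: eventually_sequentially)
    let ?d = "\<lambda>k \<omega>. y (\<tau> n (Suc k)) \<omega> - y (\<tau> n k) \<omega>" and ?v = "\<lambda>k \<omega>. V (\<tau> n (Suc k)) \<omega> - V (\<tau> n k) \<omega>"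
    let ?m = "Suc n"
    let ?S = "\<lambda>\<omega>. \<Sum>k<?m. (?v k \<omega>)\<^sup>2"
    have Vsq_int: "integrable Q (\<lambda>\<omega>. (V r \<omega>)\<^sup>2)" if "0 \<le> r" for r
      using power_mono[OF c[OF that] abs_ge_zero, of _ 2] borel_measurable_integrable[OF mart_integrable[OF V that]]
      by (intro integrable_bounded[where b = "c\<^sup>2"]) auto
    have dint: "integrable Q (\<lambda>\<omega>. (?d k \<omega>)\<^sup>2)" and vint: "integrable Q (\<lambda>\<omega>. (?v k \<omega>)\<^sup>2)" for k
      by (rule sum_sq_increments(1)[of y "\<tau> n"]; use y sq \<tau>0 \<tau>mono in simp)
        (rule sum_sq_increments(1)[of V "\<tau> n"]; use V Vsq_int \<tau>0 \<tau>mono in simp)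
    have sint: "integrable Q (\<lambda>\<omega>. if \<bar>?d k \<omega>\<bar> \<le> \<epsilon> then (?d k \<omega>)\<^sup>2 else 0)" for k
      by (rule Bochner_Integration.integrable_bound[OF dint]) auto
    have dvint: "integrable Q (\<lambda>\<omega>. ?d k \<omega> * ?v k \<omega>)" for k
      by (rule integrable_mult_of_squares[OF _ _ dint vint]) measurable
    have bvint: "integrable Q (\<lambda>\<omega>. indicator (B n) \<omega> * (?v k \<omega>)\<^sup>2)" for k
      using integrable_mult_indicator[OF B_sets vint] by simp
    have S2: "integrable Q (\<lambda>\<omega>. (?S \<omega>)\<^sup>2)" "(\<integral>\<omega>. (?S \<omega>)\<^sup>2 \<partial>Q) \<le> 6 * c ^ 4" "(\<integral>\<omega>. ?S \<omega> \<partial>Q) \<le> c\<^sup>2"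
      using sum_sq_increments_fourth_moment[of V c "\<tau> n", OF V c \<tau>0(2) \<tau>mono] by (simp_all del: sum.lessThan_Suc)
    have "E = (\<Sum>k<?m. \<integral>\<omega>. indicator A \<omega> * (?d k \<omega> * ?v k \<omega>) \<partial>Q)"
    proof -
      have "A \<in> sets (G (\<tau> n 0))" using A \<tau>0 by simp
      from product_increments[of y V c "\<tau> n", OF y sq V c \<tau>0(2) \<tau>mono this, of ?m]
      show ?thesis unfolding E_def \<tau>0 \<tau>n by (simp del: sum.lessThan_Suc)
    qed
    also have "\<bar>\<dots>\<bar> \<le> (\<Sum>k<?m. \<integral>\<omega>. \<bar>?d k \<omega> * ?v k \<omega>\<bar> \<partial>Q)"
    proof (rule order_trans[OF sum_abs sum_mono])
      fix k
      have "\<bar>\<integral>\<omega>. indicator A \<omega> * (?d k \<omega> * ?v k \<omega>) \<partial>Q\<bar> \<le> (\<integral>\<omega>. \<bar>indicator A \<omega> * (?d k \<omega> * ?v k \<omega>)\<bar> \<partial>Q)"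
        by (rule integral_abs_bound)
      also have "\<dots> \<le> (\<integral>\<omega>. \<bar>?d k \<omega> * ?v k \<omega>\<bar> \<partial>Q)"
        by (rule integral_mono_AE') (use dvint in \<open>auto simp: indicator_def\<close>)
      finally show "\<bar>\<integral>\<omega>. indicator A \<omega> * (?d k \<omega> * ?v k \<omega>) \<partial>Q\<bar> \<le> (\<integral>\<omega>. \<bar>?d k \<omega> * ?v k \<omega>\<bar> \<partial>Q)" .
    qed
    also have "\<dots> \<le> (\<Sum>k<?m. \<integral>\<omega>. \<alpha> * (if \<bar>?d k \<omega>\<bar> \<le> \<epsilon> then (?d k \<omega>)\<^sup>2 else 0) + (?v k \<omega>)\<^sup>2 / \<alpha>
        + \<kappa> * (?d k \<omega>)\<^sup>2 + \<kappa> * (?d k \<omega>)\<^sup>2 + indicator (B n) \<omega> * (?v k \<omega>)\<^sup>2 / \<kappa> \<partial>Q)"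
    proof (rule sum_mono, rule integral_mono_AE)
      fix k assume k: "k \<in> {..<?m}"
      show "AE \<omega> in Q. \<bar>?d k \<omega> * ?v k \<omega>\<bar> \<le> \<alpha> * (if \<bar>?d k \<omega>\<bar> \<le> \<epsilon> then (?d k \<omega>)\<^sup>2 else 0) + (?v k \<omega>)\<^sup>2 / \<alpha>
        + \<kappa> * (?d k \<omega>)\<^sup>2 + \<kappa> * (?d k \<omega>)\<^sup>2 + indicator (B n) \<omega> * (?v k \<omega>)\<^sup>2 / \<kappa>"
      proof (rule AE_I2)
        fix \<omega> assume \<omega>: "\<omega> \<in> space Q"
        have "\<omega> \<notin> B n \<Longrightarrow> \<bar>?v k \<omega>\<bar> \<le> h"
        proof (rule ccontr)
          assume "\<omega> \<notin> B n" "\<not> \<bar>?v k \<omega>\<bar> \<le> h"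
          moreover have "k \<in> {..n}" using k by auto
          ultimately show False using \<omega> unfolding B_def not_le by blast
        qed
        from increment_product_le[where bad = "\<omega> \<in> B n" and d = "?d k \<omega>", OF \<alpha>(1) \<epsilon> less_imp_le[OF h(1)] \<kappa> this]
        show "\<bar>?d k \<omega> * ?v k \<omega>\<bar> \<le> \<alpha> * (if \<bar>?d k \<omega>\<bar> \<le> \<epsilon> then (?d k \<omega>)\<^sup>2 else 0) + (?v k \<omega>)\<^sup>2 / \<alpha>
        + \<kappa> * (?d k \<omega>)\<^sup>2 + \<kappa> * (?d k \<omega>)\<^sup>2 + indicator (B n) \<omega> * (?v k \<omega>)\<^sup>2 / \<kappa>"
          unfolding h(2) indicator_def by simp
      qed
    qed (use dvint sint dint vint bvint in \<open>auto simp del: power2_diff\<close>)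
    also have "\<dots> = \<alpha> * (\<Sum>k<?m. \<integral>\<omega>. (if \<bar>?d k \<omega>\<bar> \<le> \<epsilon> then (?d k \<omega>)\<^sup>2 else 0) \<partial>Q) + (\<integral>\<omega>. ?S \<omega> \<partial>Q) / \<alpha>
        + 2 * (\<kappa> * (\<Sum>k<?m. \<integral>\<omega>. (?d k \<omega>)\<^sup>2 \<partial>Q)) + (\<integral>\<omega>. indicator (B n) \<omega> * ?S \<omega> \<partial>Q) / \<kappa>"
    proof -
      have e1: "(\<integral>\<omega>. ?S \<omega> \<partial>Q) = (\<Sum>k<?m. \<integral>\<omega>. (?v k \<omega>)\<^sup>2 \<partial>Q)"
        by (rule Bochner_Integration.integral_sum[OF vint])
      have e2: "(\<integral>\<omega>. indicator (B n) \<omega> * ?S \<omega> \<partial>Q) = (\<Sum>k<?m. \<integral>\<omega>. indicator (B n) \<omega> * (?v k \<omega>)\<^sup>2 \<partial>Q)"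
        unfolding sum_distrib_left by (rule Bochner_Integration.integral_sum[OF bvint])
      have e3: "(\<integral>\<omega>. \<alpha> * (if \<bar>?d k \<omega>\<bar> \<le> \<epsilon> then (?d k \<omega>)\<^sup>2 else 0) + (?v k \<omega>)\<^sup>2 / \<alpha>
          + \<kappa> * (?d k \<omega>)\<^sup>2 + \<kappa> * (?d k \<omega>)\<^sup>2 + indicator (B n) \<omega> * (?v k \<omega>)\<^sup>2 / \<kappa> \<partial>Q)
        = \<alpha> * (\<integral>\<omega>. (if \<bar>?d k \<omega>\<bar> \<le> \<epsilon> then (?d k \<omega>)\<^sup>2 else 0) \<partial>Q) + (\<integral>\<omega>. (?v k \<omega>)\<^sup>2 \<partial>Q) / \<alpha>
          + 2 * (\<kappa> * (\<integral>\<omega>. (?d k \<omega>)\<^sup>2 \<partial>Q)) + (\<integral>\<omega>. indicator (B n) \<omega> * (?v k \<omega>)\<^sup>2 \<partial>Q) / \<kappa>" for k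
        using sint[of k] dint[of k] vint[of k] bvint[of k] by simp
      show ?thesis
        unfolding e1 e2 e3 by (simp only: sum.distrib sum_distrib_left sum_divide_distrib)
    qed
    \<comment> \<open>In order: small increments of y, quadratic variation of V, the two
      \<kappa>-terms together, and the bad event with its two parts.\<close>
    also have "\<dots> \<le> \<delta> + \<delta> + 2 * \<delta> + 2 * \<delta>"
    proof (intro add_mono)
      have "(\<Sum>k<?m. \<integral>\<omega>. (if \<bar>?d k \<omega>\<bar> \<le> \<epsilon> then (?d k \<omega>)\<^sup>2 else 0) \<partial>Q) \<le> \<delta> / \<alpha>"
        by (rule sm[rule_format]) (use \<tau>0 \<tau>mono \<tau>n in auto)
      from mult_left_mono[OF this less_imp_le[OF \<alpha>(1)]]
      show "\<alpha> * (\<Sum>k<?m. \<integral>\<omega>. (if \<bar>?d k \<omega>\<bar> \<le> \<epsilon> then (?d k \<omega>)\<^sup>2 else 0) \<partial>Q) \<le> \<delta>" using \<alpha> by simp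
      show "(\<integral>\<omega>. ?S \<omega> \<partial>Q) / \<alpha> \<le> \<delta>"
        using divide_right_mono[OF S2(3), of \<alpha>] \<alpha> by linarith
      have "(\<Sum>k<?m. \<integral>\<omega>. (?d k \<omega>)\<^sup>2 \<partial>Q) = Y2 - (\<integral>\<omega>. (y s \<omega>)\<^sup>2 \<partial>Q)"
        using sum_sq_increments(2)[of y "\<tau> n", OF y sq \<tau>0(2) \<tau>mono, of ?m]
        unfolding Y2_def \<tau>n \<tau>0 by (simp del: sum.lessThan_Suc)
      then have "(\<Sum>k<?m. \<integral>\<omega>. (?d k \<omega>)\<^sup>2 \<partial>Q) \<le> Y2" by simp
      from mult_left_mono[OF this less_imp_le[OF \<kappa>]]
      show "2 * (\<kappa> * (\<Sum>k<?m. \<integral>\<omega>. (?d k \<omega>)\<^sup>2 \<partial>Q)) \<le> 2 * \<delta>" using \<kappa>Y by linarith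
      have "(\<integral>\<omega>. indicator (B n) \<omega> * ?S \<omega> \<partial>Q) \<le> (\<integral>\<omega>. \<mu> * (?S \<omega>)\<^sup>2 + indicator (B n) \<omega> / \<mu> \<partial>Q)"
      proof (rule integral_mono)
        show "indicator (B n) \<omega> * ?S \<omega> \<le> \<mu> * (?S \<omega>)\<^sup>2 + indicator (B n) \<omega> / \<mu>" for \<omega>
        proof -
          have "indicator (B n) \<omega> * ?S \<omega> \<le> \<bar>?S \<omega> * indicator (B n) \<omega>\<bar>" by (simp add: mult.commute)
          also have "\<dots> \<le> \<mu> * (?S \<omega>)\<^sup>2 + (indicator (B n) \<omega>)\<^sup>2 / \<mu>"
            by (rule abs_mult_le_weighted_squares[OF \<mu>])
          also have "(indicator (B n) \<omega>)\<^sup>2 = (indicator (B n) \<omega> :: real)" by (simp add: indicator_def)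
          finally show ?thesis .
        qed
        show "integrable Q (\<lambda>\<omega>. indicator (B n) \<omega> * ?S \<omega>)"
          unfolding sum_distrib_left by (rule Bochner_Integration.integrable_sum[OF bvint])
      qed (use S2(1) B_sets in \<open>auto intro!: Bochner_Integration.integrable_add integrable_real_indicator simp: emeasure_eq_measure\<close>)
      also have "\<dots> = \<mu> * (\<integral>\<omega>. (?S \<omega>)\<^sup>2 \<partial>Q) + measure Q (B n) / \<mu>"
        using S2(1) B_sets by (simp add: emeasure_eq_measure)
      also have "\<dots> \<le> \<delta> * \<kappa> + \<delta> * \<kappa>"
      proof (intro add_mono)
        show "\<mu> * (\<integral>\<omega>. (?S \<omega>)\<^sup>2 \<partial>Q) \<le> \<delta> * \<kappa>"
          using mult_left_mono[OF S2(2) less_imp_le[OF \<mu>]] \<mu>c by linarith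
        show "measure Q (B n) / \<mu> \<le> \<delta> * \<kappa>" using PB \<mu> by (simp add: pos_divide_le_eq)
      qed
      finally have "(\<integral>\<omega>. indicator (B n) \<omega> * ?S \<omega> \<partial>Q) \<le> 2 * \<delta> * \<kappa>" by simp
      then show "(\<integral>\<omega>. indicator (B n) \<omega> * ?S \<omega> \<partial>Q) / \<kappa> \<le> 2 * \<delta>" using \<kappa> by (simp add: pos_divide_le_eq)
    qed
    finally show ?thesis by simp
  qed
  \<comment> \<open>With this \<delta> the estimate reads |E| \<le> |E| / 2.\<close>
  from this[of "\<bar>E\<bar> / 12"] have "E = 0" by (cases "E = 0") auto
  then show ?thesis by (simp add: E_def)
qed

end

section \<open>Stopping\<close>

lemma enn2real_min_bounds:
  assumes "0 \<le> t"
  shows "0 \<le> enn2real (min (ennreal t) s)" "enn2real (min (ennreal t) s) \<le> t"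
proof -
  show "0 \<le> enn2real (min (ennreal t) s)" by simp
  have "enn2real (min (ennreal t) s) \<le> enn2real (ennreal t)" by (rule enn2real_mono) auto
  then show "enn2real (min (ennreal t) s) \<le> t" using assms by simp
qed

lemma ennreal_enn2real_min: "ennreal (enn2real (min (ennreal t) s)) = min (ennreal t) s"
  by (rule ennreal_enn2real) (simp add: min_less_iff_disj)

lemma ennreal_less_iff_enn2real_min:
  assumes "0 \<le> r" "r < t"
  shows "ennreal r < s \<longleftrightarrow> r < enn2real (min (ennreal t) s)"
proof -
  have "ennreal r < s \<longleftrightarrow> ennreal r < min (ennreal t) s" using assms by (simp add: ennreal_lessI)
  also have "\<dots> \<longleftrightarrow> r < enn2real (min (ennreal t) s)"
    using assms(1) by (subst ennreal_enn2real_min[symmetric]) (simp add: ennreal_less_iff)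
  finally show ?thesis .
qed

section \<open>Stopping on a finite grid\<close>

definition grid :: "nat \<Rightarrow> real \<Rightarrow> nat \<Rightarrow> real" where
  "grid n t k = real k * (t / real (Suc n))"

lemma grid_simps: "grid n t 0 = 0" "grid n t (Suc n) = t"
  by (simp_all add: grid_def)

lemma grid_mono: "0 \<le> t \<Longrightarrow> j \<le> k \<Longrightarrow> grid n t j \<le> grid n t k"
  unfolding grid_def by (intro mult_right_mono) auto

lemma grid_nonneg: "0 \<le> t \<Longrightarrow> 0 \<le> grid n t k"
  unfolding grid_def by simp

lemma grid_le: "0 \<le> t \<Longrightarrow> k \<le> Suc n \<Longrightarrow> grid n t k \<le> t"
  using grid_mono[of t k "Suc n" n] by (simp add: grid_simps)

text \<open>The value of \<open>y\<close> at the first grid point after \<open>min t \<sigma>\<close>, see \<open>dstop_eq\<close>; as a sum it preserves martingales term by term.\<close>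

definition dstop :: "nat \<Rightarrow> real \<Rightarrow> ('w \<Rightarrow> ennreal) \<Rightarrow> (real \<Rightarrow> 'w \<Rightarrow> real) \<Rightarrow> 'w \<Rightarrow> real" where
  "dstop n t \<sigma> y \<omega> = y 0 \<omega> + (\<Sum>k<Suc n. if ennreal (grid n t k) < \<sigma> \<omega> then y (grid n t (Suc k)) \<omega> - y (grid n t k) \<omega> else 0)"

lemma dstop_eq:
  assumes "0 < t"
  obtains r where "dstop n t \<sigma> y \<omega> = y r \<omega>" "r \<le> t"
    "enn2real (min (ennreal t) (\<sigma> \<omega>)) \<le> r" "r \<le> enn2real (min (ennreal t) (\<sigma> \<omega>)) + t * inverse (real (Suc n))"
proof -
  define s where "s = enn2real (min (ennreal t) (\<sigma> \<omega>))"
  have s: "0 \<le> s" "s \<le> t" using enn2real_min_bounds[of t "\<sigma> \<omega>"] assms by (auto simp: s_def)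
  define h where "h = t / real (Suc n)"
  have h: "0 < h" using assms by (simp add: h_def)
  have gk: "grid n t k = real k * h" for k by (simp add: grid_def h_def)
  \<comment> \<open>The number of grid points strictly before the stopped time s; the telescoping
    sum ends at the grid point with this index.\<close>
  define \<kappa> where "\<kappa> = nat \<lceil>s / h\<rceil>"
  have "0 \<le> \<lceil>s / h\<rceil>" using s h by (simp add: less_le_trans[of "-1" 0])
  then have \<kappa>: "real \<kappa> = of_int \<lceil>s / h\<rceil>" by (simp add: \<kappa>_def)
  have less_iff: "grid n t k < s \<longleftrightarrow> k < \<kappa>" for k
  proof -
    have "grid n t k < s \<longleftrightarrow> real k < s / h" using h by (simp add: gk pos_less_divide_eq)
    also have "\<dots> \<longleftrightarrow> int k < \<lceil>s / h\<rceil>" by (simp add: less_ceiling_iff)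
    also have "\<dots> \<longleftrightarrow> k < \<kappa>" unfolding \<kappa>_def by (simp add: zless_nat_eq_int_zless)
    finally show ?thesis .
  qed
  have "s / h \<le> real (Suc n)" using s h by (simp add: pos_divide_le_eq) (simp add: h_def)
  then have "\<lceil>s / h\<rceil> \<le> int (Suc n)" by (simp add: ceiling_le_iff)
  then have \<kappa>le: "\<kappa> \<le> Suc n" unfolding \<kappa>_def by linarith
  have "(\<Sum>k<Suc n. if ennreal (grid n t k) < \<sigma> \<omega> then y (grid n t (Suc k)) \<omega> - y (grid n t k) \<omega> else 0)
      = (\<Sum>k<Suc n. if k < \<kappa> then y (grid n t (Suc k)) \<omega> - y (grid n t k) \<omega> else 0)"
  proof (rule sum.cong[OF refl])
    fix k assume k: "k \<in> {..<Suc n}"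
    have "real k * h < real (Suc n) * h" using h k by (intro mult_strict_right_mono) auto
    then have "grid n t k < t" by (simp add: grid_def h_def)
    then have "ennreal (grid n t k) < \<sigma> \<omega> \<longleftrightarrow> grid n t k < s"
      unfolding s_def using assms by (intro ennreal_less_iff_enn2real_min grid_nonneg) auto
    then show "(if ennreal (grid n t k) < \<sigma> \<omega> then y (grid n t (Suc k)) \<omega> - y (grid n t k) \<omega> else 0)
      = (if k < \<kappa> then y (grid n t (Suc k)) \<omega> - y (grid n t k) \<omega> else 0)"
      by (simp add: less_iff)
  qed
  also have "\<dots> = (\<Sum>k<\<kappa>. y (grid n t (Suc k)) \<omega> - y (grid n t k) \<omega>)"
    by (rule sum.mono_neutral_cong_right) (use \<kappa>le in auto)
  also have "\<dots> = y (grid n t \<kappa>) \<omega> - y 0 \<omega>"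
    using sum_lessThan_telescope[of "\<lambda>k. y (grid n t k) \<omega>" \<kappa>] by (simp add: grid_simps)
  finally have eq: "dstop n t \<sigma> y \<omega> = y (grid n t \<kappa>) \<omega>" by (simp add: dstop_def)
  have "s / h \<le> real \<kappa>" unfolding \<kappa> by (rule le_of_int_ceiling)
  then have 1: "s \<le> grid n t \<kappa>" using h by (simp add: gk pos_divide_le_eq)
  have "real \<kappa> \<le> s / h + 1" unfolding \<kappa> by (simp add: of_int_ceiling_le_add_one)
  then have "real \<kappa> * h \<le> (s / h + 1) * h" using h by (intro mult_right_mono) auto
  then have 2: "grid n t \<kappa> \<le> s + t * inverse (real (Suc n))"
    using h by (simp add: gk distrib_right) (simp add: h_def divide_inverse)
  show thesis using that[OF eq grid_le[OF less_imp_le[OF assms] \<kappa>le]] 1 2 by (simp add: s_def)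
qed

lemma cadlag_right: "cadlag f \<Longrightarrow> 0 \<le> t \<Longrightarrow> (f \<longlongrightarrow> f t) (at_right t)"
  by (simp add: cadlag_def)

lemma dstop_tendsto:
  assumes "0 \<le> t" and c: "cadlag (\<lambda>t. y t \<omega>)"
  shows "(\<lambda>n. dstop n t \<sigma> y \<omega>) \<longlonglongrightarrow> stopped \<sigma> y t \<omega>"
proof (cases "t = 0")
  case True
  have "dstop n t \<sigma> y \<omega> = y 0 \<omega>" for n by (simp add: dstop_def True grid_def)
  moreover have "stopped \<sigma> y t \<omega> = y 0 \<omega>" by (simp add: stopped_def True)
  ultimately show ?thesis by simp
next
  case False
  define s where "s = enn2real (min (ennreal t) (\<sigma> \<omega>))"
  have s: "0 \<le> s" by (simp add: s_def)
  have "\<exists>r. dstop n t \<sigma> y \<omega> = y r \<omega> \<and> s \<le> r \<and> r \<le> s + t * inverse (real (Suc n))" for n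
    using dstop_eq[of t n \<sigma> y \<omega>] False assms(1) unfolding s_def by (metis order_le_imp_less_or_eq)
  then obtain r where r: "\<And>n. dstop n t \<sigma> y \<omega> = y (r n) \<omega>" "\<And>n. s \<le> r n" "\<And>n. r n \<le> s + t * inverse (real (Suc n))"
    by metis
  have "(\<lambda>n. s + t * inverse (real (Suc n))) \<longlonglongrightarrow> s + t * 0"
    by (intro tendsto_intros LIMSEQ_inverse_real_of_nat)
  then have "r \<longlonglongrightarrow> s"
    by (intro tendsto_sandwich[OF always_eventually always_eventually tendsto_const, of s r]) (use r in auto)
  \<comment> \<open>The grid point may coincide with s, so the limit is taken within [s,
    \<infinity>) rather than strictly to the right.\<close>
  moreover have "continuous (at s within {s..}) (\<lambda>t. y t \<omega>)"
    unfolding continuous_within at_within_Ici_at_right using cadlag_right[OF c s] .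
  moreover have "\<forall>\<^sub>F n in sequentially. r n \<in> {s..}" using r(2) by simp
  ultimately have "(\<lambda>n. y (r n) \<omega>) \<longlonglongrightarrow> y s \<omega>"
    by (rule continuous_within_tendsto_compose[rotated 2])
  then show ?thesis using r(1) by (simp add: stopped_def s_def)
qed

lemma cadlag_stopped:
  assumes "cadlag (\<lambda>t. y t \<omega>)"
  shows "cadlag (\<lambda>t. stopped \<sigma> y t \<omega>)"
proof (cases "\<sigma> \<omega>" rule: ennreal_cases)
  case top
  have eq: "stopped \<sigma> y t \<omega> = y t \<omega>" if "0 \<le> t" for t using that top by (simp add: stopped_def)
  have "((\<lambda>s. stopped \<sigma> y s \<omega>) \<longlongrightarrow> y t \<omega>) (at_right t)" if "0 \<le> t" for t
    by (rule Lim_transform_eventually[OF cadlag_right[OF assms that]])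
      (use that in \<open>auto simp: eventually_at_filter eq intro!: always_eventually\<close>)
  moreover have "\<exists>l. ((\<lambda>s. stopped \<sigma> y s \<omega>) \<longlongrightarrow> l) (at_left t)" if t: "0 < t" for t
  proof -
    obtain l where l: "((\<lambda>s. y s \<omega>) \<longlongrightarrow> l) (at_left t)" using assms t by (auto simp: cadlag_def)
    have "\<forall>\<^sub>F s in at_left t. s \<in> {0<..<t}" using eventually_at_left_real[OF t] .
    then have "\<forall>\<^sub>F s in at_left t. y s \<omega> = stopped \<sigma> y s \<omega>" by eventually_elim (simp add: eq)
    from Lim_transform_eventually[OF l this] show ?thesis by blast
  qed
  ultimately show ?thesis by (simp add: cadlag_def eq)
next
  case (real c)
  have eq: "stopped \<sigma> y t \<omega> = y (min t c) \<omega>" if "0 \<le> t" for t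
    using that real by (auto simp: stopped_def min_def)
  have "((\<lambda>s. stopped \<sigma> y s \<omega>) \<longlongrightarrow> y (min t c) \<omega>) (at_right t)" if t: "0 \<le> t" for t
  proof (cases "t < c")
    case True
    have "\<forall>\<^sub>F s in at_right t. s \<in> {t<..<c}" using eventually_at_right_real[OF True] .
    then have "\<forall>\<^sub>F s in at_right t. y s \<omega> = stopped \<sigma> y s \<omega>" by eventually_elim (use t in \<open>simp add: eq\<close>)
    from Lim_transform_eventually[OF cadlag_right[OF assms t] this] show ?thesis using True by simp
  next
    case False
    have "\<forall>\<^sub>F s in at_right t. stopped \<sigma> y s \<omega> = y (min t c) \<omega>"
      using eventually_at_right_less[of t] by eventually_elim (use t False in \<open>simp add: eq\<close>)
    then show ?thesis by (rule tendsto_eventually)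
  qed
  moreover have "\<exists>l. ((\<lambda>s. stopped \<sigma> y s \<omega>) \<longlongrightarrow> l) (at_left t)" if t: "0 < t" for t
  proof (cases "t \<le> c")
    case True
    obtain l where l: "((\<lambda>s. y s \<omega>) \<longlongrightarrow> l) (at_left t)" using assms t by (auto simp: cadlag_def)
    have "\<forall>\<^sub>F s in at_left t. s \<in> {0<..<t}" using eventually_at_left_real[OF t] .
    then have "\<forall>\<^sub>F s in at_left t. y s \<omega> = stopped \<sigma> y s \<omega>" by eventually_elim (use True in \<open>simp add: eq\<close>)
    from Lim_transform_eventually[OF l this] show ?thesis by blast
  next
    case False
    have "\<forall>\<^sub>F s in at_left t. s \<in> {max 0 c<..<t}" using eventually_at_left_real[of "max 0 c" t] False t by simp
    then have "\<forall>\<^sub>F s in at_left t. stopped \<sigma> y s \<omega> = y c \<omega>" by eventually_elim (simp add: eq)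
    then show ?thesis by (intro exI tendsto_eventually)
  qed
  ultimately show ?thesis by (simp add: cadlag_def eq)
qed

lemma continuous_imp_cadlag:
  assumes "continuous_on {0..} f"
  shows "cadlag f"
  unfolding cadlag_def
proof (intro conjI allI impI)
  fix t :: real assume "0 \<le> t"
  then have "(f \<longlongrightarrow> f t) (at t within {0..})" using assms by (auto simp: continuous_on_def)
  then show "(f \<longlongrightarrow> f t) (at_right t)" by (rule tendsto_within_subset) (use \<open>0 \<le> t\<close> in auto)
next
  fix t :: real assume t: "0 < t"
  then have "(f \<longlongrightarrow> f t) (at t within {0..})" using assms by (auto simp: continuous_on_def)
  then have "(f \<longlongrightarrow> f t) (at t within {0..t})" by (rule tendsto_within_subset) auto
  moreover have "at t within {0..t} = at_left t"
    using t by (simp add: at_within_Icc_at_left)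
  ultimately show "\<exists>l. (f \<longlongrightarrow> l) (at_left t)" by auto
qed

lemma continuous_on_stopped:
  assumes "continuous_on {0..} (\<lambda>t. y t \<omega>)"
  shows "continuous_on {0..} (\<lambda>t. stopped \<sigma> y t \<omega>)"
proof (cases "\<sigma> \<omega>" rule: ennreal_cases)
  case top
  then have "stopped \<sigma> y t \<omega> = y t \<omega>" if "0 \<le> t" for t using that by (simp add: stopped_def)
  then have "continuous_on {0..} (\<lambda>t. stopped \<sigma> y t \<omega>) \<longleftrightarrow> continuous_on {0..} (\<lambda>t. y t \<omega>)"
    by (intro continuous_on_cong) auto
  then show ?thesis using assms by simp
next
  case (real c)
  then have eq: "stopped \<sigma> y t \<omega> = y (min t c) \<omega>" if "0 \<le> t" for t
    using that by (auto simp: stopped_def min_def)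
  have "continuous_on {0..} (\<lambda>t. y (min t c) \<omega>)"
    by (rule continuous_on_compose2[OF assms]) (use real in \<open>auto intro!: continuous_intros\<close>)
  moreover have "continuous_on {0..} (\<lambda>t. stopped \<sigma> y t \<omega>) \<longleftrightarrow> continuous_on {0..} (\<lambda>t. y (min t c) \<omega>)"
    using eq by (intro continuous_on_cong) auto
  ultimately show ?thesis by simp
qed

section \<open>Exit times of continuous paths\<close>

definition first_exit :: "real \<Rightarrow> (real \<Rightarrow> real) \<Rightarrow> ennreal" where
  "first_exit N f = Inf {ennreal r |r. 0 \<le> r \<and> N \<le> \<bar>f r\<bar>}"

text \<open>The level set is closed, so the infimum is attained: if |f| stays below N on [0, t],
  continuity at t keeps it below N a little longer, and the infimum exceeds t. Hence the event is
  decided by the path up to t.\<close>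

lemma first_exit_le_iff:
  assumes "continuous_on {0..} f" "0 \<le> t"
  shows "first_exit N f \<le> ennreal t \<longleftrightarrow> (\<exists>r\<in>{0..t}. N \<le> \<bar>f r\<bar>)"
proof
  assume "\<exists>r\<in>{0..t}. N \<le> \<bar>f r\<bar>"
  then obtain r where r: "0 \<le> r" "r \<le> t" "N \<le> \<bar>f r\<bar>" by auto
  then have "first_exit N f \<le> ennreal r" unfolding first_exit_def by (intro Inf_lower) auto
  also have "\<dots> \<le> ennreal t" using r by (simp add: ennreal_leI)
  finally show "first_exit N f \<le> ennreal t" .
next
  assume le: "first_exit N f \<le> ennreal t"
  show "\<exists>r\<in>{0..t}. N \<le> \<bar>f r\<bar>"
  proof (rule ccontr)
    assume "\<not> ?thesis"
    then have less: "\<And>r. 0 \<le> r \<Longrightarrow> r \<le> t \<Longrightarrow> \<bar>f r\<bar> < N" by force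
    have "((\<lambda>r. \<bar>f r\<bar>) \<longlongrightarrow> \<bar>f t\<bar>) (at t within {0..})"
      using assms by (intro tendsto_rabs) (auto simp: continuous_on_def)
    then have "\<forall>\<^sub>F r in at t within {0..}. \<bar>f r\<bar> < N" using less[of t] assms by (intro order_tendstoD(2)) auto
    then obtain d where d: "d > 0" "\<And>r. 0 \<le> r \<Longrightarrow> r \<noteq> t \<Longrightarrow> dist r t < d \<Longrightarrow> \<bar>f r\<bar> < N"
      unfolding eventually_at by auto
    have "ennreal (t + d) \<le> first_exit N f"
      unfolding first_exit_def
    proof (rule Inf_greatest)
      fix x assume "x \<in> {ennreal r |r. 0 \<le> r \<and> N \<le> \<bar>f r\<bar>}"
      then obtain r where r: "x = ennreal r" "0 \<le> r" "N \<le> \<bar>f r\<bar>" by auto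
      have "t + d \<le> r"
      proof (rule ccontr)
        assume "\<not> t + d \<le> r"
        then have "\<bar>f r\<bar> < N" using less[of r] d(2)[of r] r by (cases "r \<le> t") (auto simp: dist_real_def)
        then show False using r by simp
      qed
      then show "ennreal (t + d) \<le> x" by (simp add: r ennreal_leI)
    qed
    then have "ennreal (t + d) \<le> ennreal t" using le by (rule order_trans)
    then show False using d(1) assms(2) by (simp add: ennreal_le_iff)
  qed
qed

text \<open>Before the exit the values are below N, and at the exit time the bound follows from the
  left. Positivity excludes a path that starts at or beyond the level, whose initial value has no
  bound.\<close>

lemma first_exit_bound:
  assumes f: "continuous_on {0..} f" and r: "0 \<le> r" "ennreal r \<le> first_exit N f" "0 < first_exit N f"
  shows "\<bar>f r\<bar> \<le> N"
proof (cases "r = 0")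
  case True
  have "\<not> first_exit N f \<le> ennreal 0" using r(3) by simp
  then show ?thesis unfolding first_exit_le_iff[OF f order_refl] using True by auto
next
  case False
  have "((\<lambda>r. \<bar>f r\<bar>) \<longlongrightarrow> \<bar>f r\<bar>) (at r within {0..})"
    using f r by (intro tendsto_rabs) (auto simp: continuous_on_def)
  then have lim: "((\<lambda>r. \<bar>f r\<bar>) \<longlongrightarrow> \<bar>f r\<bar>) (at r within {0..r})" by (rule tendsto_within_subset) auto
  have eq: "at r within {0..r} = at_left r"
    using False r by (simp add: at_within_Icc_at_left)
  have "\<bar>f r'\<bar> \<le> N" if r': "r' \<in> {0<..<r}" for r'
  proof -
    have "ennreal r' < ennreal r" using r' by (simp add: ennreal_lessI)
    then have "\<not> first_exit N f \<le> ennreal r'" using r(2) by auto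
    then have "\<not> (\<exists>r\<in>{0..r'}. N \<le> \<bar>f r\<bar>)" using r' first_exit_le_iff[OF f, of r' N] by simp
    moreover have "r' \<in> {0..r'}" using r' by simp
    ultimately have "\<not> N \<le> \<bar>f r'\<bar>" by blast
    then show ?thesis by simp
  qed
  then have "\<forall>\<^sub>F r' in at_left r. \<bar>f r'\<bar> \<le> N"
    using eventually_at_left_real[of 0 r] False r by (auto elim!: eventually_mono)
  then show ?thesis using lim unfolding eq by (intro tendsto_upperbound[OF lim[unfolded eq]]) auto
qed

lemma first_exit_mono: "N \<le> N' \<Longrightarrow> first_exit N f \<le> first_exit N' f"
  unfolding first_exit_def by (intro Inf_superset_mono) auto

lemma first_exit_gt:
  assumes f: "continuous_on {0..} f" and "0 \<le> t" "\<And>r. 0 \<le> r \<Longrightarrow> r \<le> t \<Longrightarrow> \<bar>f r\<bar> < N"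
  shows "ennreal t < first_exit N f"
  using first_exit_le_iff[OF f assms(2), of N] assms(3) by (force simp: not_le[symmetric])

text \<open>The level may be attained only at a non-dyadic time, so on dyadic times it is reached up
  to each tolerance 1 / (j + 1); conversely the maximum over the compact interval is attained. The
  countable form yields measurability.\<close>

lemma first_exit_le_iff_dyadic:
  assumes f: "continuous_on {0..} f" and t: "0 \<le> t"
  shows "first_exit N f \<le> ennreal t \<longleftrightarrow> (\<forall>j. \<exists>n k. k \<le> 2 ^ n \<and> N - inverse (real (Suc j)) < \<bar>f (real k * t / 2 ^ n)\<bar>)"
  unfolding first_exit_le_iff[OF assms]
proof
  assume "\<exists>r\<in>{0..t}. N \<le> \<bar>f r\<bar>"
  then obtain r where r: "0 \<le> r" "r \<le> t" "N \<le> \<bar>f r\<bar>" by auto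
  show "\<forall>j. \<exists>n k. k \<le> 2 ^ n \<and> N - inverse (real (Suc j)) < \<bar>f (real k * t / 2 ^ n)\<bar>"
  proof (rule allI, rule ccontr)
    fix j
    assume *: "\<not> (\<exists>n k. k \<le> 2 ^ n \<and> N - inverse (real (Suc j)) < \<bar>f (real k * t / 2 ^ n)\<bar>)"
    have "\<bar>f r\<bar> \<in> {..N - inverse (real (Suc j))}"
    proof (cases "r < t")
      case True
      have "((\<lambda>r. \<bar>f r\<bar>) \<longlongrightarrow> \<bar>f r\<bar>) (at_right r)"
        using cadlag_right[OF continuous_imp_cadlag[OF f] r(1)] by (rule tendsto_rabs)
      from right_limit_in_closed[OF r(1) True this, of "{..N - inverse (real (Suc j))}"] show ?thesis
        using * by (force simp: not_less)
    next
      case False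
      then have "r = t" using r by simp
      then show ?thesis using *[simplified, rule_format, of "2 ^ 0" 0] by (simp add: not_less)
    qed
    then have "\<bar>f r\<bar> \<le> N - inverse (real (Suc j))" unfolding atMost_iff .
    moreover have "0 < inverse (real (Suc j))" by simp
    ultimately show False using r(3) by linarith
  qed
next
  assume *: "\<forall>j. \<exists>n k. k \<le> 2 ^ n \<and> N - inverse (real (Suc j)) < \<bar>f (real k * t / 2 ^ n)\<bar>"
  have "continuous_on {0..t} (\<lambda>r. \<bar>f r\<bar>)" using f by (intro continuous_on_rabs) (auto intro: continuous_on_subset)
  then obtain m where m: "m \<in> {0..t}" "\<And>r. r \<in> {0..t} \<Longrightarrow> \<bar>f r\<bar> \<le> \<bar>f m\<bar>"
    using continuous_attains_sup[of "{0..t}" "\<lambda>r. \<bar>f r\<bar>"] t by auto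
  have "N - inverse (real (Suc j)) \<le> \<bar>f m\<bar>" for j
  proof -
    obtain n k where nk: "k \<le> 2 ^ n" "N - inverse (real (Suc j)) < \<bar>f (real k * t / 2 ^ n)\<bar>" using * by blast
    have "real k \<le> 2 ^ n" using nk(1) by (metis of_nat_le_iff of_nat_numeral of_nat_power)
    then have "real k * t \<le> 2 ^ n * t" using t by (intro mult_right_mono) auto
    then have "real k * t / 2 ^ n \<in> {0..t}" using t by (simp add: pos_divide_le_eq mult.commute)
    from m(2)[OF this] show ?thesis using nk(2) by linarith
  qed
  moreover have "(\<lambda>j. N - inverse (real (Suc j))) \<longlonglongrightarrow> N - 0"
    by (intro tendsto_intros LIMSEQ_inverse_real_of_nat)
  ultimately have "N \<le> \<bar>f m\<bar>" by (intro LIMSEQ_le_const2) auto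
  then show "\<exists>r\<in>{0..t}. N \<le> \<bar>f r\<bar>" using m(1) by blast
qed

section \<open>Stopping times and optional stopping\<close>

context filtered_prob_space
begin

lemma doob_sup_all:
  assumes y: "mart y" and sq: "\<And>t. 0 \<le> t \<Longrightarrow> integrable Q (\<lambda>\<omega>. (y t \<omega>)\<^sup>2)"
    and cad: "AE \<omega> in Q. cadlag (\<lambda>t. y t \<omega>)" and t: "0 \<le> t"
  obtains S where "S \<in> borel_measurable Q" "integrable Q (\<lambda>\<omega>. (S \<omega>)\<^sup>2)"
    "AE \<omega> in Q. \<forall>r. 0 \<le> r \<longrightarrow> r \<le> t \<longrightarrow> \<bar>y r \<omega>\<bar> \<le> S \<omega>"
proof -
  obtain S where S: "S \<in> borel_measurable Q" "\<And>\<omega>. 0 \<le> S \<omega>" "integrable Q (\<lambda>\<omega>. (S \<omega>)\<^sup>2)"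
    and AE: "AE \<omega> in Q. \<forall>n k. k \<le> 2 ^ n \<longrightarrow> \<bar>y (real k * t / 2 ^ n) \<omega>\<bar> \<le> S \<omega>"
    by (rule doob_sup[OF y _ t], erule sq, rule that)
  have "AE \<omega> in Q. \<forall>r. 0 \<le> r \<longrightarrow> r \<le> t \<longrightarrow> \<bar>y r \<omega>\<bar> \<le> S \<omega>"
    using AE cad
  proof eventually_elim
    case (elim \<omega>)
    show ?case
    proof (intro allI impI)
      fix r assume r: "0 \<le> r" "r \<le> t"
      show "\<bar>y r \<omega>\<bar> \<le> S \<omega>"
      proof (cases "r = t")
        case True
        then show ?thesis using elim(1)[rule_format, of 1 0] by simp
      next
        case False
        have "\<bar>y r \<omega>\<bar> \<in> {..S \<omega>}"
          by (rule right_limit_in_closed[OF r(1) _ tendsto_rabs[OF cadlag_right[OF elim(2) r(1)]], of t])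
            (use False r elim(1) in auto)
        then show ?thesis by simp
      qed
    qed
  qed
  then show thesis using that S by blast
qed

definition stop :: "('w \<Rightarrow> ennreal) \<Rightarrow> bool" where
  "stop \<sigma> \<longleftrightarrow> (\<forall>t\<ge>0. {\<omega> \<in> space Q. \<sigma> \<omega> \<le> ennreal t} \<in> sets (G t))"

lemma stopping_time_iff: "stopping_time (full_filtration Q G) \<sigma> \<longleftrightarrow> stop \<sigma>"
proof
  assume *: "stopping_time (full_filtration Q G) \<sigma>"
  show "stop \<sigma>"
    unfolding stop_def
  proof (intro allI impI)
    fix t :: real assume "0 \<le> t"
    then show "{\<omega> \<in> space Q. \<sigma> \<omega> \<le> ennreal t} \<in> sets (G t)"
      using stopping_timeD[OF *, of "ennreal t"] by (simp add: pred_def full_filtration_def space_G)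
  qed
next
  assume *: "stop \<sigma>"
  show "stopping_time (full_filtration Q G) \<sigma>"
  proof (rule stopping_timeI)
    fix t :: ennreal
    show "Measurable.pred (full_filtration Q G t) (\<lambda>\<omega>. \<sigma> \<omega> \<le> t)"
    proof (cases t rule: ennreal_cases)
      case top
      then show ?thesis by (simp add: full_filtration_def)
    next
      case (real r)
      then show ?thesis using * by (simp add: pred_def full_filtration_def space_G stop_def)
    qed
  qed
qed

lemma stop_le: "stop \<sigma> \<Longrightarrow> 0 \<le> r \<Longrightarrow> r \<le> t \<Longrightarrow> {\<omega> \<in> space Q. \<sigma> \<omega> \<le> ennreal r} \<in> sets (G t)"
  using G_mono[of r t] unfolding stop_def by blast

lemma stop_greater:
  assumes "stop \<sigma>" "0 \<le> r" "r \<le> t"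
  shows "{\<omega> \<in> space Q. ennreal r < \<sigma> \<omega>} \<in> sets (G t)"
proof -
  have "space (G t) - {\<omega> \<in> space Q. \<sigma> \<omega> \<le> ennreal r} \<in> sets (G t)"
    using stop_le[OF assms] by blast
  also have "space (G t) - {\<omega> \<in> space Q. \<sigma> \<omega> \<le> ennreal r} = {\<omega> \<in> space Q. ennreal r < \<sigma> \<omega>}"
    using assms by (auto simp: space_G)
  finally show ?thesis .
qed

lemma stop_min: "stop \<sigma> \<Longrightarrow> stop \<sigma>' \<Longrightarrow> stop (\<lambda>\<omega>. min (\<sigma> \<omega>) (\<sigma>' \<omega>))"
  unfolding stopping_time_iff[symmetric] by (rule stopping_time_min)

lemma measurable_if_greater:
  fixes f :: "'w \<Rightarrow> real"
  assumes "stop \<sigma>" "0 \<le> r" "r \<le> t" "f \<in> borel_measurable (G t)"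
  shows "(\<lambda>\<omega>. if ennreal r < \<sigma> \<omega> then f \<omega> else 0) \<in> borel_measurable (G t)"
  using assms stop_greater[OF assms(1-3)] by (intro measurable_If) (auto simp: space_G)

lemma measurable_partial_dstop:
  fixes y :: "real \<Rightarrow> 'w \<Rightarrow> real"
  assumes ad: "\<And>r. 0 \<le> r \<Longrightarrow> y r \<in> borel_measurable (G r)" and "stop \<sigma>" "0 \<le> t"
  shows "(\<lambda>\<omega>. y 0 \<omega> + (\<Sum>j<k. if ennreal (grid n t j) < \<sigma> \<omega> then y (grid n t (Suc j)) \<omega> - y (grid n t j) \<omega> else 0))
     \<in> borel_measurable (G (grid n t k))"
proof (intro borel_measurable_add borel_measurable_sum measurable_if_greater borel_measurable_diff)
  show "y 0 \<in> borel_measurable (G (grid n t k))"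
    using ad[of 0] assms(3) by (auto intro: measurable_G_mono grid_nonneg)
  fix j assume j: "j \<in> {..<k}"
  then have le: "grid n t j \<le> grid n t k" "grid n t (Suc j) \<le> grid n t k"
    using assms(3) by (auto intro: grid_mono)
  then show "grid n t j \<le> grid n t k" by simp
  show "0 \<le> grid n t j" using assms(3) by (rule grid_nonneg)
  show "y (grid n t j) \<in> borel_measurable (G (grid n t k))" "y (grid n t (Suc j)) \<in> borel_measurable (G (grid n t k))"
    using measurable_G_mono[OF grid_nonneg le(1) ad] measurable_G_mono[OF grid_nonneg le(2) ad] grid_nonneg assms(3) by auto
qed (rule assms(2))

lemma dstop_measurable:
  assumes "\<And>r. 0 \<le> r \<Longrightarrow> y r \<in> borel_measurable (G r)" and "stop \<sigma>" "0 \<le> t"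
  shows "dstop n t \<sigma> y \<in> borel_measurable (G t)"
  using measurable_partial_dstop[OF assms, where k = "Suc n" and n = n] unfolding dstop_def[abs_def] grid_simps .

text \<open>The difference between y t and the discretely stopped value collects the increments over
  the cells that begin once \<sigma> has passed. Each is orthogonal to the weight if W becomes known
  as soon as \<sigma> has passed; W may depend on the future of earlier times.\<close>

lemma dstop_weighted:
  assumes y: "mart y" and \<sigma>: "stop \<sigma>" and t: "0 \<le> t" and W: "W \<in> borel_measurable Q" "\<And>\<omega>. \<bar>W \<omega>\<bar> \<le> b"
    and meas: "\<And>k. k \<le> n \<Longrightarrow> (\<lambda>\<omega>. W \<omega> * of_bool (\<sigma> \<omega> \<le> ennreal (grid n t k))) \<in> borel_measurable (G (grid n t k))"
  shows "(\<integral>\<omega>. W \<omega> * y t \<omega> \<partial>Q) = (\<integral>\<omega>. W \<omega> * dstop n t \<sigma> y \<omega> \<partial>Q)"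
    and "integrable Q (dstop n t \<sigma> y)"
proof -
  let ?g = "grid n t"
  let ?I = "\<lambda>k \<omega>. of_bool (\<sigma> \<omega> \<le> ennreal (?g k)) :: real"
  have bm: "integrable Q (\<lambda>\<omega>. U \<omega> * f \<omega>)" if "integrable Q f" "U \<in> borel_measurable Q" "\<And>\<omega>. \<bar>U \<omega>\<bar> \<le> c" for f U :: "'w \<Rightarrow> real" and c
  proof (rule Bochner_Integration.integrable_bound)
    show "integrable Q (\<lambda>\<omega>. c * \<bar>f \<omega>\<bar>)" using that by simp
    have "0 \<le> c" using that(3)[of undefined] by linarith
    then show "AE \<omega> in Q. norm (U \<omega> * f \<omega>) \<le> norm (c * \<bar>f \<omega>\<bar>)"
      using that(3) by (intro AE_I2) (auto simp: abs_mult intro!: mult_right_mono)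
  qed (use that in auto)
  have g0: "0 \<le> ?g k" for k using t by (rule grid_nonneg)
  have yi: "integrable Q (y (?g k))" for k by (rule mart_integrable[OF y g0])
  have WIQ: "(\<lambda>\<omega>. W \<omega> * ?I k \<omega>) \<in> borel_measurable Q" if "k \<le> n" for k
    using measurable_G[OF g0 meas[OF that]] .
  have b0: "0 \<le> b" using W(2)[of undefined] by linarith
  have WIb: "\<bar>W \<omega> * ?I k \<omega>\<bar> \<le> b" for k \<omega> using W(2)[of \<omega>] b0 by (auto simp: of_bool_def)
  have WIi: "integrable Q (\<lambda>\<omega>. W \<omega> * ?I k \<omega> * y (?g j) \<omega>)" if "k \<le> n" for j k
    by (rule bm[OF yi WIQ[OF that] WIb])
  have zero: "(\<integral>\<omega>. W \<omega> * ?I k \<omega> * (y (?g (Suc k)) \<omega> - y (?g k) \<omega>) \<partial>Q) = 0" if "k \<le> n" for k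
    using mart_weighted[OF y g0 grid_mono[OF t] meas[OF that] WIi[OF that], of "Suc k"] WIi[OF that]
    by (simp add: right_diff_distrib)
  have dQ: "dstop n t \<sigma> y \<in> borel_measurable Q"
    using measurable_G[OF t dstop_measurable[OF mart_measurable[OF y] \<sigma> t]] .
  \<comment> \<open>A cell contributes to the difference exactly if \<sigma> is at most its left
    end.\<close>
  have diff: "y t \<omega> - dstop n t \<sigma> y \<omega> = (\<Sum>k<Suc n. ?I k \<omega> * (y (?g (Suc k)) \<omega> - y (?g k) \<omega>))" for \<omega>
  proof -
    have "y t \<omega> = y 0 \<omega> + (\<Sum>k<Suc n. y (?g (Suc k)) \<omega> - y (?g k) \<omega>)"
      using sum_lessThan_telescope[of "\<lambda>k. y (?g k) \<omega>" "Suc n"] by (simp add: grid_simps del: sum.lessThan_Suc)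
    then have "y t \<omega> - dstop n t \<sigma> y \<omega> = (\<Sum>k<Suc n. (y (?g (Suc k)) \<omega> - y (?g k) \<omega>)
        - (if ennreal (?g k) < \<sigma> \<omega> then y (?g (Suc k)) \<omega> - y (?g k) \<omega> else 0))"
      unfolding dstop_def sum_subtractf by simp
    also have "\<dots> = (\<Sum>k<Suc n. ?I k \<omega> * (y (?g (Suc k)) \<omega> - y (?g k) \<omega>))"
      by (rule sum.cong) (auto simp: not_le[symmetric])
    finally show ?thesis .
  qed
  have yt: "integrable Q (y t)" by (rule mart_integrable[OF y t])
  have eq: "dstop n t \<sigma> y = (\<lambda>\<omega>. y t \<omega> - (\<Sum>k<Suc n. ?I k \<omega> * (y (?g (Suc k)) \<omega> - y (?g k) \<omega>)))"
    using diff by (auto simp: fun_eq_iff algebra_simps)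
  have IQ: "?I k \<in> borel_measurable Q" for k
  proof -
    have "{\<omega> \<in> space Q. \<sigma> \<omega> \<le> ennreal (?g k)} \<in> sets Q"
      using \<sigma> g0[of k] sets_G[OF g0] unfolding stop_def by blast
    then have "Measurable.pred Q (\<lambda>\<omega>. \<sigma> \<omega> \<le> ennreal (?g k))" by (simp add: pred_def)
    then show ?thesis by measurable
  qed
  show int: "integrable Q (dstop n t \<sigma> y)"
    unfolding eq
    by (intro Bochner_Integration.integrable_diff Bochner_Integration.integrable_sum yt bm[OF _ IQ, of _ _ 1] yi) auto
  have "(\<integral>\<omega>. W \<omega> * y t \<omega> \<partial>Q) - (\<integral>\<omega>. W \<omega> * dstop n t \<sigma> y \<omega> \<partial>Q)
      = (\<integral>\<omega>. W \<omega> * y t \<omega> - W \<omega> * dstop n t \<sigma> y \<omega> \<partial>Q)"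
    by (rule Bochner_Integration.integral_diff[symmetric]) (rule bm[OF yt W] bm[OF int W])+
  also have "\<dots> = (\<integral>\<omega>. (\<Sum>k<Suc n. W \<omega> * ?I k \<omega> * (y (?g (Suc k)) \<omega> - y (?g k) \<omega>)) \<partial>Q)"
    unfolding right_diff_distrib[symmetric] diff sum_distrib_left mult.assoc ..
  also have "\<dots> = (\<Sum>k<Suc n. \<integral>\<omega>. W \<omega> * ?I k \<omega> * (y (?g (Suc k)) \<omega> - y (?g k) \<omega>) \<partial>Q)"
  proof (rule Bochner_Integration.integral_sum)
    fix k assume "k \<in> {..<Suc n}"
    then have "k \<le> n" by simp
    then show "integrable Q (\<lambda>\<omega>. W \<omega> * ?I k \<omega> * (y (?g (Suc k)) \<omega> - y (?g k) \<omega>))"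
      unfolding right_diff_distrib by (intro Bochner_Integration.integrable_diff WIi)
  qed
  also have "\<dots> = 0" using zero by (intro sum.neutral) auto
  finally show "(\<integral>\<omega>. W \<omega> * y t \<omega> \<partial>Q) = (\<integral>\<omega>. W \<omega> * dstop n t \<sigma> y \<omega> \<partial>Q)" by simp
qed

end

locale complete_filtered_prob_space = filtered_prob_space Q G for Q :: "'w measure" and G +
  assumes complete: "\<And>A B. B \<in> null_sets Q \<Longrightarrow> A \<subseteq> B \<Longrightarrow> A \<in> sets (G 0)"
begin

text \<open>Paths are regular only almost surely, so stopped values are limits only off a null set;
  completeness at time 0 keeps them adapted nevertheless.\<close>

lemma measurable_AE_eq:
  fixes f g :: "'w \<Rightarrow> real"
  assumes "0 \<le> t" and f: "f \<in> borel_measurable (G t)" and eq: "AE \<omega> in Q. f \<omega> = g \<omega>"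
  shows "g \<in> borel_measurable (G t)"
proof (rule borel_measurableI)
  fix U :: "real set" assume U: "open U"
  obtain N where N: "{\<omega> \<in> space Q. f \<omega> \<noteq> g \<omega>} \<subseteq> N" "N \<in> null_sets Q"
    using eq by (auto elim!: AE_E intro: null_setsI)
  have sub: "A \<in> sets (G t)" if "A \<subseteq> N" for A
    using complete[OF N(2) that] G_mono[of 0 t] assms(1) by auto
  have "f -` U \<inter> space (G t) \<in> sets (G t)" using f U by (auto intro: measurable_sets)
  then have "(f -` U \<inter> space (G t) - N) \<union> (g -` U \<inter> space (G t) \<inter> N) \<in> sets (G t)"
    using sub[of N] sub[of "g -` U \<inter> space (G t) \<inter> N"] by auto
  also have "(f -` U \<inter> space (G t) - N) \<union> (g -` U \<inter> space (G t) \<inter> N) = g -` U \<inter> space (G t)"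
    using N(1) assms(1) by (auto simp: space_G)
  finally show "g -` U \<inter> space (G t) \<in> sets (G t)" .
qed

lemma measurable_AE_limit:
  fixes g :: "'w \<Rightarrow> real"
  assumes t: "0 \<le> t" and h: "\<And>n. h n \<in> borel_measurable (G t)" and lim: "AE \<omega> in Q. (\<lambda>n. h n \<omega>) \<longlonglongrightarrow> g \<omega>"
  shows "g \<in> borel_measurable (G t)"
proof (rule measurable_AE_eq[OF t])
  show "(\<lambda>\<omega>. lim (\<lambda>n. h n \<omega>)) \<in> borel_measurable (G t)" using h by (rule borel_measurable_lim_metric)
  show "AE \<omega> in Q. lim (\<lambda>n. h n \<omega>) = g \<omega>" using lim by eventually_elim (rule limI)
qed

lemma stopped_measurable:
  assumes "\<And>r. 0 \<le> r \<Longrightarrow> y r \<in> borel_measurable (G r)" and "AE \<omega> in Q. cadlag (\<lambda>t. y t \<omega>)" and "stop \<sigma>" "0 \<le> t"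
  shows "stopped \<sigma> y t \<in> borel_measurable (G t)"
proof (rule measurable_AE_limit[OF assms(4) dstop_measurable[OF assms(1,3,4)]])
  show "AE \<omega> in Q. (\<lambda>n. dstop n t \<sigma> y \<omega>) \<longlonglongrightarrow> stopped \<sigma> y t \<omega>"
    using assms(2) by eventually_elim (rule dstop_tendsto[OF assms(4)])
qed

text \<open>The weight V t is a value at the final time, but it is frozen once \<sigma> has passed,
  which is all that the discrete argument asks for. Doob's maximal function dominates the discretely
  stopped values in the passage to the limit.\<close>

lemma optional_stopping_square_integrable:
  assumes y: "mart y" and sq: "\<And>t. 0 \<le> t \<Longrightarrow> integrable Q (\<lambda>\<omega>. (y t \<omega>)\<^sup>2)"
    and cad: "AE \<omega> in Q. cadlag (\<lambda>t. y t \<omega>)" and \<sigma>: "stop \<sigma>" and st: "0 \<le> s" "s \<le> t" and A: "A \<in> sets (G s)"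
    and V: "\<And>r. 0 \<le> r \<Longrightarrow> V r \<in> borel_measurable (G r)" "\<And>r \<omega>. \<bar>V r \<omega>\<bar> \<le> b"
      "\<And>r \<omega>. 0 \<le> r \<Longrightarrow> r \<le> t \<Longrightarrow> \<sigma> \<omega> \<le> ennreal r \<Longrightarrow> V t \<omega> = V r \<omega>"
  defines "C \<equiv> A \<inter> {\<omega> \<in> space Q. ennreal s < \<sigma> \<omega>}"
  shows "(\<integral>\<omega>. indicator C \<omega> * V t \<omega> * y t \<omega> \<partial>Q) = (\<integral>\<omega>. indicator C \<omega> * V t \<omega> * stopped \<sigma> y t \<omega> \<partial>Q)"
proof -
  have t: "0 \<le> t" using st by simp
  have C: "C \<in> sets (G s)" unfolding C_def using A stop_greater[OF \<sigma> st(1) order_refl] by blast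
  have CQ: "C \<in> sets Q" using sets_G[OF st(1) C] .
  let ?W = "\<lambda>\<omega>. indicator C \<omega> * V t \<omega>"
  have WQ: "?W \<in> borel_measurable Q"
    using CQ measurable_G[OF t V(1)[OF t]] by (intro borel_measurable_times) auto
  have b0: "0 \<le> b" using V(2)[of 0 undefined] by linarith
  have Wb: "\<bar>?W \<omega>\<bar> \<le> b" for \<omega> using V(2)[of t \<omega>] b0 by (auto simp: indicator_def)
  have meas: "(\<lambda>\<omega>. ?W \<omega> * of_bool (\<sigma> \<omega> \<le> ennreal (grid n t k))) \<in> borel_measurable (G (grid n t k))" if k: "k \<le> n" for n k
  proof (cases "grid n t k \<le> s")
    case True
    \<comment> \<open>On \<open>C\<close> the time \<sigma> exceeds s, so it has not passed any grid
      point up to s, where membership in A need not yet be known.\<close>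
    have zero: "?W \<omega> * of_bool (\<sigma> \<omega> \<le> ennreal (grid n t k)) = 0" for \<omega>
      using True by (auto simp: C_def indicator_def dest: order_trans[OF _ ennreal_leI])
    show ?thesis unfolding zero by simp
  next
    case False
    let ?r = "grid n t k"
    have r: "0 \<le> ?r" "?r \<le> t" "s \<le> ?r" using False t k by (auto intro: grid_nonneg grid_le)
    have eq: "?W \<omega> * of_bool (\<sigma> \<omega> \<le> ennreal ?r) = indicator C \<omega> * V ?r \<omega> * of_bool (\<sigma> \<omega> \<le> ennreal ?r)" for \<omega>
      using V(3)[OF r(1,2)] by (auto simp: of_bool_def)
    have [measurable]: "C \<in> sets (G ?r)" using C G_mono[OF st(1) r(3)] by blast
    have [measurable]: "Measurable.pred (G ?r) (\<lambda>\<omega>. \<sigma> \<omega> \<le> ennreal ?r)"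
      using stop_le[OF \<sigma> r(1) order_refl] r(1) by (simp add: pred_def space_G)
    note V(1)[OF r(1), measurable]
    show ?thesis unfolding eq by measurable
  qed
  obtain S where S: "S \<in> borel_measurable Q" "integrable Q (\<lambda>\<omega>. (S \<omega>)\<^sup>2)"
    and Sb: "AE \<omega> in Q. \<forall>r. 0 \<le> r \<longrightarrow> r \<le> t \<longrightarrow> \<bar>y r \<omega>\<bar> \<le> S \<omega>"
    by (rule doob_sup_all[OF y _ cad t], erule sq, rule that)
  have Sint: "integrable Q S" by (rule square_integrable_imp_integrable[OF S])
  have dQ: "dstop n t \<sigma> y \<in> borel_measurable Q" for n
    using measurable_G[OF t dstop_measurable[OF mart_measurable[OF y] \<sigma> t]] .
  have sQ: "stopped \<sigma> y t \<in> borel_measurable Q"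
    using measurable_G[OF t stopped_measurable[OF mart_measurable[OF y] cad \<sigma> t]] .
  have "(\<lambda>n. \<integral>\<omega>. ?W \<omega> * dstop n t \<sigma> y \<omega> \<partial>Q) \<longlonglongrightarrow> (\<integral>\<omega>. ?W \<omega> * stopped \<sigma> y t \<omega> \<partial>Q)"
  proof (rule integral_dominated_convergence[where w = "\<lambda>\<omega>. b * S \<omega>"])
    show "AE \<omega> in Q. (\<lambda>n. ?W \<omega> * dstop n t \<sigma> y \<omega>) \<longlonglongrightarrow> ?W \<omega> * stopped \<sigma> y t \<omega>"
      using cad by eventually_elim (intro tendsto_mult_left dstop_tendsto[OF t])
    show "AE \<omega> in Q. norm (?W \<omega> * dstop n t \<sigma> y \<omega>) \<le> b * S \<omega>" for n
      using Sb
    proof eventually_elim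
      case (elim \<omega>)
      have "\<bar>dstop n t \<sigma> y \<omega>\<bar> \<le> S \<omega>"
      proof (cases "t = 0")
        case True
        then have "dstop n t \<sigma> y \<omega> = y 0 \<omega>" by (simp add: dstop_def grid_def)
        then show ?thesis using elim t by auto
      next
        case False
        then have "0 < t" using t by simp
        from dstop_eq[OF this, of n \<sigma> y \<omega>] obtain r where "dstop n t \<sigma> y \<omega> = y r \<omega>" "r \<le> t"
          "enn2real (min (ennreal t) (\<sigma> \<omega>)) \<le> r" by metis
        then show ?thesis using elim enn2real_nonneg[of "min (ennreal t) (\<sigma> \<omega>)"] by (metis order_trans)
      qed
      then show ?case unfolding real_norm_def abs_mult[of "?W \<omega>"] using Wb[of \<omega>] b0 by (intro mult_mono) auto
    qed
  qed (use Sint WQ dQ sQ in \<open>auto intro!: borel_measurable_times\<close>)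
  moreover have "(\<integral>\<omega>. ?W \<omega> * dstop n t \<sigma> y \<omega> \<partial>Q) = (\<integral>\<omega>. ?W \<omega> * y t \<omega> \<partial>Q)" for n
    by (rule dstop_weighted(1)[OF y \<sigma> t WQ Wb meas, symmetric])
  ultimately show ?thesis by (simp add: LIMSEQ_const_iff)
qed

text \<open>An \<open>L\<^sup>1\<close>-martingale need not be dominated, but if the stopped process is bounded by \<open>N\<close> then it suffices to
  work on the event that the discretized stopped process is at most \<open>N + 1\<close>.\<close>

lemma optional_stopping_bounded:
  assumes z: "mart z" and cad: "AE \<omega> in Q. cadlag (\<lambda>t. z t \<omega>)" and \<sigma>: "stop \<sigma>"
    and N: "0 \<le> N" "AE \<omega> in Q. 0 < \<sigma> \<omega> \<longrightarrow> \<bar>stopped \<sigma> z t \<omega>\<bar> \<le> N"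
    and st: "0 \<le> s" "s \<le> t" and A: "A \<in> sets (G s)"
  defines "C \<equiv> A \<inter> {\<omega> \<in> space Q. ennreal s < \<sigma> \<omega>}"
  shows "(\<integral>\<omega>. indicator C \<omega> * z t \<omega> \<partial>Q) = (\<integral>\<omega>. indicator C \<omega> * stopped \<sigma> z t \<omega> \<partial>Q)"
proof -
  have t: "0 \<le> t" using st by simp
  have C: "C \<in> sets (G s)" unfolding C_def using A stop_greater[OF \<sigma> st(1) order_refl] by blast
  have CQ: "C \<in> sets Q" using sets_G[OF st(1) C] .
  have C_pos: "0 < \<sigma> \<omega>" if "\<omega> \<in> C" for \<omega> using that le_less_trans[of 0 "ennreal s" "\<sigma> \<omega>"] by (auto simp: C_def)
  have dQ: "dstop n t \<sigma> z \<in> borel_measurable Q" for n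
    using measurable_G[OF t dstop_measurable[OF mart_measurable[OF z] \<sigma> t]] .
  have sQ: "stopped \<sigma> z t \<in> borel_measurable Q"
    using measurable_G[OF t stopped_measurable[OF mart_measurable[OF z] cad \<sigma> t]] .
  have zQ: "integrable Q (z t)" by (rule mart_integrable[OF z t])
  \<comment> \<open>The margin 1 matters: where the stopped value is at most N, convergence brings
    the discretised values below N + 1 eventually, so the truncation disappears in the
    limit.\<close>
  define W where "W n \<omega> = indicator C \<omega> * (of_bool (\<bar>dstop n t \<sigma> z \<omega>\<bar> \<le> N + 1) :: real)" for n \<omega>
  have WQ: "W n \<in> borel_measurable Q" for n
    unfolding W_def[abs_def] using CQ dQ[of n] by measurable
  have Wb: "\<bar>W n \<omega>\<bar> \<le> 1" for n \<omega> by (auto simp: W_def indicator_def)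
  have meas: "(\<lambda>\<omega>. W n \<omega> * of_bool (\<sigma> \<omega> \<le> ennreal (grid n t k))) \<in> borel_measurable (G (grid n t k))" if k: "k \<le> n" for n k
  proof (cases "grid n t k \<le> s")
    case True
    have zero: "W n \<omega> * of_bool (\<sigma> \<omega> \<le> ennreal (grid n t k)) = 0" for \<omega>
      using True by (auto simp: W_def C_def indicator_def dest: order_trans[OF _ ennreal_leI])
    show ?thesis unfolding zero by simp
  next
    case False
    let ?r = "grid n t k"
    have r: "0 \<le> ?r" "?r \<le> t" "s \<le> ?r" using False t k by (auto intro: grid_nonneg grid_le)
    let ?p = "\<lambda>\<omega>. z 0 \<omega> + (\<Sum>j<k. if ennreal (grid n t j) < \<sigma> \<omega> then z (grid n t (Suc j)) \<omega> - z (grid n t j) \<omega> else 0)"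
    have p: "?p \<in> borel_measurable (G ?r)" by (rule measurable_partial_dstop[OF mart_measurable[OF z] \<sigma> t])
    \<comment> \<open>Once \<sigma> has passed the k-th grid point, the later terms vanish and the
      partial sum, known at that point, is already the final value. So the truncation is known there
      too.\<close>
    have "dstop n t \<sigma> z \<omega> = ?p \<omega>" if "\<sigma> \<omega> \<le> ennreal ?r" for \<omega>
    proof -
      have "\<not> ennreal (grid n t j) < \<sigma> \<omega>" if "k \<le> j" for j
        using order_trans[OF \<open>\<sigma> \<omega> \<le> ennreal ?r\<close> ennreal_leI[OF grid_mono[OF t that]]] by (simp add: not_less)
      then show ?thesis
        unfolding dstop_def using k by (intro arg_cong2[where f = "(+)"] refl sum.mono_neutral_right) auto
    qed
    then have eq: "W n \<omega> * of_bool (\<sigma> \<omega> \<le> ennreal ?r) = indicator C \<omega> * of_bool (\<bar>?p \<omega>\<bar> \<le> N + 1) * of_bool (\<sigma> \<omega> \<le> ennreal ?r)" for \<omega>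
      by (auto simp: W_def)
    have [measurable]: "C \<in> sets (G ?r)" using C G_mono[OF st(1) r(3)] by blast
    have [measurable]: "Measurable.pred (G ?r) (\<lambda>\<omega>. \<sigma> \<omega> \<le> ennreal ?r)"
      using stop_le[OF \<sigma> r(1) order_refl] r(1) by (simp add: pred_def space_G)
    have [measurable]: "Measurable.pred (G ?r) (\<lambda>\<omega>. \<bar>?p \<omega>\<bar> \<le> N + 1)" using p by measurable
    show ?thesis unfolding eq by measurable
  qed
  have conv: "AE \<omega> in Q. (\<lambda>n. W n \<omega>) \<longlonglongrightarrow> indicator C \<omega> \<and> (\<lambda>n. W n \<omega> * dstop n t \<sigma> z \<omega>) \<longlonglongrightarrow> indicator C \<omega> * stopped \<sigma> z t \<omega>"
    using cad N(2)
  proof eventually_elim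
    case (elim \<omega>)
    have lim: "(\<lambda>n. dstop n t \<sigma> z \<omega>) \<longlonglongrightarrow> stopped \<sigma> z t \<omega>"
      using dstop_tendsto[where y = z and \<omega> = \<omega>, OF t elim(1)] .
    have W: "(\<lambda>n. W n \<omega>) \<longlonglongrightarrow> indicator C \<omega>"
    proof (cases "\<omega> \<in> C")
      case True
      have "\<bar>stopped \<sigma> z t \<omega>\<bar> < N + 1" using elim(2) C_pos[OF True] by simp
      then have "\<forall>\<^sub>F n in sequentially. \<bar>dstop n t \<sigma> z \<omega>\<bar> < N + 1"
        using order_tendstoD(2)[OF tendsto_rabs[OF lim]] by blast
      then have "\<forall>\<^sub>F n in sequentially. W n \<omega> = indicator C \<omega>" by eventually_elim (simp add: W_def)
      then show ?thesis by (rule tendsto_eventually)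
    qed (simp add: W_def)
    show ?case using W tendsto_mult[OF W lim] by simp
  qed
  have "(\<lambda>n. \<integral>\<omega>. W n \<omega> * z t \<omega> \<partial>Q) \<longlonglongrightarrow> (\<integral>\<omega>. indicator C \<omega> * z t \<omega> \<partial>Q)"
  proof (rule integral_dominated_convergence[where w = "\<lambda>\<omega>. \<bar>z t \<omega>\<bar>"])
    show "AE \<omega> in Q. (\<lambda>n. W n \<omega> * z t \<omega>) \<longlonglongrightarrow> indicator C \<omega> * z t \<omega>"
      using conv by eventually_elim (intro tendsto_mult_right, blast)
    show "AE \<omega> in Q. norm (W n \<omega> * z t \<omega>) \<le> \<bar>z t \<omega>\<bar>" for n
      using Wb by (intro AE_I2) (auto simp: abs_mult intro!: mult_left_le_one_le)
  qed (use zQ WQ CQ in \<open>auto intro!: borel_measurable_times\<close>)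
  moreover have "(\<lambda>n. \<integral>\<omega>. W n \<omega> * dstop n t \<sigma> z \<omega> \<partial>Q) \<longlonglongrightarrow> (\<integral>\<omega>. indicator C \<omega> * stopped \<sigma> z t \<omega> \<partial>Q)"
  proof (rule integral_dominated_convergence[where w = "\<lambda>\<omega>. N + 1"])
    show "AE \<omega> in Q. (\<lambda>n. W n \<omega> * dstop n t \<sigma> z \<omega>) \<longlonglongrightarrow> indicator C \<omega> * stopped \<sigma> z t \<omega>"
      using conv by eventually_elim blast
    show "AE \<omega> in Q. norm (W n \<omega> * dstop n t \<sigma> z \<omega>) \<le> N + 1" for n
      using N(1) by (intro AE_I2) (auto simp: W_def indicator_def)
  qed (use WQ CQ dQ sQ in \<open>auto intro!: borel_measurable_times\<close>)
  moreover have "(\<integral>\<omega>. W n \<omega> * z t \<omega> \<partial>Q) = (\<integral>\<omega>. W n \<omega> * dstop n t \<sigma> z \<omega> \<partial>Q)" for n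
    by (rule dstop_weighted(1)[OF z \<sigma> t WQ Wb meas])
  ultimately show ?thesis by (simp add: LIMSEQ_unique)
qed

end

section \<open>Localisation and products with continuous local martingales\<close>

lemma stopped_const: "0 \<le> r \<Longrightarrow> r \<le> t \<Longrightarrow> \<sigma> \<omega> \<le> ennreal r \<Longrightarrow> stopped \<sigma> f t \<omega> = stopped \<sigma> f r \<omega>"
  by (simp add: stopped_def min_absorb2 order_trans[OF _ ennreal_leI])

lemma stopped_before: "0 \<le> s \<Longrightarrow> ennreal s < \<sigma> \<omega> \<Longrightarrow> stopped \<sigma> f s \<omega> = f s \<omega>"
  by (simp add: stopped_def min_absorb1 less_imp_le)

lemma stopped_stopped:
  assumes "0 \<le> t"
  shows "stopped \<eta> (stopped \<tau> f) t \<omega> = stopped (\<lambda>\<omega>. min (\<tau> \<omega>) (\<eta> \<omega>)) f t \<omega>"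
  unfolding stopped_def ennreal_enn2real_min by (simp add: min.assoc min.commute[of "\<eta> \<omega>"])

lemma cadlag_mult: "cadlag f \<Longrightarrow> cadlag g \<Longrightarrow> cadlag (\<lambda>t. f t * g t)"
  unfolding cadlag_def by (blast intro: tendsto_mult)

lemma cadlag_diff: "cadlag f \<Longrightarrow> cadlag g \<Longrightarrow> cadlag (\<lambda>t. f t - g t)"
  unfolding cadlag_def by (blast intro: tendsto_diff)

lemma clamp_eq: "\<bar>x\<bar> \<le> N \<Longrightarrow> max (- N) (min N x) = (x::real)"
  by (auto simp: abs_le_iff max_def min_def)

lemma clamp_bound: "0 \<le> N \<Longrightarrow> \<bar>max (- N) (min N x)\<bar> \<le> (N::real)"
  by (auto simp: max_def min_def abs_le_iff)

context complete_filtered_prob_space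
begin

text \<open>For almost every sample point the localising times eventually exceed t, so the stopped
  values at t are eventually equal to Z t.\<close>

lemma local_martingale_measurable:
  assumes Z: "local_martingale Q G Z" and t: "0 \<le> t"
  shows "Z t \<in> borel_measurable (G t)"
proof -
  obtain \<tau> where \<tau>: "localizing_sequence Q G \<tau>" and m: "\<And>n. martingale Q G (stopped (\<tau> n) Z)"
    using Z unfolding local_martingale_def by blast
  show ?thesis
  proof (rule measurable_AE_limit[OF t, of "\<lambda>n. stopped (\<tau> n) Z t"])
    show "stopped (\<tau> n) Z t \<in> borel_measurable (G t)" for n using m[of n] t unfolding martingale_def by blast
    have "AE \<omega> in Q. (\<lambda>n. \<tau> n \<omega>) \<longlonglongrightarrow> \<infinity>" using \<tau> unfolding localizing_sequence_def by auto
    then show "AE \<omega> in Q. (\<lambda>n. stopped (\<tau> n) Z t \<omega>) \<longlonglongrightarrow> Z t \<omega>"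
    proof eventually_elim
      case (elim \<omega>)
      have "\<forall>\<^sub>F n in sequentially. ennreal t < \<tau> n \<omega>" using elim by (rule order_tendstoD(1)) simp
      then have "\<forall>\<^sub>F n in sequentially. stopped (\<tau> n) Z t \<omega> = Z t \<omega>"
        by eventually_elim (rule stopped_before[OF t])
      then show ?case by (rule tendsto_eventually)
    qed
  qed
qed

text \<open>The countable description of the exit event holds where the path is continuous; the
  exceptional null set is absorbed by completeness.\<close>

lemma stop_first_exit:
  assumes ad: "\<And>t. 0 \<le> t \<Longrightarrow> Z t \<in> borel_measurable (G t)" and cont: "AE \<omega> in Q. continuous_on {0..} (\<lambda>t. Z t \<omega>)"
  shows "stop (\<lambda>\<omega>. first_exit N (\<lambda>t. Z t \<omega>))"
  unfolding stop_def
proof (intro allI impI)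
  fix t :: real assume t: "0 \<le> t"
  let ?A = "{\<omega> \<in> space (G t). first_exit N (\<lambda>t. Z t \<omega>) \<le> ennreal t}"
  \<comment> \<open>The minimum with t makes every variable in the countable description known at
    time t, also for the indices k that the condition excludes.\<close>
  let ?E = "{\<omega> \<in> space (G t). \<forall>j. \<exists>n k. k \<le> 2 ^ n \<and> N - inverse (real (Suc j)) < \<bar>Z (min t (real k * t / 2 ^ n)) \<omega>\<bar>}"
  have [measurable]: "Z (min t (real k * t / 2 ^ n)) \<in> borel_measurable (G t)" for n k
    using t by (intro measurable_G_mono[OF _ _ ad]) auto
  have "?E \<in> sets (G t)" by measurable
  then have i: "indicator ?E \<in> borel_measurable (G t)" by (rule borel_measurable_indicator)
  have eq: "min t (real k * t / 2 ^ n) = real k * t / 2 ^ n" if "k \<le> 2 ^ n" for k n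
  proof -
    have "real k \<le> 2 ^ n" using that by (metis of_nat_le_iff of_nat_numeral of_nat_power)
    then have "real k * t \<le> 2 ^ n * t" using t by (intro mult_right_mono) auto
    then show ?thesis by (simp add: pos_divide_le_eq mult.commute min_absorb2)
  qed
  have "AE \<omega> in Q. (indicator ?E \<omega> :: real) = indicator ?A \<omega>"
    using cont
  proof eventually_elim
    case (elim \<omega>)
    have "(\<forall>j. \<exists>n k. k \<le> 2 ^ n \<and> N - inverse (real (Suc j)) < \<bar>Z (min t (real k * t / 2 ^ n)) \<omega>\<bar>)
      \<longleftrightarrow> first_exit N (\<lambda>t. Z t \<omega>) \<le> ennreal t"
      unfolding first_exit_le_iff_dyadic[OF elim t] using eq by metis
    then show ?case by (auto simp: indicator_def)
  qed
  from measurable_AE_eq[OF t i this] have "?A \<inter> space (G t) \<in> sets (G t)"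
    by (simp add: borel_measurable_indicator_iff)
  moreover have "?A \<inter> space (G t) = {\<omega> \<in> space Q. first_exit N (\<lambda>t. Z t \<omega>) \<le> ennreal t}" using t by (auto simp: space_G)
  ultimately show "{\<omega> \<in> space Q. first_exit N (\<lambda>t. Z t \<omega>) \<le> ennreal t} \<in> sets (G t)" by simp
qed

text \<open>A process stopped at \<sigma> does not move after \<sigma>, so its martingale property
  from s onwards has to be checked only where s < \<sigma>.\<close>

lemma integral_indicator_split:
  fixes f g :: "'w \<Rightarrow> real"
  assumes A: "A \<in> sets Q" and C: "A \<inter> {\<omega> \<in> space Q. ennreal s < \<sigma> \<omega>} \<in> sets Q" and f: "integrable Q f" and g: "integrable Q g"
    and eq: "\<And>\<omega>. \<sigma> \<omega> \<le> ennreal s \<Longrightarrow> f \<omega> = g \<omega>"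
    and C_eq: "(\<integral>\<omega>. indicator (A \<inter> {\<omega> \<in> space Q. ennreal s < \<sigma> \<omega>}) \<omega> * f \<omega> \<partial>Q)
      = (\<integral>\<omega>. indicator (A \<inter> {\<omega> \<in> space Q. ennreal s < \<sigma> \<omega>}) \<omega> * g \<omega> \<partial>Q)"
  shows "(\<integral>\<omega>. indicator A \<omega> * f \<omega> \<partial>Q) = (\<integral>\<omega>. indicator A \<omega> * g \<omega> \<partial>Q)"
proof -
  let ?C = "A \<inter> {\<omega> \<in> space Q. ennreal s < \<sigma> \<omega>}"
  have i: "integrable Q (\<lambda>\<omega>. indicator B \<omega> * h \<omega>)" if "B \<in> sets Q" "integrable Q h" for B and h :: "'w \<Rightarrow> real"
    using integrable_mult_indicator[OF that] by simp
  have "(\<integral>\<omega>. indicator A \<omega> * f \<omega> \<partial>Q) - (\<integral>\<omega>. indicator A \<omega> * g \<omega> \<partial>Q)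
      = (\<integral>\<omega>. indicator A \<omega> * f \<omega> - indicator A \<omega> * g \<omega> \<partial>Q)"
    by (rule Bochner_Integration.integral_diff[symmetric]) (intro i A f g)+
  also have "\<dots> = (\<integral>\<omega>. indicator ?C \<omega> * f \<omega> - indicator ?C \<omega> * g \<omega> \<partial>Q)"
    using eq by (intro Bochner_Integration.integral_cong) (auto simp: indicator_def not_less[symmetric])
  also have "\<dots> = 0"
    using C_eq by (subst Bochner_Integration.integral_diff) (auto intro!: i C f g)
  finally show ?thesis by simp
qed

text \<open>Localisation by the given sequence and by exit from [-n, n] bounds Z, except when Z
  starts outside this interval. In that case \<sigma> = 0 and the stopped product is 0 because y
  starts at 0, so the stopped Z may be clamped without changing the product.\<close>

theorem product_local_martingale:
  assumes y: "mart y" and sq: "\<And>t. 0 \<le> t \<Longrightarrow> integrable Q (\<lambda>\<omega>. (y t \<omega>)\<^sup>2)"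
    and cad: "AE \<omega> in Q. cadlag (\<lambda>t. y t \<omega>)" and small: "vanishing_small_increments y"
    and y0: "\<And>\<omega>. y 0 \<omega> = 0" and Z: "continuous_local_martingale Q G Z"
  shows "local_martingale Q G (\<lambda>t \<omega>. y t \<omega> * Z t \<omega>)"
proof -
  have lm: "local_martingale Q G Z" and cont: "AE \<omega> in Q. continuous_on {0..} (\<lambda>t. Z t \<omega>)"
    using Z unfolding continuous_local_martingale_def by auto
  then obtain \<tau> where \<tau>: "localizing_sequence Q G \<tau>" and m: "\<And>n. martingale Q G (stopped (\<tau> n) Z)"
    unfolding local_martingale_def by blast
  have stop\<tau>: "stop (\<tau> n)" for n
    using \<tau> unfolding localizing_sequence_def stopping_time_iff by blast
  have AE\<tau>: "AE \<omega> in Q. incseq (\<lambda>n. \<tau> n \<omega>) \<and> (\<lambda>n. \<tau> n \<omega>) \<longlonglongrightarrow> \<infinity>"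
    using \<tau> unfolding localizing_sequence_def by blast
  have Zad: "Z t \<in> borel_measurable (G t)" if "0 \<le> t" for t
    using local_martingale_measurable[OF lm that] .
  have Zcad: "AE \<omega> in Q. cadlag (\<lambda>t. Z t \<omega>)" using cont by eventually_elim (rule continuous_imp_cadlag)
  define H where "H n \<omega> = first_exit (real n) (\<lambda>t. Z t \<omega>)" for n \<omega>
  have stopH: "stop (H n)" for n unfolding H_def by (rule stop_first_exit[OF Zad cont])
  define \<sigma> where "\<sigma> n \<omega> = min (\<tau> n \<omega>) (H n \<omega>)" for n \<omega>
  have stop\<sigma>: "stop (\<sigma> n)" for n unfolding \<sigma>_def by (rule stop_min[OF stop\<tau> stopH])
  have loc: "localizing_sequence Q G \<sigma>"
    unfolding localizing_sequence_def stopping_time_iff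
  proof (intro conjI allI stop\<sigma>)
    show "AE \<omega> in Q. incseq (\<lambda>n. \<sigma> n \<omega>) \<and> (\<lambda>n. \<sigma> n \<omega>) \<longlonglongrightarrow> \<infinity>"
      using AE\<tau> cont
    proof eventually_elim
      case (elim \<omega>)
      have "incseq (\<lambda>n. \<sigma> n \<omega>)"
      proof (rule incseq_SucI)
        fix n
        have "\<tau> n \<omega> \<le> \<tau> (Suc n) \<omega>" using elim(1) by (auto dest: incseq_SucD)
        moreover have "H n \<omega> \<le> H (Suc n) \<omega>" unfolding H_def by (rule first_exit_mono) simp
        ultimately show "\<sigma> n \<omega> \<le> \<sigma> (Suc n) \<omega>" unfolding \<sigma>_def by (rule min.mono)
      qed
      moreover have "(\<lambda>n. \<sigma> n \<omega>) \<longlonglongrightarrow> \<infinity>"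
      proof (rule order_tendstoI)
        fix a :: ennreal assume "a < \<infinity>"
        then obtain T where T: "0 \<le> T" "a = ennreal T" by (cases a rule: ennreal_cases) auto
        have "continuous_on {0..T} (\<lambda>t. \<bar>Z t \<omega>\<bar>)"
          using elim(2) by (intro continuous_on_rabs) (auto intro: continuous_on_subset)
        then obtain r where r: "\<forall>t\<in>{0..T}. \<bar>Z t \<omega>\<bar> \<le> \<bar>Z r \<omega>\<bar>"
          using continuous_attains_sup[of "{0..T}" "\<lambda>t. \<bar>Z t \<omega>\<bar>"] T(1) by fastforce
        obtain n0 :: nat where n0: "\<bar>Z r \<omega>\<bar> < real n0" using reals_Archimedean2 by blast
        have "a < H n \<omega>" if "n0 \<le> n" for n
        proof -
          have "real n0 \<le> real n" using that by simp
          then show ?thesis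
            unfolding H_def T(2) using r n0 by (intro first_exit_gt[OF elim(2) T(1)]) force
        qed
        then have "\<forall>\<^sub>F n in sequentially. a < H n \<omega>" unfolding eventually_sequentially by blast
        moreover have "\<forall>\<^sub>F n in sequentially. a < \<tau> n \<omega>"
          using elim(1) \<open>a < \<infinity>\<close> by (auto intro: order_tendstoD(1))
        ultimately show "\<forall>\<^sub>F n in sequentially. a < \<sigma> n \<omega>"
          by eventually_elim (simp add: \<sigma>_def)
      qed (simp)
      ultimately show ?case by blast
    qed
  qed
  have "martingale Q G (stopped (\<sigma> n) (\<lambda>t \<omega>. y t \<omega> * Z t \<omega>))" for n
  proof -
    let ?N = "real n"
    define z where "z = stopped (\<tau> n) Z"
    define U where "U = stopped (\<sigma> n) y"
    define D where "D = stopped (\<sigma> n) Z"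
    \<comment> \<open>The clamped process is bounded everywhere, as
      \<open>bounded_continuous_product\<close> requires, and agrees with the stopped process on the
      event 0 < \<sigma>.\<close>
    define V where "V t \<omega> = max (- ?N) (min ?N (D t \<omega>))" for t \<omega>
    have z: "mart z" "AE \<omega> in Q. cadlag (\<lambda>t. z t \<omega>)"
      using m[of n] unfolding mart_iff z_def by auto
    \<comment> \<open>Only \<open>z\<close>, stopped at the localising time, is known to be a true
      martingale; so stopping at \<sigma> is read as stopping \<open>z\<close> once more at the exit
      time, where optional stopping with a bounded stopped value applies.\<close>
    have D_z: "stopped (H n) z t \<omega> = D t \<omega>" if "0 \<le> t" for t \<omega>
      unfolding z_def D_def \<sigma>_def by (rule stopped_stopped[OF that])
    have D_bound: "AE \<omega> in Q. 0 < H n \<omega> \<longrightarrow> (\<forall>t\<ge>0. \<bar>D t \<omega>\<bar> \<le> ?N)"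
      using cont
    proof eventually_elim
      case (elim \<omega>)
      show ?case
      proof (intro impI allI)
        fix t :: real assume H: "0 < H n \<omega>" and t: "0 \<le> t"
        have "ennreal (enn2real (min (ennreal t) (\<sigma> n \<omega>))) \<le> H n \<omega>"
          unfolding ennreal_enn2real_min by (simp add: \<sigma>_def min.coboundedI2)
        then show "\<bar>D t \<omega>\<bar> \<le> ?N"
          using first_exit_bound[OF elim, of "enn2real (min (ennreal t) (\<sigma> n \<omega>))" ?N] H
          by (simp add: D_def stopped_def H_def)
      qed
    qed
    have VD: "AE \<omega> in Q. 0 < \<sigma> n \<omega> \<longrightarrow> (\<forall>t\<ge>0. V t \<omega> = D t \<omega>)"
      using D_bound
    proof eventually_elim
      case (elim \<omega>)
      then show ?case unfolding V_def using clamp_eq by (auto simp: \<sigma>_def)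
    qed
    have Vb: "\<bar>V t \<omega>\<bar> \<le> ?N" for t \<omega> unfolding V_def by (rule clamp_bound) simp
    have Dm: "D t \<in> borel_measurable (G t)" if "0 \<le> t" for t
      unfolding D_def by (rule stopped_measurable[OF Zad Zcad stop\<sigma> that])
    have Vm: "V t \<in> borel_measurable (G t)" if "0 \<le> t" for t
      unfolding V_def[abs_def] using Dm[OF that] by simp
    have Um: "U t \<in> borel_measurable (G t)" if "0 \<le> t" for t
      unfolding U_def by (rule stopped_measurable[OF mart_measurable[OF y] cad stop\<sigma> that])
    have VQ: "V t \<in> borel_measurable Q" and DQ: "D t \<in> borel_measurable Q" and UQ: "U t \<in> borel_measurable Q"
      if "0 \<le> t" for t
      using measurable_G[OF that] Vm[OF that] Dm[OF that] Um[OF that] by auto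
    have Vint: "integrable Q (V t)" if "0 \<le> t" for t by (rule integrable_bounded[OF VQ[OF that] Vb])
    have Vconst: "V t \<omega> = V r \<omega>" if "0 \<le> r" "r \<le> t" "\<sigma> n \<omega> \<le> ennreal r" for t r \<omega>
      unfolding V_def D_def by (simp only: stopped_const[of r t "\<sigma> n" \<omega> Z, OF that])
    define C where "C A s = A \<inter> {\<omega> \<in> space Q. ennreal s < \<sigma> n \<omega>}" for A s
    have CG: "C A s \<in> sets (G s)" if "0 \<le> s" "A \<in> sets (G s)" for A s
      unfolding C_def using that stop_greater[OF stop\<sigma> that(1) order_refl] by blast
    have C_pos: "0 < \<sigma> n \<omega>" "ennreal s < \<sigma> n \<omega>" if "\<omega> \<in> C A s" for \<omega> A s
      using that le_less_trans[of 0 "ennreal s" "\<sigma> n \<omega>"] by (auto simp: C_def)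
    have V: "mart V"
      unfolding mart_def
    proof (intro conjI allI impI Vm Vint)
      fix s t :: real and A assume st: "0 \<le> s" "s \<le> t" and A: "A \<in> sets (G s)"
      have t: "0 \<le> t" using st by simp
      have CQ: "C A s \<in> sets Q" using sets_G[OF st(1) CG[OF st(1) A]] .
      have AQ: "A \<in> sets Q" using sets_G[OF st(1) A] .
      have A': "A \<inter> {\<omega> \<in> space Q. ennreal s < \<tau> n \<omega>} \<in> sets (G s)"
        using A stop_greater[OF stop\<tau> st(1) order_refl] by blast
      have C': "A \<inter> {\<omega> \<in> space Q. ennreal s < \<tau> n \<omega>} \<inter> {\<omega> \<in> space Q. ennreal s < H n \<omega>} = C A s"
        by (auto simp: C_def \<sigma>_def)
      have zQ: "z r \<in> borel_measurable Q" if "0 \<le> r" for r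
        using mart_integrable[OF z(1) that] by (rule borel_measurable_integrable)
      have "(\<integral>\<omega>. indicator (C A s) \<omega> * V t \<omega> \<partial>Q) = (\<integral>\<omega>. indicator (C A s) \<omega> * stopped (H n) z t \<omega> \<partial>Q)"
      proof (rule integral_cong_AE)
        show "AE \<omega> in Q. indicator (C A s) \<omega> * V t \<omega> = indicator (C A s) \<omega> * stopped (H n) z t \<omega>"
          using VD by eventually_elim (use C_pos(1) t in \<open>auto simp: indicator_def D_z\<close>)
      next
        have "stopped (H n) z t = D t" by (rule ext) (rule D_z[OF t])
        then show "(\<lambda>\<omega>. indicator (C A s) \<omega> * stopped (H n) z t \<omega>) \<in> borel_measurable Q"
          using CQ DQ[OF t] by simp
      qed (use CQ VQ[OF t] in simp)
      also have "\<dots> = (\<integral>\<omega>. indicator (C A s) \<omega> * z t \<omega> \<partial>Q)"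
      proof -
        have "AE \<omega> in Q. 0 < H n \<omega> \<longrightarrow> \<bar>stopped (H n) z t \<omega>\<bar> \<le> ?N"
          using D_bound by eventually_elim (use t in \<open>simp add: D_z\<close>)
        from optional_stopping_bounded[OF z stopH _ this st A'] show ?thesis unfolding C' by simp
      qed
      also have "\<dots> = (\<integral>\<omega>. indicator (C A s) \<omega> * z s \<omega> \<partial>Q)"
        by (rule mart_eq[OF z(1) st CG[OF st(1) A]])
      also have "\<dots> = (\<integral>\<omega>. indicator (C A s) \<omega> * V s \<omega> \<partial>Q)"
      proof (rule integral_cong_AE)
        show "AE \<omega> in Q. indicator (C A s) \<omega> * z s \<omega> = indicator (C A s) \<omega> * V s \<omega>"
          using VD
        proof eventually_elim
          case (elim \<omega>)
          show ?case
          proof (cases "\<omega> \<in> C A s")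
            case True
            have "z s \<omega> = Z s \<omega>"
              unfolding z_def by (rule stopped_before[OF st(1)]) (use C_pos(2)[OF True] in \<open>simp add: \<sigma>_def\<close>)
            moreover have "D s \<omega> = Z s \<omega>"
              unfolding D_def by (rule stopped_before; rule st(1) C_pos(2)[OF True])
            ultimately show ?thesis using elim C_pos(1)[OF True] st(1) by simp
          qed simp
        qed
      qed (use CQ VQ[OF st(1)] zQ[OF st(1)] in simp_all)
      finally show "(\<integral>\<omega>. indicator A \<omega> * V t \<omega> \<partial>Q) = (\<integral>\<omega>. indicator A \<omega> * V s \<omega> \<partial>Q)"
        using Vconst[OF st] CQ by (intro integral_indicator_split[OF AQ _ Vint[OF t] Vint[OF st(1)], where \<sigma> = "\<sigma> n"])
          (auto simp: C_def)
    qed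
    have Vcont: "AE \<omega> in Q. continuous_on {0..} (\<lambda>t. V t \<omega>)"
      using cont
    proof eventually_elim
      case (elim \<omega>)
      have "continuous_on {0..} (\<lambda>t. D t \<omega>)" unfolding D_def by (rule continuous_on_stopped[of Z \<omega>, OF elim])
      then show ?case unfolding V_def by (intro continuous_intros)
    qed
    have prod: "(\<integral>\<omega>. indicator B \<omega> * (y t \<omega> * V t \<omega>) \<partial>Q) = (\<integral>\<omega>. indicator B \<omega> * (y s \<omega> * V s \<omega>) \<partial>Q)"
      if "0 \<le> s" "s \<le> t" "B \<in> sets (G s)" for s t B
      by (rule bounded_continuous_product[OF y _ small V _ Vcont that]) (use sq Vb in auto)
    define R where "R = stopped (\<sigma> n) (\<lambda>t \<omega>. y t \<omega> * Z t \<omega>)"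
    have R_eq: "R t \<omega> = U t \<omega> * D t \<omega>" for t \<omega> by (simp add: R_def U_def D_def stopped_def)
    have Rm: "R t \<in> borel_measurable (G t)" if "0 \<le> t" for t
      unfolding R_eq[abs_def] using Um[OF that] Dm[OF that] by (rule borel_measurable_times)
    have RQ: "R t \<in> borel_measurable Q" if "0 \<le> t" for t using measurable_G[OF that Rm[OF that]] .
    have R_UV: "AE \<omega> in Q. \<forall>t\<ge>0. R t \<omega> = V t \<omega> * U t \<omega>"
      using VD
    proof eventually_elim
      case (elim \<omega>)
      show ?case
      proof (cases "0 < \<sigma> n \<omega>")
        case True
        then show ?thesis using elim by (simp add: R_eq)
      next
        case False
        then have "\<sigma> n \<omega> = 0" by simp
        then have "U t \<omega> = 0" for t by (simp add: U_def stopped_def y0)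
        then show ?thesis by (simp add: R_eq)
      qed
    qed
    have Rint: "integrable Q (R t)" if t: "0 \<le> t" for t
    proof -
      obtain S where S: "S \<in> borel_measurable Q" "integrable Q (\<lambda>\<omega>. (S \<omega>)\<^sup>2)"
        and Sb: "AE \<omega> in Q. \<forall>r. 0 \<le> r \<longrightarrow> r \<le> t \<longrightarrow> \<bar>y r \<omega>\<bar> \<le> S \<omega>"
        by (rule doob_sup_all[OF y _ cad t], erule sq, rule that)
      have Sint: "integrable Q S" by (rule square_integrable_imp_integrable[OF S])
      show ?thesis
      proof (rule Bochner_Integration.integrable_bound)
        show "integrable Q (\<lambda>\<omega>. ?N * S \<omega>)" using Sint by simp
        show "AE \<omega> in Q. norm (R t \<omega>) \<le> norm (?N * S \<omega>)"
          using R_UV Sb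
        proof eventually_elim
          case (elim \<omega>)
          have "\<bar>U t \<omega>\<bar> \<le> S \<omega>"
            using elim(2) enn2real_min_bounds[OF t, of "\<sigma> n \<omega>"] by (simp add: U_def stopped_def)
          then have "\<bar>V t \<omega>\<bar> * \<bar>U t \<omega>\<bar> \<le> ?N * S \<omega>" using Vb[of t \<omega>] by (intro mult_mono) auto
          then have "\<bar>V t \<omega>\<bar> * \<bar>U t \<omega>\<bar> \<le> \<bar>?N * S \<omega>\<bar>" by (rule order_trans[OF _ abs_ge_self])
          then show ?case using elim(1) t by (simp add: abs_mult)
        qed
      qed (rule RQ[OF t])
    qed
    have "mart R"
      unfolding mart_def
    proof (intro conjI allI impI Rm Rint)
      fix s t :: real and A assume st: "0 \<le> s" "s \<le> t" and A: "A \<in> sets (G s)"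
      have t: "0 \<le> t" using st by simp
      have CQ: "C A s \<in> sets Q" using sets_G[OF st(1) CG[OF st(1) A]] .
      have AQ: "A \<in> sets Q" using sets_G[OF st(1) A] .
      have yQ: "y r \<in> borel_measurable Q" if "0 \<le> r" for r
        using mart_integrable[OF y that] by (rule borel_measurable_integrable)
      have Rconst: "R t \<omega> = R s \<omega>" if "\<sigma> n \<omega> \<le> ennreal s" for \<omega>
        unfolding R_def by (rule stopped_const; rule st that)
      have "(\<integral>\<omega>. indicator (C A s) \<omega> * R t \<omega> \<partial>Q) = (\<integral>\<omega>. indicator (C A s) \<omega> * V t \<omega> * U t \<omega> \<partial>Q)"
      proof (rule integral_cong_AE)
        show "AE \<omega> in Q. indicator (C A s) \<omega> * R t \<omega> = indicator (C A s) \<omega> * V t \<omega> * U t \<omega>"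
          using R_UV by eventually_elim (use t in simp)
      qed (use CQ VQ[OF t] UQ[OF t] RQ[OF t] in simp_all)
      \<comment> \<open>The stopped factor is traded for y itself, since the estimate on small
        increments is known for y. This is legitimate under the weight \<open>V\<close>, which is
        frozen after \<sigma>.\<close>
      also have "\<dots> = (\<integral>\<omega>. indicator (C A s) \<omega> * V t \<omega> * y t \<omega> \<partial>Q)"
        unfolding C_def U_def
        by (rule optional_stopping_square_integrable[symmetric, OF y sq cad stop\<sigma> st A Vm Vb Vconst])
      also have "\<dots> = (\<integral>\<omega>. indicator (C A s) \<omega> * (y t \<omega> * V t \<omega>) \<partial>Q)" by (simp add: ac_simps)
      also have "\<dots> = (\<integral>\<omega>. indicator (C A s) \<omega> * (y s \<omega> * V s \<omega>) \<partial>Q)"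
        by (rule prod[OF st CG[OF st(1) A]])
      also have "\<dots> = (\<integral>\<omega>. indicator (C A s) \<omega> * R s \<omega> \<partial>Q)"
      proof (rule integral_cong_AE)
        show "AE \<omega> in Q. indicator (C A s) \<omega> * (y s \<omega> * V s \<omega>) = indicator (C A s) \<omega> * R s \<omega>"
          using R_UV
        proof eventually_elim
          case (elim \<omega>)
          show ?case
          proof (cases "\<omega> \<in> C A s")
            case True
            have "U s \<omega> = y s \<omega>" unfolding U_def by (rule stopped_before; rule st(1) C_pos(2)[OF True])
            then show ?thesis using elim st(1) by (simp add: mult.commute)
          qed simp
        qed
      qed (use CQ VQ[OF st(1)] yQ[OF st(1)] RQ[OF st(1)] in simp_all)
      finally show "(\<integral>\<omega>. indicator A \<omega> * R t \<omega> \<partial>Q) = (\<integral>\<omega>. indicator A \<omega> * R s \<omega> \<partial>Q)"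
        using Rconst CQ by (intro integral_indicator_split[OF AQ _ Rint[OF t] Rint[OF st(1)], where \<sigma> = "\<sigma> n"])
          (auto simp: C_def)
    qed
    moreover have "AE \<omega> in Q. cadlag (\<lambda>t. R t \<omega>)"
      using cad Zcad
    proof eventually_elim
      case (elim \<omega>)
      show ?case
        unfolding R_def by (rule cadlag_stopped[of "\<lambda>t \<omega>. y t \<omega> * Z t \<omega>" \<omega>, OF cadlag_mult[OF elim]])
    qed
    ultimately show ?thesis unfolding R_def mart_iff by blast
  qed
  then show ?thesis unfolding local_martingale_def using loc by blast
qed

end

section \<open>Augmented filtrations\<close>

context filtered_prob_space
begin

lemma space_augmentation: "space (augmentation Q G t) = space Q"
  unfolding augmentation_def by (rule space_measure_of_conv)

lemma augmentation_generators: "0 \<le> t \<Longrightarrow> sets (G t) \<union> null_sets (completion Q) \<subseteq> Pow (space Q)"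
  using sets.space_closed[of "G t"] sets.space_closed[of "completion Q"] by (auto simp: space_G null_sets_def)

lemma sets_augmentation: "0 \<le> t \<Longrightarrow> sets (augmentation Q G t) = sigma_sets (space Q) (sets (G t) \<union> null_sets (completion Q))"
  unfolding augmentation_def by (rule sets_measure_of[OF augmentation_generators])

lemma sets_G_augmentation: "0 \<le> t \<Longrightarrow> sets (G t) \<subseteq> sets (augmentation Q G t)"
  unfolding sets_augmentation by (auto intro: sigma_sets.Basic)

text \<open>The sets that agree with a set of \<open>G t\<close> up to a null set of the completion
  form a sigma-algebra that contains the generators of the augmentation.\<close>

lemma augmentation_set_eq_AE:
  assumes t: "0 \<le> t" and A: "A \<in> sets (augmentation Q G t)"
  obtains B where "B \<in> sets (G t)" "(A - B) \<union> (B - A) \<in> null_sets (completion Q)"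
proof -
  have "A \<in> sigma_sets (space Q) (sets (G t) \<union> null_sets (completion Q))"
    using A unfolding sets_augmentation[OF t] .
  then have "\<exists>B\<in>sets (G t). (A - B) \<union> (B - A) \<in> null_sets (completion Q)"
  proof induction
    case (Basic A)
    then show ?case
    proof
      assume "A \<in> sets (G t)" then show ?thesis by (intro bexI[of _ A]) auto
    next
      assume "A \<in> null_sets (completion Q)" then show ?thesis by (intro bexI[of _ "{}"]) auto
    qed
  next
    case Empty
    show ?case by (intro bexI[of _ "{}"]) auto
  next
    case (Compl A)
    then obtain B where B: "B \<in> sets (G t)" "(A - B) \<union> (B - A) \<in> null_sets (completion Q)" by blast
    have "space Q - B \<in> sets (G t)" using B(1) space_G[OF t] by (metis sets.compl_sets)
    moreover have "((space Q - A) - (space Q - B)) \<union> ((space Q - B) - (space Q - A)) \<in> null_sets (completion Q)"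
      by (rule null_sets_completion_subset[OF _ B(2)]) auto
    ultimately show ?case by blast
  next
    case (Union A)
    then obtain B where B: "\<And>i. B i \<in> sets (G t)" "\<And>i. (A i - B i) \<union> (B i - A i) \<in> null_sets (completion Q)" by metis
    have "(\<Union>i. B i) \<in> sets (G t)" using B(1) by auto
    moreover have "(\<Union>i::nat. (A i - B i) \<union> (B i - A i)) \<in> null_sets (completion Q)"
      by (rule null_sets_UN[OF B(2)])
    then have "((\<Union>i. A i) - (\<Union>i. B i)) \<union> ((\<Union>i. B i) - (\<Union>i. A i)) \<in> null_sets (completion Q)"
      by (rule null_sets_completion_subset[rotated]) auto
    ultimately show ?case by blast
  qed
  then show thesis using that by blast
qed

lemma complete_augmentation: "complete_filtered_prob_space (completion Q) (augmentation Q G)"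
proof -
  interpret C: prob_space "completion Q"
    by (rule prob_spaceI) (simp add: emeasure_space_1)
  show ?thesis
  proof unfold_locales
    fix t :: real assume t: "0 \<le> t"
    have "sets (G t) \<union> null_sets (completion Q) \<subseteq> sets (completion Q)"
      using sets_G[OF t] by (auto intro: sets_completionI_sets)
    then have "sigma_sets (space (completion Q)) (sets (G t) \<union> null_sets (completion Q)) \<subseteq> sets (completion Q)"
      by (rule sets.sigma_sets_subset)
    then show "subalgebra (completion Q) (augmentation Q G t)"
      unfolding subalgebra_def space_augmentation sets_augmentation[OF t] by simp
  next
    fix s t :: real assume st: "0 \<le> s" "s \<le> t"
    then have "0 \<le> t" by simp
    show "sets (augmentation Q G s) \<subseteq> sets (augmentation Q G t)"
      unfolding sets_augmentation[OF st(1)] sets_augmentation[OF \<open>0 \<le> t\<close>]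
      by (rule sigma_sets_mono') (use G_mono[OF st] in auto)
  next
    fix A B assume "B \<in> null_sets (completion Q)" "A \<subseteq> B"
    then have "A \<in> null_sets (completion Q)" by (rule null_sets_completion_subset[rotated])
    then show "A \<in> sets (augmentation Q G 0)"
      unfolding sets_augmentation[OF order_refl] by (auto intro: sigma_sets.Basic)
  qed
qed

lemma measurable_augmentation:
  assumes "0 \<le> t" "f \<in> measurable (G t) N"
  shows "f \<in> measurable (augmentation Q G t) N"
  by (rule measurable_from_subalg[OF _ assms(2)])
    (simp add: subalgebra_def space_augmentation space_G assms sets_G_augmentation)

text \<open>An integral over an augmented set equals the integral over an unaugmented set that
  differs from it by a null set, so the testing identities carry over.\<close>

lemma mart_augmentation:
  assumes y: "mart y"
  shows "filtered_prob_space.mart (completion Q) (augmentation Q G) y"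
proof -
  interpret C: complete_filtered_prob_space "completion Q" "augmentation Q G" by (rule complete_augmentation)
  have yQ: "y t \<in> borel_measurable Q" if "0 \<le> t" for t
    using mart_integrable[OF y that] by (rule borel_measurable_integrable)
  show ?thesis
    unfolding C.mart_def
  proof (intro conjI allI impI)
    fix t :: real assume t: "0 \<le> t"
    show "y t \<in> borel_measurable (augmentation Q G t)"
      by (rule measurable_augmentation[OF t mart_measurable[OF y t]])
    show "integrable (completion Q) (y t)"
      using mart_integrable[OF y t] integrable_completion[OF yQ[OF t]] by simp
  next
    fix s t :: real and A assume st: "0 \<le> s" "s \<le> t" and A: "A \<in> sets (augmentation Q G s)"
    have t: "0 \<le> t" using st by simp
    obtain B where B: "B \<in> sets (G s)" "(A - B) \<union> (B - A) \<in> null_sets (completion Q)"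
      by (rule augmentation_set_eq_AE[OF st(1) A])
    have BQ: "B \<in> sets Q" using sets_G[OF st(1) B(1)] .
    have AC: "A \<in> sets (completion Q)" using C.sets_G[OF st(1) A] .
    have eq: "(\<integral>\<omega>. indicator A \<omega> * y r \<omega> \<partial>completion Q) = (\<integral>\<omega>. indicator B \<omega> * y r \<omega> \<partial>Q)" if r: "0 \<le> r" for r
    proof -
      have yC: "y r \<in> borel_measurable (completion Q)" using yQ[OF r] by (rule measurable_completion)
      have BC: "B \<in> sets (completion Q)" using BQ by (rule sets_completionI_sets)
      have "(\<integral>\<omega>. indicator A \<omega> * y r \<omega> \<partial>completion Q) = (\<integral>\<omega>. indicator B \<omega> * y r \<omega> \<partial>completion Q)"
      proof (rule integral_cong_AE)
        have "AE \<omega> in completion Q. \<omega> \<notin> (A - B) \<union> (B - A)" using B(2) by (rule AE_not_in)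
        then show "AE \<omega> in completion Q. indicator A \<omega> * y r \<omega> = indicator B \<omega> * y r \<omega>"
          by eventually_elim (auto simp: indicator_def)
      qed (intro borel_measurable_times borel_measurable_indicator AC BC yC)+
      also have "\<dots> = (\<integral>\<omega>. indicator B \<omega> * y r \<omega> \<partial>Q)"
        by (intro integral_completion borel_measurable_times borel_measurable_indicator BQ yQ r)
      finally show ?thesis .
    qed
    show "(\<integral>\<omega>. indicator A \<omega> * y t \<omega> \<partial>completion Q) = (\<integral>\<omega>. indicator A \<omega> * y s \<omega> \<partial>completion Q)"
      unfolding eq[OF t] eq[OF st(1)] by (rule mart_eq[OF y st B(1)])
  qed
qed

section \<open>True martingales as local martingales, localised by the constant time
  infinity\<close>

lemma stopped_top: "0 \<le> t \<Longrightarrow> stopped (\<lambda>_. top) y t = y t"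
  by (rule ext) (simp add: stopped_def)

lemma localizing_sequence_top: "localizing_sequence Q G (\<lambda>_ _. top)"
  unfolding localizing_sequence_def by (auto intro: stopping_time_const simp: incseq_def)

lemma martingale_stopped_top:
  assumes "martingale Q G y"
  shows "martingale Q G (stopped (\<lambda>_. top) y)"
proof -
  have y: "mart y" and cad: "AE \<omega> in Q. cadlag (\<lambda>t. y t \<omega>)" using assms unfolding mart_iff by auto
  have "mart (stopped (\<lambda>_. top) y)"
    unfolding mart_def
    by (auto simp: stopped_top order_trans intro: mart_measurable[OF y] mart_integrable[OF y] mart_eq[OF y])
  moreover have "AE \<omega> in Q. cadlag (\<lambda>t. stopped (\<lambda>_. top) y t \<omega>)"
    using cad by eventually_elim (rule cadlag_stopped)
  ultimately show ?thesis unfolding mart_iff by blast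
qed

lemma martingale_imp_local: "martingale Q G y \<Longrightarrow> local_martingale Q G y"
  unfolding local_martingale_def using localizing_sequence_top martingale_stopped_top by blast

lemma square_integrable_imp_locally:
  assumes "martingale Q G y" "\<And>t. 0 \<le> t \<Longrightarrow> integrable Q (\<lambda>\<omega>. (y t \<omega>)\<^sup>2)"
  shows "locally_square_integrable_martingale Q G y"
  unfolding locally_square_integrable_martingale_def square_integrable_martingale_def
  using localizing_sequence_top martingale_stopped_top[OF assms(1)] assms(2)
  by (intro exI[of _ "\<lambda>_ _. top"]) (auto simp: stopped_top)

lemma mart_zero: "mart (\<lambda>_ _. 0)"
  by (simp add: mart_def)

lemma continuous_local_martingale_zero: "continuous_local_martingale Q G (\<lambda>_ _. 0)"
proof -
  have "cadlag (\<lambda>_. 0)" by (rule continuous_imp_cadlag) auto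
  then have "martingale Q G (\<lambda>_ _. 0)" unfolding mart_iff using mart_zero by auto
  then show ?thesis unfolding continuous_local_martingale_def by (auto intro: martingale_imp_local)
qed

lemma mart_diff_const:
  assumes y: "mart y"
  shows "mart (\<lambda>t \<omega>. y t \<omega> - y 0 \<omega>)"
  unfolding mart_def
proof (intro conjI allI impI)
  fix t :: real assume t: "0 \<le> t"
  have "y 0 \<in> borel_measurable (G t)" by (rule measurable_G_mono[OF order_refl t mart_measurable[OF y order_refl]])
  then show "(\<lambda>\<omega>. y t \<omega> - y 0 \<omega>) \<in> borel_measurable (G t)" using mart_measurable[OF y t] by simp
  show "integrable Q (\<lambda>\<omega>. y t \<omega> - y 0 \<omega>)" using mart_integrable[OF y t] mart_integrable[OF y order_refl] by simp
next
  fix s t :: real and A assume st: "0 \<le> s" "s \<le> t" and A: "A \<in> sets (G s)"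
  have t: "0 \<le> t" using st by simp
  have i: "integrable Q (\<lambda>\<omega>. indicator A \<omega> * y r \<omega>)" if "0 \<le> r" for r
    using integrable_mult_indicator[OF sets_G[OF st(1) A] mart_integrable[OF y that]] by simp
  show "(\<integral>\<omega>. indicator A \<omega> * (y t \<omega> - y 0 \<omega>) \<partial>Q) = (\<integral>\<omega>. indicator A \<omega> * (y s \<omega> - y 0 \<omega>) \<partial>Q)"
    using i[OF t] i[OF st(1)] i[OF order_refl] mart_eq[OF y st A] by (simp add: right_diff_distrib)
qed

text \<open>Time is moved back to a grid point strictly before it. On the cell open at its left end
  and closed at its right end the discretised process takes the value at the left end, which is
  known there, so it is built from the generating rectangles; continuity gives convergence.\<close>

lemma continuous_adapted_predictable:
  assumes ad: "\<And>t. 0 \<le> t \<Longrightarrow> f t \<in> borel_measurable (G t)" and cont: "\<And>\<omega>. \<omega> \<in> space Q \<Longrightarrow> continuous_on {0..} (\<lambda>t. f t \<omega>)"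
  shows "(\<lambda>(t, \<omega>). f t \<omega> :: real) \<in> borel_measurable (predictable_sigma Q G)"
proof -
  let ?P = "predictable_sigma Q G"
  let ?gen = "{{0} \<times> A |A. A \<in> sets (G 0)} \<union> {{s<..t} \<times> A |s t A. 0 \<le> s \<and> s \<le> t \<and> A \<in> sets (G s)}"
  have gen: "?gen \<subseteq> Pow ({0..} \<times> space Q)"
    using sets.sets_into_space[of _ "G _"] by (fastforce simp: space_G)
  have space_P: "space ?P = {0..} \<times> space Q" unfolding predictable_sigma_def by (rule space_measure_of[OF gen])
  have gen_P: "?gen \<subseteq> sets ?P" unfolding predictable_sigma_def sets_measure_of[OF gen] by (auto intro: sigma_sets.Basic)
  have P0: "{0} \<times> A \<in> sets ?P" if "A \<in> sets (G 0)" for A using gen_P that by blast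
  have PI: "{s<..t} \<times> A \<in> sets ?P" if "0 \<le> s" "s \<le> t" "A \<in> sets (G s)" for s t A using gen_P that by blast
  have rect: "(\<lambda>p. if fst p \<in> I then h (snd p) else 0) \<in> borel_measurable ?P"
    if I: "\<And>A. A \<in> sets (G a) \<Longrightarrow> I \<times> A \<in> sets ?P" and h: "h \<in> borel_measurable (G a)" and a: "0 \<le> a" for I a and h :: "'w \<Rightarrow> real"
  proof (rule borel_measurableI)
    fix U :: "real set" assume "open U"
    then have "h -` U \<inter> space (G a) \<in> sets (G a)" using h by (auto intro: measurable_sets)
    then have 1: "I \<times> (h -` U \<inter> space Q) \<in> sets ?P" using I space_G[OF a] by simp
    have 2: "I \<times> space Q \<in> sets ?P" using I[of "space (G a)"] space_G[OF a] by (metis sets.top)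
    then have 3: "space ?P - I \<times> space Q \<in> sets ?P" by (rule sets.compl_sets)
    have "I \<times> space Q \<subseteq> space ?P" using 2 by (rule sets.sets_into_space)
    then have "(\<lambda>p. if fst p \<in> I then h (snd p) else 0) -` U \<inter> space ?P
      = I \<times> (h -` U \<inter> space Q) \<union> (if 0 \<in> U then space ?P - I \<times> space Q else {})"
      by (auto simp: space_P split: if_splits)
    then show "(\<lambda>p. if fst p \<in> I then h (snd p) else 0) -` U \<inter> space ?P \<in> sets ?P"
      using 1 3 by auto
  qed
  \<comment> \<open>Ceiling minus one, so that a positive grid point belongs to the cell ending at
    it, matching the half-open generators; time 0 has its own generators.\<close>
  define d where "d n t = (if t = 0 then 0 else (of_int \<lceil>real (Suc n) * t\<rceil> - 1) / real (Suc n))" for n and t :: real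
  have d_bounds: "0 \<le> d n t" "t - inverse (real (Suc n)) \<le> d n t" "d n t \<le> t" if "0 \<le> t" for n t
  proof -
    have c: "of_int \<lceil>real (Suc n) * t\<rceil> - 1 < real (Suc n) * t" "real (Suc n) * t \<le> of_int \<lceil>real (Suc n) * t\<rceil>"
      using ceiling_correct[of "real (Suc n) * t"] by auto
    have "0 \<le> of_int \<lceil>real (Suc n) * t\<rceil> - (1::real)" if "t \<noteq> 0"
    proof -
      have "0 < real (Suc n) * t" using that \<open>0 \<le> t\<close> by simp
      then have "1 \<le> \<lceil>real (Suc n) * t\<rceil>" by linarith
      then show ?thesis by linarith
    qed
    then show "0 \<le> d n t" by (simp add: d_def)
    have "(real (Suc n) * t - 1) / real (Suc n) \<le> (of_int \<lceil>real (Suc n) * t\<rceil> - 1) / real (Suc n)"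
      using c(2) by (intro divide_right_mono) auto
    moreover have "(real (Suc n) * t - 1) / real (Suc n) = t - inverse (real (Suc n))"
      by (simp add: diff_divide_distrib divide_inverse[of 1])
    ultimately show "t - inverse (real (Suc n)) \<le> d n t" by (auto simp: d_def)
    have "(of_int \<lceil>real (Suc n) * t\<rceil> - 1) / real (Suc n) \<le> (real (Suc n) * t) / real (Suc n)"
      using c(1) by (intro divide_right_mono) auto
    then show "d n t \<le> t" using that by (simp add: d_def)
  qed
  have "(\<lambda>p. f (d n (fst p)) (snd p)) \<in> borel_measurable ?P" for n
  proof -
    let ?R = "real (Suc n)"
    define a where "a i = (of_int i - 1) / ?R" for i :: int
    define b where "b i = of_int i / ?R" for i :: int
    \<comment> \<open>The index i stands for the ceiling of (n + 1) t: for nonnegative times it is 0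
      only at time 0, and each positive i labels one cell.\<close>
    define u where "u i p = (if i \<le> 0 then (if fst p \<in> {0} then f 0 (snd p) else 0)
      else (if fst p \<in> {a i<..b i} then f (a i) (snd p) else 0))" for i and p :: "real \<times> 'w"
    have ab: "0 \<le> a i" "a i \<le> b i" if "0 < i" for i
      using that by (auto simp: a_def b_def intro!: divide_right_mono)
    have "(\<lambda>p. u \<lceil>?R * fst p\<rceil> p) \<in> borel_measurable ?P"
    proof (rule measurable_compose_countable)
      show "u i \<in> borel_measurable ?P" for i
      proof (cases "i \<le> 0")
        case True
        then show ?thesis unfolding u_def[abs_def] using rect[OF P0 ad[OF order_refl] order_refl] by simp
      next
        case False
        then have "0 < i" by simp
        from rect[OF PI[OF ab[OF this]] ad[OF ab(1)[OF this]] ab(1)[OF this]]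
        show ?thesis unfolding u_def[abs_def] using False by simp
      qed
      show "(\<lambda>p. \<lceil>?R * fst p\<rceil>) \<in> measurable ?P (count_space UNIV)"
      proof (rule measurable_count_space_eq2_countable[THEN iffD2], intro conjI ballI)
        fix i :: int
        show "(\<lambda>p. \<lceil>?R * fst p\<rceil>) -` {i} \<inter> space ?P \<in> sets ?P"
        proof (cases "0 < i")
          case True
          have "(\<lambda>p. \<lceil>?R * fst p\<rceil>) -` {i} \<inter> space ?P = {a i<..b i} \<times> space Q"
          proof -
            have "\<lceil>?R * t\<rceil> = i \<longleftrightarrow> a i < t \<and> t \<le> b i" for t
              unfolding ceiling_eq_iff a_def b_def by (simp add: pos_divide_less_eq pos_le_divide_eq mult.commute)
            then have "(\<lambda>p. \<lceil>?R * fst p\<rceil>) -` {i} \<inter> space ?P = {p \<in> space ?P. a i < fst p \<and> fst p \<le> b i}"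
              by (simp add: vimage_def Int_def conj_commute del: of_nat_Suc)
            also have "\<dots> = {a i<..b i} \<times> space Q"
              using ab(1)[OF True] by (auto simp: space_P)
            finally show ?thesis .
          qed
          then show ?thesis using PI[OF ab[OF True], of "space (G (a i))"] space_G[OF ab(1)[OF True]] by (metis sets.top)
        next
          case False
          have *: "\<lceil>?R * t\<rceil> = i \<longleftrightarrow> i = 0 \<and> t = 0" if "0 \<le> t" for t
          proof
            assume e: "\<lceil>?R * t\<rceil> = i"
            have "\<not> 0 < ?R * t"
            proof
              assume "0 < ?R * t"
              then have "0 < \<lceil>?R * t\<rceil>" by (simp only: zero_less_ceiling)
              then show False unfolding e using False by simp
            qed
            then have "t = 0" using that by (simp add: zero_less_mult_iff)
            then show "i = 0 \<and> t = 0" using e by simp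
          qed simp
          have "(\<lambda>p. \<lceil>?R * fst p\<rceil>) -` {i} \<inter> space ?P = (if i = 0 then {0} \<times> space Q else {})"
          proof (rule set_eqI)
            fix p :: "real \<times> 'w"
            show "p \<in> (\<lambda>p. \<lceil>?R * fst p\<rceil>) -` {i} \<inter> space ?P \<longleftrightarrow> p \<in> (if i = 0 then {0} \<times> space Q else {})"
              using *[of "fst p"] by (cases p) (auto simp: space_P simp del: of_nat_Suc)
          qed
          then show ?thesis using P0[of "space (G 0)"] space_G[OF order_refl] sets.top[of "G 0"] by auto
        qed
      qed auto
    qed
    moreover have "f (d n (fst p)) (snd p) = u \<lceil>?R * fst p\<rceil> p" if "p \<in> space ?P" for p
    proof (cases "fst p = 0")
      case True
      then show ?thesis by (simp add: d_def u_def)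
    next
      case False
      then have pos: "0 < ?R * fst p" using that by (auto simp: space_P)
      then have i: "0 < \<lceil>?R * fst p\<rceil>" by simp
      have "fst p \<in> {a \<lceil>?R * fst p\<rceil><..b \<lceil>?R * fst p\<rceil>}"
        using ceiling_correct[of "?R * fst p"] by (simp add: a_def b_def pos_divide_less_eq pos_le_divide_eq mult.commute)
      then show ?thesis using i False by (simp add: d_def u_def a_def)
    qed
    ultimately show ?thesis by (simp cong: measurable_cong)
  qed
  moreover have "(\<lambda>n. f (d n (fst p)) (snd p)) \<longlonglongrightarrow> f (fst p) (snd p)" if p: "p \<in> space ?P" for p
  proof -
    have t: "0 \<le> fst p" and \<omega>: "snd p \<in> space Q" using p by (auto simp: space_P)
    have "(\<lambda>n. fst p - inverse (real (Suc n))) \<longlonglongrightarrow> fst p - 0"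
      by (intro tendsto_intros LIMSEQ_inverse_real_of_nat)
    then have lim: "(\<lambda>n. fst p - inverse (real (Suc n))) \<longlonglongrightarrow> fst p" by (simp only: diff_0_right)
    have "(\<lambda>n. d n (fst p)) \<longlonglongrightarrow> fst p"
      by (rule tendsto_sandwich[OF always_eventually always_eventually lim tendsto_const])
        (rule allI, rule d_bounds[OF t])+
    then show ?thesis
      by (rule continuous_on_tendsto_compose[OF cont[OF \<omega>]])
        (rule always_eventually allI atLeast_iff[THEN iffD2] t d_bounds(1)[OF t])+
  qed
  ultimately have "(\<lambda>p. f (fst p) (snd p)) \<in> borel_measurable ?P"
    by (rule borel_measurable_LIMSEQ_real[where u = "\<lambda>n p. f (d n (fst p)) (snd p)", rotated])
  then show ?thesis by (simp add: split_beta')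
qed

end

section \<open>The process as a martingale\<close>

lemma lipschitz_finite_variation:
  assumes "C-lipschitz_on {0..} f"
  shows "finite_variation f"
  unfolding finite_variation_def
proof (intro allI impI)
  fix t :: real assume t: "0 \<le> t"
  have C: "0 \<le> C" using assms by (rule lipschitz_on_nonneg)
  have "(\<Sum>k<n. \<bar>f (p (Suc k)) - f (p k)\<bar>) \<le> C * t" if p: "mono p" "range p \<subseteq> {0..t}" for p :: "nat \<Rightarrow> real" and n
  proof -
    have p0: "0 \<le> p k" "p k \<le> t" for k using subsetD[OF p(2) rangeI[of p k]] by auto
    have "(\<Sum>k<n. \<bar>f (p (Suc k)) - f (p k)\<bar>) \<le> (\<Sum>k<n. C * (p (Suc k) - p k))"
    proof (rule sum_mono)
      fix k
      have "p k \<le> p (Suc k)" using p(1) by (simp add: mono_iff_le_Suc)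
      then show "\<bar>f (p (Suc k)) - f (p k)\<bar> \<le> C * (p (Suc k) - p k)"
        using lipschitz_onD[OF assms, of "p (Suc k)" "p k"] p0 by (simp add: dist_real_def)
    qed
    also have "\<dots> = C * (p n - p 0)"
      by (simp add: sum_distrib_left[symmetric] sum_lessThan_telescope)
    also have "\<dots> \<le> C * t" using p0[of n] p0[of 0] by (intro mult_left_mono C) linarith
    finally show ?thesis .
  qed
  then show "\<exists>B. \<forall>p n. mono p \<longrightarrow> range p \<subseteq> {0..t} \<longrightarrow> (\<Sum>k<n. \<bar>f (p (Suc k)) - f (p (k::nat))\<bar>) \<le> B"
    by blast
qed

section \<open>Compensators, Dynkin martingales and path regularity\<close>

context feller_jump
begin

lemma filtered_prob_space_P: "filtered_prob_space (P x) F"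
  by (intro filtered_prob_space.intro filtered_prob_space_axioms.intro prob_P subalg sets_F_mono)

text \<open>The compensator in Dynkin's formula; for g = y_i y_j it is the asserted
  covariation.\<close>

definition drift :: "(real ^ 'n \<Rightarrow> real) \<Rightarrow> (real ^ 'n \<Rightarrow> real ^ 'n \<Rightarrow> real) \<Rightarrow> real \<Rightarrow> 'w \<Rightarrow> real" where
  "drift g D t \<omega> = (\<integral>r. indicator {0..t} r * jump_gen N g D (Y r \<omega>) \<partial>lborel)"

lemma drift_integrable:
  assumes "tame g D H" "0 \<le> t" "\<omega> \<in> space M"
  shows "integrable lborel (\<lambda>r. indicator {0..t} r * jump_gen N g D (Y r \<omega>))"
proof -
  obtain C where C: "C \<ge> 0" "\<And>n x. \<bar>Defs.generator T (cutoff n g) x\<bar> \<le> C" "\<And>x. \<bar>jump_gen N g D x\<bar> \<le> C"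
    and lim: "\<And>x. (\<lambda>n. Defs.generator T (cutoff n g) x) \<longlonglongrightarrow> jump_gen N g D x"
    by (rule cutoff_generator_limit[OF assms(1)]) (rule that)
  show ?thesis
  proof (rule Bochner_Integration.integrable_bound[OF integrable_indicator_const[of 0 t C]])
    have \<omega>: "\<omega> \<in> space (F t)" using assms space_F by simp
    have "(\<lambda>r. jump_gen N g D (Y (max 0 (min r t)) \<omega>)) \<in> borel_measurable borel"
      using measurable_compose[OF measurable_Pair2'[OF \<omega>] jump_gen_Y_progressive[OF assms(2,1)]] by simp
    then have "(\<lambda>r. indicator {0..t} r * jump_gen N g D (Y (max 0 (min r t)) \<omega>)) \<in> borel_measurable lborel"
      by measurable
    moreover have "indicator {0..t} r * jump_gen N g D (Y (max 0 (min r t)) \<omega>) = indicator {0..t} r * jump_gen N g D (Y r \<omega>)" for r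
      by (auto simp: indicator_def)
    ultimately show "(\<lambda>r. indicator {0..t} r * jump_gen N g D (Y r \<omega>)) \<in> borel_measurable lborel" by simp
    show "AE r in lborel. norm (indicator {0..t} r * jump_gen N g D (Y r \<omega>)) \<le> norm (indicator {0..t} r * C)"
      using C by (intro AE_I2) (auto simp: indicator_def)
  qed
qed

lemma drift_adapted:
  assumes "tame g D H" "0 \<le> t"
  shows "drift g D t \<in> borel_measurable (F t)"
proof -
  let ?h = "\<lambda>(\<omega>, r). indicator {0..t} r * jump_gen N g D (Y (max 0 (min r t)) \<omega>)"
  have m: "(\<lambda>(\<omega>, r). jump_gen N g D (Y (max 0 (min r t)) \<omega>)) \<in> borel_measurable (F t \<Otimes>\<^sub>M borel)"
    using measurable_pair_swap[OF jump_gen_Y_progressive[OF assms(2,1)]] by (simp add: split_beta')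
  have "?h \<in> borel_measurable (F t \<Otimes>\<^sub>M borel)"
    using m unfolding split_beta' by measurable
  then have "?h \<in> borel_measurable (F t \<Otimes>\<^sub>M lborel)"
    by (subst measurable_cong_sets[OF sets_pair_measure_cong[OF refl sets_lborel] refl])
  then have "(\<lambda>\<omega>. \<integral>r. indicator {0..t} r * jump_gen N g D (Y (max 0 (min r t)) \<omega>) \<partial>lborel) \<in> borel_measurable (F t)"
    by (intro lborel.borel_measurable_lebesgue_integral) simp
  moreover have "drift g D t \<omega> = (\<integral>r. indicator {0..t} r * jump_gen N g D (Y (max 0 (min r t)) \<omega>) \<partial>lborel)" for \<omega>
    unfolding drift_def by (rule Bochner_Integration.integral_cong) (auto simp: indicator_def)
  ultimately show ?thesis by (simp cong: measurable_cong)
qed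

lemma drift_diff:
  assumes "tame g D H" "0 \<le> s" "s \<le> t" "\<omega> \<in> space M"
  shows "drift g D t \<omega> - drift g D s \<omega> = (\<integral>r. indicator {s<..t} r * jump_gen N g D (Y r \<omega>) \<partial>lborel)"
proof -
  have "drift g D t \<omega> - drift g D s \<omega>
    = (\<integral>r. indicator {0..t} r * jump_gen N g D (Y r \<omega>) - indicator {0..s} r * jump_gen N g D (Y r \<omega>) \<partial>lborel)"
    unfolding drift_def using assms by (intro Bochner_Integration.integral_diff[symmetric] drift_integrable) auto
  also have "\<dots> = (\<integral>r. indicator {s<..t} r * jump_gen N g D (Y r \<omega>) \<partial>lborel)"
    using assms by (intro Bochner_Integration.integral_cong) (auto simp: indicator_def)
  finally show ?thesis .
qed

lemma drift_zero: "drift g D 0 \<omega> = 0"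
  unfolding drift_def
proof (rule integral_eq_zero_AE)
  show "AE r in lborel. indicator {0..0} r * jump_gen N g D (Y r \<omega>) = 0"
    using AE_lborel_singleton[of 0] by eventually_elim auto
qed

text \<open>\<open>jump_gen\<close> is bounded, which gives continuity and finite variation of the
  compensator at once. The bound holds at every sample point, as is needed for predictability, which
  is a statement about all of them.\<close>

lemma drift_lipschitz:
  assumes t: "tame g D H"
  obtains C where "\<And>\<omega>. \<omega> \<in> space M \<Longrightarrow> C-lipschitz_on {0..} (\<lambda>t. drift g D t \<omega>)"
proof -
  obtain C where C: "C \<ge> 0" "\<And>n x. \<bar>Defs.generator T (cutoff n g) x\<bar> \<le> C" "\<And>x. \<bar>jump_gen N g D x\<bar> \<le> C"
    and lim: "\<And>x. (\<lambda>n. Defs.generator T (cutoff n g) x) \<longlonglongrightarrow> jump_gen N g D x"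
    by (rule cutoff_generator_limit[OF t]) (rule that)
  have *: "\<bar>drift g D t \<omega> - drift g D s \<omega>\<bar> \<le> C * (t - s)" if "0 \<le> s" "s \<le> t" "\<omega> \<in> space M" for s t \<omega>
  proof -
    have i: "integrable lborel (\<lambda>r. indicator {s<..t} r * jump_gen N g D (Y r \<omega>))"
    proof -
      have "integrable lborel (\<lambda>r. indicator {0..t} r * jump_gen N g D (Y r \<omega>) - indicator {0..s} r * jump_gen N g D (Y r \<omega>))"
        using that t by (intro Bochner_Integration.integrable_diff drift_integrable) auto
      also have "(\<lambda>r. indicator {0..t} r * jump_gen N g D (Y r \<omega>) - indicator {0..s} r * jump_gen N g D (Y r \<omega>))
        = (\<lambda>r. indicator {s<..t} r * jump_gen N g D (Y r \<omega>))"
        using that by (auto simp: indicator_def fun_eq_iff)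
      finally show ?thesis .
    qed
    have "norm (\<integral>r. indicator {s<..t} r * jump_gen N g D (Y r \<omega>) \<partial>lborel) \<le> (\<integral>r. indicator {s..t} r * C \<partial>lborel)"
      using C by (intro Bochner_Integration.integral_norm_bound_integral i integrable_indicator_const) (auto simp: indicator_def)
    also have "\<dots> = C * (t - s)" using that by simp
    finally show ?thesis unfolding drift_diff[OF t that] by simp
  qed
  show thesis
  proof (rule that[of C], rule lipschitz_onI)
    fix \<omega> and s t :: real assume "\<omega> \<in> space M" "s \<in> {0..}" "t \<in> {0..}"
    then show "dist (drift g D s \<omega>) (drift g D t \<omega>) \<le> C * dist s t"
      using *[of s t \<omega>] *[of t s \<omega>] by (cases "s \<le> t") (auto simp: dist_real_def abs_minus_commute)
  qed (rule C)
qed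

lemma drift_continuous:
  assumes "tame g D H" "\<omega> \<in> space M"
  shows "continuous_on {0..} (\<lambda>t. drift g D t \<omega>)"
  by (rule drift_lipschitz[OF assms(1)]) (rule lipschitz_on_continuous_on, use assms(2) in auto)

text \<open>Dynkin's formula with the indicator of a set of \<open>F s\<close> as weight; the
  Lipschitz bound makes the compensator integrable.\<close>

lemma mart_tame:
  assumes g: "tame g D H"
  shows "filtered_prob_space.mart (P x) F (\<lambda>t \<omega>. g (Y t \<omega>) - drift g D t \<omega>)"
proof -
  interpret filtered_prob_space "P x" F by (rule filtered_prob_space_P)
  obtain C where C: "\<And>\<omega>. \<omega> \<in> space M \<Longrightarrow> C-lipschitz_on {0..} (\<lambda>t. drift g D t \<omega>)"
    by (rule drift_lipschitz[OF g]) (rule that)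
  have dint: "integrable (P x) (drift g D t)" if t: "0 \<le> t" for t
  proof (rule integrable_const_bound[where B = "C * t"])
    show "AE \<omega> in P x. norm (drift g D t \<omega>) \<le> C * t"
    proof (rule AE_I2)
      fix \<omega> assume "\<omega> \<in> space (P x)"
      then have "\<omega> \<in> space M" by (simp add: space_P)
      from lipschitz_onD[OF C[OF this], of t 0] show "norm (drift g D t \<omega>) \<le> C * t"
        using t by (simp add: drift_zero dist_real_def)
    qed
    show "drift g D t \<in> borel_measurable (P x)" by (rule measurable_F_P[OF t drift_adapted[OF g t]])
  qed
  have gint: "integrable (P x) (\<lambda>\<omega>. g (Y t \<omega>))" if "0 \<le> t" for t by (rule integrable_tame[OF that g])
  show ?thesis
    unfolding mart_def
  proof (intro conjI allI impI)
    fix t :: real assume t: "0 \<le> t"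
    have "(\<lambda>\<omega>. g (Y t \<omega>)) \<in> borel_measurable (F t)"
      by (rule measurable_compose[OF Y_adapted[OF t] tame_borel[OF g]])
    then show "(\<lambda>\<omega>. g (Y t \<omega>) - drift g D t \<omega>) \<in> borel_measurable (F t)"
      by (rule borel_measurable_diff[OF _ drift_adapted[OF g t]])
    show "integrable (P x) (\<lambda>\<omega>. g (Y t \<omega>) - drift g D t \<omega>)"
      by (rule Bochner_Integration.integrable_diff[OF gint[OF t] dint[OF t]])
  next
    fix s t :: real and A assume st: "0 \<le> s" "s \<le> t" and A: "A \<in> sets (F s)"
    have t: "0 \<le> t" using st by simp
    have i: "integrable (P x) (\<lambda>\<omega>. indicator A \<omega> * f \<omega>)" if "integrable (P x) f" for f :: "'w \<Rightarrow> real"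
      using integrable_mult_indicator[OF sets_G[OF st(1) A] that] by simp
    have "(\<integral>\<omega>. indicator A \<omega> * (g (Y t \<omega>) - g (Y s \<omega>)) \<partial>P x)
      = (\<integral>\<omega>. indicator A \<omega> * (\<integral>r. indicator {s<..t} r * jump_gen N g D (Y r \<omega>) \<partial>lborel) \<partial>P x)"
      using A by (intro weighted_expectation_diff_Fubini[OF st _ _ g, where B = 1]) auto
    also have "\<dots> = (\<integral>\<omega>. indicator A \<omega> * (drift g D t \<omega> - drift g D s \<omega>) \<partial>P x)"
      by (rule Bochner_Integration.integral_cong) (auto simp: drift_diff[OF g st] space_P)
    finally show "(\<integral>\<omega>. indicator A \<omega> * (g (Y t \<omega>) - drift g D t \<omega>) \<partial>P x)
      = (\<integral>\<omega>. indicator A \<omega> * (g (Y s \<omega>) - drift g D s \<omega>) \<partial>P x)"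
      using i[OF gint[OF t]] i[OF gint[OF st(1)]] i[OF dint[OF t]] i[OF dint[OF st(1)]]
      by (simp add: right_diff_distrib)
  qed
qed

text \<open>A coordinate is linear, so its Taylor remainder and with it the compensator vanish
  identically.\<close>

lemma mart_Y: "filtered_prob_space.mart (P x) F (\<lambda>t \<omega>. Y t \<omega> $ i)"
  using mart_tame[OF tame_nth[of i], of x] by (simp add: drift_def jump_gen_def)

text \<open>The maximal inequality bounds the path on the dyadic times, and right continuity in the compactification
  extends the bound to all times.\<close>

lemma AE_bounded_away_from_infinity:
  assumes R: "0 < R"
  shows "AE \<omega> in P x. \<exists>c>0. \<forall>s. 0 \<le> s \<longrightarrow> s < R \<longrightarrow> c \<le> ext0 den (X s \<omega>)"
proof -
  interpret filtered_prob_space "P x" F by (rule filtered_prob_space_P)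
  have "\<exists>S. AE \<omega> in P x. \<forall>n k. k \<le> 2 ^ n \<longrightarrow> \<bar>Y (real k * R / 2 ^ n) \<omega> $ i\<bar> \<le> S \<omega>" for i
    by (rule doob_sup[OF mart_Y[of x i] square_integrable_nth less_imp_le[OF R]]) (auto intro: exI)
  from choice[OF allI[OF this]]
  obtain S where S: "\<forall>i. AE \<omega> in P x. \<forall>n k. k \<le> 2 ^ n \<longrightarrow> \<bar>Y (real k * R / 2 ^ n) \<omega> $ i\<bar> \<le> S i \<omega>" ..
  have "AE \<omega> in P x. \<forall>i. \<forall>n k. k \<le> 2 ^ n \<longrightarrow> \<bar>Y (real k * R / 2 ^ n) \<omega> $ i\<bar> \<le> S i \<omega>"
    by (rule eventually_all_finite[OF spec[OF S]])
  moreover have "AE \<omega> in P x. \<forall>n k. X (real k * R / 2 ^ n) \<omega> \<noteq> None"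
    unfolding AE_all_countable using R by (intro allI AE_finite_at) simp
  ultimately show ?thesis
    using AE_space
  proof eventually_elim
    case (elim \<omega>)
    \<comment> \<open>On the dyadic times |Y|^2 is at most the sum of the squared coordinate bounds,
      which is \<open>den\<close> \<ge> c.\<close>
    define c where "c = 1 / (1 + (\<Sum>i\<in>UNIV. (S i \<omega>)\<^sup>2))"
    have pos: "0 < 1 + (\<Sum>i\<in>UNIV. (S i \<omega>)\<^sup>2)" by (intro add_pos_nonneg sum_nonneg) auto
    have "c \<le> ext0 den (X (real k * R / 2 ^ n) \<omega>)" if k: "k \<le> 2 ^ n" for n k
    proof -
      let ?d = "real k * R / 2 ^ n"
      obtain y where y: "X ?d \<omega> = Some y" using elim(2) by auto
      have "(y $ i)\<^sup>2 \<le> (S i \<omega>)\<^sup>2" for i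
      proof -
        have "\<bar>Y ?d \<omega> $ i\<bar> \<le> S i \<omega>" using elim(1) k by blast
        then have "\<bar>y $ i\<bar> \<le> S i \<omega>" by (simp add: finite_part_def y)
        from power_mono[OF this abs_ge_zero, of 2] show ?thesis by simp
      qed
      then have "(norm y)\<^sup>2 \<le> (\<Sum>i\<in>UNIV. (S i \<omega>)\<^sup>2)"
        unfolding power2_norm_eq_inner inner_vec_def by (auto simp: power2_eq_square intro: sum_mono)
      then show ?thesis
        unfolding y c_def by (simp add: ext0_def den_def frac_le add_pos_nonneg)
    qed
    then have C: "ext0 den (X (real k * R / 2 ^ n) \<omega>) \<in> {c..}" if "k \<le> 2 ^ n" for n k using that by simp
    have "c \<le> ext0 den (X s \<omega>)" if s: "0 \<le> s" "s < R" for s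
    proof -
      have "\<omega> \<in> space M" using elim(3) by (simp add: space_P)
      from right_limit_in_closed[OF s ext0_right_continuous[OF den_C_infty this s(1)] closed_atLeast C]
      show ?thesis by simp
    qed
    moreover have "0 < c" using pos by (simp add: c_def)
    ultimately show ?case by blast
  qed
qed

text \<open>A lower bound for \<open>den\<close> on [0, t] passes to the left limit in the
  compactification, so that limit is finite too; on such paths the quotient of \<open>num\<close>
  and \<open>den\<close> inherits right continuity and left limits.\<close>

lemma AE_path_regular: "AE \<omega> in P x. (\<forall>t\<ge>0. X t \<omega> \<noteq> None) \<and> (\<forall>i. cadlag (\<lambda>t. Y t \<omega> $ i))"
proof -
  have "AE \<omega> in P x. \<forall>m. \<exists>c>0. \<forall>s. 0 \<le> s \<longrightarrow> s < real (Suc m) \<longrightarrow> c \<le> ext0 den (X s \<omega>)"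
    unfolding AE_all_countable by (intro allI AE_bounded_away_from_infinity) simp
  then show ?thesis
    using AE_space
  proof eventually_elim
    case (elim \<omega>)
    have \<omega>: "\<omega> \<in> space M" using elim(2) by (simp add: space_P)
    have c: "\<exists>c>0. \<forall>s. 0 \<le> s \<longrightarrow> s \<le> t \<longrightarrow> c \<le> ext0 den (X s \<omega>)" for t
    proof -
      obtain n :: nat where "t < real n" using reals_Archimedean2 by blast
      then show ?thesis using elim(1)[rule_format, of n] by force
    qed
    have ne: "ext0 den (X t \<omega>) \<noteq> 0" if "0 \<le> t" for t
      using c[of t] that by force
    have "((\<lambda>s. Y s \<omega> $ i) \<longlongrightarrow> Y t \<omega> $ i) (at_right t)" if "0 \<le> t" for i t
      unfolding finite_part_nth
      by (intro tendsto_divide ext0_right_continuous num_C_infty den_C_infty \<omega> that ne)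
    moreover have "\<exists>l. ((\<lambda>s. Y s \<omega> $ i) \<longlongrightarrow> l) (at_left t)" if t: "0 < t" for i t
    proof -
      obtain l where l: "\<And>u. u \<in> C_infty \<Longrightarrow> ((\<lambda>s. ext0 u (X s \<omega>)) \<longlongrightarrow> ext0 u l) (at_left t)"
        by (rule ext0_left_limit[OF \<omega> t]) (rule that)
      obtain d where d: "0 < d" "\<And>s. 0 \<le> s \<Longrightarrow> s \<le> t \<Longrightarrow> d \<le> ext0 den (X s \<omega>)" using c[of t] by blast
      have "\<forall>\<^sub>F s in at_left t. d \<le> ext0 den (X s \<omega>)"
        using d(2) t by (auto simp: eventually_at_left[of 0 t] intro!: exI[of _ 0])
      then have "d \<le> ext0 den l"
        by (rule tendsto_lowerbound[OF l[OF den_C_infty]]) simp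
      then have "ext0 den l \<noteq> 0" using d(1) by simp
      from tendsto_divide[OF l[OF num_C_infty] l[OF den_C_infty] this] show ?thesis
        unfolding finite_part_nth by (rule exI)
    qed
    ultimately show ?case
      using ne unfolding cadlag_def ext0_den_eq_0_iff by blast
  qed
qed

text \<open>The Taylor remainder of y_i y_j at every point is exactly z_i z_j.\<close>

lemma drift_nth_mult:
  "drift (\<lambda>y. y $ i * y $ j) (\<lambda>y z. y $ i * z $ j + z $ i * y $ j) t \<omega>
   = (LINT s:{0..t}|lborel. (\<integral>z. (z $ i) * (z $ j) \<partial>N (Y s \<omega>)))"
  by (simp add: drift_def jump_gen_def set_lebesgue_integral_def algebra_simps)

lemma martingale_Y:
  "vector_purely_discontinuous_martingale (completion (P x)) (augmentation (P x) F) Y" (is ?pd)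
  "predictable_quadratic_covariation (completion (P x)) (augmentation (P x) F)
     (\<lambda>t \<omega>. Y t \<omega> $ i) (\<lambda>t \<omega>. Y t \<omega> $ j)
     (\<lambda>t \<omega>. LINT s:{0..t}|lborel. (\<integral>z. (z $ i) * (z $ j) \<partial>N (Y s \<omega>)))" (is ?qc)
proof -
  let ?Q = "completion (P x)" and ?G = "augmentation (P x) F"
  interpret P: filtered_prob_space "P x" F by (rule filtered_prob_space_P)
  interpret C: complete_filtered_prob_space ?Q ?G by (rule P.complete_augmentation)
  have m: "C.mart (\<lambda>t \<omega>. Y t \<omega> $ i)" for i by (rule P.mart_augmentation[OF mart_Y])
  have cad: "AE \<omega> in ?Q. cadlag (\<lambda>t. Y t \<omega> $ i)" for i
    by (rule AE_completion) (use AE_path_regular[of x] in \<open>eventually_elim, blast\<close>)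
  have mg: "martingale ?Q ?G (\<lambda>t \<omega>. Y t \<omega> $ i)" for i
    unfolding C.mart_iff using m cad by blast
  have Ym: "(\<lambda>\<omega>. Y t \<omega> $ i) \<in> borel_measurable (P x)" if "0 \<le> t" for t i
    using measurable_compose[OF measurable_Y[OF that] borel_measurable_nth] .
  have sq: "integrable ?Q (\<lambda>\<omega>. (Y t \<omega> $ i)\<^sup>2)" if "0 \<le> t" for t i
    using integrable_completion[of "\<lambda>\<omega>. (Y t \<omega> $ i)\<^sup>2" "P x"] square_integrable_nth[OF that, of x i] Ym[OF that]
    by (simp add: borel_measurable_power)
  show ?pd
    unfolding vector_purely_discontinuous_martingale_def purely_discontinuous_martingale_def
  proof (intro allI conjI mg)
    fix i
    \<comment> \<open>A purely discontinuous local martingale starts at 0; subtracting the initial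
      value leaves all increments unchanged, so the estimate on small increments applies as it
      stands.\<close>
    let ?y = "\<lambda>t \<omega>. Y t \<omega> $ i - Y 0 \<omega> $ i"
    have y: "C.mart ?y" by (rule C.mart_diff_const[OF m])
    have ysq: "integrable ?Q (\<lambda>\<omega>. (?y t \<omega>)\<^sup>2)" if "0 \<le> t" for t
    proof -
      have "integrable ?Q (\<lambda>\<omega>. Y t \<omega> $ i * Y 0 \<omega> $ i)"
        by (intro integrable_mult_of_squares sq that order_refl measurable_completion Ym)
      then show ?thesis
        unfolding power2_diff mult.assoc using sq[OF that] sq[of 0]
        by (intro Bochner_Integration.integrable_diff Bochner_Integration.integrable_add integrable_mult_right) auto
    qed
    have ycad: "AE \<omega> in ?Q. cadlag (\<lambda>t. ?y t \<omega>)"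
      using cad[of i] by eventually_elim (rule cadlag_diff[OF _ continuous_imp_cadlag[OF continuous_on_const]])
    have small: "C.vanishing_small_increments ?y"
      unfolding C.vanishing_small_increments_def
    proof (intro allI impI)
      fix t \<eta> :: real assume t: "0 \<le> t" and \<eta>: "0 < \<eta>"
      obtain \<epsilon> where \<epsilon>: "\<epsilon> > 0" and le: "\<And>\<tau> n. 0 \<le> \<tau> 0 \<Longrightarrow> (\<forall>k<n. \<tau> k \<le> \<tau> (Suc k)) \<Longrightarrow> \<tau> n \<le> t \<Longrightarrow>
        (\<Sum>k<n. \<integral>\<omega>. (if \<bar>Y (\<tau> (Suc k)) \<omega> $ i - Y (\<tau> k) \<omega> $ i\<bar> \<le> \<epsilon>
           then (Y (\<tau> (Suc k)) \<omega> $ i - Y (\<tau> k) \<omega> $ i)\<^sup>2 else 0) \<partial>P x) \<le> \<eta>"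
        using small_increments[OF t \<eta>, of x i] by blast
      have "(\<Sum>k<n. \<integral>\<omega>. (if \<bar>?y (\<tau> (Suc k)) \<omega> - ?y (\<tau> k) \<omega>\<bar> \<le> \<epsilon> then (?y (\<tau> (Suc k)) \<omega> - ?y (\<tau> k) \<omega>)\<^sup>2 else 0) \<partial>?Q) \<le> \<eta>"
        if \<tau>: "0 \<le> \<tau> 0" "\<forall>k<n. \<tau> k \<le> \<tau> (Suc k)" "\<tau> n \<le> t" for \<tau> :: "nat \<Rightarrow> real" and n
      proof -
        have \<tau>0: "k \<le> n \<Longrightarrow> 0 \<le> \<tau> k" for k
        proof (induction k)
          case (Suc k)
          then have "0 \<le> \<tau> k" "\<tau> k \<le> \<tau> (Suc k)" using \<tau>(2) by auto
          then show ?case by simp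
        qed (use \<tau> in simp)
        have "(\<integral>\<omega>. (if \<bar>?y (\<tau> (Suc k)) \<omega> - ?y (\<tau> k) \<omega>\<bar> \<le> \<epsilon> then (?y (\<tau> (Suc k)) \<omega> - ?y (\<tau> k) \<omega>)\<^sup>2 else 0) \<partial>?Q)
          = (\<integral>\<omega>. (if \<bar>Y (\<tau> (Suc k)) \<omega> $ i - Y (\<tau> k) \<omega> $ i\<bar> \<le> \<epsilon>
               then (Y (\<tau> (Suc k)) \<omega> $ i - Y (\<tau> k) \<omega> $ i)\<^sup>2 else 0) \<partial>P x)" if "k < n" for k
        proof -
          have [measurable]: "(\<lambda>\<omega>. Y (\<tau> k) \<omega> $ i) \<in> borel_measurable (P x)" "(\<lambda>\<omega>. Y (\<tau> (Suc k)) \<omega> $ i) \<in> borel_measurable (P x)"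
            using that by (simp_all add: Ym \<tau>0)
          show ?thesis
            unfolding diff_diff_eq2 diff_add_cancel by (rule integral_completion) measurable
        qed
        then show ?thesis using le[OF \<tau>] by simp
      qed
      then show "\<exists>\<epsilon>>0. \<forall>\<tau> n. 0 \<le> \<tau> 0 \<longrightarrow> (\<forall>k<n. \<tau> k \<le> \<tau> (Suc k)) \<longrightarrow> \<tau> n \<le> t \<longrightarrow>
        (\<Sum>k<n. \<integral>\<omega>. (if \<bar>?y (\<tau> (Suc k)) \<omega> - ?y (\<tau> k) \<omega>\<bar> \<le> \<epsilon> then (?y (\<tau> (Suc k)) \<omega> - ?y (\<tau> k) \<omega>)\<^sup>2 else 0) \<partial>?Q) \<le> \<eta>"
        using \<epsilon> by (intro exI[of _ \<epsilon>]) simp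
    qed
    have "local_martingale ?Q ?G ?y"
      by (rule C.martingale_imp_local) (use y ycad in \<open>simp add: C.mart_iff\<close>)
    moreover have "local_martingale ?Q ?G (\<lambda>t \<omega>. ?y t \<omega> * Z t \<omega>)" if "continuous_local_martingale ?Q ?G Z" for Z
      by (rule C.product_local_martingale[OF y ysq ycad small _ that]) auto
    ultimately have "purely_discontinuous_local_martingale ?Q ?G ?y"
      unfolding purely_discontinuous_local_martingale_def by auto
    then show "\<exists>C. continuous_martingale_part ?Q ?G (\<lambda>t \<omega>. Y t \<omega> $ i) C \<and> (AE \<omega> in ?Q. \<forall>t\<ge>0. C t \<omega> = 0)"
      unfolding continuous_martingale_part_def
      \<comment> \<open>The continuous martingale part is exhibited as the zero process.\<close>
      by (intro exI[of _ "\<lambda>_ _. 0"]) (simp add: C.continuous_local_martingale_zero)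
  qed
  let ?g = "\<lambda>y::real^'n. y $ i * y $ j" and ?D = "\<lambda>(y::real^'n) z. y $ i * z $ j + z $ i * y $ j"
  have sp: "AE \<omega> in ?Q. \<omega> \<in> space M" using AE_space[of ?Q] by (simp add: space_P)
  obtain K where K: "\<And>\<omega>. \<omega> \<in> space M \<Longrightarrow> K-lipschitz_on {0..} (\<lambda>t. drift ?g ?D t \<omega>)"
    by (rule drift_lipschitz[OF tame_nth_mult]) (rule that)
  have Acad: "AE \<omega> in ?Q. cadlag (\<lambda>t. drift ?g ?D t \<omega>)"
    using sp by eventually_elim (rule continuous_imp_cadlag[OF drift_continuous[OF tame_nth_mult]])
  have "AE \<omega> in ?Q. finite_variation (\<lambda>t. drift ?g ?D t \<omega>)"
    using sp by eventually_elim (rule lipschitz_finite_variation[OF K])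
  then have A: "AE \<omega> in ?Q. drift ?g ?D 0 \<omega> = 0 \<and> cadlag (\<lambda>t. drift ?g ?D t \<omega>) \<and> finite_variation (\<lambda>t. drift ?g ?D t \<omega>)"
    using Acad by eventually_elim (simp add: drift_zero)
  have pred: "(\<lambda>(t, \<omega>). drift ?g ?D t \<omega>) \<in> borel_measurable (predictable_sigma ?Q ?G)"
    by (rule C.continuous_adapted_predictable)
      (auto intro: P.measurable_augmentation drift_adapted[OF tame_nth_mult] drift_continuous[OF tame_nth_mult] simp: space_P)
  have "AE \<omega> in ?Q. cadlag (\<lambda>t. Y t \<omega> $ i * Y t \<omega> $ j - drift ?g ?D t \<omega>)"
    using cad[of i] cad[of j] Acad by eventually_elim (intro cadlag_diff cadlag_mult)
  then have lm: "local_martingale ?Q ?G (\<lambda>t \<omega>. Y t \<omega> $ i * Y t \<omega> $ j - drift ?g ?D t \<omega>)"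
    by (intro C.martingale_imp_local)
      (simp add: C.mart_iff P.mart_augmentation[OF mart_tame[OF tame_nth_mult]])
  have lsq: "locally_square_integrable_martingale ?Q ?G (\<lambda>t \<omega>. Y t \<omega> $ i)" for i
    by (rule C.square_integrable_imp_locally[OF mg sq])
  show ?qc
    using lsq lsq pred A lm
    unfolding predictable_quadratic_covariation_def drift_nth_mult by blast
qed

end

theorem theorem2p2:
  fixes M :: "'w measure"
    and F :: "real \<Rightarrow> 'w measure"
    and X :: "real \<Rightarrow> 'w \<Rightarrow> (real ^ 'n) option"
    and P :: "real ^ 'n \<Rightarrow> 'w measure"
    and N :: "real ^ 'n \<Rightarrow> (real ^ 'n) measure"
  defines "L \<equiv> generator (transition_semigroup P X)"
    and "Y \<equiv> finite_part X"
  assumes feller: "feller_process M F X P"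
    and sets_N: "\<And>x. sets (N x) = sets (restrict_space borel (UNIV - {0}))"
    and domain: "C_c_smooth \<subseteq> generator_domain (transition_semigroup P X)"
    and generator: "\<And>u x. u \<in> C_c_smooth \<Longrightarrow>
      L u x = (\<integral>z. (u (x + z) - u x - (grad u x \<bullet> z) * indicator {z. norm z < 1} z) \<partial>N x)"
    and second_moment: "(SUP x. \<integral>\<^sup>+z. ennreal ((norm z)\<^sup>2) \<partial>N x) < \<infinity>"
    and centred: "\<And>x i. (\<integral>z. (z $ i) * indicator {z. 1 \<le> norm z} z \<partial>N x) = 0"
  shows "\<forall>x.
     (AE \<omega> in P x. \<forall>t\<ge>0. X t \<omega> \<noteq> None) \<and>
     vector_purely_discontinuous_martingale (completion (P x)) (augmentation (P x) F) Y \<and>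
     (\<forall>t>0. \<forall>i. integrable (P x) (\<lambda>\<omega>. (Y t \<omega> $ i)\<^sup>2)) \<and>
     (\<forall>i j. predictable_quadratic_covariation (completion (P x)) (augmentation (P x) F)
        (\<lambda>t \<omega>. Y t \<omega> $ i) (\<lambda>t \<omega>. Y t \<omega> $ j)
        (\<lambda>t \<omega>. LINT s:{0..t}|lborel. (\<integral>z. (z $ i) * (z $ j) \<partial>N (Y s \<omega>))))"
proof -
  interpret feller_jump M F X P N
    by (intro feller_jump.intro feller feller_jump_axioms.intro jump_kernel.intro sets_N second_moment centred domain
        generator[unfolded L_def])
  show ?thesis
    unfolding Y_def
  proof (intro allI conjI impI martingale_Y)
    fix x
    show "AE \<omega> in P x. \<forall>t\<ge>0. X t \<omega> \<noteq> None" using AE_path_regular[of x] by eventually_elim blast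
    show "integrable (P x) (\<lambda>\<omega>. (finite_part X t \<omega> $ i)\<^sup>2)" if "0 < t" for t i
      using that by (intro square_integrable_nth) simp
  qed
qed

end
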